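(* Assume Projective Determinacy. Then $P^{Proj}$ is the minimal projectively correct model of analysis (and so also the minimal projectively correct model of analysis together with the scheme $PD$), where minimal means least under inclusion. Moreover $$P^{Proj}=\bigcup_{k}P^{\Game\Pi^1_{2k+1}}=\bigcup_{k}P^{\Game\Sigma^1_{2k}} .$$
   Context: Projective Determinacy: every (boldface) projective subset of $\mathbb{N}^{\mathbb{N}}$ is determined. As a scheme in second order number theory, $PD$ contains for every $n\in\mathbb{N}$ the statement "for every (boldface) $\Pi^1_n$ set $A\subseteq\mathbb{N}^{\mathbb{N}}$ and every tree $T\subseteq\omega^{<\omega}$, $G(A,T)$ is determined", where $G(A,T)$ is the game with payoff $A$ in which moves are restricted so that positions lie in $T$. Language. $\mathcal{L}^2$ is the language of second order number theory, with number variables and set variables, quantifiers of both kinds and symbols for the arithmetic operations. It is interpreted in structures $\mathcal{M}=(M,\mathbb{N},+,\times,0,',\ldots)$ with $M\subseteq\mathcal{P}(\mathbb{N})$ the range of the set variables; such a structure is identified with $M$. It is a model of analysis if it satisfies second order number theory $\mathsf{Z}_2$ (full comprehension). It is projectively correct if for every $n$ every $\Sigma^1_n$ formula with parameters from $M$ is absolute between $\mathcal{M}$ and the full model $\mathcal{Z}=(\mathcal{P}(\mathbb{N}),\mathbb{N},+,\times,0,',\ldots)$. Game quantifier. For $A\subseteq\mathbb{N}^{\mathbb{N}}$, in the game $G_A$ players I and II alternately play integers $n_0,m_0,n_1,m_1,\ldots$, and I wins iff $(n_0,m_0,n_1,m_1,\ldots)\in A$. For a relation $R$ on $\mathbb{N}\times\mathbb{N}^{\mathbb{N}}$,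 $\Game X\,R(k,X)$ means that Player I has a winning strategy in the game with payoff set $\{X\mid R(k,X)\}$. Extended logic. For a class $\Gamma$ of $\mathcal{L}^2$ formulas, $\mathcal{L}^{2,\Game\Gamma}$ extends $\mathcal{L}^2$ by new formulas $\Game X\,\Phi(k,X,`\psi(v_0,Y)\text{'})$, where $\Phi\in\Gamma$ and $\psi\in\mathcal{L}^2$ (so game quantifiers are not nested inside $\Phi$ or $\psi$), $Y$ a set parameter. They are interpreted by $$\mathcal{M}\models \Game X\,\Phi(k,X,`\psi(v_0,Y)\text{'})\iff \Game X\,\Phi\big(k,X,\{n\in\mathbb{N}\mid \mathcal{M}\models\psi(n,Y)\}\big),$$ where the right-hand side is evaluated in $V$ (i.e. $\Phi$ in $\mathcal{Z}$, and strategies and plays ranging over all those in $V$). All other formulas are interpreted over $\mathcal{M}$ as usual. Hierarchy. $P^{\Game\Gamma}_0=\emptyset$; $P^{\Game\Gamma}_\lambda=\bigcup_{\alpha<\lambda}P^{\Game\Gamma}_\alpha$ for limit $\lambda$; $P^{\Game\Gamma}_{\alpha+1}$ is the set of all $Y\subseteq\mathbb{N}$ definable by a formula of $\mathcal{L}^{2,\Game\Gamma}$ (set parameters from $P^{\Game\Gamma}_\alpha$ allowed) over $(P^{\Game\Gamma}_\alpha,\mathbb{N},+,\times,0,',\ldots)$. $P^{\Game\Gamma}=P^{\Game\Gamma}_\beta$ for the least $\beta$ with $P^{\Game\Gamma}_\beta=P^{\Game\Gamma}_{\beta+1}$. The classes $\Gamma=\Pi^1_{2k+1}$ ($k\ge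 0$) and $\Gamma=\Sigma^1_{2k}$ ($k\ge 1$) are the lightface classes of formulas, and $P^{Proj}=P^{\Game\Gamma}$ for $\Gamma=\Pi^1_\omega=Proj$, the class of all projective formulas ($\Sigma^1_n$ or $\Pi^1_n$ for some $n$). *)

theory Defs
  imports "HOL-Library.Nat_Bijection" "HOL-Number_Theory.Cong"
begin

section \<open>Second order number theory\<close>

text \<open>Number variables and set variables are named by natural numbers, separately for each sort.
  A structure \<open>(M, \<nat>, +, \<times>, 0, ', <)\<close> is identified with the set \<open>M\<close> of subsets of \<open>\<nat>\<close>.\<close>

datatype tm = V nat | Zero | S tm | Plus tm tm | Times tm tm

datatype fm =
    Eq tm tm | Less tm tm | Mem tm nat
  | Neg fm | Conj fm fm
  | ExN nat fm | AllN nat fm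
  | ExS nat fm | AllS nat fm

abbreviation Disj :: "fm \<Rightarrow> fm \<Rightarrow> fm" where "Disj \<phi> \<psi> \<equiv> Neg (Conj (Neg \<phi>) (Neg \<psi>))"
abbreviation Imp :: "fm \<Rightarrow> fm \<Rightarrow> fm" where "Imp \<phi> \<psi> \<equiv> Neg (Conj \<phi> (Neg \<psi>))"
abbreviation Iff :: "fm \<Rightarrow> fm \<Rightarrow> fm" where "Iff \<phi> \<psi> \<equiv> Conj (Imp \<phi> \<psi>) (Imp \<psi> \<phi>)"

primrec val :: "(nat \<Rightarrow> nat) \<Rightarrow> tm \<Rightarrow> nat" where
  "val e (V i) = e i"
| "val e Zero = 0"
| "val e (S t) = Suc (val e t)"
| "val e (Plus s t) = val e s + val e t"
| "val e (Times s t) = val e s * val e t"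

primrec sat :: "nat set set \<Rightarrow> (nat \<Rightarrow> nat) \<Rightarrow> (nat \<Rightarrow> nat set) \<Rightarrow> fm \<Rightarrow> bool" where
  "sat M e E (Eq s t) \<longleftrightarrow> val e s = val e t"
| "sat M e E (Less s t) \<longleftrightarrow> val e s < val e t"
| "sat M e E (Mem t X) \<longleftrightarrow> val e t \<in> E X"
| "sat M e E (Neg \<phi>) \<longleftrightarrow> \<not> sat M e E \<phi>"
| "sat M e E (Conj \<phi> \<psi>) \<longleftrightarrow> sat M e E \<phi> \<and> sat M e E \<psi>"
| "sat M e E (ExN i \<phi>) \<longleftrightarrow> (\<exists>n. sat M (e(i := n)) E \<phi>)"
| "sat M e E (AllN i \<phi>) \<longleftrightarrow> (\<forall>n. sat M (e(i := n)) E \<phi>)"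
| "sat M e E (ExS X \<phi>) \<longleftrightarrow> (\<exists>A\<in>M. sat M e (E(X := A)) \<phi>)"
| "sat M e E (AllS X \<phi>) \<longleftrightarrow> (\<forall>A\<in>M. sat M e (E(X := A)) \<phi>)"

primrec vars_tm :: "tm \<Rightarrow> nat set" where
  "vars_tm (V i) = {i}"
| "vars_tm Zero = {}"
| "vars_tm (S t) = vars_tm t"
| "vars_tm (Plus s t) = vars_tm s \<union> vars_tm t"
| "vars_tm (Times s t) = vars_tm s \<union> vars_tm t"

primrec fvN :: "fm \<Rightarrow> nat set" where
  "fvN (Eq s t) = vars_tm s \<union> vars_tm t"
| "fvN (Less s t) = vars_tm s \<union> vars_tm t"
| "fvN (Mem t X) = vars_tm t"
| "fvN (Neg \<phi>) = fvN \<phi>"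
| "fvN (Conj \<phi> \<psi>) = fvN \<phi> \<union> fvN \<psi>"
| "fvN (ExN i \<phi>) = fvN \<phi> - {i}"
| "fvN (AllN i \<phi>) = fvN \<phi> - {i}"
| "fvN (ExS X \<phi>) = fvN \<phi>"
| "fvN (AllS X \<phi>) = fvN \<phi>"

primrec fvS :: "fm \<Rightarrow> nat set" where
  "fvS (Eq s t) = {}"
| "fvS (Less s t) = {}"
| "fvS (Mem t X) = {X}"
| "fvS (Neg \<phi>) = fvS \<phi>"
| "fvS (Conj \<phi> \<psi>) = fvS \<phi> \<union> fvS \<psi>"
| "fvS (ExN i \<phi>) = fvS \<phi>"
| "fvS (AllN i \<phi>) = fvS \<phi>"
| "fvS (ExS X \<phi>) = fvS \<phi> - {X}"
| "fvS (AllS X \<phi>) = fvS \<phi> - {X}"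

text \<open>The restriction of \<open>E\<close> to the free set variables matters for \<open>M = {}\<close>, the bottom of the
  hierarchy below: there, sentences still have a truth value although no assignment maps
  into \<open>M\<close>.\<close>

definition models :: "nat set set \<Rightarrow> fm set \<Rightarrow> bool" where
  "models M \<Theta> \<longleftrightarrow> (\<forall>\<phi>\<in>\<Theta>. \<forall>e E. (\<forall>X\<in>fvS \<phi>. E X \<in> M) \<longrightarrow> sat M e E \<phi>)"

definition comprehension :: "fm \<Rightarrow> nat \<Rightarrow> nat \<Rightarrow> fm" where
  "comprehension \<phi> i X = ExS X (AllN i (Iff (Mem (V i) X) \<phi>))"

definition Z2 :: "fm set" where
  "Z2 =
    {Neg (Eq (S (V 0)) Zero),
     Imp (Eq (S (V 0)) (S (V 1))) (Eq (V 0) (V 1)),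
     Eq (Plus (V 0) Zero) (V 0),
     Eq (Plus (V 0) (S (V 1))) (S (Plus (V 0) (V 1))),
     Eq (Times (V 0) Zero) Zero,
     Eq (Times (V 0) (S (V 1))) (Plus (Times (V 0) (V 1)) (V 0)),
     Neg (Less (V 0) Zero),
     Iff (Less (V 0) (S (V 1))) (Disj (Less (V 0) (V 1)) (Eq (V 0) (V 1))),
     AllS 0 (Imp (Conj (Mem Zero 0) (AllN 0 (Imp (Mem (V 0) 0) (Mem (S (V 0)) 0))))
                 (AllN 0 (Mem (V 0) 0)))}
    \<union> {comprehension \<phi> i X | \<phi> i X. X \<notin> fvS \<phi>}"

definition model_of_analysis :: "nat set set \<Rightarrow> bool" where
  "model_of_analysis M \<longleftrightarrow> models M Z2"

section \<open>The projective classes\<close>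

primrec arithmetical :: "fm \<Rightarrow> bool" where
  "arithmetical (Eq s t) \<longleftrightarrow> True"
| "arithmetical (Less s t) \<longleftrightarrow> True"
| "arithmetical (Mem t X) \<longleftrightarrow> True"
| "arithmetical (Neg \<phi>) \<longleftrightarrow> arithmetical \<phi>"
| "arithmetical (Conj \<phi> \<psi>) \<longleftrightarrow> arithmetical \<phi> \<and> arithmetical \<psi>"
| "arithmetical (ExN i \<phi>) \<longleftrightarrow> arithmetical \<phi>"
| "arithmetical (AllN i \<phi>) \<longleftrightarrow> arithmetical \<phi>"
| "arithmetical (ExS X \<phi>) \<longleftrightarrow> False"
| "arithmetical (AllS X \<phi>) \<longleftrightarrow> False"

fun Sigma11 :: "nat \<Rightarrow> fm set" and Pi11 :: "nat \<Rightarrow> fm set" where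
  "Sigma11 0 = {\<phi>. arithmetical \<phi>}"
| "Sigma11 (Suc n) = {ExS X \<phi> | X \<phi>. \<phi> \<in> Pi11 n}"
| "Pi11 0 = {\<phi>. arithmetical \<phi>}"
| "Pi11 (Suc n) = {AllS X \<phi> | X \<phi>. \<phi> \<in> Sigma11 n}"

definition Proj :: "fm set" where
  "Proj = (\<Union>n. Sigma11 n \<union> Pi11 n)"

text \<open>The full model \<open>\<Z>\<close> is \<open>UNIV :: nat set set\<close>.\<close>

definition projectively_correct :: "nat set set \<Rightarrow> bool" where
  "projectively_correct M \<longleftrightarrow>
    (\<forall>n. \<forall>\<phi>\<in>Sigma11 n. \<forall>e E. (\<forall>X\<in>fvS \<phi>. E X \<in> M) \<longrightarrow> sat M e E \<phi> = sat UNIV e E \<phi>)"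

text \<open>Elements of Baire space enter formulas, whose second order variables range over sets,
  through their graphs.\<close>

definition graph :: "(nat \<Rightarrow> nat) \<Rightarrow> nat set" where
  "graph x = {prod_encode (n, x n) | n. True}"

definition projective :: "(nat \<Rightarrow> nat) set \<Rightarrow> bool" where
  "projective A \<longleftrightarrow> (\<exists>\<phi>\<in>Proj. \<exists>e E. A = {x. sat UNIV e (E(0 := graph x)) \<phi>})"

section \<open>Games and projective determinacy\<close>

text \<open>A play is the sequence \<open>n\<^sub>0, m\<^sub>0, n\<^sub>1, m\<^sub>1, \<dots>\<close>, so player I moves at even positions.\<close>

definition follows_I :: "(nat list \<Rightarrow> nat) \<Rightarrow> (nat \<Rightarrow> nat) \<Rightarrow> bool" where
  "follows_I \<sigma> x \<longleftrightarrow> (\<forall>n. even n \<longrightarrow> x n = \<sigma> (map x [0..<n]))"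

definition follows_II :: "(nat list \<Rightarrow> nat) \<Rightarrow> (nat \<Rightarrow> nat) \<Rightarrow> bool" where
  "follows_II \<sigma> x \<longleftrightarrow> (\<forall>n. odd n \<longrightarrow> x n = \<sigma> (map x [0..<n]))"

definition wins_I :: "(nat \<Rightarrow> nat) set \<Rightarrow> bool" where
  "wins_I A \<longleftrightarrow> (\<exists>\<sigma>. \<forall>x. follows_I \<sigma> x \<longrightarrow> x \<in> A)"

definition wins_II :: "(nat \<Rightarrow> nat) set \<Rightarrow> bool" where
  "wins_II A \<longleftrightarrow> (\<exists>\<sigma>. \<forall>x. follows_II \<sigma> x \<longrightarrow> x \<notin> A)"

definition determined :: "(nat \<Rightarrow> nat) set \<Rightarrow> bool" where
  "determined A \<longleftrightarrow> wins_I A \<or> wins_II A"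

definition projective_determinacy :: bool where
  "projective_determinacy \<longleftrightarrow> (\<forall>A. projective A \<longrightarrow> determined A)"

section \<open>Projective determinacy as a scheme\<close>

text \<open>The instance for \<open>\<phi>(X, Y)\<close> says that for all \<open>Y\<close> and all trees \<open>T\<close> the game
  \<open>G({X. \<phi>(X, Y)}, T)\<close> is determined. Finite sequences are represented in \<open>\<nat>\<close> by
  \<^const>\<open>list_encode\<close>, trees by sets of such codes, and functions, in particular plays and
  strategies, by their graphs. The set variables are 0 for \<open>X\<close>, 1 for \<open>Y\<close>, 2 for \<open>T\<close> and 3 for
  the strategy. Terms passed to the formulas below have to avoid the number variables bound there
  (9 in \<open>pair_in\<close>, 8 in \<open>beta\<close>, 3 to 10 in \<open>restr\<close>).\<close>

definition is_pair :: "tm \<Rightarrow> tm \<Rightarrow> tm \<Rightarrow> fm" where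
  "is_pair p s t = Eq (Plus p p) (Plus (Times (Plus s t) (S (Plus s t))) (Plus s s))"

definition pair_in :: "nat \<Rightarrow> tm \<Rightarrow> tm \<Rightarrow> fm" where
  "pair_in X s t = ExN 9 (Conj (is_pair (V 9) s t) (Mem (V 9) X))"

text \<open>Goedel's \<open>\<beta>\<close>-function: \<open>y = a mod (1 + (i + 1) b)\<close>.\<close>

definition beta_fun :: "nat \<Rightarrow> nat \<Rightarrow> nat \<Rightarrow> nat" where
  "beta_fun a b i = a mod Suc (b * Suc i)"

definition beta :: "tm \<Rightarrow> tm \<Rightarrow> tm \<Rightarrow> tm \<Rightarrow> fm" where
  "beta a b i y = ExN 8 (Conj (Eq a (Plus (Times (V 8) (S (Times b (S i)))) y))
                              (Less y (S (Times b (S i)))))"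

text \<open>\<open>c\<close> is the code of \<open>(x\<^sub>0, \<dots>, x\<^sub>n\<^sub>-\<^sub>1)\<close>, where \<open>F s t\<close> expresses that \<open>x\<^sub>s = t\<close>. The
  \<open>\<beta>\<close>-function for the parameters 3, 4 yields, at \<open>i \<le> n\<close>, the code of
  \<open>(x\<^sub>i, \<dots>, x\<^sub>n\<^sub>-\<^sub>1)\<close>.\<close>

definition restr :: "(tm \<Rightarrow> tm \<Rightarrow> fm) \<Rightarrow> tm \<Rightarrow> tm \<Rightarrow> fm" where
  "restr F n c = ExN 3 (ExN 4 (Conj (Conj (beta (V 3) (V 4) n Zero) (beta (V 3) (V 4) Zero c))
     (AllN 5 (Imp (Less (V 5) n)
       (ExN 6 (ExN 7 (ExN 10 (Conj
         (Conj (F (V 5) (V 6)) (beta (V 3) (V 4) (S (V 5)) (V 7)))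
         (Conj (is_pair (V 10) (V 6) (V 7)) (beta (V 3) (V 4) (V 5) (S (V 10))))))))))))"

text \<open>A nonempty set of codes closed under initial segments. Arbitrary finite sequences are given
  by \<open>\<beta>\<close> with parameters 11, 12.\<close>

definition tree_fm :: "nat \<Rightarrow> fm" where
  "tree_fm T = Conj (Mem Zero T)
     (AllN 11 (AllN 12 (AllN 0 (AllN 1 (AllN 2 (Imp
       (Conj (Conj (restr (beta (V 11) (V 12)) (S (V 0)) (V 1)) (Mem (V 1) T))
             (restr (beta (V 11) (V 12)) (V 0) (V 2)))
       (Mem (V 2) T)))))))"

definition function_fm :: "nat \<Rightarrow> fm" where
  "function_fm X = AllN 0 (ExN 1 (AllN 2 (Iff (pair_in X (V 0) (V 2)) (Eq (V 2) (V 1)))))"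

definition even_fm :: fm where
  "even_fm = ExN 1 (Eq (V 0) (Plus (V 1) (V 1)))"

text \<open>The second argument is the condition on the position \<open>V 0\<close> at which the strategy is used.\<close>

definition follows_fm :: "nat \<Rightarrow> fm \<Rightarrow> nat \<Rightarrow> fm" where
  "follows_fm Str \<pi> X = AllN 0 (Imp \<pi> (ExN 1 (ExN 2 (Conj (restr (pair_in X) (V 0) (V 1))
     (Conj (pair_in Str (V 1) (V 2)) (pair_in X (V 0) (V 2)))))))"

definition restr_in :: "nat \<Rightarrow> tm \<Rightarrow> nat \<Rightarrow> fm" where
  "restr_in X n T = ExN 1 (Conj (restr (pair_in X) n (V 1)) (Mem (V 1) T))"

text \<open>Player I wins a play of \<open>G(A, T)\<close> iff it stays in \<open>T\<close> and belongs to \<open>A\<close>, or player II is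
  the first to leave \<open>T\<close>. So a player without a legal move loses.\<close>

definition won_by_I_fm :: "fm \<Rightarrow> fm" where
  "won_by_I_fm \<phi> = Disj (Conj (AllN 0 (restr_in 0 (V 0) 2)) \<phi>)
     (ExN 0 (Conj (Neg even_fm) (Conj (restr_in 0 (V 0) 2) (Neg (restr_in 0 (S (V 0)) 2)))))"

definition PD_instance :: "fm \<Rightarrow> fm" where
  "PD_instance \<phi> = AllS 1 (AllS 2 (Imp (tree_fm 2) (Disj
     (ExS 3 (Conj (function_fm 3) (AllS 0 (Imp
        (Conj (function_fm 0) (follows_fm 3 even_fm 0)) (won_by_I_fm \<phi>)))))
     (ExS 3 (Conj (function_fm 3) (AllS 0 (Imp
        (Conj (function_fm 0) (follows_fm 3 (Neg even_fm) 0)) (Neg (won_by_I_fm \<phi>)))))))))"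

definition PD_scheme :: "fm set" where
  "PD_scheme = (\<Union>n. {PD_instance \<phi> | \<phi>. \<phi> \<in> Pi11 n \<and> fvN \<phi> = {} \<and> fvS \<phi> \<subseteq> {0, 1}})"

subsection \<open>Meaning of the scheme\<close>

lemma val_upd: "i \<notin> vars_tm t \<Longrightarrow> val (e(i := n)) t = val e t"
  by (induction t) auto

lemma sat_cong:
  assumes "\<forall>i\<in>fvN \<phi>. e i = e' i" "\<forall>X\<in>fvS \<phi>. E X = E' X"
  shows "sat M e E \<phi> = sat M e' E' \<phi>"
proof -
  have val_cong: "\<forall>i\<in>vars_tm t. e i = e' i \<Longrightarrow> val e t = val e' t" for t e e'
    by (induction t) auto
  show ?thesis
    using assms
  proof (induction \<phi> arbitrary: e e' E E')
    case (ExN i \<phi>)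
    then have "sat M (e(i := n)) E \<phi> = sat M (e'(i := n)) E' \<phi>" for n
      by (intro ExN.IH) auto
    then show ?case by simp
  next
    case (AllN i \<phi>)
    then have "sat M (e(i := n)) E \<phi> = sat M (e'(i := n)) E' \<phi>" for n
      by (intro AllN.IH) auto
    then show ?case by simp
  next
    case (ExS X \<phi>)
    then have "sat M e (E(X := A)) \<phi> = sat M e' (E'(X := A)) \<phi>" for A
      by (intro ExS.IH) auto
    then show ?case by simp
  next
    case (AllS X \<phi>)
    then have "sat M e (E(X := A)) \<phi> = sat M e' (E'(X := A)) \<phi>" for A
      by (intro AllS.IH) auto
    then show ?case by simp
  next
    case (Eq s t)
    then show ?case using val_cong[of s e e'] val_cong[of t e e'] by simp
  next
    case (Less s t)
    then show ?case using val_cong[of s e e'] val_cong[of t e e'] by simp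
  next
    case (Mem t X)
    then show ?case using val_cong[of t e e'] by simp
  next
    case (Neg \<phi>)
    then show ?case by (metis fvN.simps(4) fvS.simps(4) sat.simps(4))
  next
    case (Conj \<phi> \<psi>)
    then have "sat M e E \<phi> = sat M e' E' \<phi>" "sat M e E \<psi> = sat M e' E' \<psi>"
      by (auto intro!: Conj.IH)
    then show ?case by simp
  qed
qed

lemma sat_is_pair [simp]:
  "sat M e E (is_pair p s t) \<longleftrightarrow> val e p = prod_encode (val e s, val e t)"
proof -
  have *: "2 * prod_encode (m, n) = (m + n) * Suc (m + n) + (m + m)" for m n
    unfolding prod_encode_def triangle_def by simp
  have "k + k = (m + n) * Suc (m + n) + (m + m) \<longleftrightarrow> k = prod_encode (m, n)" for k m n
    unfolding *[symmetric] by auto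
  then show ?thesis unfolding is_pair_def by (simp del: mult_Suc_right)
qed

lemma sat_pair_in:
  "9 \<notin> vars_tm s \<union> vars_tm t \<Longrightarrow>
   sat M e E (pair_in X s t) \<longleftrightarrow> prod_encode (val e s, val e t) \<in> E X"
  by (auto simp: pair_in_def val_upd)

lemma sat_beta:
  assumes "8 \<notin> vars_tm a \<union> vars_tm b \<union> vars_tm i \<union> vars_tm y"
  shows "sat M e E (beta a b i y) \<longleftrightarrow> val e y = beta_fun (val e a) (val e b) (val e i)"
proof -
  have "(\<exists>q. a = q * m + y \<and> y < m) \<longleftrightarrow> y = a mod m" if "m > 0" for a y m :: nat
    using that by (metis mod_less mod_less_divisor mod_mult_self3 div_mult_mod_eq)
  from this[of "Suc (val e b * Suc (val e i))"] show ?thesis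
    using assms by (simp add: beta_def beta_fun_def val_upd)
qed

lemma ex_beta_fun: "\<exists>a b. \<forall>i<n. beta_fun a b i = f i"
proof -
  define N where "N = n + (\<Sum>i<n. f i)"
  define b where "b = (fact N :: nat)"
  have cop: "coprime (Suc (b * Suc i)) (Suc (b * Suc j))" if "i < j" "j < n" for i j
  proof (rule ccontr)
    assume "\<not> ?thesis"
    then have "gcd (Suc (b * Suc i)) (Suc (b * Suc j)) \<noteq> 1"
      by (simp add: coprime_iff_gcd_eq_1)
    then obtain p where "prime p" "p dvd gcd (Suc (b * Suc i)) (Suc (b * Suc j))"
      using prime_factor_nat by blast
    then have p: "prime p" "p dvd Suc (b * Suc i)" "p dvd Suc (b * Suc j)"
      using gcd_greatest_iff by blast+
    have "Suc (b * Suc j) - Suc (b * Suc i) = b * (j - i)"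
      using that by (simp add: diff_mult_distrib2)
    then have "p dvd b * (j - i)"
      using p(2,3) dvd_diff_nat by metis
    moreover have "j - i dvd b"
      unfolding b_def using that by (intro dvd_fact) (auto simp: N_def)
    ultimately have "p dvd b"
      using p(1) prime_dvd_mult_iff dvd_trans by blast
    then have "p dvd 1"
      using p(2) by (metis Suc_eq_plus1 dvd_add_right_iff dvd_mult2)
    then show False using p(1) by simp
  qed
  have "\<exists>a. \<forall>i\<in>{..<n}. [a = f i] (mod Suc (b * Suc i))"
    by (rule chinese_remainder_nat) (use cop in \<open>auto, metis coprime_commute nat_neq_iff\<close>)
  then obtain a where a: "\<forall>i<n. [a = f i] (mod Suc (b * Suc i))" by auto
  have "beta_fun a b i = f i" if "i < n" for i
  proof -
    have "f i \<le> (\<Sum>i<n. f i)" using that by (intro member_le_sum) auto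
    then have "f i \<le> b" unfolding b_def N_def using fact_ge_self[of "n + (\<Sum>i<n. f i)"] by linarith
    then have "f i < Suc (b * Suc i)" by simp
    then show ?thesis using a that by (simp add: beta_fun_def cong_def)
  qed
  then show ?thesis by blast
qed

lemma beta_list_encode:
  "(\<exists>a b. (beta_fun a b n = 0 \<and> c = beta_fun a b 0) \<and>
      (\<forall>i<n. beta_fun a b i = Suc (prod_encode (x i, beta_fun a b (Suc i)))))
   \<longleftrightarrow> c = list_encode (map x [0..<n])"
proof
  assume "\<exists>a b. (beta_fun a b n = 0 \<and> c = beta_fun a b 0) \<and>
      (\<forall>i<n. beta_fun a b i = Suc (prod_encode (x i, beta_fun a b (Suc i))))"
  then obtain a b where ab: "beta_fun a b n = 0" "c = beta_fun a b 0"
    "\<forall>i<n. beta_fun a b i = Suc (prod_encode (x i, beta_fun a b (Suc i)))" by blast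
  have "i \<le> n \<Longrightarrow> beta_fun a b i = list_encode (map x [i..<n])" for i
  proof (induction rule: inc_induct)
    case (step i)
    then show ?case using ab(3)[rule_format, of i]
      by (metis list.map(2) list_encode.simps(2) upt_conv_Cons)
  qed (simp add: ab(1))
  from this[of 0] show "c = list_encode (map x [0..<n])" using ab(2) by simp
next
  assume c: "c = list_encode (map x [0..<n])"
  obtain a b where ab: "\<forall>i<Suc n. beta_fun a b i = list_encode (map x [i..<n])"
    using ex_beta_fun[of "Suc n" "\<lambda>i. list_encode (map x [i..<n])"] by blast
  have "beta_fun a b i = Suc (prod_encode (x i, beta_fun a b (Suc i)))" if "i < n" for i
  proof -
    have "beta_fun a b i = list_encode (map x [i..<n])"
      "beta_fun a b (Suc i) = list_encode (map x [Suc i..<n])"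
      using ab that by auto
    then show ?thesis using that by (simp add: upt_conv_Cons)
  qed
  then show "\<exists>a b. (beta_fun a b n = 0 \<and> c = beta_fun a b 0) \<and>
      (\<forall>i<n. beta_fun a b i = Suc (prod_encode (x i, beta_fun a b (Suc i))))"
    using ab c by (intro exI[of _ a] exI[of _ b]) auto
qed

lemma sat_restr:
  assumes F: "\<And>e'. \<forall>i. i \<notin> {3..10} \<longrightarrow> e' i = e i \<Longrightarrow>
      sat M e' E (F (V 5) (V 6)) \<longleftrightarrow> e' 6 = x (e' 5)"
    and fresh: "(vars_tm n \<union> vars_tm c) \<inter> {3..10} = {}"
  shows "sat M e E (restr F n c) \<longleftrightarrow> val e c = list_encode (map x [0..<val e n])"
proof -
  have v: "i \<notin> vars_tm n" "i \<notin> vars_tm c" if "i \<in> {3..10}" for i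
    using fresh that by blast+
  have F': "sat M (e(3 := a, 4 := b, 5 := i, 6 := j, 7 := k, 10 := l)) E (F (V 5) (V 6)) \<longleftrightarrow>
      j = x i" for a b i j k l
    by (subst F) auto
  have "sat M e E (restr F n c) \<longleftrightarrow>
    (\<exists>a b. (beta_fun a b (val e n) = 0 \<and> val e c = beta_fun a b 0) \<and>
      (\<forall>i<val e n. beta_fun a b i = Suc (prod_encode (x i, beta_fun a b (Suc i)))))"
    by (simp add: restr_def sat_beta val_upd v F') (metis (no_types))
  then show ?thesis using beta_list_encode by simp
qed

lemma graph_iff [simp]: "prod_encode (n, m) \<in> graph x \<longleftrightarrow> m = x n"
  by (auto simp: graph_def)

lemma sat_restr_pair_in:
  assumes "E X = graph x" "(vars_tm n \<union> vars_tm c) \<inter> {3..10} = {}"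
  shows "sat M e E (restr (pair_in X) n c) \<longleftrightarrow> val e c = list_encode (map x [0..<val e n])"
  using assms by (intro sat_restr) (auto simp: sat_pair_in)

definition is_tree :: "nat list set \<Rightarrow> bool" where
  "is_tree T \<longleftrightarrow> [] \<in> T \<and> (\<forall>xs y. xs @ [y] \<in> T \<longrightarrow> xs \<in> T)"

lemma list_encode_in_image [simp]: "list_encode xs \<in> list_encode ` T \<longleftrightarrow> xs \<in> T"
  by (auto simp: image_iff list_encode_eq)

lemma sat_tree_fm:
  assumes "E T = list_encode ` U"
  shows "sat M e E (tree_fm T) \<longleftrightarrow> is_tree U"
proof -
  have restr: "sat M (e(11 := u, 12 := v, 0 := n, 1 := c, 2 := d)) E
        (restr (beta (V 11) (V 12)) t (V k)) \<longleftrightarrow>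
      (e(11 := u, 12 := v, 0 := n, 1 := c, 2 := d)) k = list_encode (map (beta_fun u v)
        [0..<val (e(11 := u, 12 := v, 0 := n, 1 := c, 2 := d)) t])"
    if "vars_tm t \<subseteq> {0}" "k \<in> {1, 2}" for u v n c d t k
    by (subst sat_restr[where x = "beta_fun u v"]) (use that in \<open>auto simp: sat_beta\<close>)
  have "0 \<in> list_encode ` U \<longleftrightarrow> [] \<in> U"
    using list_encode_in_image[of "[]" U] by simp
  then have "sat M e E (tree_fm T) \<longleftrightarrow> [] \<in> U \<and> (\<forall>u v n.
      map (beta_fun u v) [0..<Suc n] \<in> U \<longrightarrow> map (beta_fun u v) [0..<n] \<in> U)"
    by (simp add: tree_fm_def restr assms del: upt_Suc One_nat_def)
  also have "\<dots> \<longleftrightarrow> is_tree U"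
  proof -
    have "xs \<in> U" if *: "\<forall>u v n. map (beta_fun u v) [0..<Suc n] \<in> U \<longrightarrow> map (beta_fun u v) [0..<n] \<in> U"
      "xs @ [y] \<in> U" for xs y
    proof -
      obtain u v where uv: "\<forall>i<Suc (length xs). beta_fun u v i = (xs @ [y]) ! i"
        using ex_beta_fun[of "Suc (length xs)" "\<lambda>i. (xs @ [y]) ! i"] by blast
      have "map (beta_fun u v) [0..<Suc (length xs)] = xs @ [y]"
        using uv by (intro nth_equalityI) (auto simp del: upt_Suc)
      moreover have "map (beta_fun u v) [0..<length xs] = xs"
        using uv by (intro nth_equalityI) (auto simp: nth_append)
      ultimately show ?thesis
        using *(1)[rule_format, of u v "length xs"] *(2) by (simp del: upt_Suc)
    qed
    moreover have "map (beta_fun u v) [0..<n] \<in> U"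
      if "is_tree U" "map (beta_fun u v) [0..<Suc n] \<in> U" for u v n
      using that unfolding is_tree_def by simp blast
    ultimately show ?thesis unfolding is_tree_def by blast
  qed
  finally show ?thesis .
qed

lemma sat_function_fm: "sat M e E (function_fm X) \<longleftrightarrow> (\<exists>x. E X = graph x)"
proof -
  have "sat M e E (function_fm X) \<longleftrightarrow> (\<forall>n. \<exists>m. \<forall>y. prod_encode (n, y) \<in> E X \<longleftrightarrow> y = m)"
  proof -
    have "sat M e E (Iff \<phi> \<psi>) \<longleftrightarrow> (sat M e E \<phi> \<longleftrightarrow> sat M e E \<psi>)" for e \<phi> \<psi> by auto
    then show ?thesis 
      unfolding function_fm_def sat.simps(6,7) by (simp only:) (simp add: sat_pair_in)
  qed
  also have "\<dots> \<longleftrightarrow> (\<exists>x. \<forall>n y. prod_encode (n, y) \<in> E X \<longleftrightarrow> y = x n)"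
    by (rule choice_iff)
  also have "\<dots> \<longleftrightarrow> (\<exists>x. E X = graph x)"
  proof -
    have "E X = graph x" if "\<forall>n y. prod_encode (n, y) \<in> E X \<longleftrightarrow> y = x n" for x
    proof (rule set_eqI)
      fix p
      obtain n y where "p = prod_encode (n, y)" by (metis prod_decode_inverse surj_pair)
      then show "p \<in> E X \<longleftrightarrow> p \<in> graph x" using that by simp
    qed
    then show ?thesis by auto
  qed
  finally show ?thesis .
qed

lemma sat_even_fm: "sat M e E even_fm \<longleftrightarrow> even (e 0)"
  by (simp add: even_fm_def dvd_def mult_2)

lemma sat_follows_fm:
  assumes "E X = graph x" "E Str = graph s"
  shows "sat M e E (follows_fm Str even_fm X) \<longleftrightarrow> follows_I (s \<circ> list_encode) x"
    and "sat M e E (follows_fm Str (Neg even_fm) X) \<longleftrightarrow> follows_II (s \<circ> list_encode) x"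
proof -
  have "sat M (e(0 := n, 1 := c, 2 := m)) E (restr (pair_in X) (V 0) (V 1)) \<longleftrightarrow>
      c = list_encode (map x [0..<n])" for n c m
    using assms by (subst sat_restr_pair_in[where x = x]) auto
  then have "sat M e E (follows_fm Str \<pi> X) \<longleftrightarrow>
      (\<forall>n. sat M (e(0 := n)) E \<pi> \<longrightarrow> s (list_encode (map x [0..<n])) = x n)" for \<pi>
    using assms by (simp add: follows_fm_def sat_pair_in del: One_nat_def)
  then show "sat M e E (follows_fm Str even_fm X) \<longleftrightarrow> follows_I (s \<circ> list_encode) x"
    and "sat M e E (follows_fm Str (Neg even_fm) X) \<longleftrightarrow> follows_II (s \<circ> list_encode) x"
    by (auto simp: follows_I_def follows_II_def sat_even_fm)
qed

lemma sat_restr_in: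
  assumes "E X = graph x" "E T = list_encode ` U" "vars_tm n \<inter> ({1} \<union> {3..10}) = {}"
  shows "sat M e E (restr_in X n T) \<longleftrightarrow> map x [0..<val e n] \<in> U"
proof -
  have "sat M (e(1 := c)) E (restr (pair_in X) n (V 1)) \<longleftrightarrow> c = list_encode (map x [0..<val e n])"
    for c
    using assms by (subst sat_restr_pair_in[where x = x]) (auto simp: val_upd)
  then show ?thesis by (simp add: restr_in_def assms del: One_nat_def)
qed

definition won_by_I :: "(nat \<Rightarrow> nat) set \<Rightarrow> nat list set \<Rightarrow> (nat \<Rightarrow> nat) \<Rightarrow> bool" where
  "won_by_I A T x \<longleftrightarrow>
    (\<forall>n. map x [0..<n] \<in> T) \<and> x \<in> A \<or>
    (\<exists>n. odd n \<and> map x [0..<n] \<in> T \<and> map x [0..<Suc n] \<notin> T)"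

lemma sat_won_by_I_fm:
  assumes "E 0 = graph x" "E 2 = list_encode ` T"
  shows "sat M e E (won_by_I_fm \<phi>) \<longleftrightarrow> won_by_I {y. sat M e (E(0 := graph y)) \<phi>} T x"
proof -
  have "E(0 := graph x) = E" by (metis assms(1) fun_upd_triv)
  then show ?thesis
    by (simp add: won_by_I_fm_def won_by_I_def sat_even_fm sat_restr_in[OF assms] del: upt_Suc)
      blast
qed

lemma sat_PD_instance:
  assumes "fvN \<phi> = {}" "fvS \<phi> \<subseteq> {0, 1}"
  shows "sat M e E (PD_instance \<phi>) \<longleftrightarrow>
    (\<forall>Y\<in>M. \<forall>T. list_encode ` T \<in> M \<longrightarrow> is_tree T \<longrightarrow>
      (let A = {x. sat M e (E(0 := graph x, 1 := Y)) \<phi>} in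
       (\<exists>\<sigma>. graph (\<sigma> \<circ> list_decode) \<in> M \<and>
          (\<forall>x. graph x \<in> M \<longrightarrow> follows_I \<sigma> x \<longrightarrow> won_by_I A T x)) \<or>
       (\<exists>\<sigma>. graph (\<sigma> \<circ> list_decode) \<in> M \<and>
          (\<forall>x. graph x \<in> M \<longrightarrow> follows_II \<sigma> x \<longrightarrow> \<not> won_by_I A T x))))"
proof -
  have image: "(\<forall>B\<in>M. P B) \<longleftrightarrow> (\<forall>T. list_encode ` T \<in> M \<longrightarrow> P (list_encode ` T))" for P
    by (metis surj_list_encode surj_image_vimage_eq)
  have graph: "(\<forall>B\<in>M. (\<exists>x. B = graph x) \<longrightarrow> P B) \<longleftrightarrow> (\<forall>x. graph x \<in> M \<longrightarrow> P (graph x))" for P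
    by blast
  have strat: "(\<exists>s. graph s \<in> M \<and> P (s \<circ> list_encode)) \<longleftrightarrow>
      (\<exists>\<sigma>. graph (\<sigma> \<circ> list_decode) \<in> M \<and> P \<sigma>)" for P
  proof
    assume "\<exists>s. graph s \<in> M \<and> P (s \<circ> list_encode)"
    then obtain s where "graph s \<in> M" "P (s \<circ> list_encode)" by blast
    then show "\<exists>\<sigma>. graph (\<sigma> \<circ> list_decode) \<in> M \<and> P \<sigma>"
      by (intro exI[of _ "s \<circ> list_encode"]) (simp add: o_def)
  next
    assume "\<exists>\<sigma>. graph (\<sigma> \<circ> list_decode) \<in> M \<and> P \<sigma>"
    then obtain \<sigma> where "graph (\<sigma> \<circ> list_decode) \<in> M" "P \<sigma>" by blast
    then show "\<exists>s. graph s \<in> M \<and> P (s \<circ> list_encode)"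
      by (intro exI[of _ "\<sigma> \<circ> list_decode"]) (simp add: o_def)
  qed
  have strat': "(\<exists>B\<in>M. (\<exists>s. B = graph s) \<and> Q B) \<longleftrightarrow>
      (\<exists>\<sigma>. graph (\<sigma> \<circ> list_decode) \<in> M \<and> P \<sigma>)"
    if "\<And>s. Q (graph s) \<longleftrightarrow> P (s \<circ> list_encode)" for P Q
    unfolding strat[symmetric] using that by blast
  define A where "A = (\<lambda>Y. {x. sat M e (E(0 := graph x, 1 := Y)) \<phi>})"
  have A: "{x. sat M e (E(1 := Y, 2 := B, 3 := C, 0 := D, 0 := graph x)) \<phi>} = A Y"
    for Y B C D
  proof -
    have "sat M e (E(1 := Y, 2 := B, 3 := C, 0 := D, 0 := graph x)) \<phi> =
        sat M e (E(0 := graph x, 1 := Y)) \<phi>" for x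
      by (rule sat_cong) (use assms in auto)
    then show ?thesis unfolding A_def by blast
  qed
  have won: "sat M e (E(1 := Y, 2 := list_encode ` T, 3 := C, 0 := graph x)) (won_by_I_fm \<phi>) \<longleftrightarrow>
      won_by_I (A Y) T x" for Y T C x
    by (subst sat_won_by_I_fm[of _ x T]) (simp_all only: A, auto)
  have tree: "sat M e (E(1 := Y, 2 := list_encode ` T)) (tree_fm 2) \<longleftrightarrow> is_tree T" for Y T
    by (rule sat_tree_fm) simp
  have fol:
    "sat M e (E(1 := Y, 2 := B, 3 := graph s, 0 := graph x)) (follows_fm 3 even_fm 0) \<longleftrightarrow>
      follows_I (s \<circ> list_encode) x"
    "sat M e (E(1 := Y, 2 := B, 3 := graph s, 0 := graph x)) (follows_fm 3 (Neg even_fm) 0) \<longleftrightarrow>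
      follows_II (s \<circ> list_encode) x" for Y B s x
    by (rule sat_follows_fm; simp)+
  have I: "(\<exists>C\<in>M. (\<exists>s. C = graph s) \<and> (\<forall>D\<in>M. (\<exists>x. D = graph x) \<longrightarrow>
        sat M e (E(1 := Y, 2 := list_encode ` T, 3 := C, 0 := D)) (follows_fm 3 even_fm 0) \<longrightarrow>
        sat M e (E(1 := Y, 2 := list_encode ` T, 3 := C, 0 := D)) (won_by_I_fm \<phi>))) \<longleftrightarrow>
      (\<exists>\<sigma>. graph (\<sigma> \<circ> list_decode) \<in> M \<and>
          (\<forall>x. graph x \<in> M \<longrightarrow> follows_I \<sigma> x \<longrightarrow> won_by_I (A Y) T x))" for Y T
    by (rule strat') (simp only: graph fol won)
  have II: "(\<exists>C\<in>M. (\<exists>s. C = graph s) \<and> (\<forall>D\<in>M. (\<exists>x. D = graph x) \<longrightarrow>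
        sat M e (E(1 := Y, 2 := list_encode ` T, 3 := C, 0 := D)) (follows_fm 3 (Neg even_fm) 0) \<longrightarrow>
        \<not> sat M e (E(1 := Y, 2 := list_encode ` T, 3 := C, 0 := D)) (won_by_I_fm \<phi>))) \<longleftrightarrow>
      (\<exists>\<sigma>. graph (\<sigma> \<circ> list_decode) \<in> M \<and>
          (\<forall>x. graph x \<in> M \<longrightarrow> follows_II \<sigma> x \<longrightarrow> \<not> won_by_I (A Y) T x))" for Y T
    by (rule strat') (simp only: graph fol won)
  have "sat M e E (PD_instance \<phi>) \<longleftrightarrow> (\<forall>Y\<in>M. \<forall>B\<in>M. sat M e (E(1 := Y, 2 := B)) (tree_fm 2) \<longrightarrow>
     (\<exists>C\<in>M. (\<exists>s. C = graph s) \<and> (\<forall>D\<in>M. (\<exists>x. D = graph x) \<longrightarrow>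
        sat M e (E(1 := Y, 2 := B, 3 := C, 0 := D)) (follows_fm 3 even_fm 0) \<longrightarrow>
        sat M e (E(1 := Y, 2 := B, 3 := C, 0 := D)) (won_by_I_fm \<phi>))) \<or>
     (\<exists>C\<in>M. (\<exists>s. C = graph s) \<and> (\<forall>D\<in>M. (\<exists>x. D = graph x) \<longrightarrow>
        sat M e (E(1 := Y, 2 := B, 3 := C, 0 := D)) (follows_fm 3 (Neg even_fm) 0) \<longrightarrow>
        \<not> sat M e (E(1 := Y, 2 := B, 3 := C, 0 := D)) (won_by_I_fm \<phi>))))"
  proof -
    have "sat M e E (Imp (tree_fm 2) \<phi>) \<longleftrightarrow> sat M e E (tree_fm 2) \<longrightarrow> sat M e E \<phi>"
      and "sat M e E (Disj \<phi> \<psi>) \<longleftrightarrow> sat M e E \<phi> \<or> sat M e E \<psi>"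
      and "sat M e E (Imp (Conj \<phi> \<psi>) \<theta>) \<longleftrightarrow> (sat M e E \<phi> \<longrightarrow> sat M e E \<psi> \<longrightarrow> sat M e E \<theta>)"
      and "sat M e E (Neg (won_by_I_fm \<phi>)) \<longleftrightarrow> \<not> sat M e E (won_by_I_fm \<phi>)" for E \<phi> \<psi> \<theta>
      by auto
    note connectives = this
    show ?thesis
      by (simp only: PD_instance_def sat.simps(5,8,9) connectives sat_function_fm fun_upd_same)
  qed
  also have "\<dots> \<longleftrightarrow> (\<forall>Y\<in>M. \<forall>T. list_encode ` T \<in> M \<longrightarrow> is_tree T \<longrightarrow>
       (\<exists>\<sigma>. graph (\<sigma> \<circ> list_decode) \<in> M \<and>
          (\<forall>x. graph x \<in> M \<longrightarrow> follows_I \<sigma> x \<longrightarrow> won_by_I (A Y) T x)) \<or>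
       (\<exists>\<sigma>. graph (\<sigma> \<circ> list_decode) \<in> M \<and>
          (\<forall>x. graph x \<in> M \<longrightarrow> follows_II \<sigma> x \<longrightarrow> \<not> won_by_I (A Y) T x)))"
    by (subst image) (simp only: tree I II)
  finally show ?thesis unfolding A_def Let_def .
qed

section \<open>The extended logic\<close>

text \<open>In \<open>Game k \<Phi> \<psi>\<close>, the formula \<open>\<Phi>\<close> has the free number variable 0 (for the value of the
  number variable \<open>k\<close>) and the free set variables 0 (for the play) and 1 (for the set defined
  by \<open>\<psi>\<close>). The formula \<open>\<psi>(v\<^sub>0, Y)\<close> has the number variable 0, which is bound in
  \<open>Game k \<Phi> \<psi>\<close>, and at most one free set variable \<open>Y\<close>, which stays free.\<close>

datatype xfm =
    L2 fm
  | Game nat fm fm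
  | XNeg xfm | XConj xfm xfm
  | XExN nat xfm | XAllN nat xfm
  | XExS nat xfm | XAllS nat xfm

primrec in_lang :: "fm set \<Rightarrow> xfm \<Rightarrow> bool" where
  "in_lang \<Gamma> (L2 \<phi>) \<longleftrightarrow> True"
| "in_lang \<Gamma> (Game k \<Phi> \<psi>) \<longleftrightarrow>
     \<Phi> \<in> \<Gamma> \<and> fvN \<Phi> \<subseteq> {0} \<and> fvS \<Phi> \<subseteq> {0, 1} \<and> fvN \<psi> \<subseteq> {0} \<and> (\<exists>Y. fvS \<psi> \<subseteq> {Y})"
| "in_lang \<Gamma> (XNeg \<chi>) \<longleftrightarrow> in_lang \<Gamma> \<chi>"
| "in_lang \<Gamma> (XConj \<chi> \<theta>) \<longleftrightarrow> in_lang \<Gamma> \<chi> \<and> in_lang \<Gamma> \<theta>"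
| "in_lang \<Gamma> (XExN i \<chi>) \<longleftrightarrow> in_lang \<Gamma> \<chi>"
| "in_lang \<Gamma> (XAllN i \<chi>) \<longleftrightarrow> in_lang \<Gamma> \<chi>"
| "in_lang \<Gamma> (XExS X \<chi>) \<longleftrightarrow> in_lang \<Gamma> \<chi>"
| "in_lang \<Gamma> (XAllS X \<chi>) \<longleftrightarrow> in_lang \<Gamma> \<chi>"

primrec xfvN :: "xfm \<Rightarrow> nat set" where
  "xfvN (L2 \<phi>) = fvN \<phi>"
| "xfvN (Game k \<Phi> \<psi>) = insert k (fvN \<psi> - {0})"
| "xfvN (XNeg \<chi>) = xfvN \<chi>"
| "xfvN (XConj \<chi> \<theta>) = xfvN \<chi> \<union> xfvN \<theta>"
| "xfvN (XExN i \<chi>) = xfvN \<chi> - {i}"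
| "xfvN (XAllN i \<chi>) = xfvN \<chi> - {i}"
| "xfvN (XExS X \<chi>) = xfvN \<chi>"
| "xfvN (XAllS X \<chi>) = xfvN \<chi>"

primrec xfvS :: "xfm \<Rightarrow> nat set" where
  "xfvS (L2 \<phi>) = fvS \<phi>"
| "xfvS (Game k \<Phi> \<psi>) = fvS \<psi>"
| "xfvS (XNeg \<chi>) = xfvS \<chi>"
| "xfvS (XConj \<chi> \<theta>) = xfvS \<chi> \<union> xfvS \<theta>"
| "xfvS (XExN i \<chi>) = xfvS \<chi>"
| "xfvS (XAllN i \<chi>) = xfvS \<chi>"
| "xfvS (XExS X \<chi>) = xfvS \<chi> - {X}"
| "xfvS (XAllS X \<chi>) = xfvS \<chi> - {X}"

primrec xsat :: "nat set set \<Rightarrow> (nat \<Rightarrow> nat) \<Rightarrow> (nat \<Rightarrow> nat set) \<Rightarrow> xfm \<Rightarrow> bool" where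
  "xsat M e E (L2 \<phi>) \<longleftrightarrow> sat M e E \<phi>"
| "xsat M e E (Game k \<Phi> \<psi>) \<longleftrightarrow>
     wins_I {x. sat UNIV ((\<lambda>_. 0)(0 := e k))
       ((\<lambda>_. {})(0 := graph x, 1 := {n. sat M (e(0 := n)) E \<psi>})) \<Phi>}"
| "xsat M e E (XNeg \<chi>) \<longleftrightarrow> \<not> xsat M e E \<chi>"
| "xsat M e E (XConj \<chi> \<theta>) \<longleftrightarrow> xsat M e E \<chi> \<and> xsat M e E \<theta>"
| "xsat M e E (XExN i \<chi>) \<longleftrightarrow> (\<exists>n. xsat M (e(i := n)) E \<chi>)"
| "xsat M e E (XAllN i \<chi>) \<longleftrightarrow> (\<forall>n. xsat M (e(i := n)) E \<chi>)"
| "xsat M e E (XExS X \<chi>) \<longleftrightarrow> (\<exists>A\<in>M. xsat M e (E(X := A)) \<chi>)"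
| "xsat M e E (XAllS X \<chi>) \<longleftrightarrow> (\<forall>A\<in>M. xsat M e (E(X := A)) \<chi>)"

definition Def :: "fm set \<Rightarrow> nat set set \<Rightarrow> nat set set" where
  "Def \<Gamma> M = {Y. \<exists>\<chi> E. in_lang \<Gamma> \<chi> \<and> xfvN \<chi> \<subseteq> {0} \<and> (\<forall>X\<in>xfvS \<chi>. E X \<in> M) \<and>
     Y = {n. xsat M ((\<lambda>_. 0)(0 := n)) E \<chi>}}"

section \<open>The hierarchy\<close>

text \<open>The ordinals below the cardinal of \<open>\<P>(\<P>(\<nat>))\<close>. These suffice to reach a fixed point of
  every increasing sequence of subsets of \<open>\<P>(\<nat>)\<close>; see \<open>hier_fixed_point\<close> below.\<close>

typedef ordinal = "UNIV :: nat set set set" by simp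

instantiation ordinal :: wellorder
begin

definition less_eq_ordinal :: "ordinal \<Rightarrow> ordinal \<Rightarrow> bool" where
  "\<alpha> \<le> \<beta> \<longleftrightarrow> (Rep_ordinal \<alpha>, Rep_ordinal \<beta>) \<in> card_of (UNIV :: nat set set set)"

definition less_ordinal :: "ordinal \<Rightarrow> ordinal \<Rightarrow> bool" where
  "\<alpha> < \<beta> \<longleftrightarrow> \<alpha> \<le> \<beta> \<and> \<not> \<beta> \<le> (\<alpha> :: ordinal)"

instance
proof
  let ?r = "card_of (UNIV :: nat set set set)"
  have wo: "well_order_on UNIV ?r"
    using card_of_well_order_on .
  then have lin: "linear_order_on UNIV ?r" and wf: "wf (?r - Id)"
    by (auto simp: well_order_on_def)
  then have props: "refl ?r" "trans ?r" "antisym ?r" "total ?r"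
    by (auto simp: order_on_defs)
  fix \<alpha> \<beta> \<gamma> :: ordinal
  show "\<alpha> < \<beta> \<longleftrightarrow> \<alpha> \<le> \<beta> \<and> \<not> \<beta> \<le> \<alpha>" by (rule less_ordinal_def)
  show "\<alpha> \<le> \<alpha>" unfolding less_eq_ordinal_def using props(1) by (simp add: refl_on_def)
  show "\<alpha> \<le> \<beta> \<Longrightarrow> \<beta> \<le> \<gamma> \<Longrightarrow> \<alpha> \<le> \<gamma>" unfolding less_eq_ordinal_def using props(2) by (rule transD)
  show anti: "\<alpha> \<le> \<beta> \<Longrightarrow> \<beta> \<le> \<alpha> \<Longrightarrow> \<alpha> = \<beta>" for \<alpha> \<beta> :: ordinal
    unfolding less_eq_ordinal_def using props(3) by (auto dest: antisymD simp: Rep_ordinal_inject)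
  show "\<alpha> \<le> \<beta> \<or> \<beta> \<le> \<alpha>" unfolding less_eq_ordinal_def using props(1,4)
    by (metis UNIV_I refl_on_def total_on_def)
  fix P :: "ordinal \<Rightarrow> bool"
  assume step: "\<And>\<alpha>. (\<And>\<beta>. \<beta> < \<alpha> \<Longrightarrow> P \<beta>) \<Longrightarrow> P \<alpha>"
  have "wf (inv_image (?r - Id) Rep_ordinal)" using wf by (rule wf_inv_image)
  then show "P \<alpha>"
  proof (induction \<alpha> rule: wf_induct_rule)
    case (less \<alpha>)
    show ?case
    proof (rule step)
      fix \<beta> assume "\<beta> < \<alpha>"
      then have "\<beta> \<le> \<alpha>" "\<beta> \<noteq> \<alpha>" by (auto simp: less_ordinal_def)
      then show "P \<beta>" by (intro less) (auto simp: less_eq_ordinal_def Rep_ordinal_inject)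
    qed
  qed
qed

end

definition osuc :: "ordinal \<Rightarrow> ordinal" where
  "osuc \<alpha> = (LEAST \<beta>. \<alpha> < \<beta>)"

lemma less_osuc: "\<alpha> < osuc \<alpha>"
proof -
  have "infinite (UNIV :: nat set set set)"
    by (simp add: Finite_Set.finite_set)
  then obtain b where "Rep_ordinal \<alpha> \<noteq> b"
    "(Rep_ordinal \<alpha>, b) \<in> card_of (UNIV :: nat set set set)"
    using infinite_Card_order_limit[of "card_of (UNIV :: nat set set set)" "Rep_ordinal \<alpha>"]
    by (auto simp: card_of_card_order_on Field_card_of)
  then have "\<alpha> \<le> Abs_ordinal b" "\<alpha> \<noteq> Abs_ordinal b"
    by (auto simp: less_eq_ordinal_def Abs_ordinal_inverse)
  then have "\<alpha> < Abs_ordinal b" by simp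
  then show ?thesis unfolding osuc_def by (rule LeastI)
qed

lemma osuc_le: "\<alpha> < \<beta> \<Longrightarrow> osuc \<alpha> \<le> \<beta>"
  unfolding osuc_def by (rule Least_le)

lemma osuc_inject: "osuc \<alpha> = osuc \<beta> \<longleftrightarrow> \<alpha> = \<beta>"
  by (metis less_osuc osuc_le leD linorder_less_linear order_less_le_trans)

text \<open>The second case covers limit ordinals and 0, where the union is empty.\<close>

function hier :: "fm set \<Rightarrow> ordinal \<Rightarrow> nat set set" where
  "hier \<Gamma> \<beta> = (if \<exists>\<alpha>. \<beta> = osuc \<alpha> then Def \<Gamma> (hier \<Gamma> (THE \<alpha>. \<beta> = osuc \<alpha>))
              else \<Union>\<alpha>\<in>{..<\<beta>}. hier \<Gamma> \<alpha>)"
  by auto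
termination
proof (relation "inv_image {(\<alpha>, \<beta>). \<alpha> < \<beta>} snd")
  show "wf (inv_image {(\<alpha> :: ordinal, \<beta>). \<alpha> < \<beta>} (snd :: fm set \<times> _ \<Rightarrow> _))"
    by (simp add: wf)
qed (auto simp: osuc_inject less_osuc)

declare hier.simps [simp del]

lemma hier_zero: "hier \<Gamma> (LEAST \<beta>. True) = {}"
proof -
  have *: "\<not> \<alpha> < (LEAST \<beta>. True)" for \<alpha> :: ordinal by (simp add: Least_le leD)
  then have "\<nexists>\<alpha>. (LEAST \<beta>. True) = osuc \<alpha>" using less_osuc by metis
  with * show ?thesis by (subst hier.simps) auto
qed

lemma hier_osuc: "hier \<Gamma> (osuc \<alpha>) = Def \<Gamma> (hier \<Gamma> \<alpha>)"
  by (subst hier.simps) (auto simp: osuc_inject)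

lemma hier_limit: "\<nexists>\<alpha>. \<beta> = osuc \<alpha> \<Longrightarrow> hier \<Gamma> \<beta> = (\<Union>\<alpha>\<in>{..<\<beta>}. hier \<Gamma> \<alpha>)"
  by (subst hier.simps) auto

lemma Def_increasing: "M \<subseteq> Def \<Gamma> M"
proof
  fix Y assume "Y \<in> M"
  then show "Y \<in> Def \<Gamma> M"
    unfolding Def_def by (auto intro!: exI[of _ "L2 (Mem (V 0) 0)"] exI[of _ "\<lambda>_. Y"])
qed

lemma hier_mono: "\<alpha> \<le> \<beta> \<Longrightarrow> hier \<Gamma> \<alpha> \<subseteq> hier \<Gamma> \<beta>"
proof (induction \<beta> arbitrary: \<alpha> rule: less_induct)
  case (less \<beta>)
  show ?case
  proof (cases "\<alpha> = \<beta>")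
    case False
    then have "\<alpha> < \<beta>" using less.prems by simp
    show ?thesis
    proof (cases "\<exists>\<gamma>. \<beta> = osuc \<gamma>")
      case True
      then obtain \<gamma> where \<gamma>: "\<beta> = osuc \<gamma>" by blast
      then have "\<alpha> \<le> \<gamma>" using \<open>\<alpha> < \<beta>\<close> osuc_le by (meson leD linorder_not_le)
      then have "hier \<Gamma> \<alpha> \<subseteq> hier \<Gamma> \<gamma>" using less.IH \<gamma> less_osuc by blast
      then show ?thesis using Def_increasing \<gamma> by (auto simp: hier_osuc)
    qed (use \<open>\<alpha> < \<beta>\<close> in \<open>auto simp: hier_limit\<close>)
  qed simp
qed

lemma hier_fixed_point: "\<exists>\<beta>. hier \<Gamma> \<beta> = hier \<Gamma> (osuc \<beta>)"
proof (rule ccontr)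
  assume "\<not> ?thesis"
  then have "\<exists>Y. Y \<in> hier \<Gamma> (osuc \<beta>) \<and> Y \<notin> hier \<Gamma> \<beta>" for \<beta>
    using hier_mono[of \<beta> "osuc \<beta>" \<Gamma>] less_osuc[of \<beta>] by (metis less_imp_le subsetI subset_antisym)
  then obtain f where f: "\<And>\<beta>. f \<beta> \<in> hier \<Gamma> (osuc \<beta>)" "\<And>\<beta>. f \<beta> \<notin> hier \<Gamma> \<beta>" by metis
  have "f \<alpha> \<noteq> f \<beta>" if "\<alpha> < \<beta>" for \<alpha> \<beta>
    using f[of \<alpha>] f[of \<beta>] hier_mono[OF osuc_le[OF that]] by (metis subsetD)
  then have "inj f" by (metis injI linorder_less_linear)
  then have "inj (f \<circ> Abs_ordinal)"
    by (intro inj_compose) (auto simp: inj_def Abs_ordinal_inject)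
  then have "inj (f \<circ> Abs_ordinal :: nat set set \<Rightarrow> nat set)" .
  then have "surj (inv (f \<circ> Abs_ordinal) :: nat set \<Rightarrow> nat set set)"
    by (rule inj_imp_surj_inv)
  then show False using Cantors_theorem[of "UNIV :: nat set set"] by auto
qed

definition P_game :: "fm set \<Rightarrow> nat set set" where
  "P_game \<Gamma> = hier \<Gamma> (LEAST \<beta>. hier \<Gamma> \<beta> = hier \<Gamma> (osuc \<beta>))"

definition P_Proj :: "nat set set" where
  "P_Proj = P_game Proj"

definition minimal_model :: "(nat set set \<Rightarrow> bool) \<Rightarrow> nat set set \<Rightarrow> bool" where
  "minimal_model C M \<longleftrightarrow> C M \<and> (\<forall>N. C N \<longrightarrow> M \<subseteq> N)"

end

theory Submission
  imports Defs "HOL-Library.Countable_Set"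
begin

text \<open>Every formula is equivalent over the full model to a prenex one, so projective
  correctness of \<open>M\<close> says that \<open>M\<close> is an elementary submodel of the full
  model for the whole language (\<open>projectively_correct_elementary\<close>). Such an
  \<open>M\<close> contains every set \<open>A\<close> that is definable without parameters over
  the full model, because the sentence "some set satisfies the definition of \<open>A\<close>" is
  true in \<open>M\<close> (\<open>definable_sets_subset\<close>). The theorem follows once the
  definable sets are themselves an elementary submodel and coincide with \<open>P_Proj\<close> and
  with the two unions: they are then the least projectively correct set, and they inherit
  comprehension and the scheme \<open>PD\<close> from the full model.

  That the definable sets form an elementary submodel is, by the criterion of Tarski and Vaught, a
  basis theorem: under projective determinacy every nonempty definable set of points has a
  definable element (\<open>basis\<close>). It is proved with semiscales, which are sequences of
  prewellorderings of a set such that the limit of a convergent sequence of its elements belongs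
  to the set as soon as each prewellordering eventually does not distinguish the terms. The
  leftmost point with respect to a definable semiscale is definable
  (\<open>semiscaled_basis\<close>), and definable semiscales propagate along the construction of
  formulas. The existential quantifier minimizes over witnesses (\<open>semiscaled_ex\<close>).
  The universal quantifier is the place where determinacy enters: points are compared through
  games in which the players choose the values of the quantified variable
  (\<open>semiscaled_all\<close>, a form of the second periodicity theorem of Moschovakis).

  The definable sets already appear at the first level of the hierarchies. A set \<open>{k.
  \<exists>B. \<alpha>(k, B)}\<close> is defined by the game in which player I writes down
  \<open>B\<close> and the moves of player II are ignored; for universal quantifiers the roles are
  exchanged. With dummy quantifiers the class of \<open>\<alpha>\<close> can be chosen as
  \<open>Pi11 (2 * k + 1)\<close> or \<open>Sigma11 (2 * k)\<close>
  (\<open>definable_sets_Pi\<close>, \<open>definable_sets_Sigma\<close>). For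
  \<open>P_Proj\<close> this finishes the matter: games are evaluated in the universe, so over an
  elementary submodel the extended logic defines only definable sets, and the first level is a
  fixed point (\<open>P_Proj_eq\<close>).

  For a fixed level \<open>\<Gamma>\<close> of the projective hierarchy the first level consists of
  some definable sets only, and later stages are not known to be elementary. That \<open>P_game
  \<Gamma>\<close> contains only definable sets is shown by condensation
  (\<open>P_game_subset_definable_sets\<close>). A countable Skolem hull of the hierarchy gives a
  countable well-founded relation along which \<open>Def \<Gamma>\<close> is iterated until a
  fixed point is reached (\<open>countable_hierarchy\<close>), and conversely every such
  well-founded iteration yields \<open>P_game \<Gamma>\<close>
  (\<open>well_founded_hierarchy_top\<close>). As \<open>\<Gamma>\<close> has bounded complexity
  it has a definable truth predicate, so the set of all codes of such iterations is definable
  (\<open>Dfn_Def\<close>). By the basis theorem it has a definable element, in which every member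
  of \<open>P_game \<Gamma>\<close> occurs at a numbered place.\<close>

section \<open>Substitution\<close>

lemma finite_vars_tm [simp]: "finite (vars_tm t)"
  by (induction t) auto

lemma finite_fvN [simp]: "finite (fvN \<phi>)"
  by (induction \<phi>) auto

lemma finite_fvS [simp]: "finite (fvS \<phi>)"
  by (induction \<phi>) auto

lemma val_cong: "(\<And>i. i \<in> vars_tm t \<Longrightarrow> e i = e' i) \<Longrightarrow> val e t = val e' t"
  by (induction t) auto

primrec subst_tm :: "(nat \<Rightarrow> tm) \<Rightarrow> tm \<Rightarrow> tm" where
  "subst_tm \<rho> (V i) = \<rho> i"
| "subst_tm \<rho> Zero = Zero"
| "subst_tm \<rho> (S t) = S (subst_tm \<rho> t)"
| "subst_tm \<rho> (Plus s t) = Plus (subst_tm \<rho> s) (subst_tm \<rho> t)"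
| "subst_tm \<rho> (Times s t) = Times (subst_tm \<rho> s) (subst_tm \<rho> t)"

lemma val_subst_tm [simp]: "val e (subst_tm \<rho> t) = val (\<lambda>i. val e (\<rho> i)) t"
  by (induction t) auto

lemma vars_subst_tm [simp]: "vars_tm (subst_tm \<rho> t) = (\<Union>i\<in>vars_tm t. vars_tm (\<rho> i))"
  by (induction t) auto

text \<open>Simultaneous substitution of terms \<open>\<rho> i\<close> for number variables and of
  formulas \<open>\<delta> X\<close> for set variables, where \<open>\<delta> X\<close> describes
  the elements of the set through its number variable \<open>j\<close>. An atom passes the value
  of its term to \<open>\<delta> X\<close> by quantifying over \<open>j\<close>, so nothing has to
  be substituted into \<open>\<delta> X\<close>. Bound variables are shifted by \<open>k\<close>;
  capture is avoided as long as the variables in \<open>\<rho>\<close> and \<open>\<delta>\<close>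
  are below \<open>k\<close>.\<close>

primrec subst :: "nat \<Rightarrow> nat \<Rightarrow> fm \<Rightarrow> (nat \<Rightarrow> tm) \<Rightarrow> (nat \<Rightarrow> fm) \<Rightarrow> fm" where
  "subst k j (Eq s t) \<rho> \<delta> = Eq (subst_tm \<rho> s) (subst_tm \<rho> t)"
| "subst k j (Less s t) \<rho> \<delta> = Less (subst_tm \<rho> s) (subst_tm \<rho> t)"
| "subst k j (Mem t X) \<rho> \<delta> = ExN j (Conj (Eq (V j) (subst_tm \<rho> t)) (\<delta> X))"
| "subst k j (Neg \<phi>) \<rho> \<delta> = Neg (subst k j \<phi> \<rho> \<delta>)"
| "subst k j (Conj \<phi> \<psi>) \<rho> \<delta> = Conj (subst k j \<phi> \<rho> \<delta>) (subst k j \<psi> \<rho> \<delta>)"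
| "subst k j (ExN i \<phi>) \<rho> \<delta> = ExN (i + k) (subst k j \<phi> (\<rho>(i := V (i + k))) \<delta>)"
| "subst k j (AllN i \<phi>) \<rho> \<delta> = AllN (i + k) (subst k j \<phi> (\<rho>(i := V (i + k))) \<delta>)"
| "subst k j (ExS X \<phi>) \<rho> \<delta> = ExS (X + k) (subst k j \<phi> \<rho> (\<delta>(X := Mem (V j) (X + k))))"
| "subst k j (AllS X \<phi>) \<rho> \<delta> = AllS (X + k) (subst k j \<phi> \<rho> (\<delta>(X := Mem (V j) (X + k))))"

text \<open>The variable \<open>i + k\<close> is admitted in \<open>\<rho> i\<close> because under
  a binder the substitution sends the bound variable \<open>i\<close> to its shifted copy.\<close>

lemma sat_subst:
  assumes "j < k"
    and "\<forall>i\<in>fvN \<phi>. j \<notin> vars_tm (\<rho> i) \<and> vars_tm (\<rho> i) \<subseteq> {..<k} \<union> {i + k}"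
    and "\<forall>X\<in>fvS \<phi>. fvN (\<delta> X) \<subseteq> {..<k} \<and> fvS (\<delta> X) \<subseteq> {..<k} \<union> {X + k}"
  shows "sat M e E (subst k j \<phi> \<rho> \<delta>) \<longleftrightarrow>
    sat M (\<lambda>i. val e (\<rho> i)) (\<lambda>X. {m. sat M (e(j := m)) E (\<delta> X)}) \<phi>"
  using assms(2,3)
proof (induction \<phi> arbitrary: e E \<rho> \<delta>)
  case (Mem t X)
  have "val (e(j := m)) (subst_tm \<rho> t) = val e (subst_tm \<rho> t)" for m
    using Mem.prems by (intro val_upd) auto
  then have "val (\<lambda>i. val (e(j := m)) (\<rho> i)) t = val (\<lambda>i. val e (\<rho> i)) t" for m
    by (simp only: val_subst_tm)
  then show ?case by (simp only: subst.simps sat.simps val_subst_tm) simp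
next
  case (ExN i \<phi>)
  have \<rho>: "j \<notin> vars_tm (\<rho> l)" "vars_tm (\<rho> l) \<subseteq> {..<k} \<union> {l + k}" if "l \<in> fvN \<phi>" "l \<noteq> i" for l
    using ExN.prems(1) that by simp_all
  have \<delta>: "fvN (\<delta> X) \<subseteq> {..<k}" "fvS (\<delta> X) \<subseteq> {..<k} \<union> {X + k}" if "X \<in> fvS \<phi>" for X
    using ExN.prems(2) that by simp_all
  have "sat M (e(i + k := n)) E (subst k j \<phi> (\<rho>(i := V (i + k))) \<delta>) \<longleftrightarrow>
      sat M ((\<lambda>i. val e (\<rho> i))(i := n)) (\<lambda>X. {m. sat M (e(j := m)) E (\<delta> X)}) \<phi>" for n
  proof (subst ExN.IH)
    show "\<forall>l\<in>fvN \<phi>. j \<notin> vars_tm ((\<rho>(i := V (i + k))) l) \<and>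
        vars_tm ((\<rho>(i := V (i + k))) l) \<subseteq> {..<k} \<union> {l + k}"
      using \<rho> \<open>j < k\<close> by simp
    show "\<forall>X\<in>fvS \<phi>. fvN (\<delta> X) \<subseteq> {..<k} \<and> fvS (\<delta> X) \<subseteq> {..<k} \<union> {X + k}"
      using \<delta> by blast
    have "val (e(i + k := n)) (\<rho> l) = val e (\<rho> l)" if "l \<in> fvN \<phi>" "l \<noteq> i" for l
      using \<rho>(2)[OF that] that by (intro val_upd) auto
    moreover have "sat M (e(i + k := n, j := m)) E (\<delta> X) = sat M (e(j := m)) E (\<delta> X)"
      if "X \<in> fvS \<phi>" for X m
      using \<delta>(1)[OF that] by (intro sat_cong) auto
    ultimately show "sat M (\<lambda>l. val (e(i + k := n)) ((\<rho>(i := V (i + k))) l))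
        (\<lambda>X. {m. sat M (e(i + k := n, j := m)) E (\<delta> X)}) \<phi> \<longleftrightarrow>
      sat M ((\<lambda>i. val e (\<rho> i))(i := n)) (\<lambda>X. {m. sat M (e(j := m)) E (\<delta> X)}) \<phi>"
      by (intro sat_cong) simp_all
  qed
  then show ?case by (simp only: subst.simps sat.simps)
next
  case (AllN i \<phi>)
  have \<rho>: "j \<notin> vars_tm (\<rho> l)" "vars_tm (\<rho> l) \<subseteq> {..<k} \<union> {l + k}" if "l \<in> fvN \<phi>" "l \<noteq> i" for l
    using AllN.prems(1) that by simp_all
  have \<delta>: "fvN (\<delta> X) \<subseteq> {..<k}" "fvS (\<delta> X) \<subseteq> {..<k} \<union> {X + k}" if "X \<in> fvS \<phi>" for X
    using AllN.prems(2) that by simp_all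
  have "sat M (e(i + k := n)) E (subst k j \<phi> (\<rho>(i := V (i + k))) \<delta>) \<longleftrightarrow>
      sat M ((\<lambda>i. val e (\<rho> i))(i := n)) (\<lambda>X. {m. sat M (e(j := m)) E (\<delta> X)}) \<phi>" for n
  proof (subst AllN.IH)
    show "\<forall>l\<in>fvN \<phi>. j \<notin> vars_tm ((\<rho>(i := V (i + k))) l) \<and>
        vars_tm ((\<rho>(i := V (i + k))) l) \<subseteq> {..<k} \<union> {l + k}"
      using \<rho> \<open>j < k\<close> by simp
    show "\<forall>X\<in>fvS \<phi>. fvN (\<delta> X) \<subseteq> {..<k} \<and> fvS (\<delta> X) \<subseteq> {..<k} \<union> {X + k}"
      using \<delta> by blast
    have "val (e(i + k := n)) (\<rho> l) = val e (\<rho> l)" if "l \<in> fvN \<phi>" "l \<noteq> i" for l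
      using \<rho>(2)[OF that] that by (intro val_upd) auto
    moreover have "sat M (e(i + k := n, j := m)) E (\<delta> X) = sat M (e(j := m)) E (\<delta> X)"
      if "X \<in> fvS \<phi>" for X m
      using \<delta>(1)[OF that] by (intro sat_cong) auto
    ultimately show "sat M (\<lambda>l. val (e(i + k := n)) ((\<rho>(i := V (i + k))) l))
        (\<lambda>X. {m. sat M (e(i + k := n, j := m)) E (\<delta> X)}) \<phi> \<longleftrightarrow>
      sat M ((\<lambda>i. val e (\<rho> i))(i := n)) (\<lambda>X. {m. sat M (e(j := m)) E (\<delta> X)}) \<phi>"
      by (intro sat_cong) simp_all
  qed
  then show ?case by (simp only: subst.simps sat.simps)
next
  case (ExS X \<phi>)
  have \<delta>: "fvN (\<delta> Z) \<subseteq> {..<k}" "fvS (\<delta> Z) \<subseteq> {..<k} \<union> {Z + k}" if "Z \<in> fvS \<phi>" "Z \<noteq> X" for Z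
    using ExS.prems(2) that by simp_all
  have "sat M e (E(X + k := A)) (subst k j \<phi> \<rho> (\<delta>(X := Mem (V j) (X + k)))) \<longleftrightarrow>
      sat M (\<lambda>i. val e (\<rho> i)) ((\<lambda>X. {m. sat M (e(j := m)) E (\<delta> X)})(X := A)) \<phi>" for A
  proof (subst ExS.IH)
    show "\<forall>i\<in>fvN \<phi>. j \<notin> vars_tm (\<rho> i) \<and> vars_tm (\<rho> i) \<subseteq> {..<k} \<union> {i + k}"
      using ExS.prems(1) by simp
    show "\<forall>Z\<in>fvS \<phi>. fvN ((\<delta>(X := Mem (V j) (X + k))) Z) \<subseteq> {..<k} \<and>
        fvS ((\<delta>(X := Mem (V j) (X + k))) Z) \<subseteq> {..<k} \<union> {Z + k}"
      using \<delta> \<open>j < k\<close> by simp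
    have "sat M (e(j := m)) (E(X + k := A)) (\<delta> Z) = sat M (e(j := m)) E (\<delta> Z)"
      if "Z \<in> fvS \<phi>" "Z \<noteq> X" for Z m
      using \<delta>(2)[OF that] that by (intro sat_cong) auto
    then show "sat M (\<lambda>i. val e (\<rho> i))
        (\<lambda>Z. {m. sat M (e(j := m)) (E(X + k := A)) ((\<delta>(X := Mem (V j) (X + k))) Z)}) \<phi> \<longleftrightarrow>
      sat M (\<lambda>i. val e (\<rho> i)) ((\<lambda>X. {m. sat M (e(j := m)) E (\<delta> X)})(X := A)) \<phi>"
      by (intro sat_cong) simp_all
  qed
  then show ?case by (simp only: subst.simps sat.simps)
next
  case (AllS X \<phi>)
  have \<delta>: "fvN (\<delta> Z) \<subseteq> {..<k}" "fvS (\<delta> Z) \<subseteq> {..<k} \<union> {Z + k}" if "Z \<in> fvS \<phi>" "Z \<noteq> X" for Z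
    using AllS.prems(2) that by simp_all
  have "sat M e (E(X + k := A)) (subst k j \<phi> \<rho> (\<delta>(X := Mem (V j) (X + k)))) \<longleftrightarrow>
      sat M (\<lambda>i. val e (\<rho> i)) ((\<lambda>X. {m. sat M (e(j := m)) E (\<delta> X)})(X := A)) \<phi>" for A
  proof (subst AllS.IH)
    show "\<forall>i\<in>fvN \<phi>. j \<notin> vars_tm (\<rho> i) \<and> vars_tm (\<rho> i) \<subseteq> {..<k} \<union> {i + k}"
      using AllS.prems(1) by simp
    show "\<forall>Z\<in>fvS \<phi>. fvN ((\<delta>(X := Mem (V j) (X + k))) Z) \<subseteq> {..<k} \<and>
        fvS ((\<delta>(X := Mem (V j) (X + k))) Z) \<subseteq> {..<k} \<union> {Z + k}"
      using \<delta> \<open>j < k\<close> by simp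
    have "sat M (e(j := m)) (E(X + k := A)) (\<delta> Z) = sat M (e(j := m)) E (\<delta> Z)"
      if "Z \<in> fvS \<phi>" "Z \<noteq> X" for Z m
      using \<delta>(2)[OF that] that by (intro sat_cong) auto
    then show "sat M (\<lambda>i. val e (\<rho> i))
        (\<lambda>Z. {m. sat M (e(j := m)) (E(X + k := A)) ((\<delta>(X := Mem (V j) (X + k))) Z)}) \<phi> \<longleftrightarrow>
      sat M (\<lambda>i. val e (\<rho> i)) ((\<lambda>X. {m. sat M (e(j := m)) E (\<delta> X)})(X := A)) \<phi>"
      by (intro sat_cong) simp_all
  qed
  then show ?case by (simp only: subst.simps sat.simps)
next
  case (Conj \<phi> \<psi>)
  have "sat M e E (subst k j \<phi> \<rho> \<delta>) \<longleftrightarrow>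
      sat M (\<lambda>i. val e (\<rho> i)) (\<lambda>X. {m. sat M (e(j := m)) E (\<delta> X)}) \<phi>"
    by (rule Conj.IH(1)) (use Conj.prems in simp_all)
  moreover have "sat M e E (subst k j \<psi> \<rho> \<delta>) \<longleftrightarrow>
      sat M (\<lambda>i. val e (\<rho> i)) (\<lambda>X. {m. sat M (e(j := m)) E (\<delta> X)}) \<psi>"
    by (rule Conj.IH(2)) (use Conj.prems in simp_all)
  ultimately show ?case by (simp only: subst.simps sat.simps)
next
  case (Neg \<phi>)
  have "sat M e E (subst k j \<phi> \<rho> \<delta>) \<longleftrightarrow>
      sat M (\<lambda>i. val e (\<rho> i)) (\<lambda>X. {m. sat M (e(j := m)) E (\<delta> X)}) \<phi>"
    by (rule Neg.IH) (use Neg.prems in simp_all)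
  then show ?case by (simp only: subst.simps sat.simps)
qed simp_all

lemma fvN_subst:
  "fvN (subst k j \<phi> \<rho> \<delta>) \<subseteq> (\<Union>i\<in>fvN \<phi>. vars_tm (\<rho> i)) \<union> (\<Union>X\<in>fvS \<phi>. fvN (\<delta> X) - {j})"
proof (induction \<phi> arbitrary: \<rho> \<delta>)
  case (ExN i \<phi>)
  let ?A = "\<Union>l\<in>fvN \<phi> - {i}. vars_tm (\<rho> l)" and ?B = "\<Union>X\<in>fvS \<phi>. fvN (\<delta> X) - {j}"
  have "vars_tm ((\<rho>(i := V (i + k))) l) \<subseteq> insert (i + k) ?A" if "l \<in> fvN \<phi>" for l
    using that by (cases "l = i") auto
  then have "(\<Union>l\<in>fvN \<phi>. vars_tm ((\<rho>(i := V (i + k))) l)) \<subseteq> insert (i + k) ?A"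
    by (rule UN_least)
  then have "fvN (subst k j \<phi> (\<rho>(i := V (i + k))) \<delta>) \<subseteq> insert (i + k) ?A \<union> ?B"
    by (rule order_trans[OF ExN.IH Un_mono[OF _ subset_refl]])
  then have "fvN (subst k j \<phi> (\<rho>(i := V (i + k))) \<delta>) - {i + k} \<subseteq> ?A \<union> ?B"
    by (simp only: subset_insert_iff Un_insert_left) (meson Diff_subset order_trans)
  then show ?case by (simp only: subst.simps fvN.simps fvS.simps)
next
  case (AllN i \<phi>)
  let ?A = "\<Union>l\<in>fvN \<phi> - {i}. vars_tm (\<rho> l)" and ?B = "\<Union>X\<in>fvS \<phi>. fvN (\<delta> X) - {j}"
  have "vars_tm ((\<rho>(i := V (i + k))) l) \<subseteq> insert (i + k) ?A" if "l \<in> fvN \<phi>" for l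
    using that by (cases "l = i") auto
  then have "(\<Union>l\<in>fvN \<phi>. vars_tm ((\<rho>(i := V (i + k))) l)) \<subseteq> insert (i + k) ?A"
    by (rule UN_least)
  then have "fvN (subst k j \<phi> (\<rho>(i := V (i + k))) \<delta>) \<subseteq> insert (i + k) ?A \<union> ?B"
    by (rule order_trans[OF AllN.IH Un_mono[OF _ subset_refl]])
  then have "fvN (subst k j \<phi> (\<rho>(i := V (i + k))) \<delta>) - {i + k} \<subseteq> ?A \<union> ?B"
    by (simp only: subset_insert_iff Un_insert_left) (meson Diff_subset order_trans)
  then show ?case by (simp only: subst.simps fvN.simps fvS.simps)
next
  case (ExS X \<phi>)
  let ?A = "\<Union>i\<in>fvN \<phi>. vars_tm (\<rho> i)" and ?B = "\<Union>Y\<in>fvS \<phi> - {X}. fvN (\<delta> Y) - {j}"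
  have "fvN ((\<delta>(X := Mem (V j) (X + k))) Y) - {j} \<subseteq> ?B" if "Y \<in> fvS \<phi>" for Y
    using that by (cases "Y = X") auto
  then have "(\<Union>Y\<in>fvS \<phi>. fvN ((\<delta>(X := Mem (V j) (X + k))) Y) - {j}) \<subseteq> ?B"
    by (rule UN_least)
  then have "fvN (subst k j \<phi> \<rho> (\<delta>(X := Mem (V j) (X + k)))) \<subseteq> ?A \<union> ?B"
    by (rule order_trans[OF ExS.IH Un_mono[OF subset_refl]])
  then show ?case by (simp only: subst.simps fvN.simps fvS.simps)
next
  case (AllS X \<phi>)
  let ?A = "\<Union>i\<in>fvN \<phi>. vars_tm (\<rho> i)" and ?B = "\<Union>Y\<in>fvS \<phi> - {X}. fvN (\<delta> Y) - {j}"
  have "fvN ((\<delta>(X := Mem (V j) (X + k))) Y) - {j} \<subseteq> ?B" if "Y \<in> fvS \<phi>" for Y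
    using that by (cases "Y = X") auto
  then have "(\<Union>Y\<in>fvS \<phi>. fvN ((\<delta>(X := Mem (V j) (X + k))) Y) - {j}) \<subseteq> ?B"
    by (rule UN_least)
  then have "fvN (subst k j \<phi> \<rho> (\<delta>(X := Mem (V j) (X + k)))) \<subseteq> ?A \<union> ?B"
    by (rule order_trans[OF AllS.IH Un_mono[OF subset_refl]])
  then show ?case by (simp only: subst.simps fvN.simps fvS.simps)
next
  case (Conj \<phi> \<psi>)
  show ?case using Un_mono[OF Conj.IH(1)[of \<rho> \<delta>] Conj.IH(2)[of \<rho> \<delta>]]
    by (simp only: subst.simps fvN.simps fvS.simps UN_Un Un_ac)
qed auto

lemma fvS_subst: "fvS (subst k j \<phi> \<rho> \<delta>) \<subseteq> (\<Union>X\<in>fvS \<phi>. fvS (\<delta> X))"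
proof (induction \<phi> arbitrary: \<rho> \<delta>)
  case (ExS X \<phi>)
  let ?B = "\<Union>Y\<in>fvS \<phi> - {X}. fvS (\<delta> Y)"
  have "fvS ((\<delta>(X := Mem (V j) (X + k))) Y) \<subseteq> insert (X + k) ?B" if "Y \<in> fvS \<phi>" for Y
    using that by (cases "Y = X") auto
  then have "(\<Union>Y\<in>fvS \<phi>. fvS ((\<delta>(X := Mem (V j) (X + k))) Y)) \<subseteq> insert (X + k) ?B"
    by (rule UN_least)
  then have "fvS (subst k j \<phi> \<rho> (\<delta>(X := Mem (V j) (X + k)))) \<subseteq> insert (X + k) ?B"
    by (rule order_trans[OF ExS.IH])
  then show ?case by (simp only: subst.simps fvS.simps subset_insert_iff) (meson Diff_subset order_trans)
next
  case (AllS X \<phi>)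
  let ?B = "\<Union>Y\<in>fvS \<phi> - {X}. fvS (\<delta> Y)"
  have "fvS ((\<delta>(X := Mem (V j) (X + k))) Y) \<subseteq> insert (X + k) ?B" if "Y \<in> fvS \<phi>" for Y
    using that by (cases "Y = X") auto
  then have "(\<Union>Y\<in>fvS \<phi>. fvS ((\<delta>(X := Mem (V j) (X + k))) Y)) \<subseteq> insert (X + k) ?B"
    by (rule UN_least)
  then have "fvS (subst k j \<phi> \<rho> (\<delta>(X := Mem (V j) (X + k)))) \<subseteq> insert (X + k) ?B"
    by (rule order_trans[OF AllS.IH])
  then show ?case by (simp only: subst.simps fvS.simps subset_insert_iff) (meson Diff_subset order_trans)
next
  case (Conj \<phi> \<psi>)
  show ?case using Un_mono[OF Conj.IH(1)[of \<rho> \<delta>] Conj.IH(2)[of \<rho> \<delta>]]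
    by (simp only: subst.simps fvS.simps UN_Un)
qed auto

text \<open>Here the two kinds of set quantifiers may follow each other in any order: the prefix
  is brought into alternating form only at the end, by dummy quantifiers.\<close>

primrec prenex :: "nat \<Rightarrow> fm set" where
  "prenex 0 = {\<phi>. arithmetical \<phi>}"
| "prenex (Suc n) = {ExS X \<phi> | X \<phi>. \<phi> \<in> prenex n} \<union> {AllS X \<phi> | X \<phi>. \<phi> \<in> prenex n}"

lemma arithmetical_subst:
  "arithmetical \<phi> \<Longrightarrow> (\<And>X. arithmetical (\<delta> X)) \<Longrightarrow> arithmetical (subst k j \<phi> \<rho> \<delta>)"
  by (induction \<phi> arbitrary: \<rho> \<delta>) auto

lemma prenex_subst:
  "\<phi> \<in> prenex n \<Longrightarrow> (\<And>X. arithmetical (\<delta> X)) \<Longrightarrow> subst k j \<phi> \<rho> \<delta> \<in> prenex n"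
proof (induction n arbitrary: \<phi> \<rho> \<delta>)
  case (Suc n)
  have "subst k j \<psi> \<rho> (\<delta>(X := Mem (V j) (X + k))) \<in> prenex n" if "\<psi> \<in> prenex n" for \<psi> X
    using Suc.IH[OF that] Suc.prems(2) by simp
  then show ?case using Suc.prems(1) by auto
qed (simp add: arithmetical_subst)

lemma Sigma_Pi_subst:
  "(\<phi> \<in> Sigma11 n \<longrightarrow> subst k j \<phi> \<rho> \<delta> \<in> Sigma11 n) \<and> (\<phi> \<in> Pi11 n \<longrightarrow> subst k j \<phi> \<rho> \<delta> \<in> Pi11 n)"
  if "\<And>X. arithmetical (\<delta> X)"
  using that
proof (induction n arbitrary: \<phi> \<rho> \<delta>)
  case (Suc n)
  have "(\<psi> \<in> Sigma11 n \<longrightarrow> subst k j \<psi> \<rho> (\<delta>(X := Mem (V j) (X + k))) \<in> Sigma11 n) \<and>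
    (\<psi> \<in> Pi11 n \<longrightarrow> subst k j \<psi> \<rho> (\<delta>(X := Mem (V j) (X + k))) \<in> Pi11 n)" for \<psi> X
    using Suc.prems by (intro Suc.IH) simp
  then show ?case by auto
qed (simp add: arithmetical_subst)

text \<open>A shift above all variables that occur leaves only the condition that \<open>j\<close>
  is not used by the terms.\<close>

definition psubst :: "nat \<Rightarrow> fm \<Rightarrow> (nat \<Rightarrow> tm) \<Rightarrow> (nat \<Rightarrow> fm) \<Rightarrow> fm" where
  "psubst j \<phi> \<rho> \<delta> = subst (SOME k. \<forall>i \<in> {j} \<union> (\<Union>i\<in>fvN \<phi>. vars_tm (\<rho> i)) \<union>
     (\<Union>X\<in>fvS \<phi>. fvN (\<delta> X) \<union> fvS (\<delta> X)). i < k) j \<phi> \<rho> \<delta>"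

lemma sat_psubst:
  assumes "\<And>i. i \<in> fvN \<phi> \<Longrightarrow> j \<notin> vars_tm (\<rho> i)"
  shows "sat M e E (psubst j \<phi> \<rho> \<delta>) \<longleftrightarrow>
      sat M (\<lambda>i. val e (\<rho> i)) (\<lambda>X. {m. sat M (e(j := m)) E (\<delta> X)}) \<phi>"
proof -
  define F where "F = {j} \<union> (\<Union>i\<in>fvN \<phi>. vars_tm (\<rho> i)) \<union> (\<Union>X\<in>fvS \<phi>. fvN (\<delta> X) \<union> fvS (\<delta> X))"
  have "finite F" by (simp add: F_def)
  then have "\<exists>k. \<forall>i\<in>F. i < k" using finite_nat_set_iff_bounded by blast
  then have "\<forall>i\<in>F. i < (SOME k. \<forall>i\<in>F. i < k)" by (rule someI_ex)
  then show ?thesis unfolding psubst_def F_def[symmetric]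
    by (intro sat_subst) (use assms in \<open>auto simp: F_def\<close>)
qed

lemma fvN_psubst:
  "fvN (psubst j \<phi> \<rho> \<delta>) \<subseteq> (\<Union>i\<in>fvN \<phi>. vars_tm (\<rho> i)) \<union> (\<Union>X\<in>fvS \<phi>. fvN (\<delta> X) - {j})"
  unfolding psubst_def by (rule fvN_subst)

lemma fvS_psubst: "fvS (psubst j \<phi> \<rho> \<delta>) \<subseteq> (\<Union>X\<in>fvS \<phi>. fvS (\<delta> X))"
  unfolding psubst_def by (rule fvS_subst)

lemma
  assumes "\<And>X. arithmetical (\<delta> X)"
  shows prenex_psubst: "\<phi> \<in> prenex n \<Longrightarrow> psubst j \<phi> \<rho> \<delta> \<in> prenex n"
    and Sigma11_psubst: "\<phi> \<in> Sigma11 n \<Longrightarrow> psubst j \<phi> \<rho> \<delta> \<in> Sigma11 n"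
    and Pi11_psubst: "\<phi> \<in> Pi11 n \<Longrightarrow> psubst j \<phi> \<rho> \<delta> \<in> Pi11 n"
  using prenex_subst[OF _ assms] Sigma_Pi_subst[OF assms] by (simp_all add: psubst_def)

section \<open>Prenex normal form\<close>

definition equiv_fm :: "fm \<Rightarrow> fm \<Rightarrow> bool" where
  "equiv_fm \<phi> \<psi> \<longleftrightarrow> (\<forall>e E. sat UNIV e E \<phi> \<longleftrightarrow> sat UNIV e E \<psi>)"

lemma rename_set_variable:
  assumes "\<phi> \<in> prenex n" "Z \<notin> fvS \<phi>"
  obtains \<psi> where "\<psi> \<in> prenex n" "\<And>e E A. sat UNIV e (E(Z := A)) \<psi> = sat UNIV e (E(X := A)) \<phi>"
proof -
  obtain j where j: "j \<notin> fvN \<phi>" using ex_new_if_finite[OF infinite_UNIV_nat finite_fvN] by blast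
  define \<delta> where "\<delta> = (\<lambda>Y. Mem (V j) (if Y = X then Z else Y))"
  show thesis
  proof (rule that)
    show "psubst j \<phi> V \<delta> \<in> prenex n"
      by (rule prenex_psubst[OF _ assms(1)]) (simp add: \<delta>_def)
    show "sat UNIV e (E(Z := A)) (psubst j \<phi> V \<delta>) = sat UNIV e (E(X := A)) \<phi>" for e E A
    proof (subst sat_psubst)
      show "sat UNIV (\<lambda>i. val e (V i)) (\<lambda>Y. {m. sat UNIV (e(j := m)) (E(Z := A)) (\<delta> Y)}) \<phi> =
          sat UNIV e (E(X := A)) \<phi>"
        by (rule sat_cong) (use assms(2) in \<open>auto simp: \<delta>_def\<close>)
    qed (use j in auto)
  qed
qed

lemma prenex_Neg: "\<phi> \<in> prenex n \<Longrightarrow> \<exists>\<psi>\<in>prenex n. equiv_fm \<psi> (Neg \<phi>)"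
proof (induction n arbitrary: \<phi>)
  case 0
  then show ?case by (intro bexI[of _ "Neg \<phi>"]) (auto simp: equiv_fm_def)
next
  case (Suc n)
  from Suc.prems obtain X \<psi> where \<psi>: "\<phi> = ExS X \<psi> \<or> \<phi> = AllS X \<psi>" "\<psi> \<in> prenex n" by auto
  from Suc.IH[OF \<psi>(2)] obtain \<chi> where \<chi>: "\<chi> \<in> prenex n" "equiv_fm \<chi> (Neg \<psi>)" by blast
  from \<psi>(1) show ?case
  proof
    assume "\<phi> = ExS X \<psi>"
    with \<chi> show ?thesis by (intro bexI[of _ "AllS X \<chi>"]) (auto simp: equiv_fm_def)
  next
    assume "\<phi> = AllS X \<psi>"
    with \<chi> show ?thesis by (intro bexI[of _ "ExS X \<chi>"]) (auto simp: equiv_fm_def)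
  qed
qed

lemma prenex_Conj_arithmetical:
  "\<psi> \<in> prenex m \<Longrightarrow> arithmetical \<phi> \<Longrightarrow> \<exists>\<chi>\<in>prenex m. equiv_fm \<chi> (Conj \<phi> \<psi>)"
proof (induction m arbitrary: \<psi>)
  case 0
  then show ?case by (intro bexI[of _ "Conj \<phi> \<psi>"]) (auto simp: equiv_fm_def)
next
  case (Suc m)
  from Suc.prems obtain X \<theta> where \<theta>: "\<psi> = ExS X \<theta> \<or> \<psi> = AllS X \<theta>" "\<theta> \<in> prenex m" by auto
  obtain Z where Z: "Z \<notin> fvS \<phi> \<union> fvS \<theta>"
    using ex_new_if_finite[OF infinite_UNIV_nat, of "fvS \<phi> \<union> fvS \<theta>"] by auto
  then obtain \<theta>' where \<theta>': "\<theta>' \<in> prenex m"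
      "\<And>e E A. sat UNIV e (E(Z := A)) \<theta>' = sat UNIV e (E(X := A)) \<theta>"
    using rename_set_variable[OF \<theta>(2), of Z X] by auto
  from Suc.IH[OF \<theta>'(1) Suc.prems(2)] obtain \<chi> where \<chi>: "\<chi> \<in> prenex m" "equiv_fm \<chi> (Conj \<phi> \<theta>')" by blast
  have [simp]: "sat UNIV e (E(Z := A)) \<phi> = sat UNIV e E \<phi>" for e E A
    by (rule sat_cong) (use Z in auto)
  from \<theta>(1) show ?case
  proof
    assume "\<psi> = ExS X \<theta>"
    with \<chi> \<theta>' show ?thesis by (intro bexI[of _ "ExS Z \<chi>"]) (auto simp: equiv_fm_def)
  next
    assume "\<psi> = AllS X \<theta>"
    with \<chi> \<theta>' show ?thesis by (intro bexI[of _ "AllS Z \<chi>"]) (auto simp: equiv_fm_def)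
  qed
qed

lemma prenex_Conj:
  "\<phi> \<in> prenex n \<Longrightarrow> \<psi> \<in> prenex m \<Longrightarrow> \<exists>\<chi>\<in>prenex (n + m). equiv_fm \<chi> (Conj \<phi> \<psi>)"
proof (induction n arbitrary: \<phi>)
  case 0
  then show ?case using prenex_Conj_arithmetical by simp
next
  case (Suc n)
  from Suc.prems obtain X \<theta> where \<theta>: "\<phi> = ExS X \<theta> \<or> \<phi> = AllS X \<theta>" "\<theta> \<in> prenex n" by auto
  obtain Z where Z: "Z \<notin> fvS \<psi> \<union> fvS \<theta>"
    using ex_new_if_finite[OF infinite_UNIV_nat, of "fvS \<psi> \<union> fvS \<theta>"] by auto
  then obtain \<theta>' where \<theta>': "\<theta>' \<in> prenex n"
      "\<And>e E A. sat UNIV e (E(Z := A)) \<theta>' = sat UNIV e (E(X := A)) \<theta>"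
    using rename_set_variable[OF \<theta>(2), of Z X] by auto
  from Suc.IH[OF \<theta>'(1) Suc.prems(2)] obtain \<chi> where
    \<chi>: "\<chi> \<in> prenex (n + m)" "equiv_fm \<chi> (Conj \<theta>' \<psi>)" by blast
  have [simp]: "sat UNIV e (E(Z := A)) \<psi> = sat UNIV e E \<psi>" for e E A
    by (rule sat_cong) (use Z in auto)
  from \<theta>(1) show ?case
  proof
    assume "\<phi> = ExS X \<theta>"
    with \<chi> \<theta>' show ?thesis by (intro bexI[of _ "ExS Z \<chi>"]) (auto simp: equiv_fm_def)
  next
    assume "\<phi> = AllS X \<theta>"
    with \<chi> \<theta>' show ?thesis by (intro bexI[of _ "AllS Z \<chi>"]) (auto simp: equiv_fm_def)
  qed
qed

text \<open>A pairing function that is given by a term of the language, in contrast to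
  \<open>prod_encode\<close>.\<close>

lemma square_pairing_inject:
  fixes i m i' m' :: nat
  assumes "(i + m) * (i + m) + i = (i' + m') * (i' + m') + i'"
  shows "i = i' \<and> m = m'"
proof -
  have less: "(a + b) * (a + b) + a < (c + d) * (c + d) + c" if "a + b < c + d" for a b c d :: nat
  proof -
    have "Suc (a + b) * Suc (a + b) \<le> (c + d) * (c + d)"
      using that by (intro mult_le_mono) auto
    then show ?thesis by simp
  qed
  have "i + m = i' + m'"
    using assms less[of i m i' m'] less[of i' m' i m] by (metis nat_neq_iff)
  then show ?thesis using assms by simp
qed

text \<open>A number quantifier moves inside a universal set quantifier by choice: if
  \<open>\<exists>k. \<forall>A. \<theta>(k, A)\<close> fails, then counterexamples
  \<open>A\<^sub>k\<close> are coded into the sections of a single set \<open>B\<close>. So the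
  formula is equivalent to \<open>\<forall>B. \<exists>k. \<theta>(k, B\<^sub>k)\<close> with
  \<open>B\<^sub>k\<close> the section of \<open>B\<close> at \<open>k\<close>.\<close>

lemma prenex_ExN: "\<phi> \<in> prenex n \<Longrightarrow> \<exists>\<psi>\<in>prenex n. equiv_fm \<psi> (ExN i \<phi>)"
proof (induction n arbitrary: \<phi>)
  case 0
  then show ?case by (intro bexI[of _ "ExN i \<phi>"]) (auto simp: equiv_fm_def)
next
  case (Suc n)
  from Suc.prems obtain X \<theta> where \<theta>: "\<phi> = ExS X \<theta> \<or> \<phi> = AllS X \<theta>" "\<theta> \<in> prenex n" by auto
  from \<theta>(1) show ?case
  proof
    assume \<phi>: "\<phi> = ExS X \<theta>"
    from Suc.IH[OF \<theta>(2)] obtain \<chi> where "\<chi> \<in> prenex n" "equiv_fm \<chi> (ExN i \<theta>)" by blast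
    then show ?thesis unfolding \<phi> by (intro bexI[of _ "ExS X \<chi>"]) (auto simp: equiv_fm_def)
  next
    assume \<phi>: "\<phi> = AllS X \<theta>"
    obtain Z where Z: "Z \<notin> fvS \<theta>" using ex_new_if_finite[OF infinite_UNIV_nat finite_fvS] by blast
    obtain j where j: "j \<notin> fvN \<theta> \<union> {i}"
      using ex_new_if_finite[OF infinite_UNIV_nat, of "fvN \<theta> \<union> {i}"] by auto
    define \<delta> where "\<delta> = (\<lambda>Y. if Y = X
      then Mem (Plus (Times (Plus (V i) (V j)) (Plus (V i) (V j))) (V i)) Z else Mem (V j) Y)"
    define \<theta>' where "\<theta>' = psubst j \<theta> V \<delta>"
    have \<theta>': "\<theta>' \<in> prenex n"
      unfolding \<theta>'_def by (rule prenex_psubst[OF _ \<theta>(2)]) (simp add: \<delta>_def)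
    have sat_\<theta>': "sat UNIV (e(i := k)) (E(Z := B)) \<theta>' =
        sat UNIV (e(i := k)) (E(X := {m. (k + m) * (k + m) + k \<in> B})) \<theta>" for e k E B
      unfolding \<theta>'_def
    proof (subst sat_psubst)
      show "sat UNIV (\<lambda>l. val (e(i := k)) (V l))
          (\<lambda>Y. {m. sat UNIV (e(i := k, j := m)) (E(Z := B)) (\<delta> Y)}) \<theta> =
        sat UNIV (e(i := k)) (E(X := {m. (k + m) * (k + m) + k \<in> B})) \<theta>"
        by (rule sat_cong) (use Z j in \<open>auto simp: \<delta>_def\<close>)
    qed (use j in auto)
    from Suc.IH[OF \<theta>'] obtain \<chi> where \<chi>: "\<chi> \<in> prenex n" "equiv_fm \<chi> (ExN i \<theta>')" by blast
    have "(\<forall>B. \<exists>k. sat UNIV (e(i := k)) (E(X := {m. (k + m) * (k + m) + k \<in> B})) \<theta>) \<longleftrightarrow>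
      (\<exists>k. \<forall>A. sat UNIV (e(i := k)) (E(X := A)) \<theta>)" for e E
    proof
      assume L: "\<forall>B. \<exists>k. sat UNIV (e(i := k)) (E(X := {m. (k + m) * (k + m) + k \<in> B})) \<theta>"
      show "\<exists>k. \<forall>A. sat UNIV (e(i := k)) (E(X := A)) \<theta>"
      proof (rule ccontr)
        assume "\<nexists>k. \<forall>A. sat UNIV (e(i := k)) (E(X := A)) \<theta>"
        then obtain f where f: "\<And>k. \<not> sat UNIV (e(i := k)) (E(X := f k)) \<theta>" by metis
        define B where "B = {(k + m) * (k + m) + k | k m. m \<in> f k}"
        have "{m. (k + m) * (k + m) + k \<in> B} = f k" for k
          unfolding B_def using square_pairing_inject by blast
        then show False using L[rule_format, of B] f by simp
      qed
    qed blast
    then have "equiv_fm (AllS Z \<chi>) (ExN i \<phi>)"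
      using \<chi>(2) unfolding \<phi> equiv_fm_def by (simp add: sat_\<theta>' del: fun_upd_apply)
    then show ?thesis using \<chi>(1) by auto
  qed
qed

lemma prenex_normal_form: "\<exists>n. \<exists>\<psi>\<in>prenex n. equiv_fm \<psi> \<phi>"
proof (induction \<phi>)
  case (Eq s t)
  then show ?case by (intro exI[of _ 0] bexI[of _ "Eq s t"]) (auto simp: equiv_fm_def)
next
  case (Less s t)
  then show ?case by (intro exI[of _ 0] bexI[of _ "Less s t"]) (auto simp: equiv_fm_def)
next
  case (Mem t X)
  then show ?case by (intro exI[of _ 0] bexI[of _ "Mem t X"]) (auto simp: equiv_fm_def)
next
  case (Neg \<phi>)
  then obtain n \<psi> where \<psi>: "\<psi> \<in> prenex n" "equiv_fm \<psi> \<phi>" by blast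
  with prenex_Neg[OF \<psi>(1)] show ?case by (auto simp: equiv_fm_def)
next
  case (Conj \<phi>1 \<phi>2)
  obtain n \<psi>1 where \<psi>1: "\<psi>1 \<in> prenex n" "equiv_fm \<psi>1 \<phi>1" using Conj.IH(1) by blast
  obtain m \<psi>2 where \<psi>2: "\<psi>2 \<in> prenex m" "equiv_fm \<psi>2 \<phi>2" using Conj.IH(2) by blast
  from prenex_Conj[OF \<psi>1(1) \<psi>2(1)] \<psi>1(2) \<psi>2(2) show ?case by (auto simp: equiv_fm_def)
next
  case (ExN i \<phi>)
  then obtain n \<psi> where \<psi>: "\<psi> \<in> prenex n" "equiv_fm \<psi> \<phi>" by blast
  with prenex_ExN[OF \<psi>(1), of i] show ?case by (auto simp: equiv_fm_def)
next
  case (AllN i \<phi>)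
  then obtain n \<psi> where \<psi>: "\<psi> \<in> prenex n" "equiv_fm \<psi> \<phi>" by blast
  obtain \<psi>1 where \<psi>1: "\<psi>1 \<in> prenex n" "equiv_fm \<psi>1 (Neg \<psi>)" using prenex_Neg[OF \<psi>(1)] by blast
  obtain \<psi>2 where \<psi>2: "\<psi>2 \<in> prenex n" "equiv_fm \<psi>2 (ExN i \<psi>1)" using prenex_ExN[OF \<psi>1(1)] by blast
  from prenex_Neg[OF \<psi>2(1)] \<psi> \<psi>1 \<psi>2 show ?case by (auto simp: equiv_fm_def)
next
  case (ExS X \<phi>)
  then obtain n \<psi> where "\<psi> \<in> prenex n" "equiv_fm \<psi> \<phi>" by blast
  then show ?case by (intro exI[of _ "Suc n"] bexI[of _ "ExS X \<psi>"]) (auto simp: equiv_fm_def)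
next
  case (AllS X \<phi>)
  then obtain n \<psi> where "\<psi> \<in> prenex n" "equiv_fm \<psi> \<phi>" by blast
  then show ?case by (intro exI[of _ "Suc n"] bexI[of _ "AllS X \<psi>"]) (auto simp: equiv_fm_def)
qed

lemma dummy_quantifier:
  obtains X where "equiv_fm (ExS X \<phi>) \<phi>" "equiv_fm (AllS X \<phi>) \<phi>"
proof -
  obtain X where X: "X \<notin> fvS \<phi>" using ex_new_if_finite[OF infinite_UNIV_nat finite_fvS] by blast
  have [simp]: "sat UNIV e (E(X := A)) \<phi> = sat UNIV e E \<phi>" for e E A
    by (rule sat_cong) (use X in auto)
  show thesis by (rule that[of X]) (auto simp: equiv_fm_def)
qed

lemma equiv_fm_quantifiers:
  "equiv_fm \<phi> \<psi> \<Longrightarrow> equiv_fm (ExS X \<phi>) (ExS X \<psi>)"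
  "equiv_fm \<phi> \<psi> \<Longrightarrow> equiv_fm (AllS X \<phi>) (AllS X \<psi>)"
  by (auto simp: equiv_fm_def)

lemma equiv_fm_trans: "equiv_fm \<phi> \<psi> \<Longrightarrow> equiv_fm \<psi> \<chi> \<Longrightarrow> equiv_fm \<phi> \<chi>"
  by (auto simp: equiv_fm_def)

definition Sigma_Pi_at :: "nat \<Rightarrow> fm \<Rightarrow> bool" where
  "Sigma_Pi_at n \<phi> \<longleftrightarrow> (\<exists>\<psi>\<in>Sigma11 n. equiv_fm \<psi> \<phi>) \<and> (\<exists>\<psi>\<in>Pi11 n. equiv_fm \<psi> \<phi>)"

lemma arithmetical_Sigma_Pi_at: "arithmetical \<phi> \<Longrightarrow> Sigma_Pi_at n \<phi>"
proof (induction n)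
  case 0
  then show ?case by (auto simp: Sigma_Pi_at_def equiv_fm_def)
next
  case (Suc n)
  then obtain \<psi> \<chi> where *: "\<psi> \<in> Sigma11 n" "equiv_fm \<psi> \<phi>" "\<chi> \<in> Pi11 n" "equiv_fm \<chi> \<phi>"
    by (auto simp: Sigma_Pi_at_def)
  obtain X where "equiv_fm (ExS X \<phi>) \<phi>" "equiv_fm (AllS X \<phi>) \<phi>" by (rule dummy_quantifier)
  with * have "equiv_fm (ExS X \<chi>) \<phi>" "equiv_fm (AllS X \<psi>) \<phi>"
    using equiv_fm_quantifiers equiv_fm_trans by blast+
  with * show ?case by (auto simp: Sigma_Pi_at_def)
qed

text \<open>Where the prefix does not alternate, and where a level of the other kind is wanted, a
  quantifier over a variable that does not occur is inserted. So every sufficiently large level is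
  reached, of either kind and of either parity.\<close>

lemma eventually_Sigma_Pi_at: "\<exists>n. \<forall>m\<ge>n. Sigma_Pi_at m \<phi>"
proof -
  have *: "\<exists>n. \<forall>m\<ge>n. Sigma_Pi_at m \<phi>" if "\<phi> \<in> prenex k" for k \<phi>
    using that
  proof (induction k arbitrary: \<phi>)
    case 0
    then show ?case using arithmetical_Sigma_Pi_at by auto
  next
    case (Suc k)
    then obtain X \<psi> where \<psi>: "\<phi> = ExS X \<psi> \<or> \<phi> = AllS X \<psi>" "\<psi> \<in> prenex k" by auto
    from Suc.IH[OF \<psi>(2)] obtain n where n: "\<forall>m\<ge>n. Sigma_Pi_at m \<psi>" by blast
    obtain Z where Z: "equiv_fm (ExS Z \<phi>) \<phi>" "equiv_fm (AllS Z \<phi>) \<phi>" by (rule dummy_quantifier)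
    have "Sigma_Pi_at m \<phi>" if m: "m \<ge> Suc (Suc n)" for m
    proof -
      obtain l where l: "m = Suc (Suc l)" "l \<ge> n" using m by (metis Suc_le_D Suc_le_mono)
      then have l': "Sigma_Pi_at l \<psi>" "Sigma_Pi_at (Suc l) \<psi>" using n by auto
      from \<psi>(1) show ?thesis
      proof
        assume \<phi>: "\<phi> = ExS X \<psi>"
        have 1: "\<exists>\<chi>\<in>Sigma11 (Suc k). equiv_fm \<chi> \<phi>" if "Sigma_Pi_at k \<psi>" for k
          using that \<phi> equiv_fm_quantifiers(1)[of _ \<psi> X] by (auto simp: Sigma_Pi_at_def)
        then obtain \<chi> where "\<chi> \<in> Sigma11 (Suc l)" "equiv_fm \<chi> \<phi>" using l' by blast
        then have "AllS Z \<chi> \<in> Pi11 m" "equiv_fm (AllS Z \<chi>) \<phi>"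
          using l(1) Z equiv_fm_quantifiers(2) equiv_fm_trans by (auto, blast)
        with 1[OF l'(2)] show ?thesis unfolding Sigma_Pi_at_def l(1) by blast
      next
        assume \<phi>: "\<phi> = AllS X \<psi>"
        have 1: "\<exists>\<chi>\<in>Pi11 (Suc k). equiv_fm \<chi> \<phi>" if "Sigma_Pi_at k \<psi>" for k
          using that \<phi> equiv_fm_quantifiers(2)[of _ \<psi> X] by (auto simp: Sigma_Pi_at_def)
        then obtain \<chi> where "\<chi> \<in> Pi11 (Suc l)" "equiv_fm \<chi> \<phi>" using l' by blast
        then have "ExS Z \<chi> \<in> Sigma11 m" "equiv_fm (ExS Z \<chi>) \<phi>"
          using l(1) Z equiv_fm_quantifiers(1) equiv_fm_trans by (auto, blast)
        with 1[OF l'(2)] show ?thesis unfolding Sigma_Pi_at_def l(1) by blast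
      qed
    qed
    then show ?case by blast
  qed
  obtain k \<psi> where \<psi>: "\<psi> \<in> prenex k" "equiv_fm \<psi> \<phi>" using prenex_normal_form by blast
  obtain n where "\<forall>m\<ge>n. Sigma_Pi_at m \<psi>" using *[OF \<psi>(1)] by blast
  then show ?thesis using \<psi>(2) equiv_fm_trans unfolding Sigma_Pi_at_def by blast
qed

section \<open>Definability over the full model\<close>

text \<open>Definability over the full model is treated as a property of relations between
  assignments. Closure properties of this notion replace the construction of formulas.\<close>

definition definable_rel :: "((nat \<Rightarrow> nat) \<Rightarrow> (nat \<Rightarrow> nat set) \<Rightarrow> bool) \<Rightarrow> bool" where
  "definable_rel Q \<longleftrightarrow> (\<exists>\<phi>. \<forall>e E. sat UNIV e E \<phi> \<longleftrightarrow> Q e E)"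

lemma definable_rel_sat: "definable_rel (\<lambda>e E. sat UNIV e E \<phi>)"
  by (auto simp: definable_rel_def)

lemma definable_rel_mem: "definable_rel (\<lambda>e E. val e t \<in> E X)"
  unfolding definable_rel_def by (rule exI[of _ "Mem t X"]) simp

lemma definable_rel_eq: "definable_rel (\<lambda>e E. val e s = val e t)"
  unfolding definable_rel_def by (rule exI[of _ "Eq s t"]) simp

lemma definable_rel_pair: "definable_rel (\<lambda>e E. val e p = prod_encode (val e s, val e t))"
  unfolding definable_rel_def by (rule exI[of _ "is_pair p s t"]) simp

lemma definable_rel_not: "definable_rel P \<Longrightarrow> definable_rel (\<lambda>e E. \<not> P e E)"
  unfolding definable_rel_def by (metis sat.simps(4))

lemma definable_rel_conj:
  "definable_rel P \<Longrightarrow> definable_rel Q \<Longrightarrow> definable_rel (\<lambda>e E. P e E \<and> Q e E)"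
  unfolding definable_rel_def by (metis sat.simps(5))

lemma definable_rel_imp:
  "definable_rel P \<Longrightarrow> definable_rel Q \<Longrightarrow> definable_rel (\<lambda>e E. P e E \<longrightarrow> Q e E)"
  using definable_rel_not[OF definable_rel_conj[OF _ definable_rel_not]] by simp

lemma definable_rel_disj:
  "definable_rel P \<Longrightarrow> definable_rel Q \<Longrightarrow> definable_rel (\<lambda>e E. P e E \<or> Q e E)"
  using definable_rel_imp[OF definable_rel_not] by (simp add: disj_imp)

lemma definable_rel_iff:
  "definable_rel P \<Longrightarrow> definable_rel Q \<Longrightarrow> definable_rel (\<lambda>e E. P e E \<longleftrightarrow> Q e E)"
  using definable_rel_conj[OF definable_rel_imp definable_rel_imp, of P Q Q P]
  by (simp add: iff_conv_conj_imp)

lemma definable_rel_exN: "definable_rel P \<Longrightarrow> definable_rel (\<lambda>e E. \<exists>n. P (e(i := n)) E)"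
  unfolding definable_rel_def by (metis sat.simps(6))

lemma definable_rel_allN: "definable_rel P \<Longrightarrow> definable_rel (\<lambda>e E. \<forall>n. P (e(i := n)) E)"
  unfolding definable_rel_def by (metis sat.simps(7))

lemma definable_rel_exS: "definable_rel P \<Longrightarrow> definable_rel (\<lambda>e E. \<exists>A. P e (E(X := A)))"
proof -
  assume "definable_rel P"
  then obtain \<phi> where "\<And>e E. sat UNIV e E \<phi> \<longleftrightarrow> P e E" unfolding definable_rel_def by blast
  then show ?thesis unfolding definable_rel_def by (intro exI[of _ "ExS X \<phi>"]) simp
qed

lemmas definable_rel_intros = definable_rel_not definable_rel_conj definable_rel_imp
  definable_rel_disj definable_rel_iff

lemma definable_rel_subst:
  assumes "definable_rel P"
  shows "definable_rel (\<lambda>e E. P (\<lambda>i. val e (\<rho> i)) E)"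
proof -
  obtain \<phi> where \<phi>: "\<And>e E. sat UNIV e E \<phi> \<longleftrightarrow> P e E" using assms unfolding definable_rel_def by blast
  obtain j where j: "j \<notin> (\<Union>i\<in>fvN \<phi>. vars_tm (\<rho> i))"
    using ex_new_if_finite[OF infinite_UNIV_nat, of "\<Union>i\<in>fvN \<phi>. vars_tm (\<rho> i)"] by auto
  have "sat UNIV e E (psubst j \<phi> \<rho> (Mem (V j))) \<longleftrightarrow> P (\<lambda>i. val e (\<rho> i)) E" for e E
    by (subst sat_psubst) (use j \<phi> in auto)
  then show ?thesis unfolding definable_rel_def by blast
qed

definition definable :: "nat set set \<Rightarrow> bool" where
  "definable U \<longleftrightarrow> definable_rel (\<lambda>e E. E 0 \<in> U)"

text \<open>The formula for \<open>Q\<close> is substituted for the set variable in the formula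
  for \<open>U\<close>.\<close>

lemma definable_rel_in:
  assumes "definable U" "definable_rel Q"
  shows "definable_rel (\<lambda>e E. {m. Q (e(0 := m)) E} \<in> U)"
proof -
  obtain \<phi> where \<phi>: "\<And>e E. sat UNIV e E \<phi> \<longleftrightarrow> E 0 \<in> U"
    using assms(1) unfolding definable_rel_def definable_def by blast
  obtain \<psi> where \<psi>: "\<And>e E. sat UNIV e E \<psi> \<longleftrightarrow> Q e E" using assms(2) unfolding definable_rel_def by blast
  have "sat UNIV e E (psubst 0 \<phi> (\<lambda>_. Zero) (\<lambda>_. \<psi>)) \<longleftrightarrow> {m. Q (e(0 := m)) E} \<in> U" for e E
    by (subst sat_psubst) (use \<phi> \<psi> in auto)
  then show ?thesis unfolding definable_rel_def by blast
qed

definition left :: "nat set \<Rightarrow> nat set" where "left C = {m. m + m \<in> C}"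
definition right :: "nat set \<Rightarrow> nat set" where "right C = {m. Suc (m + m) \<in> C}"
definition join :: "nat set \<Rightarrow> nat set \<Rightarrow> nat set" where
  "join A B = {n. \<exists>m. n = m + m \<and> m \<in> A \<or> n = Suc (m + m) \<and> m \<in> B}"

lemma double_neq: "m + m \<noteq> Suc (n + n)" for m n :: nat
  by presburger

lemma double_eq: "m + m = n + n \<longleftrightarrow> m = n" for m n :: nat
  by presburger

lemma left_join [simp]: "left (join A B) = A"
  and right_join [simp]: "right (join A B) = B"
  by (auto simp: left_def right_def join_def double_neq double_neq[symmetric] double_eq)

lemma join_left_right [simp]: "join (left C) (right C) = C"
proof (rule set_eqI)
  fix n
  have "(\<exists>m. n = m + m) \<or> (\<exists>m. n = Suc (m + m))" by presburger
  then show "n \<in> join (left C) (right C) \<longleftrightarrow> n \<in> C"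
    by (auto simp: left_def right_def join_def)
qed

lemma join_inject [simp]: "join A B = join A' B' \<longleftrightarrow> A = A' \<and> B = B'"
  by (metis left_join right_join)

text \<open>The number variable 0 stands for the potential element, the set variable 0 for the
  argument.\<close>

definition definable_op :: "(nat set \<Rightarrow> nat set) \<Rightarrow> bool" where
  "definable_op h \<longleftrightarrow> definable_rel (\<lambda>e E. e 0 \<in> h (E 0))"

lemma definable_rel_op_at:
  assumes "definable_op h"
  shows "definable_rel (\<lambda>e E. val e t \<in> h (E 0))"
  using definable_rel_subst[of "\<lambda>e E. e 0 \<in> h (E 0)" "\<lambda>_. t"] assms by (simp add: definable_op_def)

lemma definable_op_id: "definable_op (\<lambda>C. C)"
  using definable_rel_mem[of "V 0" 0] by (simp add: definable_op_def)

lemma definable_op_left: "definable_op h \<Longrightarrow> definable_op (\<lambda>C. left (h C))"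
  using definable_rel_op_at[of h "Plus (V 0) (V 0)"] by (simp add: definable_op_def left_def)

lemma definable_op_right: "definable_op h \<Longrightarrow> definable_op (\<lambda>C. right (h C))"
  using definable_rel_op_at[of h "S (Plus (V 0) (V 0))"] by (simp add: definable_op_def right_def)

lemma definable_op_join:
  assumes "definable_op h" "definable_op g"
  shows "definable_op (\<lambda>C. join (h C) (g C))"
proof -
  have "definable_rel (\<lambda>e E. \<exists>m. (\<lambda>e E. (val e (V 0) = val e (Plus (V 1) (V 1)) \<and> val e (V 1) \<in> h (E 0)) \<or>
      (val e (V 0) = val e (S (Plus (V 1) (V 1))) \<and> val e (V 1) \<in> g (E 0))) (e(1 := m)) E)"
    by (intro definable_rel_exN definable_rel_intros definable_rel_eq definable_rel_op_at assms)
  then show ?thesis by (simp add: definable_op_def join_def)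
qed

text \<open>If \<open>A\<close> codes a function and \<open>B\<close> is the singleton of the code
  of an argument, this is the code of the value.\<close>

definition section_at :: "nat set \<Rightarrow> nat set \<Rightarrow> nat set" where
  "section_at A B = {m. \<exists>n. n \<in> B \<and> (\<exists>p. p = prod_encode (n, m) \<and> p \<in> A)}"

lemma definable_op_section_at:
  assumes "definable_op h" "definable_op g"
  shows "definable_op (\<lambda>C. section_at (h C) (g C))"
proof -
  have "definable_rel (\<lambda>e E. \<exists>n. (\<lambda>e E. val e (V 1) \<in> g (E 0) \<and> (\<exists>p. (\<lambda>e E.
      val e (V 2) = prod_encode (val e (V 1), val e (V 0)) \<and> val e (V 2) \<in> h (E 0)) (e(2 := p)) E))
      (e(1 := n)) E)"
    by (intro definable_rel_exN definable_rel_intros definable_rel_pair definable_rel_op_at assms)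
  then show ?thesis by (simp add: definable_op_def section_at_def)
qed

lemma definable_op_image2:
  assumes "definable_rel (\<lambda>e E. R (e 1) (e 2) (e 0))"
  shows "definable_op (\<lambda>C. {m. \<exists>k. k \<in> left C \<and> (\<exists>l. l \<in> right C \<and> R k l m)})"
proof -
  have "definable_rel (\<lambda>e E. \<exists>k. (\<lambda>e E. val e (V 1) \<in> left (E 0) \<and> (\<exists>l. (\<lambda>e E.
      val e (V 2) \<in> right (E 0) \<and> R (e 1) (e 2) (e 0)) (e(2 := l)) E)) (e(1 := k)) E)"
    by (intro definable_rel_exN definable_rel_intros definable_rel_op_at definable_op_left
        definable_op_right definable_op_id assms)
  then show ?thesis by (simp add: definable_op_def)
qed

lemma definable_vimage:
  assumes "definable U" "definable_op h"
  shows "definable {C. h C \<in> U}"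
  using definable_rel_in[OF assms(1) assms(2)[unfolded definable_op_def]] by (simp add: definable_def)

lemma definable_Compl: "definable U \<Longrightarrow> definable (- U)"
  using definable_rel_not by (simp add: definable_def)

lemma definable_Int: "definable U \<Longrightarrow> definable T \<Longrightarrow> definable (U \<inter> T)"
  using definable_rel_conj by (simp add: definable_def)

lemma definable_Ball:
  assumes "definable_op h" "definable_op g"
  shows "definable {C. h C \<subseteq> g C}" "definable {C. h C = g C}"
proof -
  have "definable_rel (\<lambda>e E. \<forall>n. (\<lambda>e E. val e (V 0) \<in> h (E 0) \<longrightarrow> val e (V 0) \<in> g (E 0)) (e(0 := n)) E)"
    by (intro definable_rel_allN definable_rel_intros definable_rel_op_at assms)
  then show "definable {C. h C \<subseteq> g C}" by (simp add: definable_def subset_iff)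
  have "definable_rel (\<lambda>e E. \<forall>n. (\<lambda>e E. val e (V 0) \<in> h (E 0) \<longleftrightarrow> val e (V 0) \<in> g (E 0)) (e(0 := n)) E)"
    by (intro definable_rel_allN definable_rel_intros definable_rel_op_at assms)
  then show "definable {C. h C = g C}" by (simp add: definable_def set_eq_iff)
qed

lemma definable_projection:
  assumes "definable U"
  shows "definable {A. \<exists>B. join A B \<in> U}"
proof -
  have "definable_rel (\<lambda>e E. \<exists>m. (\<lambda>e E. (val e (V 0) = val e (Plus (V 1) (V 1)) \<and> val e (V 1) \<in> E 0) \<or>
      (val e (V 0) = val e (S (Plus (V 1) (V 1))) \<and> val e (V 1) \<in> E 1)) (e(1 := m)) E)"
    by (intro definable_rel_exN definable_rel_intros definable_rel_eq definable_rel_mem)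
  then have "definable_rel (\<lambda>e E. e 0 \<in> join (E 0) (E 1))" by (simp add: join_def)
  then have "definable_rel (\<lambda>e E. join (E 0) (E 1) \<in> U)"
    using definable_rel_in[OF assms] by fastforce
  then show ?thesis using definable_rel_exS[of _ 1] by (fastforce simp: definable_def)
qed

lemma definable_singleton: "definable {{n}}"
proof -
  have "\<exists>t. \<forall>e. val e t = n"
  proof (induction n)
    case 0
    show ?case by (rule exI[of _ Zero]) simp
  next
    case (Suc n)
    then obtain t where "\<forall>e. val e t = n" by blast
    then show ?case by (intro exI[of _ "S t"]) simp
  qed
  then obtain t where t: "\<And>e. val e t = n" by blast
  have "definable_rel (\<lambda>e E. \<forall>m. (\<lambda>e E. val e (V 0) \<in> E 0 \<longleftrightarrow> val e (V 0) = val e t) (e(0 := m)) E)"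
    by (intro definable_rel_allN definable_rel_intros definable_rel_mem definable_rel_eq)
  then show ?thesis by (simp add: definable_def t set_eq_iff)
qed

lemma definable_singletons: "definable (range (\<lambda>n. {n}))"
proof -
  have "definable_rel (\<lambda>e E. \<exists>n. (\<lambda>e E. \<forall>m. (\<lambda>e E. val e (V 0) \<in> E 0 \<longleftrightarrow> val e (V 0) = val e (V 1))
      (e(0 := m)) E) (e(1 := n)) E)"
    by (intro definable_rel_exN definable_rel_allN definable_rel_intros definable_rel_mem definable_rel_eq)
  then show ?thesis by (simp add: definable_def set_eq_iff image_iff)
qed

lemma definable_rel_singleton_in:
  assumes "definable U"
  shows "definable_rel (\<lambda>e E. {e i} \<in> U)"
proof -
  have "definable_rel (\<lambda>e E. val e (V 0) = val e (V 1))" by (rule definable_rel_eq)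
  then have "definable_rel (\<lambda>e E. {m. val (e(0 := m)) (V 0) = val (e(0 := m)) (V 1)} \<in> U)"
    by (rule definable_rel_in[OF assms])
  then have "definable_rel (\<lambda>e E. {e 1} \<in> U)" by simp
  from definable_rel_subst[OF this, of "\<lambda>_. V i"] show ?thesis by simp
qed

subsection \<open>Types of definable objects\<close>

text \<open>Numbers, sets, pairs, functions on numbers, families of sets and formulas can all be
  coded by sets of numbers. The classes collect the types for which this is possible in a
  definable way, so that definability over the full model can be asserted for relations and
  functions between such types, and proved along the shape of their HOL definitions.\<close>

class dt =
  fixes enc :: "'a \<Rightarrow> nat set"
  assumes inj_enc: "inj enc" and definable_range_enc: "definable (range enc)"

text \<open>Types coded by numbers, whose elements can be arguments of coded functions and
  elements of coded sets.\<close>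

class cnt = dt +
  fixes cde :: "'a \<Rightarrow> nat"
  assumes enc_cde: "enc x = {cde x}"

lemma enc_eq_iff [simp]: "enc x = enc y \<longleftrightarrow> x = y"
  using inj_enc by (auto simp: inj_def)

lemma cde_eq_iff [simp]: "cde x = cde y \<longleftrightarrow> x = (y :: 'a :: cnt)"
  by (metis enc_cde enc_eq_iff)

instantiation nat :: cnt
begin
definition enc_nat :: "nat \<Rightarrow> nat set" where "enc_nat n = {n}"
definition cde_nat :: "nat \<Rightarrow> nat" where "cde_nat n = n"
instance
  by standard (auto simp: enc_nat_def[abs_def] cde_nat_def inj_def definable_singletons)
end

lemma cnt_class_criterion:
  assumes "inj (f :: 'a \<Rightarrow> nat)" "definable_rel (\<lambda>e E. e 0 \<in> range f)"
  shows "inj (\<lambda>x. {f x})" "definable (range (\<lambda>x. {f x}))"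
proof -
  show "inj (\<lambda>x. {f x})" using assms(1) by (auto simp: inj_def)
  have "definable_rel (\<lambda>e E. val e (V 0) \<in> range f)" using assms(2) by simp
  then have "definable_rel (\<lambda>e E. \<exists>n. (\<lambda>e E. val e (V 0) \<in> range f \<and> (\<forall>m. (\<lambda>e E. val e (V 1) \<in> E 0 \<longleftrightarrow>
      val e (V 1) = val e (V 0)) (e(1 := m)) E)) (e(0 := n)) E)"
    by (intro definable_rel_exN definable_rel_allN definable_rel_intros definable_rel_mem definable_rel_eq)
  moreover have "A \<in> range (\<lambda>x. {f x}) \<longleftrightarrow> (\<exists>n. n \<in> range f \<and> (\<forall>m. m \<in> A \<longleftrightarrow> m = n))" for A
    by (auto simp: set_eq_iff)
  ultimately show "definable (range (\<lambda>x. {f x}))" by (simp add: definable_def)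
qed

instantiation bool :: cnt
begin
definition enc_bool :: "bool \<Rightarrow> nat set" where "enc_bool b = {of_bool b}"
definition cde_bool :: "bool \<Rightarrow> nat" where "cde_bool b = of_bool b"
instance
proof
  have "definable_rel (\<lambda>e E. val e (V 0) = val e Zero \<or> val e (V 0) = val e (S Zero))"
    by (intro definable_rel_intros definable_rel_eq)
  then have *: "definable_rel (\<lambda>e E. e 0 \<in> range (of_bool :: bool \<Rightarrow> nat))"
    by (simp add: UNIV_bool disj_commute)
  have **: "inj (of_bool :: bool \<Rightarrow> nat)" by (auto simp: inj_def)
  show "inj (enc :: bool \<Rightarrow> nat set)" "definable (range (enc :: bool \<Rightarrow> nat set))"
    using cnt_class_criterion[OF ** *] by (simp_all add: enc_bool_def[abs_def])
qed (simp add: enc_bool_def cde_bool_def)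
end

instantiation prod :: (dt, dt) dt
begin
definition enc_prod :: "'a \<times> 'b \<Rightarrow> nat set" where "enc_prod p = join (enc (fst p)) (enc (snd p))"
instance
proof
  show "inj (enc :: 'a \<times> 'b \<Rightarrow> nat set)" by (auto simp: inj_def enc_prod_def)
  have "definable ({C. left C \<in> range (enc :: 'a \<Rightarrow> _)} \<inter> {C. right C \<in> range (enc :: 'b \<Rightarrow> _)})"
    by (intro definable_Int definable_vimage definable_range_enc definable_op_left definable_op_right
        definable_op_id)
  also have "\<dots> = range (enc :: 'a \<times> 'b \<Rightarrow> nat set)"
    by (auto simp: enc_prod_def image_iff) (metis fst_conv snd_conv join_left_right)
  finally show "definable (range (enc :: 'a \<times> 'b \<Rightarrow> nat set))" .
qed
end

instantiation set :: (cnt) dt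
begin
definition enc_set :: "'a set \<Rightarrow> nat set" where "enc_set A = cde ` A"
instance
proof
  show "inj (enc :: 'a set \<Rightarrow> nat set)"
    by (auto simp: inj_def enc_set_def image_iff set_eq_iff) (metis cde_eq_iff)+
  have "definable_rel (\<lambda>e E. \<forall>n. (\<lambda>e E. val e (V 0) \<in> E 0 \<longrightarrow> {e 0} \<in> range (enc :: 'a \<Rightarrow> _)) (e(0 := n)) E)"
    by (intro definable_rel_allN definable_rel_intros definable_rel_mem definable_rel_singleton_in
        definable_range_enc)
  then have "definable {C. \<forall>n. n \<in> C \<longrightarrow> {n} \<in> range (enc :: 'a \<Rightarrow> _)}"
    by (simp add: definable_def)
  also have "{C. \<forall>n. n \<in> C \<longrightarrow> {n} \<in> range (enc :: 'a \<Rightarrow> _)} = range (enc :: 'a set \<Rightarrow> nat set)"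
    by (auto simp: enc_set_def enc_cde subset_image_iff[symmetric] image_iff)
      (metis (no_types, lifting) UNIV_I image_eqI subsetI subset_imageE)
  finally show "definable (range (enc :: 'a set \<Rightarrow> nat set))" .
qed
end

instantiation "fun" :: (cnt, dt) dt
begin
definition enc_fun :: "('a \<Rightarrow> 'b) \<Rightarrow> nat set" where
  "enc_fun f = {prod_encode (cde x, m) | x m. m \<in> enc (f x)}"

lemma section_at_enc_fun: "section_at (enc f) {cde x} = enc (f x)"
  by (auto simp: section_at_def enc_fun_def)

instance
proof
  show "inj (enc :: ('a \<Rightarrow> 'b) \<Rightarrow> nat set)"
    by (rule injI, rule ext) (metis section_at_enc_fun enc_eq_iff)
  have m: "definable_rel (\<lambda>e E. \<exists>p. (\<lambda>e E. val e (V 3) = prod_encode (val e (V 1), val e (V 0)) \<and>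
      val e (V 3) \<in> E 0) (e(3 := p)) E)"
    by (intro definable_rel_exN definable_rel_intros definable_rel_pair definable_rel_mem)
  have "definable_rel (\<lambda>e E. {m. prod_encode (e 1, m) \<in> E 0} \<in> range (enc :: 'b \<Rightarrow> _))"
    using definable_rel_in[OF definable_range_enc[where ?'a = 'b] m] by simp
  then have 2: "definable_rel (\<lambda>e E. \<forall>n. (\<lambda>e E. {e 1} \<in> range (enc :: 'a \<Rightarrow> _) \<longrightarrow>
      {m. prod_encode (e 1, m) \<in> E 0} \<in> range (enc :: 'b \<Rightarrow> _)) (e(1 := n)) E)"
    by (intro definable_rel_allN definable_rel_imp definable_rel_singleton_in definable_range_enc)
  have 1: "definable_rel (\<lambda>e E. \<forall>n. (\<lambda>e E. \<forall>m. (\<lambda>e E. \<forall>p. (\<lambda>e E.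
      val e (V 3) \<in> E 0 \<longrightarrow> val e (V 3) = prod_encode (val e (V 1), val e (V 0)) \<longrightarrow> {e 1} \<in> range (enc :: 'a \<Rightarrow> _))
      (e(3 := p)) E) (e(0 := m)) E) (e(1 := n)) E)"
    by (intro definable_rel_allN definable_rel_intros definable_rel_mem definable_rel_pair
        definable_rel_singleton_in definable_range_enc)
  have "definable {C. (\<forall>n m. prod_encode (n, m) \<in> C \<longrightarrow> {n} \<in> range (enc :: 'a \<Rightarrow> _)) \<and>
      (\<forall>n. {n} \<in> range (enc :: 'a \<Rightarrow> _) \<longrightarrow> {m. prod_encode (n, m) \<in> C} \<in> range (enc :: 'b \<Rightarrow> _))}"
    using definable_rel_conj[OF 1 2] by (simp add: definable_def)
  also have "\<dots> = range (enc :: ('a \<Rightarrow> 'b) \<Rightarrow> nat set)"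
  proof (intro equalityI subsetI)
    fix C assume "C \<in> {C. (\<forall>n m. prod_encode (n, m) \<in> C \<longrightarrow> {n} \<in> range (enc :: 'a \<Rightarrow> _)) \<and>
      (\<forall>n. {n} \<in> range (enc :: 'a \<Rightarrow> _) \<longrightarrow> {m. prod_encode (n, m) \<in> C} \<in> range (enc :: 'b \<Rightarrow> _))}"
    then have C: "\<And>n m. prod_encode (n, m) \<in> C \<Longrightarrow> \<exists>x :: 'a. n = cde x"
      "\<And>x :: 'a. \<exists>y :: 'b. {m. prod_encode (cde x, m) \<in> C} = enc y"
      by (auto simp: enc_cde image_iff)
    from C(2) obtain f :: "'a \<Rightarrow> 'b" where f: "\<And>x. {m. prod_encode (cde x, m) \<in> C} = enc (f x)" by metis
    have "p \<in> C \<longleftrightarrow> p \<in> enc f" for p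
    proof -
      obtain n m where p: "p = prod_encode (n, m)" by (metis prod_decode_inverse surj_pair)
      have "m \<in> enc (f x) \<longleftrightarrow> prod_encode (cde x, m) \<in> C" for x using f[of x] by blast
      then show ?thesis using C(1)[of n m] by (auto simp: p enc_fun_def)
    qed
    then show "C \<in> range (enc :: ('a \<Rightarrow> 'b) \<Rightarrow> nat set)" by blast
  next
    fix C assume "C \<in> range (enc :: ('a \<Rightarrow> 'b) \<Rightarrow> nat set)"
    then obtain f :: "'a \<Rightarrow> 'b" where f: "C = enc f" by blast
    have "{m. prod_encode (cde x, m) \<in> C} = enc (f x)" for x
      by (auto simp: f enc_fun_def)
    then show "C \<in> {C. (\<forall>n m. prod_encode (n, m) \<in> C \<longrightarrow> {n} \<in> range (enc :: 'a \<Rightarrow> _)) \<and>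
      (\<forall>n. {n} \<in> range (enc :: 'a \<Rightarrow> _) \<longrightarrow> {m. prod_encode (n, m) \<in> C} \<in> range (enc :: 'b \<Rightarrow> _))}"
      by (auto simp: enc_cde image_iff f enc_fun_def)
  qed
  finally show "definable (range (enc :: ('a \<Rightarrow> 'b) \<Rightarrow> nat set))" .
qed
end

text \<open>The three notions are definability without parameters over the full model of a
  relation, of a function (by its graph) and of a point.\<close>

definition Dfn :: "('a :: dt \<Rightarrow> bool) \<Rightarrow> bool" where
  "Dfn P \<longleftrightarrow> definable (enc ` Collect P)"

definition Dfun :: "('a :: dt \<Rightarrow> 'b :: dt) \<Rightarrow> bool" where
  "Dfun f \<longleftrightarrow> Dfn (\<lambda>p. snd p = f (fst p))"

definition Dpt :: "'a :: dt \<Rightarrow> bool" where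
  "Dpt x \<longleftrightarrow> Dfn (\<lambda>y. y = x)"

named_theorems dfn

lemma Dfn_not [dfn]:
  fixes P :: "'a :: dt \<Rightarrow> bool"
  assumes "Dfn P"
  shows "Dfn (\<lambda>x. \<not> P x)"
proof -
  from assms have "definable (- enc ` Collect P \<inter> range (enc :: 'a \<Rightarrow> _))"
    unfolding Dfn_def by (intro definable_Int definable_Compl definable_range_enc)
  also have "- enc ` Collect P \<inter> range (enc :: 'a \<Rightarrow> _) = enc ` {x. \<not> P x}"
    by (auto simp: image_iff)
  finally show ?thesis by (simp add: Dfn_def)
qed

lemma Dfn_conj [dfn]: "Dfn P \<Longrightarrow> Dfn Q \<Longrightarrow> Dfn (\<lambda>x. P x \<and> Q x)"
proof -
  assume "Dfn P" "Dfn Q"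
  then have "definable (enc ` Collect P \<inter> enc ` Collect Q)" unfolding Dfn_def by (rule definable_Int)
  also have "enc ` Collect P \<inter> enc ` Collect Q = enc ` {x. P x \<and> Q x}" by auto
  finally show ?thesis by (simp add: Dfn_def)
qed

lemma Dfn_imp [dfn]: "Dfn P \<Longrightarrow> Dfn Q \<Longrightarrow> Dfn (\<lambda>x. P x \<longrightarrow> Q x)"
  using Dfn_not[OF Dfn_conj[OF _ Dfn_not]] by simp

lemma Dfn_disj [dfn]: "Dfn P \<Longrightarrow> Dfn Q \<Longrightarrow> Dfn (\<lambda>x. P x \<or> Q x)"
  using Dfn_imp[OF Dfn_not] by (simp add: disj_imp)

lemma Dfn_iff: "Dfn P \<Longrightarrow> Dfn Q \<Longrightarrow> Dfn (\<lambda>x. P x \<longleftrightarrow> Q x)"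
  using Dfn_conj[OF Dfn_imp Dfn_imp, of P Q Q P] by (simp add: iff_conv_conj_imp)

text \<open>A quantifier over a type of class \<open>dt\<close> is a quantifier over sets of
  numbers that belong to the range of the coding.\<close>

lemma Dfn_ex [dfn]: "Dfn (\<lambda>p. P (fst p) (snd p)) \<Longrightarrow> Dfn (\<lambda>x. \<exists>y. P x y)"
proof -
  assume "Dfn (\<lambda>p. P (fst p) (snd p))"
  then have "definable {A. \<exists>B. join A B \<in> enc ` {p. P (fst p) (snd p)}}"
    unfolding Dfn_def by (rule definable_projection)
  also have "{A. \<exists>B. join A B \<in> enc ` {p. P (fst p) (snd p)}} = enc ` {x. \<exists>y. P x y}"
    by (auto simp: enc_prod_def image_iff)
  finally show ?thesis by (simp add: Dfn_def)
qed

lemma Dfn_all [dfn]: "Dfn (\<lambda>p. P (fst p) (snd p)) \<Longrightarrow> Dfn (\<lambda>x. \<forall>y. P x y)"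
  using Dfn_not[OF Dfn_ex[OF Dfn_not]] by simp

lemma Dfun_graph: "Dfun f \<longleftrightarrow> definable {C. \<exists>x. C = join (enc x) (enc (f x))}"
proof -
  have "enc ` {p. snd p = f (fst p)} = {C. \<exists>x. C = join (enc x) (enc (f x))}"
    by (auto simp: enc_prod_def image_iff)
  then show ?thesis by (simp add: Dfun_def Dfn_def)
qed

lemma Dfn_vimage: "Dfn P \<Longrightarrow> Dfun f \<Longrightarrow> Dfn (\<lambda>x. P (f x))"
proof -
  assume "Dfn P" "Dfun f"
  then have "definable ({C. C \<in> {C. \<exists>x. C = join (enc x) (enc (f x))}} \<inter> {C. right C \<in> enc ` Collect P})"
    unfolding Dfun_graph Dfn_def
    by (intro definable_Int definable_vimage definable_op_right definable_op_id)
  from definable_projection[OF this]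
  show ?thesis unfolding Dfn_def by (rule back_subst[of definable]) (auto simp: image_iff)
qed

lemma Dfun_op:
  fixes f :: "'a :: dt \<Rightarrow> 'b :: dt"
  assumes "definable_op h" "\<And>x. enc (f x) = h (enc x)"
  shows "Dfun f"
proof -
  have "definable_rel (\<lambda>e E. e 0 \<in> h (E 0))" using assms(1) by (simp add: definable_op_def)
  then obtain \<phi> where \<phi>: "\<And>e E. sat UNIV e E \<phi> \<longleftrightarrow> e 0 \<in> h (E 0)" unfolding definable_rel_def by blast
  have "definable_rel (\<lambda>e E. \<exists>A. (\<lambda>e E. (\<forall>n. (\<lambda>e E. (val e (V 0) \<in> E 0 \<longleftrightarrow> val e (Plus (V 0) (V 0)) \<in> E 1)) (e(0 := n)) E)
      \<and> (\<forall>n. (\<lambda>e E. (e 0 \<in> h (E 0) \<longleftrightarrow> val e (S (Plus (V 0) (V 0))) \<in> E 1)) (e(0 := n)) E)) e (E(0 := A)))"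
    using \<phi> definable_rel_sat[of \<phi>]
    by (intro definable_rel_exS definable_rel_conj definable_rel_allN definable_rel_iff definable_rel_mem) simp
  then have "definable_rel (\<lambda>e E. \<exists>A. A = left (E 1) \<and> h A = right (E 1))"
    by (simp add: set_eq_iff left_def right_def)
  then have "definable_rel (\<lambda>e E. h (left (E 1)) = right (E 1))" by simp
  then obtain \<psi> where \<psi>: "\<And>e E. sat UNIV e E \<psi> \<longleftrightarrow> h (left (E 1)) = right (E 1)"
    unfolding definable_rel_def by blast
  have "sat UNIV e E (psubst 0 \<psi> (\<lambda>_. Zero) (\<lambda>_. Mem (V 0) 0)) \<longleftrightarrow> h (left (E 0)) = right (E 0)" for e E
    by (subst sat_psubst) (auto simp: \<psi>)
  then have "definable {C. h (left C) = right C}" unfolding definable_def definable_rel_def by auto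
  then have "definable ({C. left C \<in> range (enc :: 'a \<Rightarrow> _)} \<inter> {C. h (left C) = right C})"
    by (intro definable_Int definable_vimage definable_op_left definable_op_id definable_range_enc)
  also have "\<dots> = {C. \<exists>x. C = join (enc x) (enc (f x))}"
    by (auto simp: assms(2)) (metis join_left_right)
  finally show ?thesis by (simp add: Dfun_graph)
qed

lemma Dfun_comp: "Dfun g \<Longrightarrow> Dfun f \<Longrightarrow> Dfun (\<lambda>x. g (f x))"
proof -
  assume "Dfun g" "Dfun f"
  then have "definable ({C. join (left (left C)) (right C) \<in> {C. \<exists>x. C = join (enc x) (enc (f x))}} \<inter>
      {C. join (right C) (right (left C)) \<in> {C. \<exists>x. C = join (enc x) (enc (g x))}})"
    unfolding Dfun_graph
    by (intro definable_Int definable_vimage definable_op_join definable_op_left definable_op_right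
        definable_op_id)
  from definable_projection[OF this]
  show ?thesis unfolding Dfun_graph
    by (rule back_subst[of definable]) (auto, metis join_left_right)
qed

lemma Dfun_id [dfn]: "Dfun (\<lambda>x. x)"
  by (rule Dfun_op[OF definable_op_id]) simp

lemma Dfun_fst [dfn]: "Dfun f \<Longrightarrow> Dfun (\<lambda>x. fst (f x))"
  by (rule Dfun_comp, rule Dfun_op[OF definable_op_left[OF definable_op_id]]) (simp_all add: enc_prod_def)

lemma Dfun_snd [dfn]: "Dfun f \<Longrightarrow> Dfun (\<lambda>x. snd (f x))"
  by (rule Dfun_comp, rule Dfun_op[OF definable_op_right[OF definable_op_id]]) (simp_all add: enc_prod_def)

lemma Dfun_Pair [dfn]: "Dfun f \<Longrightarrow> Dfun g \<Longrightarrow> Dfun (\<lambda>x. (f x, g x))"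
proof -
  assume "Dfun f" "Dfun g"
  then have "definable ({C. join (left C) (left (right C)) \<in> {C. \<exists>x. C = join (enc x) (enc (f x))}} \<inter>
      {C. join (left C) (right (right C)) \<in> {C. \<exists>x. C = join (enc x) (enc (g x))}})"
    unfolding Dfun_graph
    by (intro definable_Int definable_vimage definable_op_join definable_op_left definable_op_right
        definable_op_id)
  then show ?thesis unfolding Dfun_graph
    by (rule back_subst[of definable]) (auto simp: enc_prod_def, metis join_left_right)
qed

lemma Dfn_eq [dfn]: "Dfun f \<Longrightarrow> Dfun g \<Longrightarrow> Dfn (\<lambda>x. f x = g x)"
  using Dfn_vimage[OF Dfun_id[unfolded Dfun_def] Dfun_Pair, of g f] by simp

lemma Dfun_const: "Dpt c \<Longrightarrow> Dfun (\<lambda>_. c)"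
  unfolding Dfun_def Dpt_def by (rule Dfn_vimage[OF _ Dfun_snd[OF Dfun_id]])

lemma Dfn_const [dfn]: "Dfn (\<lambda>_ :: 'a :: dt. b)"
proof -
  have "Dfn (\<lambda>x :: 'a. x = x)" by (intro dfn)
  then have "Dfn (\<lambda>x :: 'a. True)" by simp
  then show ?thesis using Dfn_not[of "\<lambda>_. True"] by (cases b) auto
qed

lemma Dpt_nat: "Dpt (n :: nat)"
  using definable_singleton[of n] by (simp add: Dpt_def Dfn_def enc_nat_def)

lemma Dfun_nat [dfn]: "Dfun (\<lambda>_. n :: nat)"
  by (rule Dfun_const[OF Dpt_nat])

lemma Dfun_apply: "Dfun f \<Longrightarrow> Dfun g \<Longrightarrow> Dfun (\<lambda>x. (f x) (g x))"
  using Dfun_comp[OF Dfun_op Dfun_Pair, of "\<lambda>C. section_at (left C) (right C)" "\<lambda>p. (fst p) (snd p)" f g]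
  by (simp add: definable_op_section_at definable_op_left definable_op_right definable_op_id
      enc_prod_def enc_cde section_at_enc_fun)

lemma Dfn_mem [dfn]:
  fixes f :: "'x :: dt \<Rightarrow> 'a :: cnt"
  assumes "Dfun f" "Dfun A"
  shows "Dfn (\<lambda>x. f x \<in> A x)"
proof -
  have "definable (range (enc :: 'a \<times> 'a set \<Rightarrow> _) \<inter> {C. left C \<subseteq> right C})"
    by (intro definable_Int definable_range_enc definable_Ball definable_op_left definable_op_right definable_op_id)
  also have "\<dots> = enc ` {p :: 'a \<times> 'a set. fst p \<in> snd p}"
    by (auto simp: enc_prod_def enc_cde enc_set_def image_iff)
  finally have "Dfn (\<lambda>p :: 'a \<times> 'a set. fst p \<in> snd p)" by (simp add: Dfn_def)
  from Dfn_vimage[OF this Dfun_Pair[OF assms]] show ?thesis by simp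
qed

lemma Dpt_True: "Dpt True"
proof -
  have "enc ` {y. y = True} = {{Suc 0}}" by (auto simp: enc_bool_def)
  then show ?thesis using definable_singleton[of "Suc 0"] by (simp only: Dpt_def Dfn_def)
qed

lemma Dfun_bool: "Dfun f \<longleftrightarrow> Dfn (f :: 'a :: dt \<Rightarrow> bool)"
proof
  assume "Dfun f"
  from Dfn_eq[OF this Dfun_const[OF Dpt_True]] show "Dfn f" by simp
next
  have "Dfn (\<lambda>b. b)" using Dpt_True by (simp add: Dpt_def)
  then have "Dfn (\<lambda>p :: 'a \<times> bool. snd p)" by (rule Dfn_vimage[OF _ Dfun_snd[OF Dfun_id]])
  moreover assume "Dfn f"
  then have "Dfn (\<lambda>p :: 'a \<times> bool. f (fst p))" by (rule Dfn_vimage[OF _ Dfun_fst[OF Dfun_id]])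
  ultimately show "Dfun f" unfolding Dfun_def by (rule Dfn_iff)
qed

text \<open>A function on a countable type is a single set of numbers, which is determined by its
  values.\<close>

lemma Dfun_lambda:
  fixes f :: "'a :: dt \<Rightarrow> 'b :: cnt \<Rightarrow> 'c :: dt"
  assumes "Dfun (\<lambda>p. f (fst p) (snd p))"
  shows "Dfun (\<lambda>x y. f x y)"
proof -
  have 1: "Dfun (\<lambda>p :: ('a \<times> ('b \<Rightarrow> 'c)) \<times> 'b. f (fst (fst p)) (snd p))"
    using Dfun_comp[OF assms Dfun_Pair[OF Dfun_fst[OF Dfun_fst[OF Dfun_id]] Dfun_snd[OF Dfun_id]]]
    by simp
  have 2: "Dfun (\<lambda>p :: ('a \<times> ('b \<Rightarrow> 'c)) \<times> 'b. (snd (fst p)) (snd p))"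
    by (rule Dfun_apply[OF Dfun_snd[OF Dfun_fst[OF Dfun_id]] Dfun_snd[OF Dfun_id]])
  have "Dfn (\<lambda>p :: 'a \<times> ('b \<Rightarrow> 'c). \<forall>y. (snd p) y = f (fst p) y)"
    by (rule Dfn_all[OF Dfn_eq[OF 2 1]])
  then show ?thesis by (simp add: Dfun_def fun_eq_iff)
qed

lemma Dfun_Collect:
  fixes P :: "'a :: dt \<Rightarrow> 'b :: cnt \<Rightarrow> bool"
  assumes "Dfn (\<lambda>p. P (fst p) (snd p))"
  shows "Dfun (\<lambda>x. {y. P x y})"
proof -
  have 1: "Dfn (\<lambda>p :: ('a \<times> 'b set) \<times> 'b. P (fst (fst p)) (snd p))"
    using Dfn_vimage[OF assms Dfun_Pair[OF Dfun_fst[OF Dfun_fst[OF Dfun_id]] Dfun_snd[OF Dfun_id]]]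
    by simp
  have 2: "Dfn (\<lambda>p :: ('a \<times> 'b set) \<times> 'b. snd p \<in> snd (fst p))"
    by (rule Dfn_mem[OF Dfun_snd[OF Dfun_id] Dfun_snd[OF Dfun_fst[OF Dfun_id]]])
  have "Dfn (\<lambda>p :: 'a \<times> 'b set. \<forall>y. y \<in> snd p \<longleftrightarrow> P (fst p) y)"
    by (rule Dfn_all[OF Dfn_iff[OF 2 1]])
  then show ?thesis by (simp add: Dfun_def set_eq_iff)
qed

text \<open>As an introduction rule \<open>Dfun_apply\<close> would match every application, also
  that of a constant. The instances are restricted to applications of variables, which appear as
  projections of a tuple.\<close>

lemmas Dfun_applies [dfn] =
  Dfun_apply[OF Dfun_id]
  Dfun_apply[OF Dfun_fst]
  Dfun_apply[OF Dfun_snd]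
  Dfun_apply[OF Dfun_apply[OF Dfun_id]]
  Dfun_apply[OF Dfun_apply[OF Dfun_fst]]
  Dfun_apply[OF Dfun_apply[OF Dfun_snd]]
  Dfun_apply[OF Dfun_apply[OF Dfun_apply[OF Dfun_id]]]
  Dfun_apply[OF Dfun_apply[OF Dfun_apply[OF Dfun_fst]]]
  Dfun_apply[OF Dfun_apply[OF Dfun_apply[OF Dfun_snd]]]

lemmas Dfn_applies [dfn] = Dfun_applies[THEN Dfun_bool[THEN iffD1]]

lemma Dfun_If [dfn]:
  assumes "Dfn P" "Dfun f" "Dfun g"
  shows "Dfun (\<lambda>x. if P x then f x else g x)"
proof -
  have fst: "Dfun fst" using Dfun_fst[OF Dfun_id] by simp
  have "Dfn (\<lambda>p. (P (fst p) \<longrightarrow> snd p = f (fst p)) \<and> (\<not> P (fst p) \<longrightarrow> snd p = g (fst p)))"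
    by (rule Dfn_conj[OF Dfn_imp[OF _ Dfn_eq[OF Dfun_snd[OF Dfun_id]]] Dfn_imp[OF Dfn_not
          Dfn_eq[OF Dfun_snd[OF Dfun_id]]]])
      (rule Dfn_vimage[OF assms(1) fst] Dfun_comp[OF assms(2) fst] Dfun_comp[OF assms(3) fst])+
  then show ?thesis unfolding Dfun_def by (rule back_subst[of Dfn]) auto
qed

text \<open>This is how functions defined by recursion are shown to be definable: their recursion
  equations determine them.\<close>

lemma Dpt_unique: "Dfn P \<Longrightarrow> P c \<Longrightarrow> (\<And>y. P y \<Longrightarrow> y = c) \<Longrightarrow> Dpt c"
proof -
  assume "Dfn P" and *: "P c" "\<And>y. P y \<Longrightarrow> y = c"
  have "P y \<longleftrightarrow> y = c" for y using * by metis
  then have "P = (\<lambda>y. y = c)" by blast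
  then show "Dpt c" using \<open>Dfn P\<close> by (simp add: Dpt_def)
qed

lemma Dpt_apply: "Dpt f \<Longrightarrow> Dfun g \<Longrightarrow> Dfun (\<lambda>x. f (g x))"
  by (rule Dfun_apply[OF Dfun_const])

lemma Dpt_apply2: "Dpt f \<Longrightarrow> Dfun g \<Longrightarrow> Dfun h \<Longrightarrow> Dfun (\<lambda>x. f (g x) (h x))"
  by (rule Dfun_apply[OF Dpt_apply])

lemma Dpt_image: "Dfun f \<Longrightarrow> Dpt c \<Longrightarrow> Dpt (f c)"
proof -
  assume "Dfun f" "Dpt c"
  then have "Dfn (\<lambda>y. y = f c)" by (intro Dfn_eq Dfun_id Dfun_comp[OF \<open>Dfun f\<close> Dfun_const])
  then show ?thesis by (simp add: Dpt_def)
qed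

lemma Dpt_Pair: "Dpt a \<Longrightarrow> Dpt b \<Longrightarrow> Dpt (a, b)"
proof -
  assume "Dpt a" "Dpt b"
  then have "Dfn (\<lambda>y. y = (a, b))" by (intro Dfn_eq Dfun_id Dfun_Pair Dfun_const)
  then show ?thesis by (simp add: Dpt_def)
qed

subsection \<open>Arithmetic\<close>

lemma Dfun_Suc [dfn]: "Dfun f \<Longrightarrow> Dfun (\<lambda>x. Suc (f x))"
proof (rule Dfun_comp[of Suc])
  have "definable_rel (\<lambda>e E. \<exists>k. (\<lambda>e E. val e (V 0) = val e (S (V 1)) \<and> val e (V 1) \<in> E 0) (e(1 := k)) E)"
    by (intro definable_rel_exN definable_rel_intros definable_rel_mem definable_rel_eq)
  then have "definable_op (\<lambda>C. {m. \<exists>k. m = Suc k \<and> k \<in> C})" by (simp add: definable_op_def)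
  then show "Dfun Suc" by (rule Dfun_op) (auto simp: enc_nat_def)
qed

lemma Dfun_nat_op:
  assumes "definable_rel (\<lambda>e E. e 0 = F (e 1) (e 2))" "Dfun f" "Dfun g"
  shows "Dfun (\<lambda>x. F (f x) (g x))"
proof -
  have "definable_rel (\<lambda>e E. (\<lambda>k l m. m = F k l) (e 1) (e 2) (e 0))" using assms(1) by simp
  then have "Dfun (\<lambda>p. F (fst p) (snd p))"
    by (rule Dfun_op[OF definable_op_image2]) (auto simp: enc_nat_def enc_prod_def)
  from Dfun_comp[OF this Dfun_Pair[OF assms(2,3)]] show ?thesis by simp
qed

lemma Dfun_add [dfn]: "Dfun f \<Longrightarrow> Dfun g \<Longrightarrow> Dfun (\<lambda>x. f x + g x :: nat)"
  by (rule Dfun_nat_op) (use definable_rel_eq[of "V 0" "Plus (V 1) (V 2)"] in simp_all)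

lemma Dfun_mult [dfn]: "Dfun f \<Longrightarrow> Dfun g \<Longrightarrow> Dfun (\<lambda>x. f x * g x :: nat)"
  by (rule Dfun_nat_op) (use definable_rel_eq[of "V 0" "Times (V 1) (V 2)"] in simp_all)

lemma Dfun_prod_encode [dfn]: "Dfun f \<Longrightarrow> Dfun g \<Longrightarrow> Dfun (\<lambda>x. prod_encode (f x, g x))"
  by (rule Dfun_nat_op[where F = "\<lambda>k l. prod_encode (k, l)"])
    (use definable_rel_pair[of "V 0" "V 1" "V 2"] in simp_all)

lemma Dfn_le [dfn]: "Dfun f \<Longrightarrow> Dfun g \<Longrightarrow> Dfn (\<lambda>x. f x \<le> (g x :: nat))"
proof -
  assume f: "Dfun f" "Dfun g"
  have "Dfn (\<lambda>p :: nat \<times> nat. \<exists>k. snd p = fst p + k)" by (intro dfn)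
  from Dfn_vimage[OF this Dfun_Pair[OF f]] show ?thesis by (simp add: le_iff_add)
qed

lemma Dfn_less [dfn]: "Dfun f \<Longrightarrow> Dfun g \<Longrightarrow> Dfn (\<lambda>x. f x < (g x :: nat))"
  unfolding less_eq_Suc_le by (intro dfn)

lemma Dfun_fst_prod_decode [dfn]: "Dfun f \<Longrightarrow> Dfun (\<lambda>x. fst (prod_decode (f x)))"
proof (rule Dfun_comp[of "\<lambda>n. fst (prod_decode n)"])
  have "Dfn (\<lambda>p. \<exists>b. fst p = prod_encode (snd p, b))" by (intro dfn)
  moreover have "(\<exists>b. n = prod_encode (m, b)) \<longleftrightarrow> m = fst (prod_decode n)" for n m
  proof -
    obtain a c where "n = prod_encode (a, c)" by (metis prod_decode_inverse surj_pair)
    then show ?thesis by auto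
  qed
  ultimately show "Dfun (\<lambda>n. fst (prod_decode n))" by (simp add: Dfun_def)
qed

lemma Dfun_snd_prod_decode [dfn]: "Dfun f \<Longrightarrow> Dfun (\<lambda>x. snd (prod_decode (f x)))"
proof (rule Dfun_comp[of "\<lambda>n. snd (prod_decode n)"])
  have "Dfn (\<lambda>p. \<exists>a. fst p = prod_encode (a, snd p))" by (intro dfn)
  moreover have "(\<exists>a. n = prod_encode (a, m)) \<longleftrightarrow> m = snd (prod_decode n)" for n m
  proof -
    obtain a c where "n = prod_encode (a, c)" by (metis prod_decode_inverse surj_pair)
    then show ?thesis by auto
  qed
  ultimately show "Dfun (\<lambda>n. snd (prod_decode n))" by (simp add: Dfun_def)
qed

subsection \<open>Inductive data types\<close>

text \<open>For a countable inductive type the range of the coding is the least set of numbers that is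
  closed under the operations which correspond to the constructors, and a set quantifier expresses
  this. The same pattern is followed for lists, terms and the two kinds of formulas.\<close>

lemma Dfun_cde [dfn]: "Dfun f \<Longrightarrow> Dfun (\<lambda>x. cde (f x))"
  by (rule Dfun_comp[OF Dfun_op[OF definable_op_id]]) (auto simp: enc_nat_def enc_cde)

lemma Dfun_cdeI:
  fixes f :: "'a :: dt \<Rightarrow> 'b :: cnt"
  assumes "Dfun (\<lambda>x. cde (f x))"
  shows "Dfun f"
proof -
  from Dfun_comp[OF assms Dfun_fst[OF Dfun_id]]
  have "Dfn (\<lambda>p :: 'a \<times> 'b. cde (snd p) = cde (f (fst p)))" by (rule Dfn_eq[OF Dfun_cde[OF Dfun_snd[OF Dfun_id]]])
  then show ?thesis by (simp add: Dfun_def)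
qed

lemma cnt_criterion:
  assumes "inj (f :: 'a \<Rightarrow> nat)" "Dfn (\<lambda>n. n \<in> range f)"
  shows "inj (\<lambda>x. {f x})" "definable (range (\<lambda>x. {f x}))"
proof -
  have "enc ` {n. n \<in> range f} = {A. \<exists>x. A = {f x}}" by (auto simp: enc_nat_def)
  with assms(2) have "definable {A. \<exists>x. A = {f x}}" by (simp add: Dfn_def)
  from definable_rel_singleton_in[OF this, of 0]
  have "definable_rel (\<lambda>e E. e 0 \<in> range f)" by (simp add: image_iff)
  from cnt_class_criterion[OF assms(1) this]
  show "inj (\<lambda>x. {f x})" "definable (range (\<lambda>x. {f x}))" .
qed

primrec list_code :: "'a :: cnt list \<Rightarrow> nat" where
  "list_code [] = 0"
| "list_code (x # xs) = Suc (prod_encode (cde x, list_code xs))"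

lemma list_code_inject: "list_code xs = list_code ys \<Longrightarrow> xs = ys"
proof (induction xs arbitrary: ys)
  case Nil
  then show ?case by (cases ys) auto
next
  case (Cons x xs)
  then show ?case by (cases ys) auto
qed

instantiation list :: (cnt) cnt
begin
definition enc_list :: "'a list \<Rightarrow> nat set" where "enc_list xs = {list_code xs}"
definition cde_list :: "'a list \<Rightarrow> nat" where "cde_list xs = list_code xs"
instance
proof
  have inj: "inj (list_code :: 'a list \<Rightarrow> nat)" by (rule injI) (rule list_code_inject)
  have "Dfn (\<lambda>n :: nat. \<forall>C. 0 \<in> C \<and> (\<forall>x :: 'a. \<forall>c. c \<in> C \<longrightarrow> Suc (prod_encode (cde x, c)) \<in> C) \<longrightarrow> n \<in> C)"
    by (intro dfn)
  also have "(\<lambda>n :: nat. \<forall>C. 0 \<in> C \<and> (\<forall>x :: 'a. \<forall>c. c \<in> C \<longrightarrow> Suc (prod_encode (cde x, c)) \<in> C) \<longrightarrow> n \<in> C) =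
      (\<lambda>n. n \<in> range (list_code :: 'a list \<Rightarrow> nat))"
  proof (rule ext, rule iffI)
    fix n :: nat
    assume *: "\<forall>C. 0 \<in> C \<and> (\<forall>x :: 'a. \<forall>c. c \<in> C \<longrightarrow> Suc (prod_encode (cde x, c)) \<in> C) \<longrightarrow> n \<in> C"
    have "0 \<in> range (list_code :: 'a list \<Rightarrow> nat)" by (rule range_eqI[of _ _ "[]"]) simp
    moreover have "Suc (prod_encode (cde x, list_code xs)) \<in> range (list_code :: 'a list \<Rightarrow> nat)" for x :: 'a and xs :: "'a list"
      by (rule range_eqI[of _ _ "x # xs"]) simp
    ultimately show "n \<in> range (list_code :: 'a list \<Rightarrow> nat)"
      by (intro *[rule_format]) auto
  next
    fix n :: nat
    assume "n \<in> range (list_code :: 'a list \<Rightarrow> nat)"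
    moreover have "list_code xs \<in> C" if "0 \<in> C \<and> (\<forall>x :: 'a. \<forall>c. c \<in> C \<longrightarrow> Suc (prod_encode (cde x, c)) \<in> C)"
      for C and xs :: "'a list"
      using that by (induction xs) auto
    ultimately show "\<forall>C. 0 \<in> C \<and> (\<forall>x :: 'a. \<forall>c. c \<in> C \<longrightarrow> Suc (prod_encode (cde x, c)) \<in> C) \<longrightarrow> n \<in> C"
      by auto
  qed
  finally have "Dfn (\<lambda>n. n \<in> range (list_code :: 'a list \<Rightarrow> nat))" .
  from cnt_criterion[OF inj this]
  show "inj (enc :: 'a list \<Rightarrow> nat set)" "definable (range (enc :: 'a list \<Rightarrow> nat set))"
    by (simp_all add: enc_list_def[abs_def])
qed (simp add: enc_list_def cde_list_def)
end

lemma Dfun_Nil [dfn]: "Dfun (\<lambda>_. [])"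
  by (rule Dfun_cdeI) (simp add: cde_list_def Dfun_nat)

lemma Dfun_Cons [dfn]: "Dfun f \<Longrightarrow> Dfun g \<Longrightarrow> Dfun (\<lambda>x. f x # g x)"
proof (rule Dfun_cdeI)
  assume "Dfun f" "Dfun g"
  then have "Dfun (\<lambda>x. Suc (prod_encode (cde (f x), cde (g x))))" by (intro dfn)
  then show "Dfun (\<lambda>x. cde (f x # g x))" by (simp add: cde_list_def)
qed

primrec tm_code :: "tm \<Rightarrow> nat" where
  "tm_code (V i) = prod_encode (0, i)"
| "tm_code Zero = prod_encode (1, 0)"
| "tm_code (S t) = prod_encode (2, tm_code t)"
| "tm_code (Plus s t) = prod_encode (3, prod_encode (tm_code s, tm_code t))"
| "tm_code (Times s t) = prod_encode (4, prod_encode (tm_code s, tm_code t))"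

lemma tm_code_inject: "tm_code s = tm_code t \<Longrightarrow> s = t"
proof (induction s arbitrary: t)
  case (V x) then show ?case by (cases t) auto
next
  case Zero then show ?case by (cases t) auto
next
  case (S s) then show ?case by (cases t) auto
next
  case (Plus s s') then show ?case by (cases t) auto
next
  case (Times s s') then show ?case by (cases t) auto
qed

instantiation tm :: cnt
begin
definition enc_tm :: "tm \<Rightarrow> nat set" where "enc_tm t = {tm_code t}"
definition cde_tm :: "tm \<Rightarrow> nat" where "cde_tm t = tm_code t"
instance
proof
  have inj: "inj tm_code" by (rule injI) (rule tm_code_inject)
  define closed where "closed C \<longleftrightarrow> (\<forall>i. prod_encode (0, i) \<in> C) \<and> prod_encode (1, 0) \<in> C \<and>
    (\<forall>c. c \<in> C \<longrightarrow> prod_encode (2, c) \<in> C) \<and>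
    (\<forall>c d. c \<in> C \<longrightarrow> d \<in> C \<longrightarrow> prod_encode (3, prod_encode (c, d)) \<in> C) \<and>
    (\<forall>c d. c \<in> C \<longrightarrow> d \<in> C \<longrightarrow> prod_encode (4, prod_encode (c, d)) \<in> C)" for C
  have "Dfn (\<lambda>n :: nat. \<forall>C. closed C \<longrightarrow> n \<in> C)"
    unfolding closed_def by (intro dfn)
  also have "(\<lambda>n :: nat. \<forall>C. closed C \<longrightarrow> n \<in> C) = (\<lambda>n. n \<in> range tm_code)"
  proof (rule ext, rule iffI)
    fix n
    assume *: "\<forall>C. closed C \<longrightarrow> n \<in> C"
    have c0: "prod_encode (0, i) \<in> range tm_code" for i
      by (rule range_eqI[of _ _ "V i"]) simp
    have c1: "prod_encode (1, 0) \<in> range tm_code"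
      by (rule range_eqI[of _ _ "Zero"]) simp
    have c2: "prod_encode (2, tm_code t) \<in> range tm_code" for t
      by (rule range_eqI[of _ _ "S t"]) simp
    have c3: "prod_encode (3, prod_encode (tm_code s, tm_code t)) \<in> range tm_code" for s t
      by (rule range_eqI[of _ _ "Plus s t"]) simp
    have c4: "prod_encode (4, prod_encode (tm_code s, tm_code t)) \<in> range tm_code" for s t
      by (rule range_eqI[of _ _ "Times s t"]) simp
    have "closed (range tm_code)"
      unfolding closed_def by (intro conjI allI impI; (elim rangeE)?; simp only: c0 c1 c2 c3 c4)
    then show "n \<in> range tm_code" using * by blast
  next
    fix n
    assume "n \<in> range tm_code"
    moreover have "tm_code t \<in> C" if "closed C" for C t
      using that unfolding closed_def by (induction t) auto
    ultimately show "\<forall>C. closed C \<longrightarrow> n \<in> C" by auto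
  qed
  finally have "Dfn (\<lambda>n. n \<in> range tm_code)" .
  from cnt_criterion[OF inj this]
  show "inj (enc :: tm \<Rightarrow> nat set)" "definable (range (enc :: tm \<Rightarrow> nat set))"
    by (simp_all add: enc_tm_def[abs_def])
qed (simp add: enc_tm_def cde_tm_def)
end

lemma cde_tm_simps:
  "cde (V i) = prod_encode (0, i)"
  "cde Zero = prod_encode (1, 0)"
  "cde (S t) = prod_encode (2, cde t)"
  "cde (Plus s t) = prod_encode (3, prod_encode (cde s, cde t))"
  "cde (Times s t) = prod_encode (4, prod_encode (cde s, cde t))"
  unfolding cde_tm_def by (fact tm_code.simps)+

lemma Dfun_V [dfn]: "Dfun f \<Longrightarrow> Dfun (\<lambda>x. V (f x))"
  by (rule Dfun_cdeI) (unfold cde_tm_simps, intro dfn)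

lemma Dfun_Zero [dfn]: "Dfun (\<lambda>_. Zero)"
  by (rule Dfun_cdeI) (unfold cde_tm_simps, intro dfn)

lemma Dfun_S [dfn]: "Dfun h \<Longrightarrow> Dfun (\<lambda>x. S (h x))"
  by (rule Dfun_cdeI) (unfold cde_tm_simps, intro dfn)

lemma Dfun_Plus [dfn]: "Dfun h \<Longrightarrow> Dfun k \<Longrightarrow> Dfun (\<lambda>x. Plus (h x) (k x))"
  by (rule Dfun_cdeI) (unfold cde_tm_simps, intro dfn)

lemma Dfun_Times [dfn]: "Dfun h \<Longrightarrow> Dfun k \<Longrightarrow> Dfun (\<lambda>x. Times (h x) (k x))"
  by (rule Dfun_cdeI) (unfold cde_tm_simps, intro dfn)

primrec fm_code :: "fm \<Rightarrow> nat" where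
  "fm_code (Eq s t) = prod_encode (0, prod_encode (cde s, cde t))"
| "fm_code (Less s t) = prod_encode (1, prod_encode (cde s, cde t))"
| "fm_code (Mem t X) = prod_encode (2, prod_encode (cde t, X))"
| "fm_code (Neg \<phi>) = prod_encode (3, fm_code \<phi>)"
| "fm_code (Conj \<phi> \<psi>) = prod_encode (4, prod_encode (fm_code \<phi>, fm_code \<psi>))"
| "fm_code (ExN i \<phi>) = prod_encode (5, prod_encode (i, fm_code \<phi>))"
| "fm_code (AllN i \<phi>) = prod_encode (6, prod_encode (i, fm_code \<phi>))"
| "fm_code (ExS X \<phi>) = prod_encode (7, prod_encode (X, fm_code \<phi>))"
| "fm_code (AllS X \<phi>) = prod_encode (8, prod_encode (X, fm_code \<phi>))"

lemma fm_code_inject: "fm_code \<phi> = fm_code \<psi> \<Longrightarrow> \<phi> = \<psi>"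
proof (induction \<phi> arbitrary: \<psi>)
  case (Eq s t) then show ?case by (cases \<psi>) auto
next
  case (Less s t) then show ?case by (cases \<psi>) auto
next
  case (Mem t X) then show ?case by (cases \<psi>) auto
next
  case (Neg \<phi>) then show ?case by (cases \<psi>) auto
next
  case (Conj \<phi> \<chi>) then show ?case by (cases \<psi>) auto
next
  case (ExN i \<phi>) then show ?case by (cases \<psi>) auto
next
  case (AllN i \<phi>) then show ?case by (cases \<psi>) auto
next
  case (ExS X \<phi>) then show ?case by (cases \<psi>) auto
next
  case (AllS X \<phi>) then show ?case by (cases \<psi>) auto
qed

instantiation fm :: cnt
begin
definition enc_fm :: "fm \<Rightarrow> nat set" where "enc_fm t = {fm_code t}"
definition cde_fm :: "fm \<Rightarrow> nat" where "cde_fm t = fm_code t"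
instance
proof
  have inj: "inj fm_code" by (rule injI) (rule fm_code_inject)
  define closed where "closed C \<longleftrightarrow>
    (\<forall>(s :: tm) (t :: tm). prod_encode (0, prod_encode (cde s, cde t)) \<in> C) \<and>
    (\<forall>(s :: tm) (t :: tm). prod_encode (1, prod_encode (cde s, cde t)) \<in> C) \<and>
    (\<forall>t :: tm. \<forall>X. prod_encode (2, prod_encode (cde t, X)) \<in> C) \<and>
    (\<forall>c. c \<in> C \<longrightarrow> prod_encode (3, c) \<in> C) \<and>
    (\<forall>c d. c \<in> C \<longrightarrow> d \<in> C \<longrightarrow> prod_encode (4, prod_encode (c, d)) \<in> C) \<and>
    (\<forall>i d. d \<in> C \<longrightarrow> prod_encode (5, prod_encode (i, d)) \<in> C \<and> prod_encode (6, prod_encode (i, d)) \<in> C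
      \<and> prod_encode (7, prod_encode (i, d)) \<in> C \<and> prod_encode (8, prod_encode (i, d)) \<in> C)" for C
  have "Dfn (\<lambda>n :: nat. \<forall>C. closed C \<longrightarrow> n \<in> C)"
    unfolding closed_def by (intro dfn)
  also have "(\<lambda>n :: nat. \<forall>C. closed C \<longrightarrow> n \<in> C) = (\<lambda>n. n \<in> range fm_code)"
  proof (rule ext, rule iffI)
    fix n
    assume *: "\<forall>C. closed C \<longrightarrow> n \<in> C"
    have c0: "prod_encode (0, prod_encode (cde s, cde t)) \<in> range fm_code" for s t :: tm
      by (rule range_eqI[of _ _ "Eq s t"]) simp
    have c1: "prod_encode (1, prod_encode (cde s, cde t)) \<in> range fm_code" for s t :: tm
      by (rule range_eqI[of _ _ "Less s t"]) simp
    have c2: "prod_encode (2, prod_encode (cde t, X)) \<in> range fm_code" for t :: tm and X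
      by (rule range_eqI[of _ _ "Mem t X"]) simp
    have c3: "prod_encode (3, fm_code s) \<in> range fm_code" for s
      by (rule range_eqI[of _ _ "Neg s"]) simp
    have c4: "prod_encode (4, prod_encode (fm_code s, fm_code t)) \<in> range fm_code" for s t
      by (rule range_eqI[of _ _ "Conj s t"]) simp
    have c5: "prod_encode (5, prod_encode (i, fm_code t)) \<in> range fm_code" for i t
      by (rule range_eqI[of _ _ "ExN i t"]) simp
    have c6: "prod_encode (6, prod_encode (i, fm_code t)) \<in> range fm_code" for i t
      by (rule range_eqI[of _ _ "AllN i t"]) simp
    have c7: "prod_encode (7, prod_encode (i, fm_code t)) \<in> range fm_code" for i t
      by (rule range_eqI[of _ _ "ExS i t"]) simp
    have c8: "prod_encode (8, prod_encode (i, fm_code t)) \<in> range fm_code" for i t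
      by (rule range_eqI[of _ _ "AllS i t"]) simp
    have "closed (range fm_code)"
      unfolding closed_def by (intro conjI allI impI; (elim rangeE)?; simp only: c0 c1 c2 c3 c4 c5 c6 c7 c8)
    then show "n \<in> range fm_code" using * by blast
  next
    fix n
    assume "n \<in> range fm_code"
    moreover have "fm_code t \<in> C" if "closed C" for C t
      using that unfolding closed_def by (induction t) auto
    ultimately show "\<forall>C. closed C \<longrightarrow> n \<in> C" by auto
  qed
  finally have "Dfn (\<lambda>n. n \<in> range fm_code)" .
  from cnt_criterion[OF inj this]
  show "inj (enc :: fm \<Rightarrow> nat set)" "definable (range (enc :: fm \<Rightarrow> nat set))"
    by (simp_all add: enc_fm_def[abs_def])
qed (simp add: enc_fm_def cde_fm_def)
end

lemma cde_fm_simps: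
  "cde (Eq s t) = prod_encode (0, prod_encode (cde s, cde t))"
  "cde (Less s t) = prod_encode (1, prod_encode (cde s, cde t))"
  "cde (Mem t X) = prod_encode (2, prod_encode (cde t, X))"
  "cde (Neg \<phi>) = prod_encode (3, cde \<phi>)"
  "cde (Conj \<phi> \<psi>) = prod_encode (4, prod_encode (cde \<phi>, cde \<psi>))"
  "cde (ExN i \<phi>) = prod_encode (5, prod_encode (i, cde \<phi>))"
  "cde (AllN i \<phi>) = prod_encode (6, prod_encode (i, cde \<phi>))"
  "cde (ExS X \<phi>) = prod_encode (7, prod_encode (X, cde \<phi>))"
  "cde (AllS X \<phi>) = prod_encode (8, prod_encode (X, cde \<phi>))"
  unfolding cde_fm_def by (fact fm_code.simps)+

lemma Dfun_Eq [dfn]: "Dfun h \<Longrightarrow> Dfun k \<Longrightarrow> Dfun (\<lambda>x. Eq (h x) (k x))"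
  by (rule Dfun_cdeI) (unfold cde_fm_simps, intro dfn)

lemma Dfun_Less [dfn]: "Dfun h \<Longrightarrow> Dfun k \<Longrightarrow> Dfun (\<lambda>x. Less (h x) (k x))"
  by (rule Dfun_cdeI) (unfold cde_fm_simps, intro dfn)

lemma Dfun_Mem [dfn]: "Dfun h \<Longrightarrow> Dfun i \<Longrightarrow> Dfun (\<lambda>x. Mem (h x) (i x))"
  by (rule Dfun_cdeI) (unfold cde_fm_simps, intro dfn)

lemma Dfun_Neg [dfn]: "Dfun f \<Longrightarrow> Dfun (\<lambda>x. Neg (f x))"
  by (rule Dfun_cdeI) (unfold cde_fm_simps, intro dfn)

lemma Dfun_Conj [dfn]: "Dfun f \<Longrightarrow> Dfun g \<Longrightarrow> Dfun (\<lambda>x. Conj (f x) (g x))"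
  by (rule Dfun_cdeI) (unfold cde_fm_simps, intro dfn)

lemma Dfun_ExN [dfn]: "Dfun i \<Longrightarrow> Dfun f \<Longrightarrow> Dfun (\<lambda>x. ExN (i x) (f x))"
  by (rule Dfun_cdeI) (unfold cde_fm_simps, intro dfn)

lemma Dfun_AllN [dfn]: "Dfun i \<Longrightarrow> Dfun f \<Longrightarrow> Dfun (\<lambda>x. AllN (i x) (f x))"
  by (rule Dfun_cdeI) (unfold cde_fm_simps, intro dfn)

lemma Dfun_ExS [dfn]: "Dfun i \<Longrightarrow> Dfun f \<Longrightarrow> Dfun (\<lambda>x. ExS (i x) (f x))"
  by (rule Dfun_cdeI) (unfold cde_fm_simps, intro dfn)

lemma Dfun_AllS [dfn]: "Dfun i \<Longrightarrow> Dfun f \<Longrightarrow> Dfun (\<lambda>x. AllS (i x) (f x))"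
  by (rule Dfun_cdeI) (unfold cde_fm_simps, intro dfn)

primrec xfm_code :: "xfm \<Rightarrow> nat" where
  "xfm_code (L2 \<phi>) = prod_encode (0, cde \<phi>)"
| "xfm_code (Game k \<phi> \<psi>) = prod_encode (1, prod_encode (k, prod_encode (cde \<phi>, cde \<psi>)))"
| "xfm_code (XNeg \<phi>) = prod_encode (3, xfm_code \<phi>)"
| "xfm_code (XConj \<phi> \<psi>) = prod_encode (4, prod_encode (xfm_code \<phi>, xfm_code \<psi>))"
| "xfm_code (XExN i \<phi>) = prod_encode (5, prod_encode (i, xfm_code \<phi>))"
| "xfm_code (XAllN i \<phi>) = prod_encode (6, prod_encode (i, xfm_code \<phi>))"
| "xfm_code (XExS X \<phi>) = prod_encode (7, prod_encode (X, xfm_code \<phi>))"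
| "xfm_code (XAllS X \<phi>) = prod_encode (8, prod_encode (X, xfm_code \<phi>))"

lemma xfm_code_inject: "xfm_code \<phi> = xfm_code \<psi> \<Longrightarrow> \<phi> = \<psi>"
proof (induction \<phi> arbitrary: \<psi>)
  case (L2 s) then show ?case by (cases \<psi>) auto
next
  case (Game k \<phi> \<chi>) then show ?case by (cases \<psi>) auto
next
  case (XNeg \<phi>) then show ?case by (cases \<psi>) auto
next
  case (XConj \<phi> \<chi>) then show ?case by (cases \<psi>) auto
next
  case (XExN i \<phi>) then show ?case by (cases \<psi>) auto
next
  case (XAllN i \<phi>) then show ?case by (cases \<psi>) auto
next
  case (XExS X \<phi>) then show ?case by (cases \<psi>) auto
next
  case (XAllS X \<phi>) then show ?case by (cases \<psi>) auto
qed

instantiation xfm :: cnt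
begin
definition enc_xfm :: "xfm \<Rightarrow> nat set" where "enc_xfm t = {xfm_code t}"
definition cde_xfm :: "xfm \<Rightarrow> nat" where "cde_xfm t = xfm_code t"
instance
proof
  have inj: "inj xfm_code" by (rule injI) (rule xfm_code_inject)
  define closed where "closed C \<longleftrightarrow>
    (\<forall>\<phi> :: fm. prod_encode (0, cde \<phi>) \<in> C) \<and>
    (\<forall>k (\<phi> :: fm) (\<psi> :: fm). prod_encode (1, prod_encode (k, prod_encode (cde \<phi>, cde \<psi>))) \<in> C) \<and>
    (\<forall>c. c \<in> C \<longrightarrow> prod_encode (3, c) \<in> C) \<and>
    (\<forall>c d. c \<in> C \<longrightarrow> d \<in> C \<longrightarrow> prod_encode (4, prod_encode (c, d)) \<in> C) \<and>
    (\<forall>i d. d \<in> C \<longrightarrow> prod_encode (5, prod_encode (i, d)) \<in> C \<and> prod_encode (6, prod_encode (i, d)) \<in> C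
      \<and> prod_encode (7, prod_encode (i, d)) \<in> C \<and> prod_encode (8, prod_encode (i, d)) \<in> C)" for C
  have "Dfn (\<lambda>n :: nat. \<forall>C. closed C \<longrightarrow> n \<in> C)"
    unfolding closed_def by (intro dfn)
  also have "(\<lambda>n :: nat. \<forall>C. closed C \<longrightarrow> n \<in> C) = (\<lambda>n. n \<in> range xfm_code)"
  proof (rule ext, rule iffI)
    fix n
    assume *: "\<forall>C. closed C \<longrightarrow> n \<in> C"
    have c0: "prod_encode (0, cde s) \<in> range xfm_code" for s :: fm
      by (rule range_eqI[of _ _ "L2 s"]) simp
    have c1: "prod_encode (1, prod_encode (k, prod_encode (cde s, cde t))) \<in> range xfm_code" for k and s t :: fm
      by (rule range_eqI[of _ _ "Game k s t"]) simp
    have c2: "prod_encode (3, xfm_code s) \<in> range xfm_code" for s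
      by (rule range_eqI[of _ _ "XNeg s"]) simp
    have c3: "prod_encode (4, prod_encode (xfm_code s, xfm_code t)) \<in> range xfm_code" for s t
      by (rule range_eqI[of _ _ "XConj s t"]) simp
    have c4: "prod_encode (5, prod_encode (i, xfm_code t)) \<in> range xfm_code" for i t
      by (rule range_eqI[of _ _ "XExN i t"]) simp
    have c5: "prod_encode (6, prod_encode (i, xfm_code t)) \<in> range xfm_code" for i t
      by (rule range_eqI[of _ _ "XAllN i t"]) simp
    have c6: "prod_encode (7, prod_encode (i, xfm_code t)) \<in> range xfm_code" for i t
      by (rule range_eqI[of _ _ "XExS i t"]) simp
    have c7: "prod_encode (8, prod_encode (i, xfm_code t)) \<in> range xfm_code" for i t
      by (rule range_eqI[of _ _ "XAllS i t"]) simp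
    have "closed (range xfm_code)"
      unfolding closed_def by (intro conjI allI impI; (elim rangeE)?; simp only: c0 c1 c2 c3 c4 c5 c6 c7)
    then show "n \<in> range xfm_code" using * by blast
  next
    fix n
    assume "n \<in> range xfm_code"
    moreover have "xfm_code t \<in> C" if "closed C" for C t
      using that unfolding closed_def by (induction t) auto
    ultimately show "\<forall>C. closed C \<longrightarrow> n \<in> C" by auto
  qed
  finally have "Dfn (\<lambda>n. n \<in> range xfm_code)" .
  from cnt_criterion[OF inj this]
  show "inj (enc :: xfm \<Rightarrow> nat set)" "definable (range (enc :: xfm \<Rightarrow> nat set))"
    by (simp_all add: enc_xfm_def[abs_def])
qed (simp add: enc_xfm_def cde_xfm_def)
end

lemma cde_xfm_simps:
  "cde (L2 \<alpha>) = prod_encode (0, cde \<alpha>)"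
  "cde (Game k \<alpha> \<beta>) = prod_encode (1, prod_encode (k, prod_encode (cde \<alpha>, cde \<beta>)))"
  "cde (XNeg \<phi>) = prod_encode (3, cde \<phi>)"
  "cde (XConj \<phi> \<psi>) = prod_encode (4, prod_encode (cde \<phi>, cde \<psi>))"
  "cde (XExN i \<phi>) = prod_encode (5, prod_encode (i, cde \<phi>))"
  "cde (XAllN i \<phi>) = prod_encode (6, prod_encode (i, cde \<phi>))"
  "cde (XExS X \<phi>) = prod_encode (7, prod_encode (X, cde \<phi>))"
  "cde (XAllS X \<phi>) = prod_encode (8, prod_encode (X, cde \<phi>))"
  unfolding cde_xfm_def by (fact xfm_code.simps)+

lemma Dfun_L2 [dfn]: "Dfun h \<Longrightarrow> Dfun (\<lambda>x. L2 (h x))"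
  by (rule Dfun_cdeI) (unfold cde_xfm_simps, intro dfn)

lemma Dfun_Game [dfn]: "Dfun i \<Longrightarrow> Dfun h \<Longrightarrow> Dfun k \<Longrightarrow> Dfun (\<lambda>x. Game (i x) (h x) (k x))"
  by (rule Dfun_cdeI) (unfold cde_xfm_simps, intro dfn)

lemma Dfun_XNeg [dfn]: "Dfun f \<Longrightarrow> Dfun (\<lambda>x. XNeg (f x))"
  by (rule Dfun_cdeI) (unfold cde_xfm_simps, intro dfn)

lemma Dfun_XConj [dfn]: "Dfun f \<Longrightarrow> Dfun g \<Longrightarrow> Dfun (\<lambda>x. XConj (f x) (g x))"
  by (rule Dfun_cdeI) (unfold cde_xfm_simps, intro dfn)

lemma Dfun_XExN [dfn]: "Dfun i \<Longrightarrow> Dfun f \<Longrightarrow> Dfun (\<lambda>x. XExN (i x) (f x))"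
  by (rule Dfun_cdeI) (unfold cde_xfm_simps, intro dfn)

lemma Dfun_XAllN [dfn]: "Dfun i \<Longrightarrow> Dfun f \<Longrightarrow> Dfun (\<lambda>x. XAllN (i x) (f x))"
  by (rule Dfun_cdeI) (unfold cde_xfm_simps, intro dfn)

lemma Dfun_XExS [dfn]: "Dfun i \<Longrightarrow> Dfun f \<Longrightarrow> Dfun (\<lambda>x. XExS (i x) (f x))"
  by (rule Dfun_cdeI) (unfold cde_xfm_simps, intro dfn)

lemma Dfun_XAllS [dfn]: "Dfun i \<Longrightarrow> Dfun f \<Longrightarrow> Dfun (\<lambda>x. XAllS (i x) (f x))"
  by (rule Dfun_cdeI) (unfold cde_xfm_simps, intro dfn)

section \<open>Games\<close>

text \<open>The player named by \<open>b\<close> (player I if \<open>b\<close> holds) follows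
  \<open>\<sigma>\<close>, the opponent plays the digits of \<open>y\<close>.\<close>

definition play :: "bool \<Rightarrow> (nat list \<Rightarrow> nat) \<Rightarrow> (nat \<Rightarrow> nat) \<Rightarrow> nat \<Rightarrow> nat list" where
  "play b \<sigma> y = rec_nat [] (\<lambda>n l. l @ [if even n = b then \<sigma> l else y (n div 2)])"

lemma play_simps:
  "play b \<sigma> y 0 = []"
  "play b \<sigma> y (Suc n) = play b \<sigma> y n @ [if even n = b then \<sigma> (play b \<sigma> y n) else y (n div 2)]"
  by (simp_all add: play_def)

definition play_seq :: "bool \<Rightarrow> (nat list \<Rightarrow> nat) \<Rightarrow> (nat \<Rightarrow> nat) \<Rightarrow> nat \<Rightarrow> nat" where
  "play_seq b \<sigma> y n = (if even n = b then \<sigma> (play b \<sigma> y n) else y (n div 2))"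

lemma play_eq: "play b \<sigma> y n = map (play_seq b \<sigma> y) [0..<n]"
  by (induction n) (simp_all add: play_simps play_seq_def)

lemma play_cong:
  "(\<And>m. m < n \<Longrightarrow> even m \<noteq> b \<Longrightarrow> y (m div 2) = y' (m div 2)) \<Longrightarrow> play b \<sigma> y n = play b \<sigma> y' n"
  by (induction n) (simp_all add: play_simps)

text \<open>Finitely supported functions, named by finite lists.\<close>

definition extend :: "nat list \<Rightarrow> nat \<Rightarrow> nat" where
  "extend l i = (if i < length l then l ! i else 0)"

lemma extend_map [simp]: "i < k \<Longrightarrow> extend (map y [0..<k]) i = y i"
  by (simp add: extend_def)

text \<open>Strategies are viewed as maps between points. Player II answers a digit after having
  seen it, while player I moves first and sees only the earlier digits of the opponent.\<close>

definition respond :: "(nat list \<Rightarrow> nat) \<Rightarrow> (nat \<Rightarrow> nat) \<Rightarrow> nat \<Rightarrow> nat" where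
  "respond \<sigma> y k = \<sigma> (map y [0..<Suc k])"

definition lead :: "(nat list \<Rightarrow> nat) \<Rightarrow> (nat \<Rightarrow> nat) \<Rightarrow> nat \<Rightarrow> nat" where
  "lead \<tau> y k = \<tau> (map y [0..<k])"

text \<open>The maps that come from strategies are the Lipschitz maps.\<close>

lemma respond_exists:
  assumes "\<And>y y' k. (\<And>i. i \<le> k \<Longrightarrow> y i = y' i) \<Longrightarrow> F y k = F y' k"
  shows "\<exists>\<sigma>. \<forall>y. F y = respond \<sigma> y"
proof (intro exI allI ext)
  fix y k
  show "F y k = respond (\<lambda>l. F (extend l) (length l - 1)) y k"
    unfolding respond_def by (simp del: upt_Suc) (rule assms, simp del: upt_Suc)
qed

lemma lead_exists:
  assumes "\<And>y y' k. (\<And>i. i < k \<Longrightarrow> y i = y' i) \<Longrightarrow> F y k = F y' k"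
  shows "\<exists>\<tau>. \<forall>y. F y = lead \<tau> y"
proof (intro exI allI ext)
  fix y k
  show "F y k = lead (\<lambda>l. F (extend l) (length l)) y k"
    unfolding lead_def by simp (rule assms, simp)
qed

lemma respond_cong: "(\<And>i. i \<le> k \<Longrightarrow> y i = y' i) \<Longrightarrow> respond \<sigma> y k = respond \<sigma> y' k"
  unfolding respond_def by (rule arg_cong[of _ _ \<sigma>]) (simp del: upt_Suc)

text \<open>In the game in which player I builds \<open>y\<close> and player II builds \<open>z\<close>, a winning strategy of I maps
  every \<open>z\<close> to a \<open>y\<close> with \<open>Q y z\<close>, and a winning strategy of II maps every \<open>y\<close> to a \<open>z\<close> with
  \<open>\<not> Q y z\<close>.\<close>

lemma determined_moves:
  assumes "determined {x. Q (\<lambda>k. x (2 * k)) (\<lambda>k. x (Suc (2 * k)))}"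
  shows "(\<exists>\<tau>. \<forall>z. Q (lead \<tau> z) z) \<or> (\<exists>\<sigma>. \<forall>y. \<not> Q y (respond \<sigma> y))"
proof -
  from assms consider
    (I) \<sigma> where "\<And>x. follows_I \<sigma> x \<Longrightarrow> Q (\<lambda>k. x (2 * k)) (\<lambda>k. x (Suc (2 * k)))" |
    (II) \<sigma> where "\<And>x. follows_II \<sigma> x \<Longrightarrow> \<not> Q (\<lambda>k. x (2 * k)) (\<lambda>k. x (Suc (2 * k)))"
    unfolding determined_def wins_I_def wins_II_def by blast
  then show ?thesis
  proof cases
    case I
    have "\<exists>\<tau>. \<forall>y. (\<lambda>k. play_seq True \<sigma> y (2 * k)) = lead \<tau> y"
    proof (rule lead_exists)
      fix y y' :: "nat \<Rightarrow> nat" and k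
      assume "\<And>i. i < k \<Longrightarrow> y i = y' i"
      then have "play True \<sigma> y (2 * k) = play True \<sigma> y' (2 * k)"
        by (intro play_cong) auto
      then show "play_seq True \<sigma> y (2 * k) = play_seq True \<sigma> y' (2 * k)"
        by (simp add: play_seq_def)
    qed
    then obtain \<tau> where \<tau>: "\<And>y. (\<lambda>k. play_seq True \<sigma> y (2 * k)) = lead \<tau> y" by blast
    have "Q (lead \<tau> y) y" for y
    proof -
      have "follows_I \<sigma> (play_seq True \<sigma> y)"
        by (simp add: follows_I_def play_seq_def play_eq)
      from I[OF this] have "Q (lead \<tau> y) (\<lambda>k. play_seq True \<sigma> y (Suc (2 * k)))" by (simp add: \<tau>)
      moreover have "(\<lambda>k. play_seq True \<sigma> y (Suc (2 * k))) = y" by (simp add: play_seq_def)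
      ultimately show ?thesis by simp
    qed
    then show ?thesis by blast
  next
    case II
    have "\<exists>\<tau>. \<forall>y. (\<lambda>k. play_seq False \<sigma> y (Suc (2 * k))) = respond \<tau> y"
    proof (rule respond_exists)
      fix y y' :: "nat \<Rightarrow> nat" and k
      assume "\<And>i. i \<le> k \<Longrightarrow> y i = y' i"
      then have "play False \<sigma> y (Suc (2 * k)) = play False \<sigma> y' (Suc (2 * k))"
        by (intro play_cong) auto
      then show "play_seq False \<sigma> y (Suc (2 * k)) = play_seq False \<sigma> y' (Suc (2 * k))"
        by (simp add: play_seq_def)
    qed
    then obtain \<tau> where \<tau>: "\<And>y. (\<lambda>k. play_seq False \<sigma> y (Suc (2 * k))) = respond \<tau> y" by blast
    have "\<not> Q y (respond \<tau> y)" for y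
    proof -
      have "follows_II \<sigma> (play_seq False \<sigma> y)"
        by (simp add: follows_II_def play_seq_def play_eq)
      from II[OF this] have "\<not> Q (\<lambda>k. play_seq False \<sigma> y (2 * k)) (respond \<tau> y)" by (simp add: \<tau>)
      moreover have "(\<lambda>k. play_seq False \<sigma> y (2 * k)) = y" by (simp add: play_seq_def)
      ultimately show ?thesis by simp
    qed
    then show ?thesis by blast
  qed
qed

lemma enc_graph: "enc x = graph x" for x :: "nat \<Rightarrow> nat"
  by (auto simp: enc_fun_def enc_nat_def cde_nat_def graph_def)

text \<open>The parameter \<open>p\<close> becomes the set parameter of a boldface projective
  set.\<close>

lemma determined_Dfn:
  assumes "projective_determinacy" "Dfn (\<lambda>q. Q (fst q) (snd q))"
  shows "determined {x. Q p x}"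
proof -
  define U where "U = enc ` {q. Q (fst q) (snd q)}"
  have "definable U" using assms(2) by (simp add: Dfn_def U_def)
  have "definable_rel (\<lambda>e E. \<exists>m. (\<lambda>e E. (val e (V 0) = val e (Plus (V 1) (V 1)) \<and> val e (V 1) \<in> E 1) \<or>
      (val e (V 0) = val e (S (Plus (V 1) (V 1))) \<and> val e (V 1) \<in> E 0)) (e(1 := m)) E)"
    by (intro definable_rel_exN definable_rel_intros definable_rel_eq definable_rel_mem)
  then have "definable_rel (\<lambda>e E. e 0 \<in> join (E 1) (E 0))" by (simp add: join_def)
  from definable_rel_in[OF \<open>definable U\<close> this]
  have "definable_rel (\<lambda>e E. join (E 1) (E 0) \<in> U)" by simp
  then obtain \<phi> where \<phi>: "\<And>e E. sat UNIV e E \<phi> \<longleftrightarrow> join (E 1) (E 0) \<in> U"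
    unfolding definable_rel_def by blast
  obtain n where "Sigma_Pi_at n \<phi>" using eventually_Sigma_Pi_at by blast
  then obtain \<psi> where \<psi>: "\<psi> \<in> Proj" "equiv_fm \<psi> \<phi>" by (auto simp: Sigma_Pi_at_def Proj_def)
  have "join (enc p) (graph x) \<in> U \<longleftrightarrow> Q p x" for x
    by (auto simp: U_def enc_prod_def enc_graph[symmetric] image_iff)
  then have "{x. Q p x} = {x. sat UNIV (\<lambda>_. 0) ((\<lambda>_. enc p)(0 := graph x)) \<psi>}"
    using \<psi>(2) by (simp add: equiv_fm_def \<phi>)
  then have "projective {x. Q p x}" using \<psi>(1) unfolding projective_def by blast
  then show ?thesis using assms(1) by (simp add: projective_determinacy_def)
qed

section \<open>Definable semiscales\<close>

definition conv :: "(nat \<Rightarrow> nat \<Rightarrow> nat) \<Rightarrow> (nat \<Rightarrow> nat) \<Rightarrow> bool" where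
  "conv xs x \<longleftrightarrow> (\<forall>k. \<exists>N. \<forall>i\<ge>N. xs i k = x k)"

text \<open>A prewellordering, in a form that needs no ordinals. Least elements of pairs show that
  the relation is reflexive and total.\<close>

definition pwo :: "'a set \<Rightarrow> ('a \<Rightarrow> 'a \<Rightarrow> bool) \<Rightarrow> bool" where
  "pwo A r \<longleftrightarrow> (\<forall>x\<in>A. \<forall>y\<in>A. \<forall>z\<in>A. r x y \<longrightarrow> r y z \<longrightarrow> r x z) \<and>
    (\<forall>B. B \<subseteq> A \<longrightarrow> B \<noteq> {} \<longrightarrow> (\<exists>m\<in>B. \<forall>y\<in>B. r m y))"

definition stabilizes :: "(nat \<Rightarrow> 'a \<Rightarrow> 'a \<Rightarrow> bool) \<Rightarrow> (nat \<Rightarrow> 'a) \<Rightarrow> bool" where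
  "stabilizes le xs \<longleftrightarrow> (\<forall>n. \<exists>N. \<forall>i\<ge>N. \<forall>j\<ge>N. le n (xs i) (xs j))"

text \<open>The relations \<open>le n\<close> take the place of norms into the ordinals: norm
  \<open>n\<close> is eventually constant along \<open>xs\<close> iff the terms are eventually
  below each other with respect to \<open>le n\<close>.\<close>

definition semiscale :: "(nat \<Rightarrow> nat) set \<Rightarrow> (nat \<Rightarrow> (nat \<Rightarrow> nat) \<Rightarrow> (nat \<Rightarrow> nat) \<Rightarrow> bool) \<Rightarrow> bool" where
  "semiscale A le \<longleftrightarrow> (\<forall>n. pwo A (le n)) \<and>
    (\<forall>xs x. (\<forall>i. xs i \<in> A) \<longrightarrow> conv xs x \<longrightarrow> stabilizes le xs \<longrightarrow> x \<in> A)"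

text \<open>In a good semiscale the relations refine each other and \<open>le n\<close> decides
  the digit \<open>n\<close>. Then a sequence along which all relations stabilize converges by
  itself.\<close>

definition good_semiscale :: "(nat \<Rightarrow> nat) set \<Rightarrow> (nat \<Rightarrow> (nat \<Rightarrow> nat) \<Rightarrow> (nat \<Rightarrow> nat) \<Rightarrow> bool) \<Rightarrow> bool" where
  "good_semiscale A le \<longleftrightarrow> (\<forall>n. pwo A (le n)) \<and>
    (\<forall>m n x y. m \<le> n \<longrightarrow> le n x y \<longrightarrow> le m x y) \<and>
    (\<forall>n x y. le n x y \<longrightarrow> le n y x \<longrightarrow> x n = y n) \<and>
    (\<forall>xs. (\<forall>i. xs i \<in> A) \<longrightarrow> stabilizes le xs \<longrightarrow> (\<exists>x\<in>A. conv xs x))"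

definition Dfn_le_rel :: "(nat \<Rightarrow> (nat \<Rightarrow> nat) \<Rightarrow> (nat \<Rightarrow> nat) \<Rightarrow> bool) \<Rightarrow> bool" where
  "Dfn_le_rel le \<longleftrightarrow> Dfn (\<lambda>p. le (fst p) (fst (snd p)) (snd (snd p)))"

definition semiscaled :: "(nat \<Rightarrow> nat) set \<Rightarrow> bool" where
  "semiscaled A \<longleftrightarrow> Dfn (\<lambda>x. x \<in> A) \<and> (\<exists>le. Dfn_le_rel le \<and> semiscale A le)"

lemma Dfn_le_relD:
  "Dfn_le_rel le \<Longrightarrow> Dfun f \<Longrightarrow> Dfun g \<Longrightarrow> Dfun h \<Longrightarrow> Dfn (\<lambda>x. le (f x) (g x) (h x))"
  using Dfn_vimage[OF _ Dfun_Pair[OF _ Dfun_Pair], of "\<lambda>p. le (fst p) (fst (snd p)) (snd (snd p))" f g h]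
  by (simp add: Dfn_le_rel_def)

lemma conv_unique: "conv xs x \<Longrightarrow> conv xs y \<Longrightarrow> x = y"
proof
  fix k
  assume "conv xs x" "conv xs y"
  then obtain N M where N: "\<forall>i\<ge>N. xs i k = x k" and M: "\<forall>i\<ge>M. xs i k = y k"
    unfolding conv_def by blast
  show "x k = y k" using N[rule_format, of "max N M"] M[rule_format, of "max N M"] by simp
qed

lemma pwo_trans:
  assumes "pwo A r" "x \<in> A" "y \<in> A" "z \<in> A" "r x y" "r y z"
  shows "r x z"
  using assms(1)[unfolded pwo_def, THEN conjunct1, rule_format, OF assms(2-6)] .

lemma pwo_least:
  assumes "pwo A r" "B \<subseteq> A" "B \<noteq> {}"
  shows "\<exists>m\<in>B. \<forall>y\<in>B. r m y"
  using assms(1)[unfolded pwo_def, THEN conjunct2, rule_format, OF assms(2,3)] .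

lemma pwoI:
  assumes "\<And>x y z. x \<in> A \<Longrightarrow> y \<in> A \<Longrightarrow> z \<in> A \<Longrightarrow> r x y \<Longrightarrow> r y z \<Longrightarrow> r x z"
    and "\<And>B. B \<subseteq> A \<Longrightarrow> B \<noteq> {} \<Longrightarrow> \<exists>m\<in>B. \<forall>y\<in>B. r m y"
  shows "pwo A r"
  unfolding pwo_def
proof (intro conjI ballI allI impI)
  show "r x z" if "x \<in> A" "y \<in> A" "z \<in> A" "r x y" "r y z" for x y z
    using assms(1)[OF that] .
  show "\<exists>m\<in>B. \<forall>y\<in>B. r m y" if "B \<subseteq> A" "B \<noteq> {}" for B
    using assms(2)[OF that] .
qed

lemma pwo_subset:
  assumes "pwo A r" "B \<subseteq> A"
  shows "pwo B r"
proof (rule pwoI)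
  show "r x z" if "x \<in> B" "y \<in> B" "z \<in> B" "r x y" "r y z" for x y z
    by (rule pwo_trans[OF assms(1) _ _ _ that(4,5)]) (use assms(2) that in auto)
  show "\<exists>m\<in>C. \<forall>y\<in>C. r m y" if "C \<subseteq> B" "C \<noteq> {}" for C
    by (rule pwo_least[OF assms(1) order_trans[OF that(1) assms(2)] that(2)])
qed

lemma pwo_lex:
  assumes "pwo A r" "pwo A s"
  shows "pwo A (\<lambda>x y. r x y \<and> (r y x \<longrightarrow> s x y))"
proof (rule pwoI)
  note r = pwo_trans[OF assms(1)] and s = pwo_trans[OF assms(2)]
  fix x y z
  assume A: "x \<in> A" "y \<in> A" "z \<in> A" and *: "r x y \<and> (r y x \<longrightarrow> s x y)" "r y z \<and> (r z y \<longrightarrow> s y z)"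
  have "s x z" if "r z x"
  proof -
    have "r y x" "r z y" using r[of y z x] r[of z x y] A * that by simp_all
    then show ?thesis using s[OF A] * by simp
  qed
  then show "r x z \<and> (r z x \<longrightarrow> s x z)" using r[OF A] * by simp
next
  note r = pwo_trans[OF assms(1)]
  fix B assume B: "B \<subseteq> A" "B \<noteq> {}"
  obtain m where m: "m \<in> B" "\<And>y. y \<in> B \<Longrightarrow> r m y" using pwo_least[OF assms(1) B] by blast
  have "{y \<in> B. r y m} \<subseteq> A" "{y \<in> B. r y m} \<noteq> {}" using B m by auto
  from pwo_least[OF assms(2) this] obtain l where
    l: "l \<in> B" "r l m" "\<And>y. y \<in> B \<Longrightarrow> r y m \<Longrightarrow> s l y" by auto
  show "\<exists>m\<in>B. \<forall>y\<in>B. r m y \<and> (r y m \<longrightarrow> s m y)"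
  proof (intro bexI[OF _ l(1)] ballI conjI impI)
    fix y assume y: "y \<in> B"
    then have A: "l \<in> A" "m \<in> A" "y \<in> A" using B l(1) m(1) by auto
    show "r l y" using r[OF A l(2) m(2)[OF y]] .
    assume "r y l"
    then show "s l y" using r[OF A(3,1,2) _ l(2)] l(3)[OF y] by simp
  qed
qed

text \<open>A weakly descending sequence in a prewellordering is eventually constant up to
  equivalence.\<close>

lemma pwo_descending:
  assumes "pwo A r" "\<And>i. i \<ge> n \<Longrightarrow> p i \<in> A" "\<And>i. i \<ge> n \<Longrightarrow> r (p (Suc i)) (p i)"
  shows "\<exists>N. \<forall>i\<ge>N. \<forall>j\<ge>N. r (p i) (p j)"
proof -
  note tr = pwo_trans[OF assms(1)]
  have "p ` {n..} \<subseteq> A" "p ` {n..} \<noteq> {}" using assms(2) by auto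
  from pwo_least[OF assms(1) this] obtain N where N: "N \<ge> n" "\<And>i. i \<ge> n \<Longrightarrow> r (p N) (p i)" by auto
  have *: "r (p i) (p N)" if "i \<ge> N" for i
    using that
  proof (induction rule: dec_induct)
    case base
    show ?case using N by simp
  next
    case (step i)
    then have "i \<ge> n" using N(1) by simp
    then show ?case using tr[of "p (Suc i)" "p i" "p N"] assms(2,3) N(1) step.IH by simp
  qed
  have "r (p i) (p j)" if "i \<ge> N" "j \<ge> N" for i j
  proof (rule tr[of _ "p N"])
    show "p i \<in> A" "p j \<in> A" "p N \<in> A" using assms(2) that N(1) by simp_all
    show "r (p i) (p N)" "r (p N) (p j)" using * N that by simp_all
  qed
  then show ?thesis by blast
qed

lemma semiscaleD:
  assumes "semiscale A le"
  shows "pwo A (le n)"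
    "(\<And>i. xs i \<in> A) \<Longrightarrow> conv xs x \<Longrightarrow> stabilizes le xs \<Longrightarrow> x \<in> A"
  by (rule assms[unfolded semiscale_def, THEN conjunct1, rule_format])
    (rule assms[unfolded semiscale_def, THEN conjunct2, rule_format])

lemma semiscaleI:
  assumes "\<And>n. pwo A (le n)"
    and "\<And>xs x. (\<And>i. xs i \<in> A) \<Longrightarrow> conv xs x \<Longrightarrow> stabilizes le xs \<Longrightarrow> x \<in> A"
  shows "semiscale A le"
  unfolding semiscale_def
proof (intro conjI allI impI)
  show "pwo A (le n)" for n by (rule assms(1))
  show "x \<in> A" if "\<forall>i. xs i \<in> A" "conv xs x" "stabilizes le xs" for xs x
    by (rule assms(2)[OF _ that(2,3)]) (use that(1) in blast)
qed

lemma good_semiscaleD: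
  assumes "good_semiscale A le"
  shows "pwo A (le n)" "m \<le> n \<Longrightarrow> le n x y \<Longrightarrow> le m x y"
    "le n x y \<Longrightarrow> le n y x \<Longrightarrow> x n = y n"
    "(\<And>i. xs i \<in> A) \<Longrightarrow> stabilizes le xs \<Longrightarrow> \<exists>x\<in>A. conv xs x"
  using assms by (simp_all add: good_semiscale_def)

text \<open>The lexicographic order of \<open>le 0 x\<close>, \<open>x 0\<close>, \<open>le 1
  x\<close>, \<open>x 1\<close>, and so on, cut off at stage \<open>n\<close>.\<close>

lemma good_semiscale_exists:
  assumes "semiscale A le" "Dfn_le_rel le"
  obtains le' where "good_semiscale A le'" "Dfn_le_rel le'"
proof -
  define s where "s = (\<lambda>n x y. le n x y \<and> (le n y x \<longrightarrow> x n \<le> (y n :: nat)))"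
  \<comment> \<open>At the first stage up to \<open>n\<close> that distinguishes the two points, if there is one,
    \<open>x\<close> is below.\<close>
  define le' where "le' = (\<lambda>n x y. \<forall>m\<le>n. (\<forall>k<m. s k y x) \<longrightarrow> s m x y)"
  have both: "s k x y \<and> s k y x" if "le' n x y" "le' n y x" "k \<le> n" for n k x y
    using that(3)
  proof (induction k rule: less_induct)
    case (less k)
    then have l: "\<forall>l<k. s l x y" "\<forall>l<k. s l y x" by simp_all
    show ?case
      using that(1)[unfolded le'_def, THEN spec, THEN mp, OF less.prems, THEN mp, OF l(2)]
        that(2)[unfolded le'_def, THEN spec, THEN mp, OF less.prems, THEN mp, OF l(1)] by blast
  qed
  have le'_Suc: "le' (Suc n) x y \<longleftrightarrow> le' n x y \<and> (le' n y x \<longrightarrow> s (Suc n) x y)" for n x y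
  proof
    assume L: "le' (Suc n) x y"
    then have "le' n x y" by (simp add: le'_def)
    moreover have "s (Suc n) x y" if "le' n y x"
      using L both[OF \<open>le' n x y\<close> that] unfolding le'_def by (simp add: less_Suc_eq_le)
    ultimately show "le' n x y \<and> (le' n y x \<longrightarrow> s (Suc n) x y)" by blast
  next
    assume R: "le' n x y \<and> (le' n y x \<longrightarrow> s (Suc n) x y)"
    have "s m x y" if "m \<le> Suc n" "\<forall>k<m. s k y x" for m
    proof (cases "m = Suc n")
      case True
      then have "le' n y x" using that(2) by (simp add: le'_def)
      then show ?thesis using R True by simp
    next
      case False
      then show ?thesis using that R by (simp add: le'_def)
    qed
    then show "le' (Suc n) x y" by (simp add: le'_def)
  qed
  have s: "pwo A (s n)" for n
  proof -
    have "pwo A (\<lambda>x y. x n \<le> y n)"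
    proof (rule pwoI)
      fix B :: "(nat \<Rightarrow> nat) set" assume "B \<noteq> {}"
      then obtain b where "b \<in> B" by blast
      from ex_has_least_nat[of "\<lambda>x. x \<in> B" b "\<lambda>x. x n", OF this]
      show "\<exists>m\<in>B. \<forall>y\<in>B. m n \<le> y n" by blast
    qed simp
    then show ?thesis unfolding s_def using assms(1) by (intro pwo_lex) (auto simp: semiscale_def)
  qed
  have pwo: "pwo A (le' n)" for n
  proof (induction n)
    case 0
    have "le' 0 = s 0" by (simp add: le'_def fun_eq_iff)
    then show ?case using s by simp
  next
    case (Suc n)
    have "le' (Suc n) = (\<lambda>x y. le' n x y \<and> (le' n y x \<longrightarrow> s (Suc n) x y))" using le'_Suc by blast
    then show ?case using pwo_lex[OF Suc.IH s] by simp
  qed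
  have "\<exists>x\<in>A. conv xs x" if xs: "\<And>i. xs i \<in> A" "stabilizes le' xs" for xs
  proof -
    from xs(2) obtain N where N: "\<And>n i j. i \<ge> N n \<Longrightarrow> j \<ge> N n \<Longrightarrow> le' n (xs i) (xs j)"
      unfolding stabilizes_def by metis
    have s: "s n (xs i) (xs j)" if "i \<ge> N n" "j \<ge> N n" for n i j
      using both[OF N[OF that] N[OF that(2,1)]] by blast
    then have le: "le n (xs i) (xs j)" if "i \<ge> N n" "j \<ge> N n" for n i j
      using that unfolding s_def by blast
    then have "stabilizes le xs" unfolding stabilizes_def by blast
    have "xs i n = xs (N n) n" if "i \<ge> N n" for n i
      using s[OF that order_refl] s[OF order_refl that] le[OF that order_refl] le[OF order_refl that]
      unfolding s_def by simp
    then have "conv xs (\<lambda>n. xs (N n) n)" unfolding conv_def by blast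
    from semiscaleD(2)[OF assms(1) xs(1) this \<open>stabilizes le xs\<close>] this show ?thesis by blast
  qed
  moreover have "x n = y n" if "le' n x y" "le' n y x" for n x y
    using both[OF that order_refl] unfolding s_def by (meson order_antisym)
  moreover have "le' m x y" if "m \<le> n" "le' n x y" for m n x y
    using that by (simp add: le'_def)
  ultimately have "good_semiscale A le'" using pwo unfolding good_semiscale_def by blast
  moreover have "Dfn_le_rel le'"
    unfolding Dfn_le_rel_def le'_def s_def by (intro dfn Dfn_le_relD[OF assms(2)])
  ultimately show thesis by (rule that)
qed

text \<open>For a closed set the trivial prewellordering suffices.\<close>

lemma semiscaled_closed:
  assumes "Dfn (\<lambda>x. x \<in> A)" "\<And>xs x. (\<And>i. xs i \<in> A) \<Longrightarrow> conv xs x \<Longrightarrow> x \<in> A"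
  shows "semiscaled A"
  unfolding semiscaled_def
proof (intro conjI exI)
  show "Dfn_le_rel (\<lambda>_ _ _. True)" unfolding Dfn_le_rel_def by (intro dfn)
  show "semiscale A (\<lambda>_ _ _. True)"
    by (rule semiscaleI, rule pwoI) (blast, blast, rule assms(2))
qed (rule assms)

text \<open>The lexicographic product of the two prewellorderings stabilizes only if both
  components do.\<close>

lemma semiscaled_Int:
  assumes "semiscaled A" "semiscaled B"
  shows "semiscaled (A \<inter> B)"
proof -
  obtain r s where r: "Dfn_le_rel r" "semiscale A r" and s: "Dfn_le_rel s" "semiscale B s"
    using assms unfolding semiscaled_def by blast
  define le where "le = (\<lambda>n x y. r n x y \<and> (r n y x \<longrightarrow> s n x y))"
  have "semiscale (A \<inter> B) le"
  proof (rule semiscaleI)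
    fix n
    have "pwo (A \<inter> B) (r n)" "pwo (A \<inter> B) (s n)"
      using pwo_subset[OF semiscaleD(1)[OF r(2)] inf_le1] pwo_subset[OF semiscaleD(1)[OF s(2)] inf_le2] .
    then show "pwo (A \<inter> B) (le n)" unfolding le_def by (rule pwo_lex)
  next
    fix xs x assume xs: "\<And>i. xs i \<in> A \<inter> B" "conv xs x" "stabilizes le xs"
    have "\<exists>N. \<forall>i\<ge>N. \<forall>j\<ge>N. r n (xs i) (xs j) \<and> s n (xs i) (xs j)" for n
    proof -
      obtain N where "\<And>i j. i \<ge> N \<Longrightarrow> j \<ge> N \<Longrightarrow> le n (xs i) (xs j)"
        using xs(3) unfolding stabilizes_def by blast
      then show ?thesis unfolding le_def by (intro exI[of _ N]) simp
    qed
    then have "stabilizes r xs" "stabilizes s xs" unfolding stabilizes_def by metis+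
    then show "x \<in> A \<inter> B" using semiscaleD(2)[OF r(2) _ xs(2)] semiscaleD(2)[OF s(2) _ xs(2)] xs(1) by simp
  qed
  moreover have "Dfn_le_rel le"
    unfolding Dfn_le_rel_def le_def by (intro dfn Dfn_le_relD[OF r(1)] Dfn_le_relD[OF s(1)])
  moreover have "Dfn (\<lambda>x. x \<in> A \<inter> B)"
    using assms by (simp add: semiscaled_def Dfn_conj)
  ultimately show ?thesis unfolding semiscaled_def by blast
qed

text \<open>The elements of \<open>A\<close> come first. Hence a sequence along which the
  relations stabilize is eventually contained in \<open>A\<close> or eventually disjoint from
  it.\<close>

lemma semiscaled_Un:
  assumes "semiscaled A" "semiscaled B"
  shows "semiscaled (A \<union> B)"
proof -
  obtain r s where r: "Dfn_le_rel r" "semiscale A r" and s: "Dfn_le_rel s" "semiscale B s"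
    using assms unfolding semiscaled_def by blast
  have A: "Dfn (\<lambda>x. x \<in> A)" and B: "Dfn (\<lambda>x. x \<in> B)" using assms by (auto simp: semiscaled_def)
  have rp: "pwo A (r n)" and sp: "pwo B (s n)" for n using r(2) s(2) by (auto simp: semiscale_def)
  define le where "le = (\<lambda>n x y. (x \<in> A \<longrightarrow> y \<in> A \<longrightarrow> r n x y) \<and> (x \<notin> A \<longrightarrow> y \<notin> A \<and> s n x y))"
  have "semiscale (A \<union> B) le"
  proof (rule semiscaleI)
    fix n
    note rt = pwo_trans[OF rp] and st = pwo_trans[OF sp]
    have "\<exists>m\<in>C. \<forall>y\<in>C. le n m y" if C: "C \<subseteq> A \<union> B" "C \<noteq> {}" for C
    proof (cases "C \<inter> A = {}")
      case True
      then have "C \<subseteq> B" using C by blast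
      from pwo_least[OF sp this C(2)] obtain m where "m \<in> C" "\<And>y. y \<in> C \<Longrightarrow> s n m y" by blast
      then show ?thesis using True unfolding le_def by blast
    next
      case False
      from pwo_least[OF rp inf_le2 this] obtain m where
        "m \<in> C \<inter> A" "\<And>y. y \<in> C \<inter> A \<Longrightarrow> r n m y" by blast
      then show ?thesis unfolding le_def by blast
    qed
    moreover have "le n x z" if "x \<in> A \<union> B" "y \<in> A \<union> B" "z \<in> A \<union> B" "le n x y" "le n y z" for x y z
      using that rt[of x y z n] st[of x y z n] unfolding le_def by blast
    ultimately show "pwo (A \<union> B) (le n)" by (intro pwoI) assumption+
  next
    fix xs x assume xs: "\<And>i. xs i \<in> A \<union> B" "conv xs x" "stabilizes le xs"
    from xs(3) obtain N where N: "\<And>n i j. i \<ge> N n \<Longrightarrow> j \<ge> N n \<Longrightarrow> le n (xs i) (xs j)"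
      unfolding stabilizes_def by metis
    define K where "K = N 0"
    have K: "xs i \<in> A \<longleftrightarrow> xs j \<in> A" if "i \<ge> K" "j \<ge> K" for i j
      using N[of 0 i j] N[of 0 j i] that unfolding le_def K_def by blast
    define ys where "ys = (\<lambda>i. xs (i + K))"
    have conv: "conv ys x"
      using xs(2) unfolding conv_def ys_def by (meson le_add1 order_trans)
    have st: "le n (ys i) (ys j)" if "i \<ge> N n" "j \<ge> N n" for n i j
      using N[of n "i + K" "j + K"] that by (simp add: ys_def)
    show "x \<in> A \<union> B"
    proof (cases "xs K \<in> A")
      case True
      then have *: "ys i \<in> A" for i using K[of "i + K" K] by (simp add: ys_def)
      have "r n (ys i) (ys j)" if "i \<ge> N n" "j \<ge> N n" for n i j
        using st[OF that] * unfolding le_def by simp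
      then have "stabilizes r ys" unfolding stabilizes_def by blast
      from semiscaleD(2)[OF r(2) * conv this] show ?thesis by simp
    next
      case False
      then have *: "ys i \<notin> A" for i using K[of "i + K" K] by (simp add: ys_def)
      then have B: "ys i \<in> B" for i using xs(1) unfolding ys_def by blast
      have "s n (ys i) (ys j)" if "i \<ge> N n" "j \<ge> N n" for n i j
        using st[OF that] * unfolding le_def by simp
      then have "stabilizes s ys" unfolding stabilizes_def by blast
      from semiscaleD(2)[OF s(2) B conv this] show ?thesis by simp
    qed
  qed
  moreover have "Dfn_le_rel le"
    unfolding Dfn_le_rel_def le_def
    by (intro dfn Dfn_le_relD[OF r(1)] Dfn_le_relD[OF s(1)] Dfn_vimage[OF A])
  moreover have "Dfn (\<lambda>x. x \<in> A \<union> B)" using Dfn_disj[OF A B] by simp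
  ultimately show ?thesis unfolding semiscaled_def by blast
qed

text \<open>The digits of \<open>w\<close> in \<open>D\<close> are overwritten by those of
  \<open>y\<close>, read at the positions \<open>g\<close>. If \<open>D\<close> is the set of the
  digits that code the value of a variable, then quantification over \<open>y\<close> is
  quantification over this variable.\<close>

definition merge :: "(nat \<Rightarrow> bool) \<Rightarrow> (nat \<Rightarrow> nat) \<Rightarrow> (nat \<Rightarrow> nat) \<Rightarrow> (nat \<Rightarrow> nat) \<Rightarrow> nat \<Rightarrow> nat" where
  "merge D g w y = (\<lambda>k. if D k then y (g k) else w k)"

lemma Dfun_merge:
  assumes "Dfn D" "Dfun g" "Dfun u" "Dfun v"
  shows "Dfun (\<lambda>x. merge D g (u x) (v x))"
proof -
  have "Dfun (\<lambda>p :: (nat \<Rightarrow> nat) \<times> (nat \<Rightarrow> nat). merge D g (fst p) (snd p))"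
    unfolding merge_def
    by (rule Dfun_lambda) (intro dfn Dfn_vimage[OF assms(1)] Dfun_comp[OF assms(2)])
  from Dfun_comp[OF this Dfun_Pair[OF assms(3,4)]] show ?thesis by simp
qed

lemma conv_merge:
  assumes "conv ws w" "conv ys y"
  shows "conv (\<lambda>i. merge D g (ws i) (ys i)) (merge D g w y)"
  using assms unfolding conv_def merge_def by (auto split: if_splits)

lemma conv_merge_limit:
  assumes "conv ws w" "conv (\<lambda>i. merge D g (ws i) (ys i)) z" "inj_on g (Collect D)"
  shows "\<exists>y. z = merge D g w y"
proof (intro exI ext)
  fix k
  show "z k = merge D g w (\<lambda>m. z (inv_into (Collect D) g m)) k"
  proof (cases "D k")
    case True
    then show ?thesis using assms(3) by (simp add: merge_def)
  next
    case False
    obtain N M where N: "\<forall>i\<ge>N. ws i k = w k" and M: "\<forall>i\<ge>M. merge D g (ws i) (ys i) k = z k"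
      using assms(1,2) unfolding conv_def by blast
    have "z k = w k"
      using N[rule_format, of "max N M"] M[rule_format, of "max N M"] False by (simp add: merge_def)
    then show ?thesis using False by (simp add: merge_def)
  qed
qed

text \<open>Points are compared through their least witnesses. If these relations stabilize along
  a sequence, one thins it out so that stage \<open>n\<close> is stable from the term
  \<open>n\<close> on and chooses for that term a witness that is least at stage \<open>n\<close>.
  As the relations refine each other, the chosen witnesses stabilize too, so they
  converge.\<close>

lemma semiscaled_ex:
  assumes "semiscaled A" "Dfn D" "Dfun g" "inj_on g (Collect D)"
  shows "semiscaled {w. \<exists>y. merge D g w y \<in> A}"
proof -
  obtain r where r: "good_semiscale A r" "Dfn_le_rel r"
    using assms(1) good_semiscale_exists unfolding semiscaled_def by metis
  have A: "Dfn (\<lambda>x. x \<in> A)" using assms(1) by (simp add: semiscaled_def)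
  let ?f = "merge D g"
  let ?B = "{w. \<exists>y. ?f w y \<in> A}"
  note tr = pwo_trans[OF good_semiscaleD(1)[OF r(1)]]
    and least = good_semiscaleD(1)[OF r(1), unfolded pwo_def, THEN conjunct2, rule_format]
    and refine = good_semiscaleD(2)[OF r(1)] and lim = good_semiscaleD(4)[OF r(1)]
  define le where "le = (\<lambda>n w w'. \<forall>y'. ?f w' y' \<in> A \<longrightarrow> (\<exists>y. ?f w y \<in> A \<and> r n (?f w y) (?f w' y')))"
  have "semiscale ?B le"
  proof (rule semiscaleI)
    fix n
    have "le n x z" if le: "le n x y" "le n y z" for x y z
      unfolding le_def
    proof (intro allI impI)
      fix c assume c: "?f z c \<in> A"
      then obtain b where b: "?f y b \<in> A" "r n (?f y b) (?f z c)" using le(2) unfolding le_def by blast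
      then obtain a where a: "?f x a \<in> A" "r n (?f x a) (?f y b)" using le(1) unfolding le_def by blast
      show "\<exists>a. ?f x a \<in> A \<and> r n (?f x a) (?f z c)" using tr[OF a(1) b(1) c a(2) b(2)] a(1) by blast
    qed
    moreover have "\<exists>m\<in>C. \<forall>y\<in>C. le n m y" if C: "C \<subseteq> ?B" "C \<noteq> {}" for C
    proof -
      have "{?f w y | w y. w \<in> C \<and> ?f w y \<in> A} \<subseteq> A" "{?f w y | w y. w \<in> C \<and> ?f w y \<in> A} \<noteq> {}"
        using C by blast+
      from least[OF this] show ?thesis unfolding le_def by blast
    qed
    ultimately show "pwo ?B (le n)" by (intro pwoI) assumption+
  next
    fix xs x assume xs: "\<And>i. xs i \<in> ?B" "conv xs x" "stabilizes le xs"
    from xs(3) obtain N where N: "\<And>n i j. i \<ge> N n \<Longrightarrow> j \<ge> N n \<Longrightarrow> le n (xs i) (xs j)"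
      unfolding stabilizes_def by metis
    \<comment> \<open>Term \<open>h n\<close> lies beyond the points where the stages up to
      \<open>n\<close> become stable.\<close>
    define h where "h = (\<lambda>n. n + (\<Sum>m\<le>n. N m))"
    have h: "h n \<ge> N m" if "m \<le> n" for m n
      using that member_le_sum[of m "{..n}" N] by (simp add: h_def)
    define zs where "zs = (\<lambda>n. xs (h n))"
    have "\<exists>y. ?f (zs n) y \<in> A \<and> (\<forall>y'. ?f (zs n) y' \<in> A \<longrightarrow> r n (?f (zs n) y) (?f (zs n) y'))" for n
    proof -
      have "{?f (zs n) y | y. ?f (zs n) y \<in> A} \<subseteq> A" "{?f (zs n) y | y. ?f (zs n) y \<in> A} \<noteq> {}"
        using xs(1) by (auto simp: zs_def)
      from least[OF this, of n] show ?thesis by blast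
    qed
    then obtain ys where ys: "\<And>n. ?f (zs n) (ys n) \<in> A"
      "\<And>n y. ?f (zs n) y \<in> A \<Longrightarrow> r n (?f (zs n) (ys n)) (?f (zs n) y)" by metis
    have "r k (?f (zs i) (ys i)) (?f (zs j) (ys j))" if "i \<ge> k" "j \<ge> k" for i j k
    proof -
      have "le k (zs i) (zs j)" unfolding zs_def using N h that by blast
      then obtain y where y: "?f (zs i) y \<in> A" "r k (?f (zs i) y) (?f (zs j) (ys j))"
        using ys(1)[of j] unfolding le_def by blast
      have "r k (?f (zs i) (ys i)) (?f (zs i) y)" using refine[OF that(1) ys(2)[OF y(1)]] .
      then show ?thesis using tr[OF ys(1) y(1) ys(1)] y(2) by blast
    qed
    then have "stabilizes r (\<lambda>i. ?f (zs i) (ys i))" unfolding stabilizes_def by blast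
    from lim[OF ys(1) this] obtain z where z: "z \<in> A" "conv (\<lambda>i. ?f (zs i) (ys i)) z" by blast
    have "conv zs x" unfolding conv_def
    proof
      fix k
      obtain M where "\<forall>i\<ge>M. xs i k = x k" using xs(2) unfolding conv_def by blast
      moreover have "h i \<ge> i" for i by (simp add: h_def)
      ultimately show "\<exists>N. \<forall>i\<ge>N. zs i k = x k" unfolding zs_def by (meson order_trans)
    qed
    from conv_merge_limit[OF this z(2) assms(4)] show "x \<in> ?B" using z(1) by blast
  qed
  moreover have "Dfn_le_rel le"
    unfolding Dfn_le_rel_def le_def
    by (intro dfn Dfn_le_relD[OF r(2)] Dfn_vimage[OF A] Dfun_merge[OF assms(2,3)])
  moreover have "Dfn (\<lambda>w. w \<in> ?B)"
    unfolding mem_Collect_eq by (intro dfn Dfn_vimage[OF A] Dfun_merge[OF assms(2,3)])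
  ultimately show ?thesis unfolding semiscaled_def by blast
qed

lemma Dpt_length: "Dpt (length :: 'b :: cnt list \<Rightarrow> nat)"
proof (rule Dpt_unique)
  show "Dfn (\<lambda>g :: 'b list \<Rightarrow> nat. g [] = 0 \<and> (\<forall>x xs. g (x # xs) = Suc (g xs)))"
    by (intro dfn)
  show "y = length" if "y [] = 0 \<and> (\<forall>x xs. y (x # xs) = Suc (y xs))" for y :: "'b list \<Rightarrow> nat"
  proof
    show "y xs = length xs" for xs using that by (induction xs) auto
  qed
qed simp

lemmas Dfun_length = Dpt_apply[OF Dpt_length]

lemma Dpt_extend: "Dpt extend"
proof (rule Dpt_unique)
  let ?P = "\<lambda>g :: nat list \<Rightarrow> nat \<Rightarrow> nat. (\<forall>i. g [] i = 0) \<and>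
    (\<forall>x xs. g (x # xs) 0 = x \<and> (\<forall>i. g (x # xs) (Suc i) = g xs i))"
  show "Dfn ?P" by (intro dfn)
  show "?P extend" by (simp add: extend_def)
  show "y = extend" if y: "?P y" for y
  proof (rule ext, rule ext)
    show "y xs i = extend xs i" for xs i
    proof (induction xs arbitrary: i)
      case (Cons x xs)
      show ?case using y Cons.IH by (cases i) (auto simp: extend_def)
    qed (use y in \<open>simp add: extend_def\<close>)
  qed
qed

lemmas Dfun_extend = Dpt_apply2[OF Dpt_extend]

lemma Dfun_map_upt:
  assumes "Dfun f" "Dfun g"
  shows "Dfun (\<lambda>x. map (f x :: nat \<Rightarrow> nat) [0..<g x])"
proof -
  have "Dfn (\<lambda>p :: ((nat \<Rightarrow> nat) \<times> nat) \<times> nat list. length (snd p) = snd (fst p) \<and>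
      (\<forall>i. i < snd (fst p) \<longrightarrow> extend (snd p) i = fst (fst p) i))"
    by (intro dfn Dfun_length Dfun_extend)
  moreover have "(length l = k \<and> (\<forall>i. i < k \<longrightarrow> extend l i = y i)) \<longleftrightarrow> l = map y [0..<k]" for l k y
    by (auto simp: extend_def intro!: nth_equalityI)
  ultimately have "Dfun (\<lambda>p :: (nat \<Rightarrow> nat) \<times> nat. map (fst p) [0..<snd p])" by (simp add: Dfun_def)
  from Dfun_comp[OF this Dfun_Pair[OF assms]] show ?thesis by simp
qed

lemma Dfun_respond:
  assumes "Dfun f" "Dfun g"
  shows "Dfun (\<lambda>x. respond (f x) (g x))"
proof -
  have "Dfun (\<lambda>p :: (nat list \<Rightarrow> nat) \<times> (nat \<Rightarrow> nat). respond (fst p) (snd p))"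
    unfolding respond_def by (rule Dfun_lambda) (intro dfn Dfun_map_upt)
  from Dfun_comp[OF this Dfun_Pair[OF assms]] show ?thesis by simp
qed

definition prepend :: "nat list \<Rightarrow> (nat \<Rightarrow> nat) \<Rightarrow> nat \<Rightarrow> nat" where
  "prepend s y k = (if k < length s then s ! k else y (k - length s))"

lemma Dfun_prepend:
  assumes "Dfun f" "Dfun g"
  shows "Dfun (\<lambda>x. prepend (f x) (g x))"
proof -
  have "Dfn (\<lambda>p :: (nat list \<times> (nat \<Rightarrow> nat)) \<times> (nat \<Rightarrow> nat).
      (\<forall>k. k < length (fst (fst p)) \<longrightarrow> snd p k = extend (fst (fst p)) k) \<and>
      (\<forall>k. snd p (length (fst (fst p)) + k) = snd (fst p) k))"
    by (intro dfn Dfun_length Dfun_extend)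
  moreover have "(\<forall>k. k < length s \<longrightarrow> z k = extend s k) \<and> (\<forall>k. z (length s + k) = y k) \<longleftrightarrow> z = prepend s y"
    for s y z
  proof
    assume *: "(\<forall>k. k < length s \<longrightarrow> z k = extend s k) \<and> (\<forall>k. z (length s + k) = y k)"
    show "z = prepend s y"
    proof
      fix k
      show "z k = prepend s y k"
      proof (cases "k < length s")
        case False
        then have "z (length s + (k - length s)) = y (k - length s)" using * by blast
        then show ?thesis using False by (simp add: prepend_def)
      qed (use * in \<open>simp add: prepend_def extend_def\<close>)
    qed
  qed (simp add: prepend_def extend_def)
  ultimately have "Dfun (\<lambda>p :: nat list \<times> (nat \<Rightarrow> nat). prepend (fst p) (snd p))"
    by (simp add: Dfun_def)
  from Dfun_comp[OF this Dfun_Pair[OF assms]] show ?thesis by simp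
qed

text \<open>Infinitely many boards are played at the same time: on board \<open>i\<close> player I
  follows \<open>\<tau> i\<close> against the moves that are made on board \<open>i + 1\<close>.
  Since player I moves first, the digit \<open>k\<close> of board \<open>i\<close> depends on the
  digits below \<open>k\<close> of board \<open>i + 1\<close> only, and the recursion is
  well-founded.\<close>

lemma chain_of_leads: "\<exists>ys. \<forall>i :: nat. ys i = lead (\<tau> i) (ys (Suc i))"
proof -
  define L where "L = rec_nat (\<lambda>i. []) (\<lambda>k l i. l i @ [\<tau> i (l (Suc i))])"
  have L: "L 0 i = []" "L (Suc k) i = L k i @ [\<tau> i (L k (Suc i))]" for i k
    by (simp_all add: L_def)
  define ys where "ys = (\<lambda>i k. \<tau> i (L k (Suc i)))"
  have map: "L k i = map (ys i) [0..<k]" for i k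
    by (induction k) (simp_all add: L ys_def)
  have "ys i k = lead (\<tau> i) (ys (Suc i)) k" for i k
  proof -
    have "ys i k = \<tau> i (L k (Suc i))" by (simp only: ys_def)
    then show ?thesis by (simp only: lead_def map)
  qed
  then show ?thesis by blast
qed

text \<open>On board \<open>n\<close> the first \<open>n\<close> digits are those of
  \<open>y\<close>, and the other digits are the answers of the strategy \<open>\<sigma> n\<close>
  to board \<open>n + 1\<close>. Digit \<open>k\<close> of board \<open>n\<close> depends on the
  digits up to \<open>k\<close> of board \<open>n + 1\<close>, which are given once
  \<open>n\<close> exceeds \<open>k\<close>.\<close>

function limit_moves :: "(nat \<Rightarrow> nat list \<Rightarrow> nat) \<Rightarrow> (nat \<Rightarrow> nat) \<Rightarrow> nat \<Rightarrow> nat \<Rightarrow> nat" where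
  "limit_moves \<sigma> y n k = (if k < n then y k else \<sigma> n (map (\<lambda>j. limit_moves \<sigma> y (Suc n) j) [n..<Suc k]))"
  by auto
termination
  by (relation "measure (\<lambda>(\<sigma>, y, n, k). Suc k - n)") auto

declare limit_moves.simps [simp del]

lemma limit_moves_eq:
  "limit_moves \<sigma> y n = prepend (map y [0..<n]) (respond (\<sigma> n) (\<lambda>j. limit_moves \<sigma> y (Suc n) (n + j)))"
proof
  fix k
  show "limit_moves \<sigma> y n k =
    prepend (map y [0..<n]) (respond (\<sigma> n) (\<lambda>j. limit_moves \<sigma> y (Suc n) (n + j))) k"
  proof (cases "k < n")
    case True
    then show ?thesis by (subst limit_moves.simps) (simp add: prepend_def)
  next
    case False
    have "map (\<lambda>j. limit_moves \<sigma> y (Suc n) (n + j)) [0..<Suc (k - n)] =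
        map (limit_moves \<sigma> y (Suc n)) [n..<Suc k]"
      by (rule nth_equalityI) (use False in \<open>auto simp del: upt_Suc\<close>)
    then show ?thesis using False
      by (subst limit_moves.simps) (simp add: prepend_def respond_def del: upt_Suc)
  qed
qed

lemma limit_moves_prepend:
  "limit_moves \<sigma> y (Suc n) = prepend (map y [0..<n]) (\<lambda>j. limit_moves \<sigma> y (Suc n) (n + j))"
proof
  fix k
  show "limit_moves \<sigma> y (Suc n) k =
    prepend (map y [0..<n]) (\<lambda>j. limit_moves \<sigma> y (Suc n) (n + j)) k"
  proof (cases "k < n")
    case True
    then show ?thesis by (subst limit_moves.simps) (simp add: prepend_def)
  qed (simp add: prepend_def)
qed

text \<open>The relation with index \<open>s\<close>, a finite list of digits, compares
  \<open>x\<close> and \<open>x'\<close> by a game. Both players continue \<open>s\<close>, player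
  I to a point \<open>u\<close> and player II to a point \<open>u'\<close>, and player II wins if
  \<open>merge D g x u\<close> is below \<open>merge D g x' u'\<close> at the stage given by the
  length of \<open>s\<close>. The relation holds if player II has a winning strategy.

  It is transitive because strategies compose. If a nonempty set of points had no least element,
  determinacy would give winning strategies of player I against a sequence of its points, and
  playing all of them against each other would produce a subset of \<open>A\<close> without least
  element. If the relations stabilize along a sequence that converges to \<open>x\<close>, then
  winning strategies of player II connect successive terms of a subsequence. For given
  \<open>y\<close>, played against each other they produce continuations of the initial segments
  of \<open>y\<close> such that the merged points descend at every stage. So they converge to an
  element of \<open>A\<close>, and the limit is \<open>merge D g x y\<close>.\<close>

lemma semiscaled_all:
  assumes PD: "projective_determinacy"
    and "semiscaled A" "Dfn D" "Dfun g"
  shows "semiscaled {w. \<forall>y. merge D g w y \<in> A}"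
proof -
  obtain r where r: "good_semiscale A r" "Dfn_le_rel r"
    using assms(2) good_semiscale_exists unfolding semiscaled_def by metis
  have A: "Dfn (\<lambda>x. x \<in> A)" using assms(2) by (simp add: semiscaled_def)
  let ?f = "merge D g"
  let ?B = "{w. \<forall>y. ?f w y \<in> A}"
  note pwo = good_semiscaleD(1)[OF r(1)]
  note tr = pwo_trans[OF pwo] and refine = good_semiscaleD(2)[OF r(1)] and lim = good_semiscaleD(4)[OF r(1)]
  \<comment> \<open>Player II wins the comparison game.\<close>
  define G where "G = (\<lambda>s x x'. \<exists>\<sigma>. \<forall>y. r (length s) (?f x (prepend s y)) (?f x' (prepend s (respond \<sigma> y))))"
  define le where "le = (\<lambda>n x x'. \<forall>s. n = cde s \<longrightarrow> G s x x')"
  have le_cde: "le (cde s) x x' \<longleftrightarrow> G s x x'" for s x x' by (auto simp: le_def)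
  have not_G: "\<exists>\<tau>. \<forall>z. \<not> r (length s) (?f x (prepend s (lead \<tau> z))) (?f x' (prepend s z))"
    if "\<not> G s x x'" for s x x'
  proof -
    define Q where "Q = (\<lambda>y z. \<not> r (length s) (?f x (prepend s y)) (?f x' (prepend s z)))"
    have "Dfn (\<lambda>q :: (nat list \<times> (nat \<Rightarrow> nat) \<times> (nat \<Rightarrow> nat)) \<times> (nat \<Rightarrow> nat).
      \<not> r (length (fst (fst q)))
        (?f (fst (snd (fst q))) (prepend (fst (fst q)) (\<lambda>k. snd q (2 * k))))
        (?f (snd (snd (fst q))) (prepend (fst (fst q)) (\<lambda>k. snd q (Suc (2 * k))))))"
      by (intro dfn Dfn_le_relD[OF r(2)] Dfun_merge[OF assms(3,4)] Dfun_prepend Dfun_length Dfun_lambda)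
    from determined_Dfn[OF PD this, of "(s, x, x')"]
    have "determined {x. Q (\<lambda>k. x (2 * k)) (\<lambda>k. x (Suc (2 * k)))}" by (simp add: Q_def)
    from determined_moves[OF this] that show ?thesis by (auto simp: Q_def G_def)
  qed
  have "semiscale ?B le"
  proof (rule semiscaleI)
    fix n
    show "pwo ?B (le n)"
    proof (rule pwoI)
      fix x x' x'' assume x: "x \<in> ?B" "x' \<in> ?B" "x'' \<in> ?B" and le: "le n x x'" "le n x' x''"
      show "le n x x''" unfolding le_def
      proof (intro allI impI)
        fix s assume n: "n = cde (s :: nat list)"
        obtain \<sigma> where \<sigma>: "\<And>y. r (length s) (?f x (prepend s y)) (?f x' (prepend s (respond \<sigma> y)))"
          using le(1)[unfolded n le_cde G_def] by blast
        obtain \<tau> where \<tau>: "\<And>y. r (length s) (?f x' (prepend s y)) (?f x'' (prepend s (respond \<tau> y)))"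
          using le(2)[unfolded n le_cde G_def] by blast
        have "\<exists>\<upsilon>. \<forall>y. respond \<tau> (respond \<sigma> y) = respond \<upsilon> y"
          by (rule respond_exists) (intro respond_cong, simp)
        then obtain \<upsilon> where \<upsilon>: "\<And>y. respond \<tau> (respond \<sigma> y) = respond \<upsilon> y" by blast
        have "r (length s) (?f x (prepend s y)) (?f x'' (prepend s (respond \<upsilon> y)))" for y
          using tr[OF _ _ _ \<sigma>[of y] \<tau>[of "respond \<sigma> y"]] x by (simp add: \<upsilon>)
        then show "G s x x''" unfolding G_def by blast
      qed
    next
      fix C assume C: "C \<subseteq> ?B" "C \<noteq> {}"
      show "\<exists>m\<in>C. \<forall>y\<in>C. le n m y"
      proof (rule ccontr)
        assume "\<not> ?thesis"
        then have *: "\<exists>y. y \<in> C \<and> \<not> le n m y" if "m \<in> C" for m using that by blast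
        obtain c where c: "c \<in> C" using C(2) by blast
        obtain s where s: "n = cde (s :: nat list)" using *[OF c] by (auto simp: le_def)
        obtain h where h: "\<And>m. m \<in> C \<Longrightarrow> h m \<in> C \<and> \<not> G s m (h m)"
          using * unfolding s le_cde by metis
        \<comment> \<open>Iterating the choice of a point that is not above gives an infinite
          sequence.\<close>
        define X where "X = (\<lambda>i. (h ^^ i) c)"
        have X: "X i \<in> C" for i by (induction i) (simp_all add: X_def c h)
        have "\<not> G s (X i) (X (Suc i))" for i using h[OF X[of i]] by (simp add: X_def)
        then have "\<forall>i. \<exists>\<tau>. \<forall>z. \<not> r (length s) (?f (X i) (prepend s (lead \<tau> z))) (?f (X (Suc i)) (prepend s z))"
          using not_G by blast
        then obtain \<tau> where \<tau>: "\<And>i z. \<not> r (length s) (?f (X i) (prepend s (lead (\<tau> i) z))) (?f (X (Suc i)) (prepend s z))"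
          by metis
        obtain ys where ys: "\<And>i. ys i = lead (\<tau> i) (ys (Suc i))" using chain_of_leads by blast
        \<comment> \<open>Least elements in the range of \<open>p\<close> are impossible, as no
          term is below the next one.\<close>
        define p where "p = (\<lambda>i. ?f (X i) (prepend s (ys i)))"
        have p: "\<not> r (length s) (p i) (p (Suc i))" for i
          using \<tau>[of i "ys (Suc i)"] unfolding p_def ys[of i, symmetric] .
        have "range p \<subseteq> A" using X C(1) by (auto simp: p_def)
        from pwo_least[OF pwo this] p show False by blast
      qed
    qed
  next
    fix xs x assume xs: "\<And>i. xs i \<in> ?B" "conv xs x" "stabilizes le xs"
    have "?f x y \<in> A" for y
    proof -
      define s where "s = (\<lambda>n. map y [0..<n])"
      have "\<forall>n. \<exists>N. \<forall>i\<ge>N. \<forall>j\<ge>N. G (s n) (xs i) (xs j)"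
        using xs(3) unfolding stabilizes_def le_cde[symmetric] by blast
      then obtain N where N: "\<And>n i j. i \<ge> N n \<Longrightarrow> j \<ge> N n \<Longrightarrow> G (s n) (xs i) (xs j)" by metis
      define h where "h = (\<lambda>n. n + (\<Sum>m\<le>n. N m))"
      have h: "h n \<ge> N m" if "m \<le> n" for m n
        using that member_le_sum[of m "{..n}" N] by (simp add: h_def)
      define zs where "zs = (\<lambda>n. xs (h n))"
      have "G (s n) (zs (Suc n)) (zs n)" for n
        unfolding zs_def using h[of n "Suc n"] h[of n n] N by simp
      then obtain \<sigma> where \<sigma>: "\<And>n u. r n (?f (zs (Suc n)) (prepend (s n) u)) (?f (zs n) (prepend (s n) (respond (\<sigma> n) u)))"
        unfolding G_def s_def by (simp, metis)
      define p where "p = (\<lambda>n. ?f (zs n) (limit_moves \<sigma> y n))"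
      have p: "r n (p (Suc n)) (p n)" for n
        using \<sigma>[of n "\<lambda>j. limit_moves \<sigma> y (Suc n) (n + j)"]
        unfolding s_def limit_moves_prepend[symmetric] limit_moves_eq[symmetric] p_def .
      have pA: "p n \<in> A" for n using xs(1) by (simp add: p_def zs_def)
      have "\<exists>N. \<forall>i\<ge>N. \<forall>j\<ge>N. r n (p i) (p j)" for n
      proof (rule pwo_descending[OF pwo])
        show "p i \<in> A" for i by (rule pA)
        show "r n (p (Suc i)) (p i)" if "i \<ge> n" for i by (rule refine[OF that p])
      qed
      then have "stabilizes r p" unfolding stabilizes_def by blast
      from lim[OF pA this] obtain z where z: "z \<in> A" "conv p z" by blast
      have "conv zs x" unfolding conv_def
      proof
        fix k
        obtain M where M: "\<And>i. i \<ge> M \<Longrightarrow> xs i k = x k" using xs(2) unfolding conv_def by blast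
        have "h i \<ge> i" for i by (simp add: h_def)
        then have "zs i k = x k" if "i \<ge> M" for i unfolding zs_def using that by (intro M) (rule order_trans)
        then show "\<exists>N. \<forall>i\<ge>N. zs i k = x k" by blast
      qed
      moreover have "conv (limit_moves \<sigma> y) y" unfolding conv_def
      proof
        fix k
        have "limit_moves \<sigma> y i k = y k" if "i \<ge> Suc k" for i
          using that by (subst limit_moves.simps) simp
        then show "\<exists>N. \<forall>i\<ge>N. limit_moves \<sigma> y i k = y k" by blast
      qed
      ultimately have "conv p (?f x y)" unfolding p_def by (rule conv_merge)
      from conv_unique[OF this z(2)] z(1) show ?thesis by simp
    qed
    then show "x \<in> ?B" by simp
  qed
  moreover have "Dfn_le_rel le"
    unfolding Dfn_le_rel_def le_def G_def
    by (intro dfn Dfn_le_relD[OF r(2)] Dfun_merge[OF assms(3,4)] Dfun_prepend Dfun_length Dfun_respond)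
  moreover have "Dfn (\<lambda>w. w \<in> ?B)"
    unfolding mem_Collect_eq by (intro dfn Dfn_vimage[OF A] Dfun_merge[OF assms(3,4)])
  ultimately show ?thesis unfolding semiscaled_def by blast
qed

section \<open>The basis theorem\<close>

text \<open>A point \<open>w\<close> codes an assignment: digit \<open>(0, i)\<close> is the value
  of the number variable \<open>i\<close>, and digit \<open>(X + 1, m)\<close> is nonzero iff
  \<open>m\<close> belongs to the value of the set variable \<open>X\<close>.\<close>

definition eN :: "(nat \<Rightarrow> nat) \<Rightarrow> nat \<Rightarrow> nat" where
  "eN w i = w (prod_encode (0, i))"

definition eS :: "(nat \<Rightarrow> nat) \<Rightarrow> nat \<Rightarrow> nat set" where
  "eS w X = {m. w (prod_encode (Suc X, m)) \<noteq> 0}"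

definition truth_set :: "fm \<Rightarrow> (nat \<Rightarrow> nat) set" where
  "truth_set \<phi> = {w. sat UNIV (eN w) (eS w) \<phi>}"

definition numD :: "nat \<Rightarrow> nat \<Rightarrow> bool" where "numD i k \<longleftrightarrow> k = prod_encode (0, i)"
definition setD :: "nat \<Rightarrow> nat \<Rightarrow> bool" where "setD X k \<longleftrightarrow> fst (prod_decode k) = Suc X"

lemma eN_merge_numD: "eN (merge (numD i) (\<lambda>_. 0) w y) = (eN w)(i := y 0)"
  and eS_merge_numD: "eS (merge (numD i) (\<lambda>_. 0) w y) = eS w"
  by (auto simp: fun_eq_iff eN_def eS_def merge_def numD_def)

lemma eN_merge_setD: "eN (merge (setD X) (\<lambda>k. snd (prod_decode k)) w y) = eN w"
  and eS_merge_setD: "eS (merge (setD X) (\<lambda>k. snd (prod_decode k)) w y) = (eS w)(X := {m. y m \<noteq> 0})"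
  by (auto simp: fun_eq_iff eN_def eS_def merge_def setD_def)

lemma ex_digit: "(\<exists>y :: nat \<Rightarrow> nat. P (y 0)) \<longleftrightarrow> (\<exists>n. P n)"
proof
  show "\<exists>y :: nat \<Rightarrow> nat. P (y 0)" if "\<exists>n. P n"
  proof -
    from that obtain n where "P n" by blast
    then show ?thesis by (intro exI[of _ "\<lambda>_. n"])
  qed
qed blast

lemma ex_characteristic: "(\<exists>y :: nat \<Rightarrow> nat. P {m. y m \<noteq> 0}) \<longleftrightarrow> (\<exists>B. P B)"
proof
  show "\<exists>y :: nat \<Rightarrow> nat. P {m. y m \<noteq> 0}" if "\<exists>B. P B"
  proof -
    from that obtain B where "P B" by blast
    then show ?thesis by (intro exI[of _ "\<lambda>m. of_bool (m \<in> B)"]) simp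
  qed
qed blast

lemma truth_set_simps:
  "truth_set (Neg (Neg \<phi>)) = truth_set \<phi>"
  "truth_set (Conj \<phi> \<psi>) = truth_set \<phi> \<inter> truth_set \<psi>"
  "truth_set (Neg (Conj \<phi> \<psi>)) = truth_set (Neg \<phi>) \<union> truth_set (Neg \<psi>)"
  "truth_set (ExN i \<phi>) = {w. \<exists>y. merge (numD i) (\<lambda>_. 0) w y \<in> truth_set \<phi>}"
  "truth_set (Neg (ExN i \<phi>)) = {w. \<forall>y. merge (numD i) (\<lambda>_. 0) w y \<in> truth_set (Neg \<phi>)}"
  "truth_set (AllN i \<phi>) = {w. \<forall>y. merge (numD i) (\<lambda>_. 0) w y \<in> truth_set \<phi>}"
  "truth_set (Neg (AllN i \<phi>)) = {w. \<exists>y. merge (numD i) (\<lambda>_. 0) w y \<in> truth_set (Neg \<phi>)}"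
  "truth_set (ExS X \<phi>) = {w. \<exists>y. merge (setD X) (\<lambda>k. snd (prod_decode k)) w y \<in> truth_set \<phi>}"
  "truth_set (Neg (ExS X \<phi>)) =
    {w. \<forall>y. merge (setD X) (\<lambda>k. snd (prod_decode k)) w y \<in> truth_set (Neg \<phi>)}"
  "truth_set (AllS X \<phi>) = {w. \<forall>y. merge (setD X) (\<lambda>k. snd (prod_decode k)) w y \<in> truth_set \<phi>}"
  "truth_set (Neg (AllS X \<phi>)) =
    {w. \<exists>y. merge (setD X) (\<lambda>k. snd (prod_decode k)) w y \<in> truth_set (Neg \<phi>)}"
proof -
  show "truth_set (Neg (Neg \<phi>)) = truth_set \<phi>"
    "truth_set (Conj \<phi> \<psi>) = truth_set \<phi> \<inter> truth_set \<psi>"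
    "truth_set (Neg (Conj \<phi> \<psi>)) = truth_set (Neg \<phi>) \<union> truth_set (Neg \<psi>)"
    unfolding truth_set_def by auto
  have exN: "truth_set (ExN i \<phi>) = {w. \<exists>y. merge (numD i) (\<lambda>_. 0) w y \<in> truth_set \<phi>}" for \<phi>
    unfolding truth_set_def mem_Collect_eq eN_merge_numD eS_merge_numD sat.simps
    by (subst ex_digit[of "\<lambda>n. sat UNIV ((eN _)(i := n)) (eS _) \<phi>"]) simp
  have exS: "truth_set (ExS X \<phi>) = {w. \<exists>y. merge (setD X) (\<lambda>k. snd (prod_decode k)) w y \<in> truth_set \<phi>}" for \<phi>
    unfolding truth_set_def mem_Collect_eq eN_merge_setD eS_merge_setD sat.simps
    by (subst ex_characteristic[of "\<lambda>B. sat UNIV (eN _) ((eS _)(X := B)) \<phi>"]) simp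
  have neg: "truth_set (Neg \<phi>) = - truth_set \<phi>" for \<phi> by (auto simp: truth_set_def)
  have all: "truth_set (AllN i \<phi>) = - truth_set (ExN i (Neg \<phi>))"
    "truth_set (AllS X \<phi>) = - truth_set (ExS X (Neg \<phi>))"
    by (auto simp: truth_set_def)
  show "truth_set (ExN i \<phi>) = {w. \<exists>y. merge (numD i) (\<lambda>_. 0) w y \<in> truth_set \<phi>}"
    "truth_set (Neg (ExN i \<phi>)) = {w. \<forall>y. merge (numD i) (\<lambda>_. 0) w y \<in> truth_set (Neg \<phi>)}"
    "truth_set (AllN i \<phi>) = {w. \<forall>y. merge (numD i) (\<lambda>_. 0) w y \<in> truth_set \<phi>}"
    "truth_set (Neg (AllN i \<phi>)) = {w. \<exists>y. merge (numD i) (\<lambda>_. 0) w y \<in> truth_set (Neg \<phi>)}"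
    unfolding all neg exN by auto
  show "truth_set (ExS X \<phi>) = {w. \<exists>y. merge (setD X) (\<lambda>k. snd (prod_decode k)) w y \<in> truth_set \<phi>}"
    "truth_set (Neg (ExS X \<phi>)) =
      {w. \<forall>y. merge (setD X) (\<lambda>k. snd (prod_decode k)) w y \<in> truth_set (Neg \<phi>)}"
    "truth_set (AllS X \<phi>) = {w. \<forall>y. merge (setD X) (\<lambda>k. snd (prod_decode k)) w y \<in> truth_set \<phi>}"
    "truth_set (Neg (AllS X \<phi>)) =
      {w. \<exists>y. merge (setD X) (\<lambda>k. snd (prod_decode k)) w y \<in> truth_set (Neg \<phi>)}"
    unfolding all neg exS by auto
qed

lemma val_eN_continuous: "conv ws w \<Longrightarrow> \<exists>N. \<forall>i\<ge>N. val (eN (ws i)) t = val (eN w) t"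
proof (induction t)
  case (V j)
  then show ?case by (simp add: conv_def eN_def)
next
  case (S t)
  then obtain N where "\<forall>i\<ge>N. val (eN (ws i)) t = val (eN w) t" by blast
  then show ?case by (intro exI[of _ N]) simp
next
  case (Plus s t)
  then obtain N M where "\<forall>i\<ge>N. val (eN (ws i)) s = val (eN w) s" "\<forall>i\<ge>M. val (eN (ws i)) t = val (eN w) t"
    by blast
  then show ?case by (intro exI[of _ "max N M"]) simp
next
  case (Times s t)
  then obtain N M where "\<forall>i\<ge>N. val (eN (ws i)) s = val (eN w) s" "\<forall>i\<ge>M. val (eN (ws i)) t = val (eN w) t"
    by blast
  then show ?case by (intro exI[of _ "max N M"]) simp
qed simp

lemma Dfun_val_eN: "Dfun (\<lambda>w. val (eN w) t)"
  by (induction t) (simp_all add: eN_def dfn)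

text \<open>Only finitely many digits are relevant.\<close>

lemma atomic_continuous:
  assumes "\<phi> \<in> {Eq s t, Less s t, Mem t X}" "conv ws w"
  shows "\<exists>N. \<forall>i\<ge>N. ws i \<in> truth_set \<phi> \<longleftrightarrow> w \<in> truth_set \<phi>"
proof -
  obtain N where N: "\<forall>i\<ge>N. val (eN (ws i)) s = val (eN w) s" using val_eN_continuous[OF assms(2)] by blast
  obtain M where M: "\<forall>i\<ge>M. val (eN (ws i)) t = val (eN w) t" using val_eN_continuous[OF assms(2)] by blast
  obtain K where K: "\<forall>i\<ge>K. ws i (prod_encode (Suc X, val (eN w) t)) = w (prod_encode (Suc X, val (eN w) t))"
    using assms(2) unfolding conv_def by blast
  show ?thesis using assms(1) N M K
    by (intro exI[of _ "max K (max N M)"]) (auto simp: truth_set_def eS_def)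
qed

lemma semiscaled_atomic:
  assumes "\<phi> \<in> {Eq s t, Less s t, Mem t X}"
  shows "semiscaled (truth_set \<phi>)" "semiscaled (truth_set (Neg \<phi>))"
proof -
  have "Dfn (\<lambda>w. w \<in> truth_set \<phi>)" using assms
    by (auto simp: truth_set_def eS_def intro!: dfn Dfun_val_eN)
  moreover have neg: "w \<in> truth_set (Neg \<phi>) \<longleftrightarrow> w \<notin> truth_set \<phi>" for w by (simp add: truth_set_def)
  ultimately have D: "Dfn (\<lambda>w. w \<in> truth_set \<phi>)" "Dfn (\<lambda>w. w \<in> truth_set (Neg \<phi>))"
    by (simp_all add: Dfn_not)
  note c = atomic_continuous[OF assms]
  show "semiscaled (truth_set \<phi>)"
    by (rule semiscaled_closed[OF D(1)]) (use c in blast)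
  show "semiscaled (truth_set (Neg \<phi>))"
    by (rule semiscaled_closed[OF D(2)]) (use c neg in blast)
qed

text \<open>The negation is carried along in the induction, since it turns the quantifiers into
  their duals. Determinacy is used for universal quantifiers only.\<close>

theorem semiscaled_truth_set:
  assumes "projective_determinacy"
  shows "semiscaled (truth_set \<phi>) \<and> semiscaled (truth_set (Neg \<phi>))"
proof (induction \<phi>)
  case (Eq s t)
  then show ?case using semiscaled_atomic by blast
next
  case (Less s t)
  then show ?case using semiscaled_atomic by blast
next
  case (Mem t X)
  then show ?case using semiscaled_atomic by blast
next
  case (Neg \<phi>)
  then show ?case by (simp add: truth_set_simps)
next
  case (Conj \<phi> \<psi>)
  then show ?case by (simp add: truth_set_simps semiscaled_Int semiscaled_Un)
next
  case (ExN i \<phi>)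
  have D: "Dfn (numD i)" "Dfun (\<lambda>_ :: nat. 0 :: nat)" "inj_on (\<lambda>_ :: nat. 0 :: nat) (Collect (numD i))"
    unfolding numD_def[abs_def] by ((intro dfn)+, auto simp: numD_def intro: inj_onI)
  show ?case unfolding truth_set_simps using ExN semiscaled_ex[OF _ D] semiscaled_all[OF assms _ D(1,2)] by blast
next
  case (AllN i \<phi>)
  have D: "Dfn (numD i)" "Dfun (\<lambda>_ :: nat. 0 :: nat)" "inj_on (\<lambda>_ :: nat. 0 :: nat) (Collect (numD i))"
    unfolding numD_def[abs_def] by ((intro dfn)+, auto simp: numD_def intro: inj_onI)
  show ?case unfolding truth_set_simps using AllN semiscaled_ex[OF _ D] semiscaled_all[OF assms _ D(1,2)] by blast
next
  case (ExS X \<phi>)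
  have D: "Dfn (setD X)" "Dfun (\<lambda>k :: nat. snd (prod_decode k))"
    unfolding setD_def[abs_def] by (intro dfn)+
  have inj: "inj_on (\<lambda>k. snd (prod_decode k)) (Collect (setD X))"
    by (rule inj_onI) (metis mem_Collect_eq prod_decode_inverse prod_eqI setD_def)
  show ?case unfolding truth_set_simps using ExS semiscaled_ex[OF _ D inj] semiscaled_all[OF assms _ D] by blast
next
  case (AllS X \<phi>)
  have D: "Dfn (setD X)" "Dfun (\<lambda>k :: nat. snd (prod_decode k))"
    unfolding setD_def[abs_def] by (intro dfn)+
  have inj: "inj_on (\<lambda>k. snd (prod_decode k)) (Collect (setD X))"
    by (rule inj_onI) (metis mem_Collect_eq prod_decode_inverse prod_eqI setD_def)
  show ?case unfolding truth_set_simps using AllS semiscaled_ex[OF _ D inj] semiscaled_all[OF assms _ D] by blast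
qed

text \<open>The leftmost branch: all points that are least at stage \<open>n\<close> agree in the
  digit \<open>n\<close>. These digits form a point of \<open>A\<close>, to which the least
  elements converge.\<close>

lemma semiscaled_basis:
  assumes "semiscaled A" "A \<noteq> {}"
  shows "\<exists>x\<in>A. Dpt x"
proof -
  obtain r where r: "good_semiscale A r" "Dfn_le_rel r"
    using assms(1) good_semiscale_exists unfolding semiscaled_def by metis
  have A: "Dfn (\<lambda>x. x \<in> A)" using assms(1) by (simp add: semiscaled_def)
  note pwo = good_semiscaleD(1)[OF r(1)] and refine = good_semiscaleD(2)[OF r(1)]
    and digit = good_semiscaleD(3)[OF r(1)] and lim = good_semiscaleD(4)[OF r(1)]
  have "\<exists>m. m \<in> A \<and> (\<forall>y\<in>A. r n m y)" for n using pwo_least[OF pwo subset_refl assms(2)] by blast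
  then obtain m where m: "\<And>n. m n \<in> A" "\<And>n y. y \<in> A \<Longrightarrow> r n (m n) y" by metis
  have st: "r n (m i) (m j)" if "i \<ge> n" "j \<ge> n" for n i j
    using refine[OF that(1) m(2)[OF m(1)]] .
  then have "stabilizes r m" unfolding stabilizes_def by blast
  from lim[OF m(1) this] obtain x where x: "x \<in> A" "conv m x" by blast
  have mx: "m n n = x n" for n
  proof -
    obtain N where "\<And>i. i \<ge> N \<Longrightarrow> m i n = x n" using x(2) unfolding conv_def by blast
    then have "m (max N n) n = x n" by simp
    moreover have "m n n = m (max N n) n" by (rule digit) (simp_all add: st)
    ultimately show ?thesis by simp
  qed
  have "(\<exists>z. z \<in> A \<and> (\<forall>y. y \<in> A \<longrightarrow> r k z y) \<and> z k = v) \<longleftrightarrow> v = x k" for k v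
  proof
    assume "\<exists>z. z \<in> A \<and> (\<forall>y. y \<in> A \<longrightarrow> r k z y) \<and> z k = v"
    then obtain z where z: "z \<in> A" "\<And>y. y \<in> A \<Longrightarrow> r k z y" "z k = v" by blast
    have "z k = m k k" by (rule digit) (simp_all add: z m)
    then show "v = x k" using z(3) mx by simp
  next
    assume "v = x k"
    then show "\<exists>z. z \<in> A \<and> (\<forall>y. y \<in> A \<longrightarrow> r k z y) \<and> z k = v"
      using m mx by (intro exI[of _ "m k"]) simp
  qed
  moreover have "Dfn (\<lambda>f. \<forall>k. \<exists>z. z \<in> A \<and> (\<forall>y. y \<in> A \<longrightarrow> r k z y) \<and> z k = f k)"
    by (intro dfn Dfn_vimage[OF A] Dfn_le_relD[OF r(2)])
  ultimately have "Dfn (\<lambda>f. f = x)" by (simp add: fun_eq_iff)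
  then show ?thesis using x(1) unfolding Dpt_def by blast
qed

theorem basis:
  fixes P :: "'a :: dt \<Rightarrow> bool"
  assumes "projective_determinacy" "Dfn P" "P x"
  shows "\<exists>x. P x \<and> Dpt x"
proof -
  have "definable (enc ` Collect P)" using assms(2) by (simp add: Dfn_def)
  then obtain \<phi> where \<phi>: "\<And>e E. sat UNIV e E \<phi> \<longleftrightarrow> E 0 \<in> enc ` Collect P"
    unfolding definable_def definable_rel_def by blast
  have in_truth: "w \<in> truth_set \<phi> \<longleftrightarrow> eS w 0 \<in> enc ` Collect P" for w
    by (simp add: truth_set_def \<phi>)
  have "eS (\<lambda>k. of_bool (snd (prod_decode k) \<in> enc x)) 0 = enc x" by (simp add: eS_def)
  then have "truth_set \<phi> \<noteq> {}" using in_truth assms(3) by blast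
  with semiscaled_truth_set[OF assms(1)] obtain w where w: "w \<in> truth_set \<phi>" "Dpt w"
    using semiscaled_basis by blast
  then obtain x where x: "P x" "eS w 0 = enc x" using in_truth by blast
  have enc: "Dfun (\<lambda>y :: 'a. enc y)"
    by (rule Dfun_op[OF definable_op_id]) (simp add: enc_set_def cde_nat_def)
  have "Dfn (\<lambda>y :: 'a. \<forall>m. m \<in> enc y \<longleftrightarrow> w (prod_encode (1, m)) \<noteq> 0)"
    by (intro dfn Dfn_iff Dfun_comp[OF enc] Dpt_apply[OF w(2)])
  also have "(\<lambda>y :: 'a. \<forall>m. m \<in> enc y \<longleftrightarrow> w (prod_encode (1, m)) \<noteq> 0) = (\<lambda>y. enc y = eS w 0)"
    by (auto simp: eS_def)
  finally have "Dpt x" by (simp add: Dpt_def x(2))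
  with x(1) show ?thesis by blast
qed

section \<open>Definability of satisfaction\<close>

lemma Dfn_rel2: "Dfn (\<lambda>p. R (fst p) (snd p)) \<Longrightarrow> Dfun f \<Longrightarrow> Dfun g \<Longrightarrow> Dfn (\<lambda>x. R (f x) (g x))"
  using Dfn_vimage[OF _ Dfun_Pair, of "\<lambda>p. R (fst p) (snd p)" f g] by simp

lemma Dfun_fun_upd [dfn]:
  fixes f :: "'x :: dt \<Rightarrow> 'a :: cnt \<Rightarrow> 'b :: dt"
  assumes "Dfun f" "Dfun i" "Dfun v"
  shows "Dfun (\<lambda>x. (f x)(i x := v x))"
proof -
  have "Dfun (\<lambda>p :: ('a \<Rightarrow> 'b) \<times> 'a \<times> 'b. (\<lambda>k. if k = fst (snd p) then snd (snd p) else fst p k))"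
    by (rule Dfun_lambda) (intro dfn)
  from Dfun_comp[OF this Dfun_Pair[OF assms(1) Dfun_Pair[OF assms(2,3)]]]
  show ?thesis unfolding fst_conv snd_conv fun_upd_def .
qed

lemma Dfun_const_fun [dfn]: "Dfun (\<lambda>_. (\<lambda>_ :: 'a :: cnt. n :: nat))"
  by (rule Dfun_lambda) (intro dfn)

lemma Dpt_empty: "Dpt ({} :: nat set)"
proof -
  have "Dfn (\<lambda>y :: nat set. \<forall>n. n \<notin> y)" by (intro dfn)
  moreover have "(\<lambda>y :: nat set. \<forall>n. n \<notin> y) = (\<lambda>y. y = {})" by auto
  ultimately show ?thesis by (simp add: Dpt_def)
qed

lemma Dfun_empty [dfn]: "Dfun (\<lambda>_. {} :: nat set)"
  by (rule Dfun_const[OF Dpt_empty])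

lemma Dfun_const_empty [dfn]: "Dfun (\<lambda>_. (\<lambda>_ :: 'a :: cnt. {} :: nat set))"
  by (rule Dfun_lambda) (intro dfn)

lemma enc_nat_set: "enc A = A" for A :: "nat set"
  by (simp add: enc_set_def cde_nat_def)

lemma Dfun_enc: "Dfun f \<Longrightarrow> Dfun (\<lambda>x. enc (f x))"
  by (rule Dfun_comp[OF Dfun_op[OF definable_op_id]]) (simp add: enc_nat_set)

lemma Dfun_graph_of [dfn]: "Dfun f \<Longrightarrow> Dfun (\<lambda>x. graph (f x))"
  unfolding enc_graph[symmetric] by (rule Dfun_enc)

lemma Dfn_even [dfn]: "Dfun f \<Longrightarrow> Dfn (\<lambda>x. even (f x :: nat))"
proof -
  assume "Dfun f"
  have "Dfn (\<lambda>n :: nat. \<exists>m. n = m + m)" by (intro dfn)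
  from Dfn_vimage[OF this \<open>Dfun f\<close>] show ?thesis by (simp add: dvd_def mult_2)
qed

lemma Dfn_wins_I:
  fixes R :: "'a :: dt \<Rightarrow> (nat \<Rightarrow> nat) \<Rightarrow> bool"
  assumes "Dfn (\<lambda>q. R (fst q) (snd q))"
  shows "Dfn (\<lambda>p. wins_I {x. R p x})"
  unfolding wins_I_def follows_I_def mem_Collect_eq
  by (intro dfn Dfun_map_upt Dfn_rel2[OF assms])

lemma Dfun_val: "Dfun f \<Longrightarrow> Dfun (\<lambda>x. val (f x) t)"
proof -
  assume "Dfun f"
  have "Dfun (\<lambda>e. val e t)" by (induction t) (simp_all add: dfn)
  from Dfun_comp[OF this \<open>Dfun f\<close>] show ?thesis .
qed

text \<open>One formula at a time: for the full model a definition that is uniform in the formula would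
  contradict the undefinability of truth.\<close>

lemma Dfn_sat:
  assumes M: "Dfn (\<lambda>A. A \<in> M)"
  shows "Dfn (\<lambda>p. sat M (fst p) (snd p) \<phi>)"
proof (induction \<phi>)
  case (Eq s t)
  show ?case by (simp, intro dfn Dfun_val)
next
  case (Less s t)
  show ?case by (simp, intro dfn Dfun_val)
next
  case (Mem t X)
  show ?case by (simp, intro dfn Dfun_val)
next
  case (Neg \<phi>)
  then show ?case by (simp add: Dfn_not)
next
  case (Conj \<phi> \<psi>)
  then show ?case by (simp add: Dfn_conj)
next
  case (ExN i \<phi>)
  show ?case unfolding sat.simps by (intro dfn Dfn_rel2[OF ExN])
next
  case (AllN i \<phi>)
  show ?case unfolding sat.simps by (intro dfn Dfn_rel2[OF AllN])
next
  case (ExS X \<phi>)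
  show ?case unfolding sat.simps Bex_def by (intro dfn Dfn_rel2[OF ExS] Dfn_vimage[OF M])
next
  case (AllS X \<phi>)
  show ?case unfolding sat.simps Ball_def by (intro dfn Dfn_rel2[OF AllS] Dfn_vimage[OF M])
qed

lemma Dfn_xsat:
  assumes M: "Dfn (\<lambda>A. A \<in> M)"
  shows "Dfn (\<lambda>p. xsat M (fst p) (snd p) \<chi>)"
proof (induction \<chi>)
  case (L2 \<phi>)
  show ?case using Dfn_sat[OF M] by simp
next
  case (Game k \<Phi> \<psi>)
  have U: "Dfn (\<lambda>A :: nat set. A \<in> UNIV)" by (simp add: Dfn_const)
  show ?case unfolding xsat.simps
    by (intro Dfn_wins_I dfn Dfn_rel2[OF Dfn_sat[OF U]] Dfn_rel2[OF Dfn_sat[OF M]] Dfun_Collect)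
next
  case (XNeg \<phi>)
  then show ?case by (simp add: Dfn_not)
next
  case (XConj \<phi> \<psi>)
  then show ?case by (simp add: Dfn_conj)
next
  case (XExN i \<phi>)
  show ?case unfolding xsat.simps by (intro dfn Dfn_rel2[OF XExN])
next
  case (XAllN i \<phi>)
  show ?case unfolding xsat.simps by (intro dfn Dfn_rel2[OF XAllN])
next
  case (XExS X \<phi>)
  show ?case unfolding xsat.simps Bex_def by (intro dfn Dfn_rel2[OF XExS] Dfn_vimage[OF M])
next
  case (XAllS X \<phi>)
  show ?case unfolding xsat.simps Ball_def by (intro dfn Dfn_rel2[OF XAllS] Dfn_vimage[OF M])
qed

lemma xsat_cong:
  assumes "\<forall>i\<in>xfvN \<chi>. e i = e' i" "\<forall>X\<in>xfvS \<chi>. E X = E' X"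
  shows "xsat M e E \<chi> = xsat M e' E' \<chi>"
  using assms
proof (induction \<chi> arbitrary: e e' E E')
  case (L2 \<phi>)
  then show ?case using sat_cong[of \<phi> e e' E E'] by simp
next
  case (Game k \<Phi> \<psi>)
  have "sat M (e(0 := n)) E \<psi> = sat M (e'(0 := n)) E' \<psi>" for n
    by (rule sat_cong) (use Game.prems in auto)
  moreover have "e k = e' k" using Game.prems by simp
  ultimately show ?case by simp
next
  case (XConj \<chi> \<theta>)
  have "xsat M e E \<chi> = xsat M e' E' \<chi>" "xsat M e E \<theta> = xsat M e' E' \<theta>"
    using XConj.prems by (auto intro!: XConj.IH)
  then show ?case by simp
next
  case (XNeg \<chi>)
  then show ?case by (metis xfvN.simps(3) xfvS.simps(3) xsat.simps(3))
next
  case (XExN i \<chi>)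
  have "xsat M (e(i := n)) E \<chi> = xsat M (e'(i := n)) E' \<chi>" for n
    by (rule XExN.IH) (use XExN.prems in auto)
  then show ?case by simp
next
  case (XAllN i \<chi>)
  have "xsat M (e(i := n)) E \<chi> = xsat M (e'(i := n)) E' \<chi>" for n
    by (rule XAllN.IH) (use XAllN.prems in auto)
  then show ?case by simp
next
  case (XExS X \<chi>)
  have "xsat M e (E(X := A)) \<chi> = xsat M e' (E'(X := A)) \<chi>" for A
    by (rule XExS.IH) (use XExS.prems in auto)
  then show ?case by simp
next
  case (XAllS X \<chi>)
  have "xsat M e (E(X := A)) \<chi> = xsat M e' (E'(X := A)) \<chi>" for A
    by (rule XAllS.IH) (use XAllS.prems in auto)
  then show ?case by simp
qed

lemma finite_xfvN [simp]: "finite (xfvN \<chi>)"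
  by (induction \<chi>) auto

lemma finite_xfvS [simp]: "finite (xfvS \<chi>)"
  by (induction \<chi>) auto

section \<open>The definable sets form an elementary submodel\<close>

definition definable_sets :: "nat set set" where
  "definable_sets = {A. Dpt A}"

lemma Dpt_fun_upd: "Dpt f \<Longrightarrow> Dpt (i :: 'a :: cnt) \<Longrightarrow> Dpt v \<Longrightarrow> Dpt (f(i := v))"
  using Dpt_image[OF Dfun_fun_upd[OF Dfun_fst[OF Dfun_id] Dfun_fst[OF Dfun_snd[OF Dfun_id]]
        Dfun_snd[OF Dfun_snd[OF Dfun_id]]] Dpt_Pair[OF _ Dpt_Pair], of f i v]
  by simp

lemma Dpt_of_Dfun: "Dfun (\<lambda>_ :: nat. c) \<Longrightarrow> Dpt c"
  using Dpt_image[of "\<lambda>_ :: nat. c" 0] Dpt_nat by blast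

lemma Dpt_finite_assignment:
  assumes "finite F" "\<And>X. X \<in> F \<Longrightarrow> Dpt (E X)" "Dpt (\<lambda>_ :: nat. d)"
  shows "Dpt (\<lambda>X :: nat. if X \<in> F then E X else d)"
  using assms(1,2)
proof (induction F)
  case empty
  then show ?case using assms(3) by simp
next
  case (insert X F)
  have "Dpt ((\<lambda>X. if X \<in> F then E X else d)(X := E X))"
    using insert by (intro Dpt_fun_upd Dpt_nat) auto
  moreover have "(\<lambda>X. if X \<in> F then E X else d)(X := E X) = (\<lambda>Y. if Y \<in> insert X F then E Y else d)"
    by auto
  ultimately show ?case by simp
qed

lemma Dpt_Collect: "Dfn R \<Longrightarrow> Dpt {n :: nat. R n}"
proof -
  assume "Dfn R"
  have "Dfn (\<lambda>A. \<forall>n. n \<in> A \<longleftrightarrow> R n)" by (intro dfn Dfn_iff Dfn_vimage[OF \<open>Dfn R\<close>])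
  moreover have "(\<lambda>A. \<forall>n. n \<in> A \<longleftrightarrow> R n) = (\<lambda>A. A = {n. R n})" by auto
  ultimately show ?thesis by (simp add: Dpt_def)
qed

lemma Dfn_xsat_set_variable:
  assumes "Dpt e" "Dpt E"
  shows "Dfn (\<lambda>A. xsat UNIV e (E(X := A)) \<chi>)"
proof -
  have "Dfn (\<lambda>A :: nat set. A \<in> UNIV)" by (simp add: Dfn_const)
  from Dfn_xsat[OF this] show ?thesis
    by (rule Dfn_rel2) (intro dfn Dfun_const[OF assms(1)] Dfun_const[OF assms(2)])+
qed

text \<open>The criterion of Tarski and Vaught, with witnesses from the basis theorem. Game
  formulas cause no difficulty, because the game is evaluated in the universe and only its
  parameter refers to the model.\<close>

lemma xsat_definable_sets:
  assumes "projective_determinacy" "Dpt e" "Dpt E"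
  shows "xsat definable_sets e E \<chi> = xsat UNIV e E \<chi>"
  using assms(2,3)
proof (induction \<chi> arbitrary: e E)
  have sat: "sat definable_sets e E \<phi> = sat UNIV e E \<phi>" if "Dpt e" "Dpt E" for \<phi> e E
    using that
  proof (induction \<phi> arbitrary: e E)
    case (ExN i \<phi>)
    have "sat definable_sets (e(i := n)) E \<phi> = sat UNIV (e(i := n)) E \<phi>" for n
      by (rule ExN.IH[OF Dpt_fun_upd[OF ExN.prems(1) Dpt_nat Dpt_nat] ExN.prems(2)])
    then show ?case by simp
  next
    case (AllN i \<phi>)
    have "sat definable_sets (e(i := n)) E \<phi> = sat UNIV (e(i := n)) E \<phi>" for n
      by (rule AllN.IH[OF Dpt_fun_upd[OF AllN.prems(1) Dpt_nat Dpt_nat] AllN.prems(2)])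
    then show ?case by simp
  next
    case (ExS X \<phi>)
    have IH: "sat definable_sets e (E(X := A)) \<phi> = sat UNIV e (E(X := A)) \<phi>" if "Dpt A" for A
      using ExS that by (intro ExS.IH Dpt_fun_upd Dpt_nat)
    have "Dfn (\<lambda>A. sat UNIV e (E(X := A)) \<phi>)"
      using Dfn_xsat_set_variable[OF ExS.prems, of X "L2 \<phi>"] by simp
    from basis[OF assms(1) this] show ?case using IH by (auto simp: definable_sets_def)
  next
    case (AllS X \<phi>)
    have IH: "sat definable_sets e (E(X := A)) \<phi> = sat UNIV e (E(X := A)) \<phi>" if "Dpt A" for A
      using AllS that by (intro AllS.IH Dpt_fun_upd Dpt_nat)
    have "Dfn (\<lambda>A. \<not> sat UNIV e (E(X := A)) \<phi>)"
      using Dfn_xsat_set_variable[OF AllS.prems, of X "L2 (Neg \<phi>)"] by simp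
    from basis[OF assms(1) this] show ?case using IH by (auto simp: definable_sets_def)
  qed simp_all
  {
    case (L2 \<phi>)
    then show ?case using sat by simp
  next
    case (Game k \<Phi> \<psi>)
    have "sat definable_sets (e(0 := n)) E \<psi> = sat UNIV (e(0 := n)) E \<psi>" for n
      by (rule sat[OF Dpt_fun_upd[OF Game.prems(1) Dpt_nat Dpt_nat] Game.prems(2)])
    then show ?case by simp
  next
    case (XNeg \<chi>)
    then show ?case by simp
  next
    case (XConj \<chi> \<theta>)
    then show ?case by simp
  next
    case (XExN i \<phi>)
    have "xsat definable_sets (e(i := n)) E \<phi> = xsat UNIV (e(i := n)) E \<phi>" for n
      by (rule XExN.IH[OF Dpt_fun_upd[OF XExN.prems(1) Dpt_nat Dpt_nat] XExN.prems(2)])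
    then show ?case by simp
  next
    case (XAllN i \<phi>)
    have "xsat definable_sets (e(i := n)) E \<phi> = xsat UNIV (e(i := n)) E \<phi>" for n
      by (rule XAllN.IH[OF Dpt_fun_upd[OF XAllN.prems(1) Dpt_nat Dpt_nat] XAllN.prems(2)])
    then show ?case by simp
  next
    case (XExS X \<chi>)
    have IH: "xsat definable_sets e (E(X := A)) \<chi> = xsat UNIV e (E(X := A)) \<chi>" if "Dpt A" for A
      using XExS that by (intro XExS.IH Dpt_fun_upd Dpt_nat)
    from basis[OF assms(1) Dfn_xsat_set_variable[OF XExS.prems, of X \<chi>]]
    show ?case using IH by (auto simp: definable_sets_def)
  next
    case (XAllS X \<chi>)
    have IH: "xsat definable_sets e (E(X := A)) \<chi> = xsat UNIV e (E(X := A)) \<chi>" if "Dpt A" for A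
      using XAllS that by (intro XAllS.IH Dpt_fun_upd Dpt_nat)
    from basis[OF assms(1) Dfn_xsat_set_variable[OF XAllS.prems, of X "XNeg \<chi>"]]
    show ?case using IH by (auto simp: definable_sets_def)
  }
qed

definition elementary :: "nat set set \<Rightarrow> bool" where
  "elementary M \<longleftrightarrow> (\<forall>\<phi> e E. (\<forall>X\<in>fvS \<phi>. E X \<in> M) \<longrightarrow> sat M e E \<phi> = sat UNIV e E \<phi>)"

text \<open>A formula depends on finitely many values of the assignment. The other ones can be
  changed so that the whole assignment becomes a definable point.\<close>

lemma elementary_definable_sets:
  assumes "projective_determinacy"
  shows "elementary definable_sets"
  unfolding elementary_def
proof (intro allI impI)
  fix \<phi> and e :: "nat \<Rightarrow> nat" and E assume E: "\<forall>X\<in>fvS \<phi>. E X \<in> definable_sets"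
  define e' where "e' = (\<lambda>i. if i \<in> fvN \<phi> then e i else 0)"
  define E' where "E' = (\<lambda>X. if X \<in> fvS \<phi> then E X else {})"
  have "Dpt e'" unfolding e'_def
    by (rule Dpt_finite_assignment[OF finite_fvN Dpt_nat Dpt_of_Dfun[OF Dfun_const_fun]])
  moreover have "Dpt E'" unfolding E'_def
    by (rule Dpt_finite_assignment[OF finite_fvS _ Dpt_of_Dfun[OF Dfun_const_empty]])
      (use E in \<open>simp add: definable_sets_def\<close>)
  ultimately have "sat definable_sets e' E' \<phi> = sat UNIV e' E' \<phi>"
    using xsat_definable_sets[OF assms, of e' E' "L2 \<phi>"] by simp
  moreover have "sat M e E \<phi> = sat M e' E' \<phi>" for M
    by (rule sat_cong) (auto simp: e'_def E'_def)
  ultimately show "sat definable_sets e E \<phi> = sat UNIV e E \<phi>" by simp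
qed

lemma elementary_nonempty:
  assumes "elementary M" shows "M \<noteq> {}"
proof -
  have "sat UNIV (\<lambda>_. 0) (\<lambda>_. {}) (ExS 0 (Eq Zero Zero))" by simp
  then have "sat M (\<lambda>_. 0) (\<lambda>_. {}) (ExS 0 (Eq Zero Zero))"
    using assms[unfolded elementary_def, rule_format, of "ExS 0 (Eq Zero Zero)" "\<lambda>_. {}"] by simp
  then show ?thesis by auto
qed

text \<open>The sentence that some set satisfies the definition of \<open>A\<close> is true in
  \<open>M\<close>, and the witness in \<open>M\<close> satisfies the definition over the full
  model as well.\<close>

lemma definable_sets_subset:
  assumes "elementary M"
  shows "definable_sets \<subseteq> M"
proof
  fix A assume "A \<in> definable_sets"
  then have "definable (enc ` {y. y = A})" by (simp add: definable_sets_def Dpt_def Dfn_def)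
  then obtain \<phi> where \<phi>: "\<And>e E. sat UNIV e E \<phi> \<longleftrightarrow> E 0 = A"
    unfolding definable_def definable_rel_def by (auto simp: enc_nat_set)
  obtain B where "B \<in> M" using elementary_nonempty[OF assms] by blast
  then have "sat M (\<lambda>_. 0) (\<lambda>_. B) (ExS 0 \<phi>) = sat UNIV (\<lambda>_. 0) (\<lambda>_. B) (ExS 0 \<phi>)"
    using assms[unfolded elementary_def, rule_format, of "ExS 0 \<phi>" "\<lambda>_. B" "\<lambda>_. 0"] \<open>B \<in> M\<close> by blast
  then obtain C where C: "C \<in> M" "sat M (\<lambda>_. 0) ((\<lambda>_. B)(0 := C)) \<phi>" by (auto simp: \<phi>)
  have "sat M (\<lambda>_. 0) ((\<lambda>_. B)(0 := C)) \<phi> = sat UNIV (\<lambda>_. 0) ((\<lambda>_. B)(0 := C)) \<phi>"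
    using assms[unfolded elementary_def, rule_format, of \<phi> "(\<lambda>_. B)(0 := C)" "\<lambda>_. 0"] C(1) \<open>B \<in> M\<close> by simp
  then have "C = A" using C(2) by (simp add: \<phi>)
  then show "A \<in> M" using C(1) by simp
qed

lemma elementary_models: "elementary M \<Longrightarrow> models UNIV \<Theta> \<Longrightarrow> models M \<Theta>"
  unfolding elementary_def models_def by simp

lemma models_Z2: "models UNIV Z2"
proof -
  have compr: "sat UNIV e E (comprehension \<phi> i X)" if "X \<notin> fvS \<phi>" for \<phi> i X e E
  proof -
    have "sat UNIV (e(i := n)) (E(X := A)) \<phi> = sat UNIV (e(i := n)) E \<phi>" for n A
      by (rule sat_cong) (use that in auto)
    then show ?thesis unfolding comprehension_def
      by (auto intro!: exI[of _ "{n. sat UNIV (e(i := n)) E \<phi>}"])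
  qed
  have axioms: "sat UNIV e E \<phi>" if "\<phi> \<in> {Neg (Eq (S (V 0)) Zero),
     Imp (Eq (S (V 0)) (S (V 1))) (Eq (V 0) (V 1)),
     Eq (Plus (V 0) Zero) (V 0),
     Eq (Plus (V 0) (S (V 1))) (S (Plus (V 0) (V 1))),
     Eq (Times (V 0) Zero) Zero,
     Eq (Times (V 0) (S (V 1))) (Plus (Times (V 0) (V 1)) (V 0)),
     Neg (Less (V 0) Zero),
     Iff (Less (V 0) (S (V 1))) (Disj (Less (V 0) (V 1)) (Eq (V 0) (V 1)))}" for \<phi> e E
    using that by (elim insertE) (simp_all add: less_Suc_eq, blast?)
  have "sat UNIV e E (AllS 0 (Imp (Conj (Mem Zero 0) (AllN 0 (Imp (Mem (V 0) 0) (Mem (S (V 0)) 0))))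
                 (AllN 0 (Mem (V 0) 0))))" for e E
    unfolding sat.simps val.simps fun_upd_same
  proof (intro ballI notI)
    fix A :: "nat set"
    assume *: "(0 \<in> A \<and> (\<forall>n. \<not> (n \<in> A \<and> \<not> Suc n \<in> A))) \<and> \<not> (\<forall>n. n \<in> A)"
    have "n \<in> A" for n by (induction n) (use * in blast)+
    then show False using * by blast
  qed
  then show ?thesis unfolding models_def Z2_def using compr axioms by blast
qed

lemma elementary_projectively_correct: "elementary M \<Longrightarrow> projectively_correct M"
  unfolding elementary_def projectively_correct_def by blast

lemma Sigma_Pi_dual:
  "(\<phi> \<in> Pi11 n \<longrightarrow> (\<exists>\<psi>\<in>Sigma11 n. fvS \<psi> = fvS \<phi> \<and> (\<forall>M e E. sat M e E \<psi> \<longleftrightarrow> \<not> sat M e E \<phi>))) \<and>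
   (\<phi> \<in> Sigma11 n \<longrightarrow> (\<exists>\<psi>\<in>Pi11 n. fvS \<psi> = fvS \<phi> \<and> (\<forall>M e E. sat M e E \<psi> \<longleftrightarrow> \<not> sat M e E \<phi>)))"
proof (induction n arbitrary: \<phi>)
  case 0
  have "fvS (Neg \<phi>) = fvS \<phi> \<and> (\<forall>M e E. sat M e E (Neg \<phi>) \<longleftrightarrow> \<not> sat M e E \<phi>)" by simp
  then show ?case by (metis Pi11.simps(1) Sigma11.simps(1) arithmetical.simps(4) mem_Collect_eq)
next
  case (Suc n)
  show ?case
  proof (intro conjI impI)
    assume "\<phi> \<in> Pi11 (Suc n)"
    then obtain X \<theta> where \<phi>: "\<phi> = AllS X \<theta>" "\<theta> \<in> Sigma11 n" by auto
    obtain \<psi> where "\<psi> \<in> Pi11 n" "fvS \<psi> = fvS \<theta>" "\<forall>M e E. sat M e E \<psi> \<longleftrightarrow> \<not> sat M e E \<theta>"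
      using Suc.IH[of \<theta>] \<phi>(2) by blast
    then show "\<exists>\<psi>\<in>Sigma11 (Suc n). fvS \<psi> = fvS \<phi> \<and> (\<forall>M e E. sat M e E \<psi> \<longleftrightarrow> \<not> sat M e E \<phi>)"
      by (intro bexI[of _ "ExS X \<psi>"]) (auto simp: \<phi>(1))
  next
    assume "\<phi> \<in> Sigma11 (Suc n)"
    then obtain X \<theta> where \<phi>: "\<phi> = ExS X \<theta>" "\<theta> \<in> Pi11 n" by auto
    obtain \<psi> where "\<psi> \<in> Sigma11 n" "fvS \<psi> = fvS \<theta>" "\<forall>M e E. sat M e E \<psi> \<longleftrightarrow> \<not> sat M e E \<theta>"
      using Suc.IH[of \<theta>] \<phi>(2) by blast
    then show "\<exists>\<psi>\<in>Pi11 (Suc n). fvS \<psi> = fvS \<phi> \<and> (\<forall>M e E. sat M e E \<psi> \<longleftrightarrow> \<not> sat M e E \<phi>)"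
      by (intro bexI[of _ "AllS X \<psi>"]) (auto simp: \<phi>(1))
  qed
qed

text \<open>A witness for a true existential formula is found in \<open>M\<close> by applying
  correctness to an equivalent \<open>Sigma11\<close> formula. The equivalence is known over the
  full model only, so one passes back to the given formula there.\<close>

lemma projectively_correct_elementary:
  assumes "projectively_correct M"
  shows "elementary M"
proof -
  note Sigma = assms[unfolded projectively_correct_def, rule_format]
  have Pi: "sat M e E \<phi> = sat UNIV e E \<phi>" if \<phi>: "\<phi> \<in> Pi11 n" "\<And>X. X \<in> fvS \<phi> \<Longrightarrow> E X \<in> M" for \<phi> n e E
  proof -
    obtain \<psi> where \<psi>: "\<psi> \<in> Sigma11 n" "fvS \<psi> = fvS \<phi>" "\<And>M e E. sat M e E \<psi> \<longleftrightarrow> \<not> sat M e E \<phi>"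
      using Sigma_Pi_dual[of \<phi> n] \<phi>(1) by blast
    have "sat M e E \<psi> = sat UNIV e E \<psi>" by (rule Sigma[OF \<psi>(1)]) (use \<phi>(2) \<psi>(2) in auto)
    then show ?thesis using \<psi>(3) by blast
  qed
  have "ExS 0 (Eq Zero Zero) \<in> Sigma11 (Suc 0)" by simp
  from Sigma[OF this, of "\<lambda>_. {}" "\<lambda>_. 0"] have "\<exists>A. A \<in> M" by auto
  then obtain C where C: "C \<in> M" by blast
  have witness: "\<exists>A\<in>M. sat UNIV e (E(X := A)) \<phi>"
    if "sat UNIV e (E(X := A)) \<phi>" "\<And>X. E X \<in> M" for e E X A \<phi>
  proof -
    obtain n where "Sigma_Pi_at n \<phi>" using eventually_Sigma_Pi_at by blast
    then obtain \<psi> where \<psi>: "\<psi> \<in> Pi11 n" "equiv_fm \<psi> \<phi>" by (auto simp: Sigma_Pi_at_def)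
    have "sat M e E (ExS X \<psi>) = sat UNIV e E (ExS X \<psi>)"
      by (rule Sigma[of _ "Suc n"]) (use \<psi>(1) that(2) in auto)
    moreover have "sat UNIV e E (ExS X \<psi>)" using that(1) \<psi>(2) by (auto simp: equiv_fm_def)
    ultimately obtain B where B: "B \<in> M" "sat M e (E(X := B)) \<psi>" by auto
    have "sat M e (E(X := B)) \<psi> = sat UNIV e (E(X := B)) \<psi>"
      by (rule Pi[OF \<psi>(1)]) (use that(2) B(1) in auto)
    then show ?thesis using B \<psi>(2) by (auto simp: equiv_fm_def)
  qed
  have total: "sat M e E \<phi> = sat UNIV e E \<phi>" if "\<And>X. E X \<in> M" for e E \<phi>
    using that
  proof (induction \<phi> arbitrary: e E)
    case (ExS X \<phi>)
    have IH: "sat M e (E(X := A)) \<phi> = sat UNIV e (E(X := A)) \<phi>" if "A \<in> M" for A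
      by (rule ExS.IH) (use that ExS.prems in auto)
    show ?case using IH witness[of e E X _ \<phi>] ExS.prems by auto
  next
    case (AllS X \<phi>)
    have IH: "sat M e (E(X := A)) \<phi> = sat UNIV e (E(X := A)) \<phi>" if "A \<in> M" for A
      by (rule AllS.IH) (use that AllS.prems in auto)
    show ?case using IH witness[of e E X _ "Neg \<phi>"] AllS.prems by auto
  qed simp_all
  show ?thesis unfolding elementary_def
  proof (intro allI impI)
    fix \<phi> e E assume E: "\<forall>X\<in>fvS \<phi>. E X \<in> M"
    define E' where "E' = (\<lambda>X. if X \<in> fvS \<phi> then E X else C)"
    have "sat N e E \<phi> = sat N e E' \<phi>" for N by (rule sat_cong) (auto simp: E'_def)
    moreover have "sat M e E' \<phi> = sat UNIV e E' \<phi>" by (rule total) (use E C in \<open>auto simp: E'_def\<close>)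
    ultimately show "sat M e E \<phi> = sat UNIV e E \<phi>" by simp
  qed
qed

text \<open>A game on a tree is an ordinary game whose payoff set \<open>won_by_I A T\<close> makes the player lose
  who leaves the tree first, and this set is definable from the parameter of \<open>A\<close> and from \<open>T\<close>.\<close>

lemma models_PD_scheme:
  assumes "projective_determinacy"
  shows "models UNIV PD_scheme"
proof -
  have "sat UNIV e E (PD_instance \<phi>)" if \<phi>: "fvN \<phi> = {}" "fvS \<phi> \<subseteq> {0, 1}" for \<phi> e E
  proof -
    have "(\<exists>\<sigma>. \<forall>x. follows_I \<sigma> x \<longrightarrow> won_by_I {x. sat UNIV e (E(0 := graph x, 1 := Y)) \<phi>} T x) \<or>
      (\<exists>\<sigma>. \<forall>x. follows_II \<sigma> x \<longrightarrow> \<not> won_by_I {x. sat UNIV e (E(0 := graph x, 1 := Y)) \<phi>} T x)" for Y T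
    proof -
      have U: "Dfn (\<lambda>A :: nat set. A \<in> UNIV)" by (simp add: Dfn_const)
      have sat: "sat UNIV e (E(0 := graph x, 1 := Y)) \<phi> = sat UNIV (\<lambda>_. 0) ((\<lambda>_. {})(0 := graph x, 1 := Y)) \<phi>" for x
        by (rule sat_cong) (use \<phi> in auto)
      have "Dfn (\<lambda>q :: (nat set \<times> nat list set) \<times> (nat \<Rightarrow> nat). won_by_I
          {x. sat UNIV (\<lambda>_. 0) ((\<lambda>_. {})(0 := graph x, 1 := fst (fst q))) \<phi>} (snd (fst q)) (snd q))"
        unfolding won_by_I_def mem_Collect_eq
        by (intro dfn Dfn_rel2[OF Dfn_sat[OF U]] Dfun_map_upt)
      from determined_Dfn[OF assms this, of "(Y, T)"]
      show ?thesis
        unfolding sat fst_conv snd_conv determined_def wins_I_def wins_II_def mem_Collect_eq .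
    qed
    then show ?thesis by (simp add: sat_PD_instance[OF \<phi>] Let_def)
  qed
  then show ?thesis unfolding models_def PD_scheme_def by blast
qed

section \<open>The bottom of the hierarchy\<close>

lemma hier_constant:
  assumes "hier \<Gamma> \<alpha> = hier \<Gamma> (osuc \<alpha>)" "\<alpha> \<le> \<gamma>"
  shows "hier \<Gamma> \<gamma> = hier \<Gamma> \<alpha>"
  using assms(2)
proof (induction \<gamma> rule: less_induct)
  case (less \<gamma>)
  show ?case
  proof (cases "\<gamma> = \<alpha>")
    case False
    then have "\<alpha> < \<gamma>" using less.prems by simp
    show ?thesis
    proof (cases "\<exists>\<delta>. \<gamma> = osuc \<delta>")
      case True
      then obtain \<delta> where \<delta>: "\<gamma> = osuc \<delta>" by blast
      have "\<alpha> \<le> \<delta>" using \<open>\<alpha> < \<gamma>\<close> osuc_le[of \<delta> \<alpha>] unfolding \<delta> by (meson leD linorder_not_le)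
      then have *: "hier \<Gamma> \<delta> = hier \<Gamma> \<alpha>" using less.IH[of \<delta>] less_osuc \<delta> by blast
      have "hier \<Gamma> \<gamma> = Def \<Gamma> (hier \<Gamma> \<delta>)" unfolding \<delta> by (rule hier_osuc)
      also have "\<dots> = hier \<Gamma> (osuc \<alpha>)" unfolding * by (rule hier_osuc[symmetric])
      also have "\<dots> = hier \<Gamma> \<alpha>" by (rule assms(1)[symmetric])
      finally show ?thesis .
    next
      case False
      have "hier \<Gamma> \<delta> \<subseteq> hier \<Gamma> \<alpha>" if "\<delta> < \<gamma>" for \<delta>
      proof (cases "\<alpha> \<le> \<delta>")
        case True
        then show ?thesis using less.IH[OF that] by simp
      next
        case False
        then show ?thesis using hier_mono[of \<delta> \<alpha> \<Gamma>] by simp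
      qed
      then show ?thesis using \<open>\<alpha> < \<gamma>\<close> unfolding hier_limit[OF False] by blast
    qed
  qed simp
qed

lemma P_game_fixed: "hier \<Gamma> (LEAST \<beta>. hier \<Gamma> \<beta> = hier \<Gamma> (osuc \<beta>)) = hier \<Gamma> (osuc (LEAST \<beta>. hier \<Gamma> \<beta> = hier \<Gamma> (osuc \<beta>)))"
  using LeastI_ex[OF hier_fixed_point[of \<Gamma>]] .

lemma P_game_eqI:
  assumes "hier \<Gamma> \<alpha> = hier \<Gamma> (osuc \<alpha>)"
  shows "P_game \<Gamma> = hier \<Gamma> \<alpha>"
  unfolding P_game_def using hier_constant[OF P_game_fixed Least_le[of "\<lambda>\<beta>. hier \<Gamma> \<beta> = hier \<Gamma> (osuc \<beta>)", OF assms]]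
  by simp

lemma hier_subset_P_game: "hier \<Gamma> \<alpha> \<subseteq> P_game \<Gamma>"
proof (cases "(LEAST \<beta>. hier \<Gamma> \<beta> = hier \<Gamma> (osuc \<beta>)) \<le> \<alpha>")
  case True
  then show ?thesis using hier_constant[OF P_game_fixed True] by (simp add: P_game_def)
next
  case False
  then show ?thesis using hier_mono[of \<alpha> _ \<Gamma>] by (simp add: P_game_def)
qed

lemma Def_empty: "Def \<Gamma> {} = hier \<Gamma> (osuc (LEAST \<beta>. True))"
  by (simp add: hier_osuc hier_zero)

lemma Def_mono: "\<Gamma> \<subseteq> \<Gamma>' \<Longrightarrow> Def \<Gamma> M \<subseteq> Def \<Gamma>' M"
proof -
  assume "\<Gamma> \<subseteq> \<Gamma>'"
  then have "in_lang \<Gamma> \<chi> \<Longrightarrow> in_lang \<Gamma>' \<chi>" for \<chi> by (induction \<chi>) auto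
  then show ?thesis unfolding Def_def by blast
qed

lemma Dpt_xsat_set:
  assumes M: "Dfn (\<lambda>A. A \<in> M)" and E: "Dpt E"
  shows "Dpt {n. xsat M ((\<lambda>_. 0)(0 := n)) E \<chi>}"
proof (rule Dpt_Collect)
  show "Dfn (\<lambda>n. xsat M ((\<lambda>_. 0)(0 := n)) E \<chi>)"
    by (rule Dfn_rel2[OF Dfn_xsat[OF M] _ Dfun_const[OF E]]) (intro dfn)
qed

lemma Def_empty_subset: "Def \<Gamma> {} \<subseteq> definable_sets"
proof
  fix Y assume "Y \<in> Def \<Gamma> {}"
  then obtain \<chi> E where \<chi>: "\<forall>X\<in>xfvS \<chi>. E X \<in> ({} :: nat set set)"
    "Y = {n. xsat {} ((\<lambda>_. 0)(0 := n)) E \<chi>}" unfolding Def_def by blast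
  have "xsat {} ((\<lambda>_. 0)(0 := n)) E \<chi> = xsat {} ((\<lambda>_. 0)(0 := n)) (\<lambda>_. {}) \<chi>" for n
    by (rule xsat_cong) (use \<chi>(1) in auto)
  moreover have "Dfn (\<lambda>A :: nat set. A \<in> {})" by (simp add: Dfn_const)
  moreover have "Dpt (\<lambda>_ :: nat. {} :: nat set)" by (rule Dpt_of_Dfun) (intro dfn)
  ultimately show "Y \<in> definable_sets" unfolding \<chi>(2) by (simp add: Dpt_xsat_set definable_sets_def)
qed

text \<open>By elementarity the formulas may be evaluated over the full model instead.\<close>

lemma Def_definable_sets:
  assumes "projective_determinacy"
  shows "Def \<Gamma> definable_sets = definable_sets"
proof
  show "Def \<Gamma> definable_sets \<subseteq> definable_sets"
  proof
    fix Y assume "Y \<in> Def \<Gamma> definable_sets"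
    then obtain \<chi> E where \<chi>: "\<forall>X\<in>xfvS \<chi>. E X \<in> definable_sets"
      "Y = {n. xsat definable_sets ((\<lambda>_. 0)(0 := n)) E \<chi>}" unfolding Def_def by blast
    define E' where "E' = (\<lambda>X. if X \<in> xfvS \<chi> then E X else {})"
    have E': "Dpt E'" unfolding E'_def
      by (rule Dpt_finite_assignment[OF finite_xfvS _ Dpt_of_Dfun[OF Dfun_const_empty]])
        (use \<chi>(1) in \<open>simp add: definable_sets_def\<close>)
    have "Dpt ((\<lambda>_ :: nat. 0 :: nat)(0 := n))" for n
      by (rule Dpt_fun_upd[OF Dpt_of_Dfun[OF Dfun_const_fun] Dpt_nat Dpt_nat])
    from xsat_definable_sets[OF assms this E']
    have "xsat definable_sets ((\<lambda>_. 0)(0 := n)) E' \<chi> = xsat UNIV ((\<lambda>_. 0)(0 := n)) E' \<chi>" for n .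
    moreover have "xsat definable_sets ((\<lambda>_. 0)(0 := n)) E \<chi> = xsat definable_sets ((\<lambda>_. 0)(0 := n)) E' \<chi>" for n
      by (rule xsat_cong) (auto simp: E'_def)
    moreover have "Dfn (\<lambda>A :: nat set. A \<in> UNIV)" by (simp add: Dfn_const)
    ultimately show "Y \<in> definable_sets" unfolding \<chi>(2) using E' by (simp add: Dpt_xsat_set definable_sets_def)
  qed
qed (rule Def_increasing)

text \<open>Player I writes a set with his moves; the moves of player II are irrelevant.\<close>

lemma wins_I_even_moves: "wins_I {x. P {m. x (m + m) = Suc 0}} \<longleftrightarrow> (\<exists>B. P B)"
proof
  assume "wins_I {x. P {m. x (m + m) = Suc 0}}"
  then obtain \<sigma> where \<sigma>: "\<And>x. follows_I \<sigma> x \<Longrightarrow> P {m. x (m + m) = Suc 0}" unfolding wins_I_def by blast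
  have "follows_I \<sigma> (play_seq True \<sigma> (\<lambda>_. 0))" by (simp add: follows_I_def play_seq_def play_eq)
  then show "\<exists>B. P B" using \<sigma> by blast
next
  assume "\<exists>B. P B"
  then obtain B where B: "P B" by blast
  have "{m. x (m + m) = Suc 0} = B" if "follows_I (\<lambda>l. of_bool (length l div 2 \<in> B)) x" for x
    using that by (auto simp: follows_I_def)
  then show "wins_I {x. P {m. x (m + m) = Suc 0}}" unfolding wins_I_def using B by auto
qed

text \<open>Player II writes the set, and player I has to be content with any outcome.\<close>

lemma wins_I_odd_moves: "wins_I {x. P {m. x (Suc (m + m)) = Suc 0}} \<longleftrightarrow> (\<forall>B. P B)"
proof
  assume "wins_I {x. P {m. x (Suc (m + m)) = Suc 0}}"
  then obtain \<sigma> where \<sigma>: "\<And>x. follows_I \<sigma> x \<Longrightarrow> P {m. x (Suc (m + m)) = Suc 0}" unfolding wins_I_def by blast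
  show "\<forall>B. P B"
  proof
    fix B
    define x where "x = play_seq True \<sigma> (\<lambda>k. of_bool (k \<in> B))"
    have "follows_I \<sigma> x" by (simp add: x_def follows_I_def play_seq_def play_eq)
    moreover have "{m. x (Suc (m + m)) = Suc 0} = B" by (auto simp: x_def play_seq_def)
    ultimately show "P B" using \<sigma>[of x] by simp
  qed
next
  assume "\<forall>B. P B"
  then show "wins_I {x. P {m. x (Suc (m + m)) = Suc 0}}" unfolding wins_I_def by auto
qed

text \<open>The set variable \<open>X\<close> is replaced by the set that the moves at the
  positions \<open>t(m)\<close> write down. This is an arithmetical substitution, so it does not
  leave the class.\<close>

lemma game_definable:
  assumes \<Gamma>: "\<And>j \<rho> \<delta>. (\<And>X. arithmetical (\<delta> X)) \<Longrightarrow> psubst j \<alpha> \<rho> \<delta> \<in> \<Gamma>" and t: "vars_tm t = {1}"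
    and A: "\<And>k. k \<in> A \<longleftrightarrow>
      wins_I {x. sat UNIV (\<lambda>_. k) ((\<lambda>_. {})(X := {m. x (val ((\<lambda>_. 0)(1 := m)) t) = Suc 0})) \<alpha>}"
  shows "A \<in> Def \<Gamma> M"
proof -
  define \<delta> where "\<delta> = (\<lambda>Y. if Y = X then pair_in 0 t (S Zero) else Eq Zero (S Zero))"
  define \<Phi> where "\<Phi> = psubst 1 \<alpha> (\<lambda>_. V 0) \<delta>"
  have ar: "arithmetical (\<delta> Y)" for Y by (simp add: \<delta>_def pair_in_def is_pair_def)
  have cls: "\<Phi> \<in> \<Gamma>"
    unfolding \<Phi>_def by (rule \<Gamma>[OF ar])
  have d: "fvN (\<delta> Y) - {1} \<subseteq> {0}" "fvS (\<delta> Y) \<subseteq> {0, 1}" for Y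
    using t by (auto simp: \<delta>_def pair_in_def is_pair_def)
  have "(\<Union>i\<in>fvN \<alpha>. vars_tm (V 0)) \<subseteq> {0}" by (rule UN_least) simp
  from Un_least[OF this UN_least[OF d(1)]] have fv: "fvN \<Phi> \<subseteq> {0}"
    unfolding \<Phi>_def by (rule order_trans[OF fvN_psubst])
  have fv': "fvS \<Phi> \<subseteq> {0, 1}"
    unfolding \<Phi>_def by (rule order_trans[OF fvS_psubst UN_least[OF d(2)]])
  have sat: "sat UNIV e E \<Phi> \<longleftrightarrow>
      sat UNIV (\<lambda>_. e 0) ((\<lambda>_. {})(X := {m. x (val ((\<lambda>_. 0)(1 := m)) t) = Suc 0})) \<alpha>"
    if "E 0 = graph x" for e E x
  proof -
    have v: "val (e(1 := m)) t = val ((\<lambda>_. 0)(1 := m)) t" for m by (rule val_cong) (simp add: t)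
    have "{m. sat UNIV (e(1 := m)) E (\<delta> Y)} =
        ((\<lambda>_. {})(X := {m. x (val ((\<lambda>_. 0)(1 := m)) t) = Suc 0})) Y" for Y
      using that by (auto simp: \<delta>_def sat_pair_in t v simp del: One_nat_def)
    then show ?thesis unfolding \<Phi>_def by (subst sat_psubst) (simp_all add: fun_upd_def del: One_nat_def)
  qed
  define \<chi> where "\<chi> = Game 0 \<Phi> (Eq Zero Zero)"
  have "k \<in> A \<longleftrightarrow> xsat M ((\<lambda>_. 0)(0 := k)) (\<lambda>_. {}) \<chi>" for k
  proof -
    have "sat UNIV ((\<lambda>_. 0)(0 := k)) ((\<lambda>_. {})(0 := graph x, 1 := B)) \<Phi> \<longleftrightarrow>
        sat UNIV (\<lambda>_. k) ((\<lambda>_. {})(X := {m. x (val ((\<lambda>_. 0)(1 := m)) t) = Suc 0})) \<alpha>" for x B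
      using sat[of "(\<lambda>_. {})(0 := graph x, 1 := B)" x "(\<lambda>_. 0)(0 := k)"] by simp
    then show ?thesis by (simp only: A \<chi>_def xsat.simps fun_upd_same)
  qed
  then have "A = {k. xsat M ((\<lambda>_. 0)(0 := k)) (\<lambda>_. {}) \<chi>}" by blast
  moreover have "in_lang \<Gamma> \<chi>" "xfvN \<chi> \<subseteq> {0}" "xfvS \<chi> = {}"
    using cls fv fv' by (simp_all add: \<chi>_def)
  ultimately show ?thesis unfolding Def_def by blast
qed

lemma game_definable_Sigma:
  assumes "\<alpha> \<in> Sigma11 n" "vars_tm t = {1}"
    and "\<And>k. k \<in> A \<longleftrightarrow>
      wins_I {x. sat UNIV (\<lambda>_. k) ((\<lambda>_. {})(X := {m. x (val ((\<lambda>_. 0)(1 := m)) t) = Suc 0})) \<alpha>}"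
  shows "A \<in> Def (Sigma11 n) M"
proof (rule game_definable[OF _ assms(2,3)])
  show "psubst j \<alpha> \<rho> \<delta> \<in> Sigma11 n" if "\<And>X. arithmetical (\<delta> X)" for j \<rho> \<delta>
    using Sigma11_psubst[OF that assms(1)] .
qed

lemma game_definable_Pi:
  assumes "\<alpha> \<in> Pi11 n" "vars_tm t = {1}"
    and "\<And>k. k \<in> A \<longleftrightarrow>
      wins_I {x. sat UNIV (\<lambda>_. k) ((\<lambda>_. {})(X := {m. x (val ((\<lambda>_. 0)(1 := m)) t) = Suc 0})) \<alpha>}"
  shows "A \<in> Def (Pi11 n) M"
proof (rule game_definable[OF _ assms(2,3)])
  show "psubst j \<alpha> \<rho> \<delta> \<in> Pi11 n" if "\<And>X. arithmetical (\<delta> X)" for j \<rho> \<delta>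
    using Pi11_psubst[OF that assms(1)] .
qed

lemma definable_set_number_variable:
  assumes "Dpt (A :: nat set)"
  obtains \<phi> where "\<And>e E. sat UNIV e E \<phi> \<longleftrightarrow> e 0 \<in> A"
proof -
  from assms have "definable (enc ` {y. y = A})" by (simp add: Dpt_def Dfn_def)
  then obtain \<phi> where \<phi>: "\<And>e E. sat UNIV e E \<phi> \<longleftrightarrow> E 0 = A"
    unfolding definable_def definable_rel_def by (auto simp: enc_nat_set)
  show thesis by (rule that[of "ExS 0 (Conj \<phi> (Mem (V 0) 0))"]) (simp add: \<phi>)
qed

text \<open>\<open>A\<close> has a definition \<open>\<exists>B. \<alpha>\<close> with
  \<open>\<alpha>\<close> in an odd level \<open>Pi11\<close>, and player I can play
  \<open>B\<close>.\<close>

lemma definable_sets_Pi: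
  assumes "A \<in> definable_sets"
  obtains k where "A \<in> Def (Pi11 (2 * k + 1)) {}"
proof -
  obtain \<phi> where \<phi>: "\<And>e E. sat UNIV e E \<phi> \<longleftrightarrow> e 0 \<in> A"
    using definable_set_number_variable[of A] assms by (auto simp: definable_sets_def)
  obtain n where n: "\<And>m. m \<ge> n \<Longrightarrow> Sigma_Pi_at m \<phi>" using eventually_Sigma_Pi_at by blast
  have "Sigma_Pi_at (Suc (2 * n + 1)) \<phi>" by (rule n) simp
  then obtain X \<alpha> where \<alpha>: "\<alpha> \<in> Pi11 (2 * n + 1)" "equiv_fm (ExS X \<alpha>) \<phi>" by (auto simp: Sigma_Pi_at_def)
  have "A \<in> Def (Pi11 (2 * n + 1)) {}"
  proof (rule game_definable_Pi[OF \<alpha>(1), of "Plus (V 1) (V 1)"])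
    fix k
    have "k \<in> A \<longleftrightarrow> (\<exists>B. sat UNIV (\<lambda>_. k) ((\<lambda>_. {})(X := B)) \<alpha>)"
      using \<alpha>(2) \<phi>[of "\<lambda>_. k" "\<lambda>_. {}"] by (simp add: equiv_fm_def)
    also have "\<dots> \<longleftrightarrow> wins_I {x. sat UNIV (\<lambda>_. k) ((\<lambda>_. {})(X := {m. x (m + m) = Suc 0})) \<alpha>}"
      by (rule wins_I_even_moves[symmetric])
    finally show "k \<in> A \<longleftrightarrow> wins_I {x. sat UNIV (\<lambda>_. k)
        ((\<lambda>_. {})(X := {m. x (val ((\<lambda>_. 0)(1 := m)) (Plus (V 1) (V 1))) = Suc 0})) \<alpha>}" by simp
  qed simp
  then show thesis by (rule that)
qed

text \<open>\<open>A\<close> has a definition \<open>\<forall>B. \<alpha>\<close> with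
  \<open>\<alpha>\<close> in an even level \<open>Sigma11\<close>, and player II can play
  \<open>B\<close>.\<close>

lemma definable_sets_Sigma:
  assumes "A \<in> definable_sets"
  obtains k where "k \<ge> 1" "A \<in> Def (Sigma11 (2 * k)) {}"
proof -
  obtain \<phi> where \<phi>: "\<And>e E. sat UNIV e E \<phi> \<longleftrightarrow> e 0 \<in> A"
    using definable_set_number_variable[of A] assms by (auto simp: definable_sets_def)
  obtain n where n: "\<And>m. m \<ge> n \<Longrightarrow> Sigma_Pi_at m \<phi>" using eventually_Sigma_Pi_at by blast
  have "Sigma_Pi_at (Suc (2 * Suc n)) \<phi>" by (rule n) simp
  then obtain X \<alpha> where \<alpha>: "\<alpha> \<in> Sigma11 (2 * Suc n)" "equiv_fm (AllS X \<alpha>) \<phi>"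
    by (auto simp only: Sigma_Pi_at_def Pi11.simps)
  have "A \<in> Def (Sigma11 (2 * Suc n)) {}"
  proof (rule game_definable_Sigma[OF \<alpha>(1), of "S (Plus (V 1) (V 1))"])
    fix k
    have "k \<in> A \<longleftrightarrow> (\<forall>B. sat UNIV (\<lambda>_. k) ((\<lambda>_. {})(X := B)) \<alpha>)"
      using \<alpha>(2) \<phi>[of "\<lambda>_. k" "\<lambda>_. {}"] by (simp add: equiv_fm_def)
    also have "\<dots> \<longleftrightarrow> wins_I {x. sat UNIV (\<lambda>_. k) ((\<lambda>_. {})(X := {m. x (Suc (m + m)) = Suc 0})) \<alpha>}"
      by (rule wins_I_odd_moves[symmetric])
    finally show "k \<in> A \<longleftrightarrow> wins_I {x. sat UNIV (\<lambda>_. k)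
        ((\<lambda>_. {})(X := {m. x (val ((\<lambda>_. 0)(1 := m)) (S (Plus (V 1) (V 1)))) = Suc 0})) \<alpha>}" by simp
  qed simp
  then show thesis using that[of "Suc n"] by simp
qed

text \<open>The hierarchy is constant from its first level on.\<close>

lemma P_Proj_eq:
  assumes "projective_determinacy"
  shows "P_Proj = definable_sets"
proof -
  have "Pi11 k \<subseteq> Proj" for k by (auto simp: Proj_def)
  then have "definable_sets \<subseteq> Def Proj {}"
    using definable_sets_Pi Def_mono by (metis subsetD subsetI)
  then have 1: "hier Proj (osuc (LEAST \<beta>. True)) = definable_sets"
    using Def_empty_subset[of Proj] by (simp add: Def_empty[symmetric] subset_antisym)
  have "hier Proj (osuc (osuc (LEAST \<beta>. True))) = Def Proj definable_sets"
    unfolding hier_osuc[of Proj "osuc (LEAST \<beta>. True)"] 1 ..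
  then have "hier Proj (osuc (LEAST \<beta>. True)) = hier Proj (osuc (osuc (LEAST \<beta>. True)))"
    using Def_definable_sets[OF assms] 1 by simp
  from P_game_eqI[OF this] show ?thesis unfolding P_Proj_def 1 .
qed

section \<open>Truth definitions\<close>

lemmas Dfun_boolI = Dfun_bool[THEN iffD2]

lemma extend_finite:
  assumes "finite F"
  shows "\<exists>l. \<forall>i\<in>F. extend l i = f i"
proof -
  obtain k where k: "\<forall>i\<in>F. i < k" using assms finite_nat_set_iff_bounded by blast
  then show ?thesis by (intro exI[of _ "map f [0..<k]"]) simp
qed

lemma extend_update: "\<exists>l'. extend l' = (extend l)(i := n)"
proof
  show "extend (map ((extend l)(i := n)) [0..<length l + Suc i]) = (extend l)(i := n)"
    by (rule ext) (auto simp: extend_def nth_append simp del: upt_Suc)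
qed

lemma extend_singleton: "extend [n] = (\<lambda>_. 0)(0 := n)"
  by (auto simp: extend_def fun_eq_iff)

lemma Dfun_extend_fun: "Dfun f \<Longrightarrow> Dfun (\<lambda>x. extend (f x))"
  by (rule Dpt_apply[OF Dpt_extend])

lemma Dpt_val: "Dpt (\<lambda>t l. val (extend l) t)"
proof (rule Dpt_unique)
  let ?P = "\<lambda>v :: tm \<Rightarrow> nat list \<Rightarrow> nat. \<forall>l. (\<forall>i. v (V i) l = extend l i) \<and> v Zero l = 0 \<and>
    (\<forall>t. v (S t) l = Suc (v t l)) \<and> (\<forall>s t. v (Plus s t) l = v s l + v t l) \<and>
    (\<forall>s t. v (Times s t) l = v s l * v t l)"
  show "Dfn ?P" by (intro dfn Dfun_extend)
  show "?P (\<lambda>t l. val (extend l) t)" by simp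
  show "v = (\<lambda>t l. val (extend l) t)" if v: "?P v" for v
  proof (rule ext, rule ext)
    show "v t l = val (extend l) t" for t l
      by (induction t) (simp_all add: v)
  qed
qed

lemmas Dfun_val_code = Dpt_apply2[OF Dpt_val]

text \<open>Assignments are coded by lists \<open>l\<close> and \<open>b\<close>. Set variables
  take values in the family \<open>F\<close>, and \<open>b\<close> lists the indices of these
  values; the range of the set quantifiers is the image of the index set \<open>J\<close>.\<close>

definition sat_code :: "(nat \<Rightarrow> nat set) \<Rightarrow> nat set \<Rightarrow> fm \<Rightarrow> nat list \<Rightarrow> nat list \<Rightarrow> bool" where
  "sat_code F J \<phi> l b \<longleftrightarrow> sat (F ` J) (extend l) (\<lambda>X. F (extend b X)) \<phi>"

text \<open>The clauses of Tarski, formulated as a property of a function \<open>T\<close> in such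
  a way that its definability is evident. In particular, updates of coded assignments are
  expressed by quantifiers over lists.\<close>

definition sat_clauses :: "(nat \<Rightarrow> nat set) \<Rightarrow> nat set \<Rightarrow> (fm \<Rightarrow> nat list \<Rightarrow> nat list \<Rightarrow> bool) \<Rightarrow> bool" where
  "sat_clauses F J T \<longleftrightarrow> (\<forall>l b.
    (\<forall>s t. T (Eq s t) l b = (val (extend l) s = val (extend l) t)) \<and>
    (\<forall>s t. T (Less s t) l b = (val (extend l) s < val (extend l) t)) \<and>
    (\<forall>t X. T (Mem t X) l b = (val (extend l) t \<in> F (extend b X))) \<and>
    (\<forall>\<phi>. T (Neg \<phi>) l b = (\<not> T \<phi> l b)) \<and>
    (\<forall>\<phi> \<psi>. T (Conj \<phi> \<psi>) l b = (T \<phi> l b \<and> T \<psi> l b)) \<and>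
    (\<forall>i \<phi>. T (ExN i \<phi>) l b = (\<exists>n l'. extend l' = (extend l)(i := n) \<and> T \<phi> l' b)) \<and>
    (\<forall>i \<phi>. T (AllN i \<phi>) l b = (\<forall>n l'. extend l' = (extend l)(i := n) \<longrightarrow> T \<phi> l' b)) \<and>
    (\<forall>X \<phi>. T (ExS X \<phi>) l b = (\<exists>j b'. j \<in> J \<and> extend b' = (extend b)(X := j) \<and> T \<phi> l b')) \<and>
    (\<forall>X \<phi>. T (AllS X \<phi>) l b = (\<forall>j b'. j \<in> J \<longrightarrow> extend b' = (extend b)(X := j) \<longrightarrow> T \<phi> l b')))"

lemma ex_extend_update: "(\<exists>l'. extend l' = (extend l)(i := n) \<and> P (extend l')) \<longleftrightarrow> P ((extend l)(i := n))"
  and all_extend_update: "(\<forall>l'. extend l' = (extend l)(i := n) \<longrightarrow> P (extend l')) \<longleftrightarrow> P ((extend l)(i := n))"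
  using extend_update[of l i n] by metis+

lemma index_update: "(\<lambda>Y. F (((extend b)(X := j)) Y)) = (\<lambda>Y. F (extend b Y))(X := F j)"
  by auto

lemma sat_code_quantifiers:
  "sat_code F J (ExN i \<phi>) l b \<longleftrightarrow> (\<exists>n l'. extend l' = (extend l)(i := n) \<and> sat_code F J \<phi> l' b)"
  "sat_code F J (AllN i \<phi>) l b \<longleftrightarrow> (\<forall>n l'. extend l' = (extend l)(i := n) \<longrightarrow> sat_code F J \<phi> l' b)"
  "sat_code F J (ExS X \<phi>) l b \<longleftrightarrow> (\<exists>j b'. j \<in> J \<and> extend b' = (extend b)(X := j) \<and> sat_code F J \<phi> l b')"
  "sat_code F J (AllS X \<phi>) l b \<longleftrightarrow> (\<forall>j b'. j \<in> J \<longrightarrow> extend b' = (extend b)(X := j) \<longrightarrow> sat_code F J \<phi> l b')"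
proof -
  note ex = ex_extend_update[where P = "\<lambda>e. sat (F ` J) e (\<lambda>X. F (extend b X)) \<phi>"]
    and all = all_extend_update[where P = "\<lambda>e. sat (F ` J) e (\<lambda>X. F (extend b X)) \<phi>"]
    and exS = ex_extend_update[where P = "\<lambda>d. sat (F ` J) (extend l) (\<lambda>X. F (d X)) \<phi>"]
    and allS = all_extend_update[where P = "\<lambda>d. sat (F ` J) (extend l) (\<lambda>X. F (d X)) \<phi>"]
  show "sat_code F J (ExN i \<phi>) l b \<longleftrightarrow> (\<exists>n l'. extend l' = (extend l)(i := n) \<and> sat_code F J \<phi> l' b)"
    unfolding sat_code_def sat.simps ex ..
  show "sat_code F J (AllN i \<phi>) l b \<longleftrightarrow> (\<forall>n l'. extend l' = (extend l)(i := n) \<longrightarrow> sat_code F J \<phi> l' b)"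
    unfolding sat_code_def sat.simps all ..
  have "(\<exists>j b'. j \<in> J \<and> extend b' = (extend b)(X := j) \<and> sat_code F J \<phi> l b') \<longleftrightarrow>
      (\<exists>j. j \<in> J \<and> (\<exists>b'. extend b' = (extend b)(X := j) \<and> sat (F ` J) (extend l) (\<lambda>X. F (extend b' X)) \<phi>))"
    unfolding sat_code_def by blast
  then show "sat_code F J (ExS X \<phi>) l b \<longleftrightarrow> (\<exists>j b'. j \<in> J \<and> extend b' = (extend b)(X := j) \<and> sat_code F J \<phi> l b')"
    unfolding exS index_update unfolding sat_code_def sat.simps by blast
  have "(\<forall>j b'. j \<in> J \<longrightarrow> extend b' = (extend b)(X := j) \<longrightarrow> sat_code F J \<phi> l b') \<longleftrightarrow>
      (\<forall>j. j \<in> J \<longrightarrow> (\<forall>b'. extend b' = (extend b)(X := j) \<longrightarrow> sat (F ` J) (extend l) (\<lambda>X. F (extend b' X)) \<phi>))"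
    unfolding sat_code_def by blast
  then show "sat_code F J (AllS X \<phi>) l b \<longleftrightarrow> (\<forall>j b'. j \<in> J \<longrightarrow> extend b' = (extend b)(X := j) \<longrightarrow> sat_code F J \<phi> l b')"
    unfolding allS index_update unfolding sat_code_def sat.simps by blast
qed

lemma sat_clauses_sat_code: "sat_clauses F J (sat_code F J)"
  unfolding sat_clauses_def sat_code_quantifiers by (simp add: sat_code_def)

lemma sat_clauses_unique: "sat_clauses F J T \<Longrightarrow> T \<phi> l b = sat_code F J \<phi> l b"
proof (induction \<phi> arbitrary: l b)
  note c = sat_clauses_def[of F J T]
  {
    case (Eq s t)
    then show ?case unfolding c by (simp add: sat_code_def)
  next
    case (Less s t)
    then show ?case unfolding c by (simp add: sat_code_def)
  next
    case (Mem t X)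
    then show ?case unfolding c by (simp add: sat_code_def)
  next
    case (Neg \<phi>)
    have "T (Neg \<phi>) l b = (\<not> T \<phi> l b)" using Neg.prems unfolding c by simp
    then show ?case using Neg by (simp add: sat_code_def)
  next
    case (Conj \<phi> \<psi>)
    have "T (Conj \<phi> \<psi>) l b = (T \<phi> l b \<and> T \<psi> l b)" using Conj.prems unfolding c by simp
    then show ?case using Conj by (simp add: sat_code_def)
  next
    case (ExN i \<phi>)
    have "T (ExN i \<phi>) l b = (\<exists>n l'. extend l' = (extend l)(i := n) \<and> T \<phi> l' b)"
      using ExN.prems unfolding c by simp
    then show ?case unfolding sat_code_quantifiers ExN.IH[OF ExN.prems] .
  next
    case (AllN i \<phi>)
    have "T (AllN i \<phi>) l b = (\<forall>n l'. extend l' = (extend l)(i := n) \<longrightarrow> T \<phi> l' b)"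
      using AllN.prems unfolding c by simp
    then show ?case unfolding sat_code_quantifiers AllN.IH[OF AllN.prems] .
  next
    case (ExS X \<phi>)
    have "T (ExS X \<phi>) l b = (\<exists>j b'. j \<in> J \<and> extend b' = (extend b)(X := j) \<and> T \<phi> l b')"
      using ExS.prems unfolding c by simp
    then show ?case unfolding sat_code_quantifiers ExS.IH[OF ExS.prems] .
  next
    case (AllS X \<phi>)
    have "T (AllS X \<phi>) l b = (\<forall>j b'. j \<in> J \<longrightarrow> extend b' = (extend b)(X := j) \<longrightarrow> T \<phi> l b')"
      using AllS.prems unfolding c by simp
    then show ?case unfolding sat_code_quantifiers AllS.IH[OF AllS.prems] .
  }
qed

text \<open>Satisfaction over a countable model is definable uniformly in the model and in the
  formula, as the unique solution of the clauses.\<close>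

lemma Dfn_sat_code:
  assumes "Dfun F" "Dfun J" "Dfun f" "Dfun l" "Dfun b"
  shows "Dfn (\<lambda>x. sat_code (F x) (J x) (f x) (l x) (b x))"
proof -
  have eq: "sat_code F J \<phi> l b \<longleftrightarrow> (\<exists>T. sat_clauses F J T \<and> T \<phi> l b)" for F J \<phi> l b
    using sat_clauses_unique sat_clauses_sat_code by blast
  have "Dfn (\<lambda>p :: (nat \<Rightarrow> nat set) \<times> nat set \<times> fm \<times> nat list \<times> nat list.
      sat_code (fst p) (fst (snd p)) (fst (snd (snd p))) (fst (snd (snd (snd p)))) (snd (snd (snd (snd p)))))"
    unfolding eq sat_clauses_def
    by (intro dfn Dfun_boolI Dfun_val_code Dfun_extend Dfun_extend_fun)
  from Dfn_vimage[OF this Dfun_Pair[OF assms(1) Dfun_Pair[OF assms(2) Dfun_Pair[OF assms(3)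
          Dfun_Pair[OF assms(4,5)]]]]]
  show ?thesis by simp
qed

subsection \<open>Notions of syntax\<close>

lemma Dpt_vars_tm: "Dpt vars_tm"
proof (rule Dpt_unique)
  let ?P = "\<lambda>v :: tm \<Rightarrow> nat set. \<forall>m. (\<forall>i. m \<in> v (V i) \<longleftrightarrow> m = i) \<and> (m \<notin> v Zero) \<and>
    (\<forall>t. m \<in> v (S t) \<longleftrightarrow> m \<in> v t) \<and> (\<forall>s t. m \<in> v (Plus s t) \<longleftrightarrow> m \<in> v s \<or> m \<in> v t) \<and>
    (\<forall>s t. m \<in> v (Times s t) \<longleftrightarrow> m \<in> v s \<or> m \<in> v t)"
  show "Dfn ?P" by (intro dfn Dfun_boolI)
  show "?P vars_tm" by simp
  show "v = vars_tm" if v: "?P v" for v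
  proof
    show "v t = vars_tm t" for t by (induction t) (simp_all add: set_eq_iff v)
  qed
qed

lemmas Dfun_vars_tm = Dpt_apply[OF Dpt_vars_tm]

lemma Dpt_fvN: "Dpt fvN"
proof (rule Dpt_unique)
  let ?P = "\<lambda>v :: fm \<Rightarrow> nat set. \<forall>m.
    (\<forall>s t. (m \<in> v (Eq s t) \<longleftrightarrow> m \<in> vars_tm s \<or> m \<in> vars_tm t) \<and>
      (m \<in> v (Less s t) \<longleftrightarrow> m \<in> vars_tm s \<or> m \<in> vars_tm t)) \<and>
    (\<forall>t X. m \<in> v (Mem t X) \<longleftrightarrow> m \<in> vars_tm t) \<and>
    (\<forall>\<phi>. m \<in> v (Neg \<phi>) \<longleftrightarrow> m \<in> v \<phi>) \<and> (\<forall>\<phi> \<psi>. m \<in> v (Conj \<phi> \<psi>) \<longleftrightarrow> m \<in> v \<phi> \<or> m \<in> v \<psi>) \<and>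
    (\<forall>i \<phi>. (m \<in> v (ExN i \<phi>) \<longleftrightarrow> m \<in> v \<phi> \<and> m \<noteq> i) \<and> (m \<in> v (AllN i \<phi>) \<longleftrightarrow> m \<in> v \<phi> \<and> m \<noteq> i) \<and>
      (m \<in> v (ExS i \<phi>) \<longleftrightarrow> m \<in> v \<phi>) \<and> (m \<in> v (AllS i \<phi>) \<longleftrightarrow> m \<in> v \<phi>))"
  show "Dfn ?P" by (intro dfn Dfun_boolI Dfun_vars_tm)
  show "?P fvN" by simp
  show "v = fvN" if v: "?P v" for v
  proof
    show "v \<phi> = fvN \<phi>" for \<phi> by (induction \<phi>) (simp_all add: set_eq_iff v)
  qed
qed

lemmas Dfun_fvN = Dpt_apply[OF Dpt_fvN]

lemma Dpt_fvS: "Dpt fvS"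
proof (rule Dpt_unique)
  let ?P = "\<lambda>v :: fm \<Rightarrow> nat set. \<forall>m.
    (\<forall>s t. m \<notin> v (Eq s t) \<and> m \<notin> v (Less s t)) \<and>
    (\<forall>t X. m \<in> v (Mem t X) \<longleftrightarrow> m = X) \<and>
    (\<forall>\<phi>. m \<in> v (Neg \<phi>) \<longleftrightarrow> m \<in> v \<phi>) \<and> (\<forall>\<phi> \<psi>. m \<in> v (Conj \<phi> \<psi>) \<longleftrightarrow> m \<in> v \<phi> \<or> m \<in> v \<psi>) \<and>
    (\<forall>i \<phi>. (m \<in> v (ExS i \<phi>) \<longleftrightarrow> m \<in> v \<phi> \<and> m \<noteq> i) \<and> (m \<in> v (AllS i \<phi>) \<longleftrightarrow> m \<in> v \<phi> \<and> m \<noteq> i) \<and>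
      (m \<in> v (ExN i \<phi>) \<longleftrightarrow> m \<in> v \<phi>) \<and> (m \<in> v (AllN i \<phi>) \<longleftrightarrow> m \<in> v \<phi>))"
  show "Dfn ?P" by (intro dfn Dfun_boolI)
  show "?P fvS" by simp
  show "v = fvS" if v: "?P v" for v
  proof
    show "v \<phi> = fvS \<phi>" for \<phi> by (induction \<phi>) (simp_all add: set_eq_iff v)
  qed
qed

lemmas Dfun_fvS = Dpt_apply[OF Dpt_fvS]

lemma Dpt_xfvN: "Dpt xfvN"
proof (rule Dpt_unique)
  let ?P = "\<lambda>v :: xfm \<Rightarrow> nat set. \<forall>m.
    (\<forall>\<phi>. m \<in> v (L2 \<phi>) \<longleftrightarrow> m \<in> fvN \<phi>) \<and>
    (\<forall>k \<phi> \<psi>. m \<in> v (Game k \<phi> \<psi>) \<longleftrightarrow> m = k \<or> m \<in> fvN \<psi> \<and> m \<noteq> 0) \<and>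
    (\<forall>\<phi>. m \<in> v (XNeg \<phi>) \<longleftrightarrow> m \<in> v \<phi>) \<and> (\<forall>\<phi> \<psi>. m \<in> v (XConj \<phi> \<psi>) \<longleftrightarrow> m \<in> v \<phi> \<or> m \<in> v \<psi>) \<and>
    (\<forall>i \<phi>. (m \<in> v (XExN i \<phi>) \<longleftrightarrow> m \<in> v \<phi> \<and> m \<noteq> i) \<and> (m \<in> v (XAllN i \<phi>) \<longleftrightarrow> m \<in> v \<phi> \<and> m \<noteq> i) \<and>
      (m \<in> v (XExS i \<phi>) \<longleftrightarrow> m \<in> v \<phi>) \<and> (m \<in> v (XAllS i \<phi>) \<longleftrightarrow> m \<in> v \<phi>))"
  show "Dfn ?P" by (intro dfn Dfun_boolI Dfun_fvN)
  show "?P xfvN" by auto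
  show "v = xfvN" if v: "?P v" for v
  proof
    show "v \<phi> = xfvN \<phi>" for \<phi> by (induction \<phi>) (simp_all add: set_eq_iff v)
  qed
qed

lemmas Dfun_xfvN = Dpt_apply[OF Dpt_xfvN]

lemma Dpt_xfvS: "Dpt xfvS"
proof (rule Dpt_unique)
  let ?P = "\<lambda>v :: xfm \<Rightarrow> nat set. \<forall>m.
    (\<forall>\<phi>. m \<in> v (L2 \<phi>) \<longleftrightarrow> m \<in> fvS \<phi>) \<and>
    (\<forall>k \<phi> \<psi>. m \<in> v (Game k \<phi> \<psi>) \<longleftrightarrow> m \<in> fvS \<psi>) \<and>
    (\<forall>\<phi>. m \<in> v (XNeg \<phi>) \<longleftrightarrow> m \<in> v \<phi>) \<and> (\<forall>\<phi> \<psi>. m \<in> v (XConj \<phi> \<psi>) \<longleftrightarrow> m \<in> v \<phi> \<or> m \<in> v \<psi>) \<and>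
    (\<forall>i \<phi>. (m \<in> v (XExS i \<phi>) \<longleftrightarrow> m \<in> v \<phi> \<and> m \<noteq> i) \<and> (m \<in> v (XAllS i \<phi>) \<longleftrightarrow> m \<in> v \<phi> \<and> m \<noteq> i) \<and>
      (m \<in> v (XExN i \<phi>) \<longleftrightarrow> m \<in> v \<phi>) \<and> (m \<in> v (XAllN i \<phi>) \<longleftrightarrow> m \<in> v \<phi>))"
  show "Dfn ?P" by (intro dfn Dfun_boolI Dfun_fvS)
  show "?P xfvS" by auto
  show "v = xfvS" if v: "?P v" for v
  proof
    show "v \<phi> = xfvS \<phi>" for \<phi> by (induction \<phi>) (simp_all add: set_eq_iff v)
  qed
qed

lemmas Dfun_xfvS = Dpt_apply[OF Dpt_xfvS]

lemma Dpt_arithmetical: "Dpt arithmetical"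
proof (rule Dpt_unique)
  let ?P = "\<lambda>v :: fm \<Rightarrow> bool. (\<forall>s t. v (Eq s t) \<and> v (Less s t)) \<and> (\<forall>t X. v (Mem t X)) \<and>
    (\<forall>\<phi>. v (Neg \<phi>) = v \<phi>) \<and> (\<forall>\<phi> \<psi>. v (Conj \<phi> \<psi>) = (v \<phi> \<and> v \<psi>)) \<and>
    (\<forall>i \<phi>. v (ExN i \<phi>) = v \<phi> \<and> v (AllN i \<phi>) = v \<phi> \<and> \<not> v (ExS i \<phi>) \<and> \<not> v (AllS i \<phi>))"
  show "Dfn ?P" by (intro dfn Dfun_boolI)
  show "?P arithmetical" by simp
  show "v = arithmetical" if v: "?P v" for v
  proof
    show "v \<phi> = arithmetical \<phi>" for \<phi> by (induction \<phi>) (simp_all add: v)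
  qed
qed

lemma Dpt_in_lang:
  assumes "Dfn (\<lambda>\<phi>. \<phi> \<in> \<Gamma>)"
  shows "Dpt (in_lang \<Gamma>)"
proof (rule Dpt_unique)
  let ?P = "\<lambda>v :: xfm \<Rightarrow> bool. (\<forall>\<phi>. v (L2 \<phi>)) \<and>
    (\<forall>k \<phi> \<psi>. v (Game k \<phi> \<psi>) = (\<phi> \<in> \<Gamma> \<and> (\<forall>m. m \<in> fvN \<phi> \<longrightarrow> m = 0) \<and> (\<forall>m. m \<in> fvS \<phi> \<longrightarrow> m = 0 \<or> m = Suc 0) \<and>
      (\<forall>m. m \<in> fvN \<psi> \<longrightarrow> m = 0) \<and> (\<exists>Y. \<forall>m. m \<in> fvS \<psi> \<longrightarrow> m = Y))) \<and>
    (\<forall>\<phi>. v (XNeg \<phi>) = v \<phi>) \<and> (\<forall>\<phi> \<psi>. v (XConj \<phi> \<psi>) = (v \<phi> \<and> v \<psi>)) \<and>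
    (\<forall>i \<phi>. v (XExN i \<phi>) = v \<phi> \<and> v (XAllN i \<phi>) = v \<phi> \<and> v (XExS i \<phi>) = v \<phi> \<and> v (XAllS i \<phi>) = v \<phi>)"
  show "Dfn ?P" by (intro dfn Dfun_boolI Dfun_fvN Dfun_fvS Dfn_vimage[OF assms])
  show "?P (in_lang \<Gamma>)" by (simp add: subset_iff)
  show "v = in_lang \<Gamma>" if v: "?P v" for v
  proof
    show "v \<phi> = in_lang \<Gamma> \<phi>" for \<phi> by (induction \<phi>) (simp_all add: v subset_iff)
  qed
qed

subsection \<open>Truth in the projective classes and in the extended logic\<close>

lemma sat_arithmetical: "arithmetical \<phi> \<Longrightarrow> sat M e E \<phi> = sat N e E \<phi>"
  by (induction \<phi> arbitrary: e E) auto

text \<open>The free set variables of an arithmetical formula refer to the assignment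
  \<open>E\<close>, which can serve as a family of sets itself if variable \<open>X\<close> is
  given the index \<open>X\<close>. As lists are finite, this is demanded for an initial segment
  of the variables only.\<close>

lemma sat_arithmetical_code:
  assumes "arithmetical \<phi>"
  shows "sat UNIV (extend l) E \<phi> \<longleftrightarrow> (\<exists>N. \<forall>b. (\<forall>X. X < N \<longrightarrow> extend b X = X) \<longrightarrow> sat_code E {} \<phi> l b)"
proof -
  obtain K where K: "\<forall>X\<in>fvS \<phi>. X < K" using finite_nat_set_iff_bounded finite_fvS by blast
  have eq: "sat_code E {} \<phi> l b \<longleftrightarrow> sat UNIV (extend l) E \<phi>" if "\<forall>X<K. extend b X = X" for b
  proof -
    have "sat_code E {} \<phi> l b \<longleftrightarrow> sat {} (extend l) E \<phi>"
      unfolding sat_code_def image_empty by (rule sat_cong) (use that K in auto)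
    also have "\<dots> \<longleftrightarrow> sat UNIV (extend l) E \<phi>" by (rule sat_arithmetical[OF assms])
    finally show ?thesis .
  qed
  show ?thesis
  proof
    assume "sat UNIV (extend l) E \<phi>"
    then show "\<exists>N. \<forall>b. (\<forall>X. X < N \<longrightarrow> extend b X = X) \<longrightarrow> sat_code E {} \<phi> l b"
      using eq by (intro exI[of _ K]) simp
  next
    assume "\<exists>N. \<forall>b. (\<forall>X. X < N \<longrightarrow> extend b X = X) \<longrightarrow> sat_code E {} \<phi> l b"
    then obtain N where N: "\<And>b. \<forall>X. X < N \<longrightarrow> extend b X = X \<Longrightarrow> sat_code E {} \<phi> l b" by blast
    define b where "b = map (\<lambda>X. X) [0..<max N K]"
    have b: "extend b X = X" if "X < max N K" for X unfolding b_def using that by (rule extend_map)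
    have "sat_code E {} \<phi> l b" by (rule N) (simp add: b)
    then show "sat UNIV (extend l) E \<phi>" using eq b by simp
  qed
qed

text \<open>A class of formulas with a truth definition over the full model. It exists for every
  level of the projective hierarchy but, by the theorem of Tarski, not for the class
  \<open>Proj\<close>.\<close>

definition Dfn_class :: "fm set \<Rightarrow> bool" where
  "Dfn_class \<Gamma> \<longleftrightarrow> Dfn (\<lambda>\<phi>. \<phi> \<in> \<Gamma>) \<and>
    Dfn (\<lambda>p. fst p \<in> \<Gamma> \<and> sat UNIV (extend (fst (snd p))) (snd (snd p)) (fst p))"

lemma Dfn_rel3: "Dfn (\<lambda>p. R (fst p) (fst (snd p)) (snd (snd p))) \<Longrightarrow> Dfun f \<Longrightarrow> Dfun g \<Longrightarrow> Dfun h \<Longrightarrow>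
    Dfn (\<lambda>x. R (f x) (g x) (h x))"
  using Dfn_vimage[OF _ Dfun_Pair[OF _ Dfun_Pair], of "\<lambda>p. R (fst p) (fst (snd p)) (snd (snd p))" f g h]
  by simp

text \<open>Each level adds one set quantifier to the truth definition of the previous
  one.\<close>

lemma Dfn_class_Sigma_Pi: "Dfn_class (Sigma11 n) \<and> Dfn_class (Pi11 n)"
proof (induction n)
  case 0
  have 1: "Dfn (\<lambda>\<phi>. arithmetical \<phi>)" using Dpt_image[OF Dfun_id Dpt_arithmetical]
    Dpt_apply[OF Dpt_arithmetical Dfun_id] by (simp add: Dfun_bool)
  have "Dfn (\<lambda>p :: fm \<times> nat list \<times> (nat \<Rightarrow> nat set). arithmetical (fst p) \<and>
      (\<exists>N. \<forall>b. (\<forall>X. X < N \<longrightarrow> extend b X = X) \<longrightarrow> sat_code (snd (snd p)) {} (fst p) (fst (snd p)) b))"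
    by (intro dfn Dfn_vimage[OF 1] Dfun_extend Dfn_sat_code)
  then have "Dfn (\<lambda>p. arithmetical (fst p) \<and> sat UNIV (extend (fst (snd p))) (snd (snd p)) (fst p))"
    using sat_arithmetical_code by (simp cong: conj_cong)
  with 1 show ?case by (simp add: Dfn_class_def)
next
  case (Suc n)
  have S: "Dfn (\<lambda>\<phi>. \<phi> \<in> Sigma11 n)" "Dfn (\<lambda>\<phi>. \<phi> \<in> Pi11 n)" using Suc by (simp_all add: Dfn_class_def)
  define RS where "RS = (\<lambda>\<phi> l E. \<phi> \<in> Sigma11 n \<and> sat UNIV (extend l) E \<phi>)"
  define RP where "RP = (\<lambda>\<phi> l E. \<phi> \<in> Pi11 n \<and> sat UNIV (extend l) E \<phi>)"
  have R: "Dfn (\<lambda>p. RS (fst p) (fst (snd p)) (snd (snd p)))" "Dfn (\<lambda>p. RP (fst p) (fst (snd p)) (snd (snd p)))"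
    using Suc by (simp_all add: Dfn_class_def RS_def RP_def)
  have "Dfn (\<lambda>\<phi>. \<exists>X \<psi>. \<phi> = ExS X \<psi> \<and> \<psi> \<in> Pi11 n)" "Dfn (\<lambda>\<phi>. \<exists>X \<psi>. \<phi> = AllS X \<psi> \<and> \<psi> \<in> Sigma11 n)"
    by (intro dfn Dfn_vimage[OF S(1)] Dfn_vimage[OF S(2)])+
  moreover have "Dfn (\<lambda>p :: fm \<times> nat list \<times> (nat \<Rightarrow> nat set). \<exists>X \<psi>. fst p = ExS X \<psi> \<and>
      (\<exists>A. RP \<psi> (fst (snd p)) ((snd (snd p))(X := A))))"
    by (intro dfn Dfn_rel3[OF R(2)])
  moreover have "Dfn (\<lambda>p :: fm \<times> nat list \<times> (nat \<Rightarrow> nat set). \<exists>X \<psi>. fst p = AllS X \<psi> \<and>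
      (\<forall>A. RS \<psi> (fst (snd p)) ((snd (snd p))(X := A))))"
    by (intro dfn Dfn_rel3[OF R(1)])
  moreover have "(\<lambda>p :: fm \<times> nat list \<times> (nat \<Rightarrow> nat set). \<exists>X \<psi>. fst p = ExS X \<psi> \<and>
      (\<exists>A. RP \<psi> (fst (snd p)) ((snd (snd p))(X := A)))) =
    (\<lambda>p. fst p \<in> Sigma11 (Suc n) \<and> sat UNIV (extend (fst (snd p))) (snd (snd p)) (fst p))"
    by (rule ext) (auto simp: RP_def)
  moreover have "(\<lambda>p :: fm \<times> nat list \<times> (nat \<Rightarrow> nat set). \<exists>X \<psi>. fst p = AllS X \<psi> \<and>
      (\<forall>A. RS \<psi> (fst (snd p)) ((snd (snd p))(X := A)))) =
    (\<lambda>p. fst p \<in> Pi11 (Suc n) \<and> sat UNIV (extend (fst (snd p))) (snd (snd p)) (fst p))"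
    by (rule ext) (auto simp: RS_def)
  ultimately show ?case by (simp add: Dfn_class_def)
qed

definition xsat_code :: "(nat \<Rightarrow> nat set) \<Rightarrow> nat set \<Rightarrow> xfm \<Rightarrow> nat list \<Rightarrow> nat list \<Rightarrow> bool" where
  "xsat_code F J \<chi> l b \<longleftrightarrow> xsat (F ` J) (extend l) (\<lambda>X. F (extend b X)) \<chi>"

text \<open>The condition \<open>\<Phi> \<in> \<Gamma>\<close> is repeated inside the game so that
  the truth predicate of the class appears in the form that \<open>Dfn_class\<close>
  provides.\<close>

definition xsat_clauses ::
    "fm set \<Rightarrow> (nat \<Rightarrow> nat set) \<Rightarrow> nat set \<Rightarrow> (xfm \<Rightarrow> nat list \<Rightarrow> nat list \<Rightarrow> bool) \<Rightarrow> bool" where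
  "xsat_clauses \<Gamma> F J T \<longleftrightarrow> (\<forall>l b.
    (\<forall>\<phi>. T (L2 \<phi>) l b = sat_code F J \<phi> l b) \<and>
    (\<forall>k \<Phi> \<psi>. \<Phi> \<in> \<Gamma> \<longrightarrow> T (Game k \<Phi> \<psi>) l b = wins_I {x. \<Phi> \<in> \<Gamma> \<and>
      sat UNIV (extend [extend l k]) ((\<lambda>_. {})(0 := graph x,
        1 := {n. \<exists>l'. extend l' = (extend l)(0 := n) \<and> sat_code F J \<psi> l' b})) \<Phi>}) \<and>
    (\<forall>\<phi>. T (XNeg \<phi>) l b = (\<not> T \<phi> l b)) \<and>
    (\<forall>\<phi> \<psi>. T (XConj \<phi> \<psi>) l b = (T \<phi> l b \<and> T \<psi> l b)) \<and>
    (\<forall>i \<phi>. T (XExN i \<phi>) l b = (\<exists>n l'. extend l' = (extend l)(i := n) \<and> T \<phi> l' b)) \<and>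
    (\<forall>i \<phi>. T (XAllN i \<phi>) l b = (\<forall>n l'. extend l' = (extend l)(i := n) \<longrightarrow> T \<phi> l' b)) \<and>
    (\<forall>X \<phi>. T (XExS X \<phi>) l b = (\<exists>j b'. j \<in> J \<and> extend b' = (extend b)(X := j) \<and> T \<phi> l b')) \<and>
    (\<forall>X \<phi>. T (XAllS X \<phi>) l b = (\<forall>j b'. j \<in> J \<longrightarrow> extend b' = (extend b)(X := j) \<longrightarrow> T \<phi> l b')))"

lemma xsat_code_quantifiers:
  "xsat_code F J (XExN i \<phi>) l b \<longleftrightarrow> (\<exists>n l'. extend l' = (extend l)(i := n) \<and> xsat_code F J \<phi> l' b)"
  "xsat_code F J (XAllN i \<phi>) l b \<longleftrightarrow> (\<forall>n l'. extend l' = (extend l)(i := n) \<longrightarrow> xsat_code F J \<phi> l' b)"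
  "xsat_code F J (XExS X \<phi>) l b \<longleftrightarrow> (\<exists>j b'. j \<in> J \<and> extend b' = (extend b)(X := j) \<and> xsat_code F J \<phi> l b')"
  "xsat_code F J (XAllS X \<phi>) l b \<longleftrightarrow> (\<forall>j b'. j \<in> J \<longrightarrow> extend b' = (extend b)(X := j) \<longrightarrow> xsat_code F J \<phi> l b')"
proof -
  note ex = ex_extend_update[where P = "\<lambda>e. xsat (F ` J) e (\<lambda>X. F (extend b X)) \<phi>"]
    and all = all_extend_update[where P = "\<lambda>e. xsat (F ` J) e (\<lambda>X. F (extend b X)) \<phi>"]
    and exS = ex_extend_update[where P = "\<lambda>d. xsat (F ` J) (extend l) (\<lambda>X. F (d X)) \<phi>"]
    and allS = all_extend_update[where P = "\<lambda>d. xsat (F ` J) (extend l) (\<lambda>X. F (d X)) \<phi>"]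
  show "xsat_code F J (XExN i \<phi>) l b \<longleftrightarrow> (\<exists>n l'. extend l' = (extend l)(i := n) \<and> xsat_code F J \<phi> l' b)"
    unfolding xsat_code_def xsat.simps ex ..
  show "xsat_code F J (XAllN i \<phi>) l b \<longleftrightarrow> (\<forall>n l'. extend l' = (extend l)(i := n) \<longrightarrow> xsat_code F J \<phi> l' b)"
    unfolding xsat_code_def xsat.simps all ..
  have "(\<exists>j b'. j \<in> J \<and> extend b' = (extend b)(X := j) \<and> xsat_code F J \<phi> l b') \<longleftrightarrow>
      (\<exists>j. j \<in> J \<and> (\<exists>b'. extend b' = (extend b)(X := j) \<and> xsat (F ` J) (extend l) (\<lambda>X. F (extend b' X)) \<phi>))"
    unfolding xsat_code_def by blast
  then show "xsat_code F J (XExS X \<phi>) l b \<longleftrightarrow> (\<exists>j b'. j \<in> J \<and> extend b' = (extend b)(X := j) \<and> xsat_code F J \<phi> l b')"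
    unfolding exS index_update unfolding xsat_code_def xsat.simps by blast
  have "(\<forall>j b'. j \<in> J \<longrightarrow> extend b' = (extend b)(X := j) \<longrightarrow> xsat_code F J \<phi> l b') \<longleftrightarrow>
      (\<forall>j. j \<in> J \<longrightarrow> (\<forall>b'. extend b' = (extend b)(X := j) \<longrightarrow> xsat (F ` J) (extend l) (\<lambda>X. F (extend b' X)) \<phi>))"
    unfolding xsat_code_def by blast
  then show "xsat_code F J (XAllS X \<phi>) l b \<longleftrightarrow> (\<forall>j b'. j \<in> J \<longrightarrow> extend b' = (extend b)(X := j) \<longrightarrow> xsat_code F J \<phi> l b')"
    unfolding allS index_update unfolding xsat_code_def xsat.simps by blast
qed

lemma xsat_code_Game:
  assumes "\<Phi> \<in> \<Gamma>"
  shows "xsat_code F J (Game k \<Phi> \<psi>) l b = wins_I {x. \<Phi> \<in> \<Gamma> \<and>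
      sat UNIV (extend [extend l k]) ((\<lambda>_. {})(0 := graph x,
        1 := {n. \<exists>l'. extend l' = (extend l)(0 := n) \<and> sat_code F J \<psi> l' b})) \<Phi>}"
  unfolding xsat_code_def xsat.simps extend_singleton sat_code_def
    ex_extend_update[where P = "\<lambda>e. sat (F ` J) e (\<lambda>X. F (extend b X)) \<psi>"]
  using assms by simp

lemma xsat_clauses_xsat_code: "xsat_clauses \<Gamma> F J (xsat_code F J)"
  unfolding xsat_clauses_def xsat_code_quantifiers
  by (intro allI conjI impI xsat_code_Game) (simp_all add: xsat_code_def sat_code_def)

lemma xsat_clauses_unique:
  "xsat_clauses \<Gamma> F J T \<Longrightarrow> in_lang \<Gamma> \<chi> \<Longrightarrow> T \<chi> l b = xsat_code F J \<chi> l b"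
proof (induction \<chi> arbitrary: l b)
  note c = xsat_clauses_def[of \<Gamma> F J T]
  {
    case (L2 \<phi>)
    then show ?case unfolding c by (simp add: sat_code_def xsat_code_def)
  next
    case (Game k \<Phi> \<psi>)
    have "\<Phi> \<in> \<Gamma>" using Game.prems(2) by simp
    then show ?case unfolding xsat_code_Game[OF \<open>\<Phi> \<in> \<Gamma>\<close>] using Game.prems(1) unfolding c by simp
  next
    case (XNeg \<phi>)
    have "T (XNeg \<phi>) l b = (\<not> T \<phi> l b)" using XNeg.prems(1) unfolding c by simp
    then show ?case using XNeg by (simp add: xsat_code_def)
  next
    case (XConj \<phi> \<psi>)
    have "T (XConj \<phi> \<psi>) l b = (T \<phi> l b \<and> T \<psi> l b)" using XConj.prems(1) unfolding c by simp
    then show ?case using XConj by (simp add: xsat_code_def)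
  next
    case (XExN i \<phi>)
    have l: "in_lang \<Gamma> \<phi>" using XExN.prems(2) by simp
    have "T (XExN i \<phi>) l b = (\<exists>n l'. extend l' = (extend l)(i := n) \<and> T \<phi> l' b)"
      using XExN.prems(1) unfolding c by simp
    then show ?case unfolding xsat_code_quantifiers XExN.IH[OF XExN.prems(1) l] .
  next
    case (XAllN i \<phi>)
    have l: "in_lang \<Gamma> \<phi>" using XAllN.prems(2) by simp
    have "T (XAllN i \<phi>) l b = (\<forall>n l'. extend l' = (extend l)(i := n) \<longrightarrow> T \<phi> l' b)"
      using XAllN.prems(1) unfolding c by simp
    then show ?case unfolding xsat_code_quantifiers XAllN.IH[OF XAllN.prems(1) l] .
  next
    case (XExS X \<phi>)
    have l: "in_lang \<Gamma> \<phi>" using XExS.prems(2) by simp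
    have "T (XExS X \<phi>) l b = (\<exists>j b'. j \<in> J \<and> extend b' = (extend b)(X := j) \<and> T \<phi> l b')"
      using XExS.prems(1) unfolding c by simp
    then show ?case unfolding xsat_code_quantifiers XExS.IH[OF XExS.prems(1) l] .
  next
    case (XAllS X \<phi>)
    have l: "in_lang \<Gamma> \<phi>" using XAllS.prems(2) by simp
    have "T (XAllS X \<phi>) l b = (\<forall>j b'. j \<in> J \<longrightarrow> extend b' = (extend b)(X := j) \<longrightarrow> T \<phi> l b')"
      using XAllS.prems(1) unfolding c by simp
    then show ?case unfolding xsat_code_quantifiers XAllS.IH[OF XAllS.prems(1) l] .
  }
qed

text \<open>A parameter from the image of \<open>J\<close> is named by an index, and finitely many
  indices form a list.\<close>

lemma Def_family:
  "Y \<in> Def \<Gamma> (F ` J) \<longleftrightarrow> (\<exists>\<chi> b. in_lang \<Gamma> \<chi> \<and> (\<forall>i. i \<in> xfvN \<chi> \<longrightarrow> i = 0) \<and>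
    (\<forall>X. X \<in> xfvS \<chi> \<longrightarrow> extend b X \<in> J) \<and> (\<forall>n. n \<in> Y \<longleftrightarrow> xsat_code F J \<chi> [n] b))"
proof
  assume "Y \<in> Def \<Gamma> (F ` J)"
  then obtain \<chi> E where \<chi>: "in_lang \<Gamma> \<chi>" "xfvN \<chi> \<subseteq> {0}" "\<forall>X\<in>xfvS \<chi>. E X \<in> F ` J"
    "Y = {n. xsat (F ` J) ((\<lambda>_. 0)(0 := n)) E \<chi>}" unfolding Def_def by blast
  have "\<forall>X\<in>xfvS \<chi>. \<exists>j. j \<in> J \<and> E X = F j" using \<chi>(3) by blast
  from bchoice[OF this] obtain g where g: "\<forall>X\<in>xfvS \<chi>. g X \<in> J \<and> E X = F (g X)" by blast
  obtain b where b: "\<forall>X\<in>xfvS \<chi>. extend b X = g X" using extend_finite[OF finite_xfvS] by blast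
  have x: "xsat (F ` J) ((\<lambda>_. 0)(0 := n)) E \<chi> = xsat_code F J \<chi> [n] b" for n
    unfolding xsat_code_def extend_singleton by (rule xsat_cong) (use g b in simp_all)
  show "\<exists>\<chi> b. in_lang \<Gamma> \<chi> \<and> (\<forall>i. i \<in> xfvN \<chi> \<longrightarrow> i = 0) \<and>
    (\<forall>X. X \<in> xfvS \<chi> \<longrightarrow> extend b X \<in> J) \<and> (\<forall>n. n \<in> Y \<longleftrightarrow> xsat_code F J \<chi> [n] b)"
  proof (intro exI[of _ \<chi>] exI[of _ b] conjI allI impI)
    show "i = 0" if "i \<in> xfvN \<chi>" for i using that \<chi>(2) by blast
    show "extend b X \<in> J" if "X \<in> xfvS \<chi>" for X using that g b by simp
    show "n \<in> Y \<longleftrightarrow> xsat_code F J \<chi> [n] b" for n unfolding \<chi>(4) x[symmetric] by simp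
  qed (rule \<chi>(1))
next
  assume "\<exists>\<chi> b. in_lang \<Gamma> \<chi> \<and> (\<forall>i. i \<in> xfvN \<chi> \<longrightarrow> i = 0) \<and>
    (\<forall>X. X \<in> xfvS \<chi> \<longrightarrow> extend b X \<in> J) \<and> (\<forall>n. n \<in> Y \<longleftrightarrow> xsat_code F J \<chi> [n] b)"
  then obtain \<chi> b where \<chi>: "in_lang \<Gamma> \<chi>" "\<forall>i. i \<in> xfvN \<chi> \<longrightarrow> i = 0"
    "\<forall>X. X \<in> xfvS \<chi> \<longrightarrow> extend b X \<in> J" "\<forall>n. n \<in> Y \<longleftrightarrow> xsat_code F J \<chi> [n] b" by blast
  have "Y = {n. xsat (F ` J) ((\<lambda>_. 0)(0 := n)) (\<lambda>X. F (extend b X)) \<chi>}"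
    using \<chi>(4) by (auto simp: xsat_code_def extend_singleton)
  moreover have "xfvN \<chi> \<subseteq> {0}" using \<chi>(2) by blast
  moreover have "\<forall>X\<in>xfvS \<chi>. F (extend b X) \<in> F ` J" using \<chi>(3) by simp
  ultimately have "in_lang \<Gamma> \<chi> \<and> xfvN \<chi> \<subseteq> {0} \<and> (\<forall>X\<in>xfvS \<chi>. F (extend b X) \<in> F ` J) \<and>
      Y = {n. xsat (F ` J) ((\<lambda>_. 0)(0 := n)) (\<lambda>X. F (extend b X)) \<chi>}" using \<chi>(1) by simp
  then show "Y \<in> Def \<Gamma> (F ` J)"
    unfolding Def_def by (intro CollectI) (rule exI, rule exI)
qed

lemma Dfn_Def:
  fixes F :: "'x :: dt \<Rightarrow> nat \<Rightarrow> nat set"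
  assumes \<Gamma>: "Dfn_class \<Gamma>" and "Dfun Y" "Dfun F" "Dfun J"
  shows "Dfn (\<lambda>x. Y x \<in> Def \<Gamma> (F x ` J x))"
proof -
  have "Dfn (\<lambda>\<phi>. \<phi> \<in> \<Gamma>)" using \<Gamma> by (simp add: Dfn_class_def)
  then have L: "Dfn (\<lambda>\<chi>. in_lang \<Gamma> \<chi>)"
    using Dpt_apply[OF Dpt_in_lang Dfun_id] by (simp add: Dfun_bool)
  define mem where "mem = (\<lambda>\<phi>. \<phi> \<in> \<Gamma>)"
  define R where "R = (\<lambda>\<Phi> l E. \<Phi> \<in> \<Gamma> \<and> sat UNIV (extend l) E \<Phi>)"
  have R: "Dfn (\<lambda>p. R (fst p) (fst (snd p)) (snd (snd p)))" using \<Gamma> by (simp add: Dfn_class_def R_def)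
  have G: "Dfn mem" using \<Gamma> by (simp add: Dfn_class_def mem_def)
  have fold: "(\<Phi> \<in> \<Gamma> \<and> sat UNIV (extend l) E \<Phi>) = R \<Phi> l E" "(\<Phi> \<in> \<Gamma> \<longrightarrow> Q) = (mem \<Phi> \<longrightarrow> Q)" for \<Phi> l E Q
    by (simp_all add: R_def mem_def)
  have eq: "Y \<in> Def \<Gamma> (F ` J) \<longleftrightarrow> (\<exists>T. xsat_clauses \<Gamma> F J T \<and> (\<exists>\<chi> b. in_lang \<Gamma> \<chi> \<and>
      (\<forall>i. i \<in> xfvN \<chi> \<longrightarrow> i = 0) \<and> (\<forall>X. X \<in> xfvS \<chi> \<longrightarrow> extend b X \<in> J) \<and> (\<forall>n. n \<in> Y \<longleftrightarrow> T \<chi> [n] b)))"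
    for Y F J
    unfolding Def_family
  proof
    assume "\<exists>T. xsat_clauses \<Gamma> F J T \<and> (\<exists>\<chi> b. in_lang \<Gamma> \<chi> \<and>
      (\<forall>i. i \<in> xfvN \<chi> \<longrightarrow> i = 0) \<and> (\<forall>X. X \<in> xfvS \<chi> \<longrightarrow> extend b X \<in> J) \<and> (\<forall>n. n \<in> Y \<longleftrightarrow> T \<chi> [n] b))"
    then obtain T \<chi> b where T: "xsat_clauses \<Gamma> F J T" and \<chi>: "in_lang \<Gamma> \<chi>"
      "\<forall>i. i \<in> xfvN \<chi> \<longrightarrow> i = 0" "\<forall>X. X \<in> xfvS \<chi> \<longrightarrow> extend b X \<in> J" "\<forall>n. n \<in> Y \<longleftrightarrow> T \<chi> [n] b" by blast
    from \<chi>(4) have "\<forall>n. n \<in> Y \<longleftrightarrow> xsat_code F J \<chi> [n] b" unfolding xsat_clauses_unique[OF T \<chi>(1)] .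
    then show "\<exists>\<chi> b. in_lang \<Gamma> \<chi> \<and> (\<forall>i. i \<in> xfvN \<chi> \<longrightarrow> i = 0) \<and>
        (\<forall>X. X \<in> xfvS \<chi> \<longrightarrow> extend b X \<in> J) \<and> (\<forall>n. n \<in> Y \<longleftrightarrow> xsat_code F J \<chi> [n] b)"
      using \<chi>(1-3) by blast
  qed (use xsat_clauses_xsat_code in blast)
  have "Dfn (\<lambda>p :: nat set \<times> (nat \<Rightarrow> nat set) \<times> nat set. fst p \<in> Def \<Gamma> (fst (snd p) ` snd (snd p)))"
    unfolding eq xsat_clauses_def fold
    by (intro dfn Dfun_boolI Dfun_extend Dfun_extend_fun Dfn_sat_code Dfn_wins_I Dfn_rel3[OF R] Dfun_Collect
        Dfn_vimage[OF L] Dfn_vimage[OF G] Dfun_xfvN Dfun_xfvS)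
  from Dfn_rel3[where R = "\<lambda>Y F J. Y \<in> Def \<Gamma> (F ` J)", OF this assms(2-4)] show ?thesis .
qed

section \<open>Condensation\<close>

instance xfm :: countable
  by (rule countable_classI[of cde]) simp

text \<open>Names for the elements of the closure of the empty set under the functions with names
  in \<open>'k\<close>.\<close>

datatype 'k hull_term = Apply 'k "'k hull_term list"

instance hull_term :: (countable) countable
  by countable_datatype

primrec hull_value :: "('k \<Rightarrow> 'a list \<Rightarrow> 'a) \<Rightarrow> 'k hull_term \<Rightarrow> 'a" where
  "hull_value f (Apply k ts) = f k (map (hull_value f) ts)"

text \<open>The values of countably many terms.\<close>

lemma countable_hull:
  fixes f :: "'k :: countable \<Rightarrow> 'a list \<Rightarrow> 'a"
  obtains H where "countable H" "\<And>k xs. set xs \<subseteq> H \<Longrightarrow> f k xs \<in> H"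
proof (rule that[of "range (hull_value f)"])
  show "countable (range (hull_value f))" by simp
  fix k xs
  assume "set xs \<subseteq> range (hull_value f)"
  then have "\<exists>ts. xs = map (hull_value f) ts"
  proof (induction xs)
    case (Cons x xs)
    then obtain t ts where "x = hull_value f t" "xs = map (hull_value f) ts" by auto
    then show ?case by (intro exI[of _ "t # ts"]) simp
  qed simp
  then obtain ts where "xs = map (hull_value f) ts" by blast
  then have "f k xs = hull_value f (Apply k ts)" by simp
  then show "f k xs \<in> range (hull_value f)" by blast
qed

lemma Tarski_Vaught:
  assumes sub: "H \<subseteq> N"
    and witness: "\<And>\<chi> e E X B. \<lbrakk>\<forall>Y\<in>xfvS \<chi> - {X}. E Y \<in> H; B \<in> N; xsat N e (E(X := B)) \<chi>\<rbrakk> \<Longrightarrow>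
      \<exists>B\<in>H. xsat N e (E(X := B)) \<chi>"
    and "\<forall>X\<in>xfvS \<chi>. E X \<in> H"
  shows "xsat H e E \<chi> = xsat N e E \<chi>"
  using assms(3)
proof (induction \<chi> arbitrary: e E)
  have sat: "sat H e E \<phi> = sat N e E \<phi>" if "\<forall>X\<in>fvS \<phi>. E X \<in> H" for \<phi> e E
    using that
  proof (induction \<phi> arbitrary: e E)
    case (ExS X \<phi>)
    have IH: "sat H e (E(X := B)) \<phi> = sat N e (E(X := B)) \<phi>" if "B \<in> H" for B
      by (rule ExS.IH) (use ExS.prems that in auto)
    have "\<exists>B\<in>H. sat N e (E(X := B)) \<phi>" if "B \<in> N" "sat N e (E(X := B)) \<phi>" for B
      using witness[of "L2 \<phi>" X E B e] ExS.prems that by simp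
    then show ?case using IH sub by auto
  next
    case (AllS X \<phi>)
    have IH: "sat H e (E(X := B)) \<phi> = sat N e (E(X := B)) \<phi>" if "B \<in> H" for B
      by (rule AllS.IH) (use AllS.prems that in auto)
    have "\<exists>B\<in>H. \<not> sat N e (E(X := B)) \<phi>" if "B \<in> N" "\<not> sat N e (E(X := B)) \<phi>" for B
      using witness[of "L2 (Neg \<phi>)" X E B e] AllS.prems that by simp
    then show ?case using IH sub by auto
  next
    case (Conj \<phi> \<psi>)
    have "sat H e E \<phi> = sat N e E \<phi>" "sat H e E \<psi> = sat N e E \<psi>"
      by (rule Conj.IH; use Conj.prems in simp)+
    then show ?case by (simp only: sat.simps)
  next
    case (ExN i \<phi>)
    have "sat H (e(i := n)) E \<phi> = sat N (e(i := n)) E \<phi>" for n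
      by (rule ExN.IH) (use ExN.prems in simp)
    then show ?case by (simp only: sat.simps)
  next
    case (AllN i \<phi>)
    have "sat H (e(i := n)) E \<phi> = sat N (e(i := n)) E \<phi>" for n
      by (rule AllN.IH) (use AllN.prems in simp)
    then show ?case by (simp only: sat.simps)
  qed simp_all
  {
    case (L2 \<phi>)
    then show ?case using sat by simp
  next
    case (Game k \<Phi> \<psi>)
    have "sat H (e(0 := n)) E \<psi> = sat N (e(0 := n)) E \<psi>" for n
      by (rule sat) (use Game.prems in simp)
    then show ?case by simp
  next
    case (XExS X \<chi>)
    have IH: "xsat H e (E(X := B)) \<chi> = xsat N e (E(X := B)) \<chi>" if "B \<in> H" for B
      by (rule XExS.IH) (use XExS.prems that in auto)
    have "\<exists>B\<in>H. xsat N e (E(X := B)) \<chi>" if "B \<in> N" "xsat N e (E(X := B)) \<chi>" for B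
      using witness[of \<chi> X E B e] XExS.prems that by simp
    then show ?case using IH sub by auto
  next
    case (XAllS X \<chi>)
    have IH: "xsat H e (E(X := B)) \<chi> = xsat N e (E(X := B)) \<chi>" if "B \<in> H" for B
      by (rule XAllS.IH) (use XAllS.prems that in auto)
    have "\<exists>B\<in>H. \<not> xsat N e (E(X := B)) \<chi>" if "B \<in> N" "\<not> xsat N e (E(X := B)) \<chi>" for B
      using witness[of "XNeg \<chi>" X E B e] XAllS.prems that by simp
    then show ?case using IH sub by auto
  next
    case (XConj \<phi> \<psi>)
    have "xsat H e E \<phi> = xsat N e E \<phi>" "xsat H e E \<psi> = xsat N e E \<psi>"
      by (rule XConj.IH; use XConj.prems in simp)+
    then show ?case by (simp only: xsat.simps)
  next
    case (XNeg \<phi>)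
    have "xsat H e E \<phi> = xsat N e E \<phi>" by (rule XNeg.IH) (use XNeg.prems in simp)
    then show ?case by (simp only: xsat.simps)
  next
    case (XExN i \<phi>)
    have "xsat H (e(i := n)) E \<phi> = xsat N (e(i := n)) E \<phi>" for n
      by (rule XExN.IH) (use XExN.prems in simp)
    then show ?case by (simp only: xsat.simps)
  next
    case (XAllN i \<phi>)
    have "xsat H (e(i := n)) E \<phi> = xsat N (e(i := n)) E \<phi>" for n
      by (rule XAllN.IH) (use XAllN.prems in simp)
    then show ?case by (simp only: xsat.simps)
  }
qed

text \<open>Successor and limit stages obey the same recursion, which makes sense along any
  well-founded relation.\<close>

lemma hier_Union_Def: "hier \<Gamma> \<alpha> = (\<Union>\<xi>\<in>{..<\<alpha>}. Def \<Gamma> (hier \<Gamma> \<xi>))"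
proof
  show "(\<Union>\<xi>\<in>{..<\<alpha>}. Def \<Gamma> (hier \<Gamma> \<xi>)) \<subseteq> hier \<Gamma> \<alpha>"
  proof (rule UN_least)
    fix \<xi> assume "\<xi> \<in> {..<\<alpha>}"
    then have "hier \<Gamma> (osuc \<xi>) \<subseteq> hier \<Gamma> \<alpha>" by (intro hier_mono osuc_le) simp
    then show "Def \<Gamma> (hier \<Gamma> \<xi>) \<subseteq> hier \<Gamma> \<alpha>" by (simp only: hier_osuc)
  qed
  show "hier \<Gamma> \<alpha> \<subseteq> (\<Union>\<xi>\<in>{..<\<alpha>}. Def \<Gamma> (hier \<Gamma> \<xi>))"
  proof (cases "\<exists>\<gamma>. \<alpha> = osuc \<gamma>")
    case True
    then obtain \<gamma> where \<gamma>: "\<alpha> = osuc \<gamma>" by blast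
    have "\<gamma> \<in> {..<\<alpha>}" by (simp add: \<gamma> less_osuc)
    moreover have "hier \<Gamma> \<alpha> = Def \<Gamma> (hier \<Gamma> \<gamma>)" unfolding \<gamma> by (rule hier_osuc)
    ultimately show ?thesis by blast
  next
    case False
    show ?thesis unfolding hier_limit[OF False] by (rule UN_mono) (auto intro: Def_increasing[THEN subsetD])
  qed
qed

text \<open>The union is the level of the least upper bound of the indices. If they have no upper bound,
  one of them lies beyond the fixed point of the hierarchy.\<close>

lemma hier_Union: "\<exists>\<gamma>. (\<Union>\<alpha>\<in>U. hier \<Gamma> \<alpha>) = hier \<Gamma> \<gamma>"
proof (cases "\<exists>\<gamma>. \<forall>\<alpha>\<in>U. \<alpha> \<le> \<gamma>")
  case True
  define \<gamma> where "\<gamma> = (LEAST \<gamma>. \<forall>\<alpha>\<in>U. \<alpha> \<le> \<gamma>)"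
  have \<gamma>: "\<forall>\<alpha>\<in>U. \<alpha> \<le> \<gamma>" unfolding \<gamma>_def using True by (rule LeastI_ex)
  have least: "\<gamma> \<le> \<delta>" if "\<forall>\<alpha>\<in>U. \<alpha> \<le> \<delta>" for \<delta> unfolding \<gamma>_def using that by (rule Least_le)
  have sub: "(\<Union>\<alpha>\<in>U. hier \<Gamma> \<alpha>) \<subseteq> hier \<Gamma> \<gamma>" by (rule UN_least) (use \<gamma> in \<open>simp add: hier_mono\<close>)
  have "hier \<Gamma> \<gamma> \<subseteq> (\<Union>\<alpha>\<in>U. hier \<Gamma> \<alpha>)"
  proof (cases "\<gamma> \<in> U")
    case False
    then have less: "\<alpha> < \<gamma>" if "\<alpha> \<in> U" for \<alpha> using \<gamma> that False by (cases "\<alpha> = \<gamma>") auto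
    have above: "\<exists>\<alpha>\<in>U. \<delta> < \<alpha>" if "\<delta> < \<gamma>" for \<delta>
    proof (rule ccontr)
      assume "\<not> ?thesis"
      then have "\<forall>\<alpha>\<in>U. \<alpha> \<le> \<delta>" by (simp add: linorder_not_less)
      from least[OF this] that show False by simp
    qed
    have "\<nexists>\<delta>. \<gamma> = osuc \<delta>"
    proof
      assume "\<exists>\<delta>. \<gamma> = osuc \<delta>"
      then obtain \<delta> where \<delta>: "\<gamma> = osuc \<delta>" by blast
      have "\<delta> < \<gamma>" unfolding \<delta> by (rule less_osuc)
      from above[OF this] obtain \<alpha> where \<alpha>: "\<alpha> \<in> U" "\<delta> < \<alpha>" by blast
      from osuc_le[OF \<alpha>(2)] less[OF \<alpha>(1)] show False unfolding \<delta> by simp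
    qed
    then have limit: "hier \<Gamma> \<gamma> = (\<Union>\<delta>\<in>{..<\<gamma>}. hier \<Gamma> \<delta>)" by (rule hier_limit)
    show ?thesis unfolding limit
    proof (rule UN_least)
      fix \<delta> assume "\<delta> \<in> {..<\<gamma>}"
      then have "\<delta> < \<gamma>" by simp
      from above[OF this] obtain \<alpha> where \<alpha>: "\<alpha> \<in> U" "\<delta> < \<alpha>" by blast
      have "hier \<Gamma> \<delta> \<subseteq> hier \<Gamma> \<alpha>" by (rule hier_mono) (use \<alpha>(2) in simp)
      with \<alpha>(1) show "hier \<Gamma> \<delta> \<subseteq> (\<Union>\<alpha>\<in>U. hier \<Gamma> \<alpha>)" by blast
    qed
  qed blast
  with sub show ?thesis by blast
next
  case False
  define \<beta> where "\<beta> = (LEAST \<beta>. hier \<Gamma> \<beta> = hier \<Gamma> (osuc \<beta>))"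
  obtain \<alpha> where \<alpha>: "\<alpha> \<in> U" "\<beta> < \<alpha>" using False by (auto simp: linorder_not_le)
  have "hier \<Gamma> \<alpha> = P_game \<Gamma>"
    using hier_constant[OF P_game_fixed[of \<Gamma>], of \<alpha>] \<alpha>(2) unfolding \<beta>_def P_game_def by simp
  then have "(\<Union>\<alpha>\<in>U. hier \<Gamma> \<alpha>) = hier \<Gamma> \<alpha>"
    using hier_subset_P_game[of \<Gamma>] \<alpha>(1) by blast
  then show ?thesis by blast
qed

text \<open>By well-founded induction every stage is a level, because unions of levels are levels.\<close>

lemma well_founded_hierarchy:
  assumes wf: "\<And>A :: 'i set. A \<noteq> {} \<Longrightarrow> \<exists>m\<in>A. \<forall>k. R k m \<longrightarrow> k \<notin> A"
    and F: "\<And>i. F i = (\<Union>j\<in>{j. R j i}. Def \<Gamma> (F j))"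
  shows "\<exists>\<alpha>. F i = hier \<Gamma> \<alpha>"
proof (rule ccontr)
  assume "\<nexists>\<alpha>. F i = hier \<Gamma> \<alpha>"
  then have "{i. \<nexists>\<alpha>. F i = hier \<Gamma> \<alpha>} \<noteq> {}" by blast
  from wf[OF this] obtain m where m: "\<nexists>\<alpha>. F m = hier \<Gamma> \<alpha>" "\<And>k. R k m \<Longrightarrow> \<exists>\<alpha>. F k = hier \<Gamma> \<alpha>" by blast
  then have "\<forall>k. \<exists>\<alpha>. R k m \<longrightarrow> F k = hier \<Gamma> \<alpha>" by blast
  from choice[OF this] obtain a where a: "\<And>k. R k m \<Longrightarrow> F k = hier \<Gamma> (a k)" by blast
  have "F m = (\<Union>j\<in>{j. R j m}. hier \<Gamma> (osuc (a j)))"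
    unfolding F[of m] by (rule SUP_cong) (simp_all add: a hier_osuc)
  also have "\<dots> = (\<Union>\<alpha>\<in>(\<lambda>j. osuc (a j)) ` {j. R j m}. hier \<Gamma> \<alpha>)" by simp
  finally show False using hier_Union[of \<Gamma> "(\<lambda>j. osuc (a j)) ` {j. R j m}"] m(1) by simp
qed

lemma well_founded_hierarchy_top:
  assumes "\<And>A :: 'i set. A \<noteq> {} \<Longrightarrow> \<exists>m\<in>A. \<forall>k. R k m \<longrightarrow> k \<notin> A"
    and "\<And>i. F i = (\<Union>j\<in>{j. R j i}. Def \<Gamma> (F j))"
    and "Def \<Gamma> (F i) \<subseteq> F i"
  shows "F i = P_game \<Gamma>"
proof -
  obtain \<alpha> where \<alpha>: "F i = hier \<Gamma> \<alpha>" using well_founded_hierarchy[OF assms(1,2)] by blast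
  have "hier \<Gamma> \<alpha> = hier \<Gamma> (osuc \<alpha>)"
    unfolding hier_osuc using assms(3) Def_increasing[of "hier \<Gamma> \<alpha>" \<Gamma>] unfolding \<alpha> by blast
  from P_game_eqI[OF this] show ?thesis by (simp add: \<alpha>)
qed

text \<open>Skolem functions have finite lists of sets as arguments; \<open>vs\<close> tells to
  which variables these are assigned.\<close>

definition assign :: "nat list \<Rightarrow> nat set list \<Rightarrow> nat \<Rightarrow> nat set" where
  "assign vs ps X = (case map_of (zip vs ps) X of Some A \<Rightarrow> A | None \<Rightarrow> {})"

lemma assign_map: "X \<in> set vs \<Longrightarrow> assign vs (map E vs) X = E X"
  unfolding assign_def map_of_zip_map by simp

text \<open>A Skolem hull that consists of ordinals, collected in \<open>A\<close>, and of sets,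
  collected in \<open>U\<close>. It contains with every set of a level an earlier stage at which
  this set is defined, together with parameters of such a definition. It contains the sets defined
  over levels with parameters in \<open>U\<close>, and witnesses for existential statements about
  levels.\<close>

lemma condensation_hull:
  obtains A :: "ordinal set" and U :: "nat set set" where
    "countable A" "countable U" "\<beta> \<in> A"
    "\<And>\<alpha> Y. \<alpha> \<in> A \<Longrightarrow> Y \<in> U \<Longrightarrow> Y \<in> hier \<Gamma> \<alpha> \<Longrightarrow> \<exists>\<xi>\<in>A. \<xi> < \<alpha> \<and> (\<exists>\<chi> E. in_lang \<Gamma> \<chi> \<and> xfvN \<chi> \<subseteq> {0} \<and>
      (\<forall>X\<in>xfvS \<chi>. E X \<in> hier \<Gamma> \<xi> \<inter> U) \<and> Y = {n. xsat (hier \<Gamma> \<xi>) ((\<lambda>_. 0)(0 := n)) E \<chi>})"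
    "\<And>\<xi> \<chi> E. \<xi> \<in> A \<Longrightarrow> \<forall>X\<in>xfvS \<chi>. E X \<in> U \<Longrightarrow> {n. xsat (hier \<Gamma> \<xi>) ((\<lambda>_. 0)(0 := n)) E \<chi>} \<in> U"
    "\<And>\<xi> \<chi> e E X B. \<xi> \<in> A \<Longrightarrow> \<forall>Y\<in>xfvS \<chi> - {X}. E Y \<in> U \<Longrightarrow> B \<in> hier \<Gamma> \<xi> \<Longrightarrow>
      xsat (hier \<Gamma> \<xi>) e (E(X := B)) \<chi> \<Longrightarrow> \<exists>B\<in>hier \<Gamma> \<xi> \<inter> U. xsat (hier \<Gamma> \<xi>) e (E(X := B)) \<chi>"
proof -
  define defining where "defining = (\<lambda>\<xi> \<chi> E Y. in_lang \<Gamma> \<chi> \<and> xfvN \<chi> \<subseteq> {0} \<and>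
      (\<forall>X\<in>xfvS \<chi>. E X \<in> hier \<Gamma> \<xi>) \<and> Y = {n. xsat (hier \<Gamma> \<xi>) ((\<lambda>_. 0)(0 := n)) E \<chi>})"
  \<comment> \<open>The Skolem functions, combined into one function \<open>f\<close> that selects
    them by a tag.\<close>
  define birth where "birth = (\<lambda>\<alpha> Y. SOME \<xi>. \<xi> < \<alpha> \<and> Y \<in> Def \<Gamma> (hier \<Gamma> \<xi>))"
  define params where "params = (\<lambda>\<xi> Y. SOME E. \<exists>\<chi>. defining \<xi> \<chi> E Y)"
  define wit where "wit = (\<lambda>\<xi> \<chi> l E X. SOME B. B \<in> hier \<Gamma> \<xi> \<and> xsat (hier \<Gamma> \<xi>) (extend l) (E(X := B)) \<chi>)"
  define f :: "nat \<times> xfm \<times> nat list \<times> nat \<times> nat list \<Rightarrow> (ordinal + nat set) list \<Rightarrow> ordinal + nat set" where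
    "f = (\<lambda>(tag, \<chi>, l, X, vs) xs. let \<xi> = projl (hd xs); ps = map projr (tl xs) in
      if tag = 0 then Inl \<beta>
      else if tag = 1 then Inl (birth \<xi> (hd ps))
      else if tag = 2 then Inr (params \<xi> (hd ps) X)
      else if tag = 3 then Inr {n. xsat (hier \<Gamma> \<xi>) ((\<lambda>_. 0)(0 := n)) (assign vs ps) \<chi>}
      else Inr (wit \<xi> \<chi> l (assign vs ps) X))"
  obtain H where H: "countable H" "\<And>k xs. set xs \<subseteq> H \<Longrightarrow> f k xs \<in> H" using countable_hull[of f] by metis
  define A where "A = {\<alpha>. Inl \<alpha> \<in> H}"
  define U where "U = {Y. Inr Y \<in> H}"
  have top: "\<beta> \<in> A"
    using H(2)[of "[]" "(0, L2 (Eq Zero Zero), [], 0, [])"] by (simp add: A_def f_def Let_def)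
  have birth: "birth \<alpha> Y \<in> A" if "\<alpha> \<in> A" "Y \<in> U" for \<alpha> Y
    using H(2)[of "[Inl \<alpha>, Inr Y]" "(1, L2 (Eq Zero Zero), [], 0, [])"] that
    by (simp add: A_def U_def f_def Let_def)
  have params: "params \<xi> Y X \<in> U" if "\<xi> \<in> A" "Y \<in> U" for \<xi> Y X
    using H(2)[of "[Inl \<xi>, Inr Y]" "(2, L2 (Eq Zero Zero), [], X, [])"] that
    by (simp add: A_def U_def f_def Let_def)
  have defd: "{n. xsat (hier \<Gamma> \<xi>) ((\<lambda>_. 0)(0 := n)) (assign vs ps) \<chi>} \<in> U"
    if "\<xi> \<in> A" "set ps \<subseteq> U" for \<xi> ps vs \<chi>
  proof -
    have "set (Inl \<xi> # map Inr ps) \<subseteq> H" using that by (auto simp: A_def U_def)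
    from H(2)[OF this, of "(3, \<chi>, [], 0, vs)"] show ?thesis by (simp add: U_def f_def Let_def o_def)
  qed
  have wit: "wit \<xi> \<chi> l (assign vs ps) X \<in> U"
    if "\<xi> \<in> A" "set ps \<subseteq> U" for \<xi> ps vs \<chi> l X
  proof -
    have "set (Inl \<xi> # map Inr ps) \<subseteq> H" using that by (auto simp: A_def U_def)
    from H(2)[OF this, of "(4, \<chi>, l, X, vs)"] show ?thesis by (simp add: U_def f_def Let_def o_def)
  qed
  show thesis
  proof (rule that[of A U])
    have H': "Inl ` A \<subseteq> H" "Inr ` U \<subseteq> H" by (auto simp: A_def U_def)
    have "countable (Inl ` A :: (ordinal + nat set) set)" by (rule countable_subset[OF H'(1) H(1)])
    moreover have "countable (Inr ` U :: (ordinal + nat set) set)" by (rule countable_subset[OF H'(2) H(1)])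
    ultimately show "countable A" "countable U" by (simp_all add: countable_image_inj_eq)
    show "\<beta> \<in> A" by (rule top)
    show "\<exists>\<xi>\<in>A. \<xi> < \<alpha> \<and> (\<exists>\<chi> E. in_lang \<Gamma> \<chi> \<and> xfvN \<chi> \<subseteq> {0} \<and>
      (\<forall>X\<in>xfvS \<chi>. E X \<in> hier \<Gamma> \<xi> \<inter> U) \<and> Y = {n. xsat (hier \<Gamma> \<xi>) ((\<lambda>_. 0)(0 := n)) E \<chi>})"
      if "\<alpha> \<in> A" "Y \<in> U" "Y \<in> hier \<Gamma> \<alpha>" for \<alpha> Y
    proof -
      have "\<exists>\<xi>. \<xi> < \<alpha> \<and> Y \<in> Def \<Gamma> (hier \<Gamma> \<xi>)" using that(3) unfolding hier_Union_Def[of \<Gamma> \<alpha>] by blast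
      then have b: "birth \<alpha> Y < \<alpha> \<and> Y \<in> Def \<Gamma> (hier \<Gamma> (birth \<alpha> Y))" unfolding birth_def by (rule someI_ex)
      then have "\<exists>E \<chi>. defining (birth \<alpha> Y) \<chi> E Y" unfolding defining_def Def_def by blast
      then have "\<exists>\<chi>. defining (birth \<alpha> Y) \<chi> (params (birth \<alpha> Y) Y) Y" unfolding params_def by (rule someI_ex)
      then obtain \<chi> where \<chi>: "defining (birth \<alpha> Y) \<chi> (params (birth \<alpha> Y) Y) Y" by blast
      show ?thesis
      proof (intro bexI[of _ "birth \<alpha> Y"] conjI exI[of _ \<chi>] exI[of _ "params (birth \<alpha> Y) Y"] ballI)
        show "params (birth \<alpha> Y) Y X \<in> hier \<Gamma> (birth \<alpha> Y) \<inter> U" if "X \<in> xfvS \<chi>" for X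
          using \<chi> that params[OF birth[OF \<open>\<alpha> \<in> A\<close> \<open>Y \<in> U\<close>] \<open>Y \<in> U\<close>] unfolding defining_def by blast
      qed (use b \<chi> birth that in \<open>simp_all add: defining_def\<close>)
    qed
    show "{n. xsat (hier \<Gamma> \<xi>) ((\<lambda>_. 0)(0 := n)) E \<chi>} \<in> U"
      if "\<xi> \<in> A" "\<forall>X\<in>xfvS \<chi>. E X \<in> U" for \<xi> \<chi> E
    proof -
      obtain vs where vs: "set vs = xfvS \<chi>" using finite_list[OF finite_xfvS] by blast
      have "xsat (hier \<Gamma> \<xi>) e E \<chi> = xsat (hier \<Gamma> \<xi>) e (assign vs (map E vs)) \<chi>" for e
        by (rule xsat_cong) (simp_all add: vs assign_map)
      then show ?thesis using defd[OF that(1), of "map E vs" vs \<chi>] that(2) vs by auto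
    qed
    show "\<exists>B\<in>hier \<Gamma> \<xi> \<inter> U. xsat (hier \<Gamma> \<xi>) e (E(X := B)) \<chi>"
      if "\<xi> \<in> A" "\<forall>Y\<in>xfvS \<chi> - {X}. E Y \<in> U" "B \<in> hier \<Gamma> \<xi>" "xsat (hier \<Gamma> \<xi>) e (E(X := B)) \<chi>" for \<xi> \<chi> e E X B
    proof -
      obtain vs where vs: "set vs = xfvS \<chi> - {X}" using finite_list[of "xfvS \<chi> - {X}"] by auto
      obtain l where l: "\<forall>i\<in>xfvN \<chi>. extend l i = e i" using extend_finite[of "xfvN \<chi>" e] by auto
      have eq: "xsat (hier \<Gamma> \<xi>) e (E(X := C)) \<chi> =
          xsat (hier \<Gamma> \<xi>) (extend l) ((assign vs (map E vs))(X := C)) \<chi>" for C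
        by (rule xsat_cong) (use vs l in \<open>simp_all add: assign_map\<close>)
      define C where "C = wit \<xi> \<chi> l (assign vs (map E vs)) X"
      have "\<exists>C. C \<in> hier \<Gamma> \<xi> \<and> xsat (hier \<Gamma> \<xi>) (extend l) ((assign vs (map E vs))(X := C)) \<chi>"
        using that(3,4) eq by blast
      then have "C \<in> hier \<Gamma> \<xi> \<and> xsat (hier \<Gamma> \<xi>) (extend l) ((assign vs (map E vs))(X := C)) \<chi>"
        unfolding C_def wit_def by (rule someI_ex)
      moreover have "C \<in> U" unfolding C_def by (rule wit[OF that(1)]) (use that(2) vs in auto)
      ultimately show ?thesis using eq by blast
    qed
  qed
qed

lemma Def_nonempty: "Def \<Gamma> M \<noteq> {}"
proof -
  have "in_lang \<Gamma> (L2 (Eq Zero Zero)) \<and> xfvN (L2 (Eq Zero Zero)) \<subseteq> {0} \<and>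
      (\<forall>X\<in>xfvS (L2 (Eq Zero Zero)). {} \<in> M) \<and>
      UNIV = {n. xsat M ((\<lambda>_. 0)(0 := n)) (\<lambda>_. {}) (L2 (Eq Zero Zero))}" by simp
  then have "UNIV \<in> Def \<Gamma> M" unfolding Def_def by (intro CollectI) (rule exI, rule exI)
  then show ?thesis by blast
qed

text \<open>With \<open>A\<close> and \<open>U\<close> from the hull, \<open>hier \<Gamma>
  \<alpha>\<close> for \<open>\<alpha>\<close> in \<open>A\<close> has the elementary submodel
  \<open>hier \<Gamma> \<alpha> \<inter> U\<close>. So these countable sets are obtained from each
  other by \<open>Def \<Gamma>\<close> along \<open>A\<close>. The relation \<open>R\<close> is
  the order of \<open>A\<close> transferred to the numbers, \<open>G i\<close> enumerates the
  stage that succeeds \<open>i\<close>, and 0 is the index of a fixed point.\<close>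

lemma countable_hierarchy:
  obtains R :: "nat \<Rightarrow> nat \<Rightarrow> bool" and G :: "nat \<Rightarrow> nat \<Rightarrow> nat set" where
    "\<And>A. A \<noteq> {} \<Longrightarrow> \<exists>m\<in>A. \<forall>k. R k m \<longrightarrow> k \<notin> A"
    "\<And>i. range (G i) = Def \<Gamma> (\<Union>j\<in>{j. R j i}. range (G j))"
    "Def \<Gamma> (\<Union>j\<in>{j. R j 0}. range (G j)) \<subseteq> (\<Union>j\<in>{j. R j 0}. range (G j))"
proof -
  define \<beta> where "\<beta> = (LEAST \<beta>. hier \<Gamma> \<beta> = hier \<Gamma> (osuc \<beta>))"
  have \<beta>: "hier \<Gamma> \<beta> = Def \<Gamma> (hier \<Gamma> \<beta>)"
    using P_game_fixed[of \<Gamma>] unfolding \<beta>_def hier_osuc .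
  obtain A U where A: "countable A" "\<beta> \<in> A" and U: "countable U"
    and birth: "\<And>\<alpha> Y. \<alpha> \<in> A \<Longrightarrow> Y \<in> U \<Longrightarrow> Y \<in> hier \<Gamma> \<alpha> \<Longrightarrow> \<exists>\<xi>\<in>A. \<xi> < \<alpha> \<and> (\<exists>\<chi> E. in_lang \<Gamma> \<chi> \<and> xfvN \<chi> \<subseteq> {0} \<and>
      (\<forall>X\<in>xfvS \<chi>. E X \<in> hier \<Gamma> \<xi> \<inter> U) \<and> Y = {n. xsat (hier \<Gamma> \<xi>) ((\<lambda>_. 0)(0 := n)) E \<chi>})"
    and defd: "\<And>\<xi> \<chi> E. \<xi> \<in> A \<Longrightarrow> \<forall>X\<in>xfvS \<chi>. E X \<in> U \<Longrightarrow> {n. xsat (hier \<Gamma> \<xi>) ((\<lambda>_. 0)(0 := n)) E \<chi>} \<in> U"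
    and wit: "\<And>\<xi> \<chi> e E X B. \<xi> \<in> A \<Longrightarrow> \<forall>Y\<in>xfvS \<chi> - {X}. E Y \<in> U \<Longrightarrow> B \<in> hier \<Gamma> \<xi> \<Longrightarrow>
      xsat (hier \<Gamma> \<xi>) e (E(X := B)) \<chi> \<Longrightarrow> \<exists>B\<in>hier \<Gamma> \<xi> \<inter> U. xsat (hier \<Gamma> \<xi>) e (E(X := B)) \<chi>"
    by (rule condensation_hull[of \<beta> \<Gamma>]) blast
  have el: "xsat (hier \<Gamma> \<xi> \<inter> U) e E \<chi> = xsat (hier \<Gamma> \<xi>) e E \<chi>"
    if "\<xi> \<in> A" "\<forall>X\<in>xfvS \<chi>. E X \<in> hier \<Gamma> \<xi> \<inter> U" for \<xi> e E \<chi>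
  proof (rule Tarski_Vaught[OF Int_lower1 _ that(2)])
    fix \<chi> e E X B
    assume *: "\<forall>Y\<in>xfvS \<chi> - {X}. E Y \<in> hier \<Gamma> \<xi> \<inter> U" "B \<in> hier \<Gamma> \<xi>" "xsat (hier \<Gamma> \<xi>) e (E(X := B)) \<chi>"
    have "\<forall>Y\<in>xfvS \<chi> - {X}. E Y \<in> U" using *(1) by blast
    from wit[OF that(1) this *(2,3)] show "\<exists>B\<in>hier \<Gamma> \<xi> \<inter> U. xsat (hier \<Gamma> \<xi>) e (E(X := B)) \<chi>" .
  qed
  have Def_sub: "Def \<Gamma> (hier \<Gamma> \<xi> \<inter> U) \<subseteq> Def \<Gamma> (hier \<Gamma> \<xi>) \<inter> U" if \<xi>: "\<xi> \<in> A" for \<xi>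
  proof
    fix Y assume "Y \<in> Def \<Gamma> (hier \<Gamma> \<xi> \<inter> U)"
    then obtain \<chi> E where \<chi>: "in_lang \<Gamma> \<chi>" "xfvN \<chi> \<subseteq> {0}" "\<forall>X\<in>xfvS \<chi>. E X \<in> hier \<Gamma> \<xi> \<inter> U"
      "Y = {n. xsat (hier \<Gamma> \<xi> \<inter> U) ((\<lambda>_. 0)(0 := n)) E \<chi>}" unfolding Def_def by blast
    have Y: "Y = {n. xsat (hier \<Gamma> \<xi>) ((\<lambda>_. 0)(0 := n)) E \<chi>}" unfolding \<chi>(4) el[OF \<xi> \<chi>(3)] ..
    have "\<forall>X\<in>xfvS \<chi>. E X \<in> U" "\<forall>X\<in>xfvS \<chi>. E X \<in> hier \<Gamma> \<xi>" using \<chi>(3) by blast+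
    with defd[OF \<xi>] Y have "Y \<in> U" by blast
    have "in_lang \<Gamma> \<chi> \<and> xfvN \<chi> \<subseteq> {0} \<and> (\<forall>X\<in>xfvS \<chi>. E X \<in> hier \<Gamma> \<xi>) \<and>
        Y = {n. xsat (hier \<Gamma> \<xi>) ((\<lambda>_. 0)(0 := n)) E \<chi>}" using \<chi>(1-3) Y by blast
    then have "Y \<in> Def \<Gamma> (hier \<Gamma> \<xi>)" unfolding Def_def by (intro CollectI) (rule exI, rule exI)
    with \<open>Y \<in> U\<close> show "Y \<in> Def \<Gamma> (hier \<Gamma> \<xi>) \<inter> U" by blast
  qed
  have level: "hier \<Gamma> \<alpha> \<inter> U = (\<Union>\<xi>\<in>{\<xi>\<in>A. \<xi> < \<alpha>}. Def \<Gamma> (hier \<Gamma> \<xi> \<inter> U))" if \<alpha>: "\<alpha> \<in> A" for \<alpha>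
  proof
    show "hier \<Gamma> \<alpha> \<inter> U \<subseteq> (\<Union>\<xi>\<in>{\<xi>\<in>A. \<xi> < \<alpha>}. Def \<Gamma> (hier \<Gamma> \<xi> \<inter> U))"
    proof
      fix Y assume "Y \<in> hier \<Gamma> \<alpha> \<inter> U"
      then obtain \<xi> \<chi> E where \<xi>: "\<xi> \<in> A" "\<xi> < \<alpha>" and \<chi>: "in_lang \<Gamma> \<chi>" "xfvN \<chi> \<subseteq> {0}"
        "\<forall>X\<in>xfvS \<chi>. E X \<in> hier \<Gamma> \<xi> \<inter> U" "Y = {n. xsat (hier \<Gamma> \<xi>) ((\<lambda>_. 0)(0 := n)) E \<chi>}"
        using birth[OF \<alpha>] by blast
      have "Y = {n. xsat (hier \<Gamma> \<xi> \<inter> U) ((\<lambda>_. 0)(0 := n)) E \<chi>}" unfolding \<chi>(4) el[OF \<xi>(1) \<chi>(3)] ..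
      then have "in_lang \<Gamma> \<chi> \<and> xfvN \<chi> \<subseteq> {0} \<and> (\<forall>X\<in>xfvS \<chi>. E X \<in> hier \<Gamma> \<xi> \<inter> U) \<and>
        Y = {n. xsat (hier \<Gamma> \<xi> \<inter> U) ((\<lambda>_. 0)(0 := n)) E \<chi>}" using \<chi>(1-3) by blast
      then have "Y \<in> Def \<Gamma> (hier \<Gamma> \<xi> \<inter> U)" unfolding Def_def by (intro CollectI) (rule exI, rule exI)
      with \<xi> show "Y \<in> (\<Union>\<xi>\<in>{\<xi>\<in>A. \<xi> < \<alpha>}. Def \<Gamma> (hier \<Gamma> \<xi> \<inter> U))" by blast
    qed
    show "(\<Union>\<xi>\<in>{\<xi>\<in>A. \<xi> < \<alpha>}. Def \<Gamma> (hier \<Gamma> \<xi> \<inter> U)) \<subseteq> hier \<Gamma> \<alpha> \<inter> U"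
      unfolding hier_Union_Def[of \<Gamma> \<alpha>] using Def_sub by (intro UN_least) blast
  qed
  have closed: "Def \<Gamma> (hier \<Gamma> \<beta> \<inter> U) \<subseteq> hier \<Gamma> \<beta> \<inter> U" using Def_sub[OF A(2)] unfolding \<beta>[symmetric] .
  \<comment> \<open>The fixed point gets the index 0.\<close>
  define a where "a = case_nat \<beta> (from_nat_into A)"
  have range_a: "range a = A"
  proof -
    have "range a = insert \<beta> (range (from_nat_into A))"
      by (auto simp: a_def image_iff split: nat.splits)
    also have "\<dots> = A" using range_from_nat_into[of A] A by blast
    finally show ?thesis .
  qed
  define G where "G = (\<lambda>i. from_nat_into (Def \<Gamma> (hier \<Gamma> (a i) \<inter> U)))"
  have G: "range (G i) = Def \<Gamma> (hier \<Gamma> (a i) \<inter> U)" for i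
  proof -
    have "a i \<in> A" using range_a by blast
    from Def_sub[OF this] have "Def \<Gamma> (hier \<Gamma> (a i) \<inter> U) \<subseteq> U" by blast
    then have "countable (Def \<Gamma> (hier \<Gamma> (a i) \<inter> U))" by (rule countable_subset[OF _ U])
    then show ?thesis unfolding G_def by (intro range_from_nat_into Def_nonempty)
  qed
  have F: "(\<Union>j\<in>{j. a j < a i}. range (G j)) = hier \<Gamma> (a i) \<inter> U" for i
  proof -
    have "a i \<in> A" using range_a by blast
    have "(\<Union>j\<in>{j. a j < a i}. range (G j)) = (\<Union>\<xi>\<in>a ` {j. a j < a i}. Def \<Gamma> (hier \<Gamma> \<xi> \<inter> U))" by (simp add: G)
    also have "a ` {j. a j < a i} = {\<xi>\<in>A. \<xi> < a i}" using range_a by auto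
    finally show ?thesis using level[OF \<open>a i \<in> A\<close>] by simp
  qed
  have a0: "a 0 = \<beta>" by (simp add: a_def)
  show thesis
  proof (rule that[of "\<lambda>i j. a i < a j" G])
    show "\<exists>m\<in>B. \<forall>k. a k < a m \<longrightarrow> k \<notin> B" if B: "B \<noteq> {}" for B
    proof -
      obtain b where b: "b \<in> B" using B by blast
      have "(LEAST \<xi>. \<xi> \<in> a ` B) \<in> a ` B" by (rule LeastI[of _ "a b"]) (use b in simp)
      then obtain m where m: "m \<in> B" "a m = (LEAST \<xi>. \<xi> \<in> a ` B)" by auto
      have "k \<notin> B" if "a k < a m" for k using not_less_Least[of "a k" "\<lambda>\<xi>. \<xi> \<in> a ` B"] that m(2) by auto
      with m(1) show ?thesis by blast
    qed
    show "range (G i) = Def \<Gamma> (\<Union>j\<in>{j. a j < a i}. range (G j))" for i unfolding F by (rule G)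
    show "Def \<Gamma> (\<Union>j\<in>{j. a j < a 0}. range (G j)) \<subseteq> (\<Union>j\<in>{j. a j < a 0}. range (G j))"
      unfolding F unfolding a0 by (rule closed)
  qed
qed

section \<open>The definable sets are an upper bound\<close>

text \<open>The properties established in \<open>countable_hierarchy\<close>, with unions of the
  rows of \<open>G\<close> written as images of sets of numbers, which is the form of
  \<open>Dfn_Def\<close>.\<close>

definition codes_hierarchy :: "fm set \<Rightarrow> (nat \<Rightarrow> nat \<Rightarrow> bool) \<Rightarrow> (nat \<Rightarrow> nat \<Rightarrow> nat set) \<Rightarrow> bool" where
  "codes_hierarchy \<Gamma> R G \<longleftrightarrow>
    (\<forall>A :: nat set. (\<exists>m. m \<in> A) \<longrightarrow> (\<exists>m. m \<in> A \<and> (\<forall>k. R k m \<longrightarrow> k \<notin> A))) \<and>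
    (\<forall>i Y. (\<exists>k. Y = G i k) = (Y \<in> Def \<Gamma> ((\<lambda>q. G (fst (prod_decode q)) (snd (prod_decode q))) ` {q. R (fst (prod_decode q)) i}))) \<and>
    (\<forall>Y. Y \<in> Def \<Gamma> ((\<lambda>q. G (fst (prod_decode q)) (snd (prod_decode q))) ` {q. R (fst (prod_decode q)) 0}) \<longrightarrow>
      (\<exists>j k. R j 0 \<and> Y = G j k))"

lemma image_prod_decode:
  "(\<lambda>q. G (fst (prod_decode q)) (snd (prod_decode q))) ` {q. P (fst (prod_decode q))} = (\<Union>j\<in>{j. P j}. range (G j))"
proof -
  have "(\<lambda>q. G (fst (prod_decode q)) (snd (prod_decode q))) ` {q. P (fst (prod_decode q))} =
      (\<lambda>p. G (fst p) (snd p)) ` prod_decode ` {q. P (fst (prod_decode q))}" unfolding image_image ..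
  also have "prod_decode ` {q. P (fst (prod_decode q))} = {p. P (fst p)}"
  proof
    show "{p :: nat \<times> nat. P (fst p)} \<subseteq> prod_decode ` {q. P (fst (prod_decode q))}"
    proof
      fix p :: "nat \<times> nat" assume "p \<in> {p. P (fst p)}"
      then show "p \<in> prod_decode ` {q. P (fst (prod_decode q))}" by (intro image_eqI[of _ _ "prod_encode p"]) simp_all
    qed
  qed auto
  also have "(\<lambda>p. G (fst p) (snd p)) ` {p. P (fst p)} = (\<Union>j\<in>{j. P j}. range (G j))"
  proof
    show "(\<Union>j\<in>{j. P j}. range (G j)) \<subseteq> (\<lambda>p. G (fst p) (snd p)) ` {p. P (fst p)}"
    proof
      fix Y assume "Y \<in> (\<Union>j\<in>{j. P j}. range (G j))"
      then obtain j k where "P j" "Y = G j k" by blast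
      then show "Y \<in> (\<lambda>p. G (fst p) (snd p)) ` {p. P (fst p)}" by (intro image_eqI[of _ _ "(j, k)"]) simp_all
    qed
  qed blast
  finally show ?thesis .
qed

lemma codes_hierarchy_iff:
  "codes_hierarchy \<Gamma> R G \<longleftrightarrow>
    (\<forall>A. A \<noteq> {} \<longrightarrow> (\<exists>m\<in>A. \<forall>k. R k m \<longrightarrow> k \<notin> A)) \<and>
    (\<forall>i. range (G i) = Def \<Gamma> (\<Union>j\<in>{j. R j i}. range (G j))) \<and>
    Def \<Gamma> (\<Union>j\<in>{j. R j 0}. range (G j)) \<subseteq> (\<Union>j\<in>{j. R j 0}. range (G j))"
proof -
  have "(\<forall>Y. (\<exists>k. Y = G i k) = (Y \<in> D)) \<longleftrightarrow> range (G i) = D" for i D by (auto simp: set_eq_iff image_iff)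
  moreover have "(\<forall>Y. Y \<in> D \<longrightarrow> (\<exists>j k. R j 0 \<and> Y = G j k)) \<longleftrightarrow> D \<subseteq> (\<Union>j\<in>{j. R j 0}. range (G j))" for D
    by blast
  moreover have "(\<forall>A :: nat set. (\<exists>m. m \<in> A) \<longrightarrow> (\<exists>m. m \<in> A \<and> (\<forall>k. R k m \<longrightarrow> k \<notin> A))) \<longleftrightarrow>
      (\<forall>A. A \<noteq> {} \<longrightarrow> (\<exists>m\<in>A. \<forall>k. R k m \<longrightarrow> k \<notin> A))" by blast
  moreover have "(\<lambda>q. G (fst (prod_decode q)) (snd (prod_decode q))) ` {q. R (fst (prod_decode q)) i} =
      (\<Union>j\<in>{j. R j i}. range (G j))" for i
    by (rule image_prod_decode[where P = "\<lambda>j. R j i"])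
  ultimately show ?thesis unfolding codes_hierarchy_def by (simp only:)
qed

lemma Dfn_codes_hierarchy:
  assumes "Dfn_class \<Gamma>"
  shows "Dfn (\<lambda>p. codes_hierarchy \<Gamma> (fst p) (snd p))"
  unfolding codes_hierarchy_def
  by (intro dfn Dfun_boolI Dfn_Def[OF assms] Dfun_lambda Dfun_Collect)

text \<open>The definable code that the basis theorem provides may differ from the one that is
  obtained by condensation, but every code has the same union at its index 0, namely \<open>P_game
  \<Gamma>\<close>.\<close>

lemma P_game_subset_definable_sets:
  assumes "projective_determinacy" "Dfn_class \<Gamma>"
  shows "P_game \<Gamma> \<subseteq> definable_sets"
proof -
  have "\<exists>R G. codes_hierarchy \<Gamma> R G"
  proof (rule countable_hierarchy[of \<Gamma>], intro exI)
    fix R :: "nat \<Rightarrow> nat \<Rightarrow> bool" and G :: "nat \<Rightarrow> nat \<Rightarrow> nat set"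
    assume "\<And>A. A \<noteq> {} \<Longrightarrow> \<exists>m\<in>A. \<forall>k. R k m \<longrightarrow> k \<notin> A"
      "\<And>i. range (G i) = Def \<Gamma> (\<Union>j\<in>{j. R j i}. range (G j))"
      "Def \<Gamma> (\<Union>j\<in>{j. R j 0}. range (G j)) \<subseteq> (\<Union>j\<in>{j. R j 0}. range (G j))"
    then show "codes_hierarchy \<Gamma> R G" unfolding codes_hierarchy_iff by (intro conjI allI impI)
  qed
  then obtain R G where "codes_hierarchy \<Gamma> R G" by blast
  then have "codes_hierarchy \<Gamma> (fst (R, G)) (snd (R, G))" by simp
  from basis[OF assms(1) Dfn_codes_hierarchy[OF assms(2)] this]
  obtain p where p: "codes_hierarchy \<Gamma> (fst p) (snd p)" "Dpt p" by blast
  note clauses = p(1)[unfolded codes_hierarchy_iff]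
  define F where "F = (\<lambda>i. \<Union>j\<in>{j. fst p j i}. range (snd p j))"
  have wf: "\<exists>m\<in>A. \<forall>k. fst p k m \<longrightarrow> k \<notin> A" if "A \<noteq> {}" for A
    by (rule clauses[THEN conjunct1, rule_format, OF that])
  have level: "range (snd p i) = Def \<Gamma> (F i)" for i
    unfolding F_def by (rule clauses[THEN conjunct2, THEN conjunct1, rule_format])
  have F: "F i = (\<Union>j\<in>{j. fst p j i}. Def \<Gamma> (F j))" for i
    unfolding level[symmetric] by (simp add: F_def)
  have top: "Def \<Gamma> (F 0) \<subseteq> F 0" unfolding F_def by (rule clauses[THEN conjunct2, THEN conjunct2])
  have "P_game \<Gamma> = F 0" using well_founded_hierarchy_top[of "fst p", OF wf F top] by simp
  moreover have "Dpt (snd p j k)" for j k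
  proof -
    have "Dfun (\<lambda>p :: (nat \<Rightarrow> nat \<Rightarrow> bool) \<times> (nat \<Rightarrow> nat \<Rightarrow> nat set). snd p j k)" by (intro dfn)
    from Dpt_image[OF this p(2)] show ?thesis .
  qed
  ultimately show ?thesis by (auto simp: F_def definable_sets_def)
qed

theorem theorem4p3:
  assumes "projective_determinacy"
  shows "minimal_model (\<lambda>M. projectively_correct M \<and> model_of_analysis M) P_Proj
    \<and> minimal_model (\<lambda>M. projectively_correct M \<and> model_of_analysis M \<and> models M PD_scheme) P_Proj
    \<and> P_Proj = (\<Union>k. P_game (Pi11 (2 * k + 1)))
    \<and> P_Proj = (\<Union>k\<in>{1..}. P_game (Sigma11 (2 * k)))"
proof -
  have el: "elementary definable_sets" by (rule elementary_definable_sets[OF assms])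
  have correct: "projectively_correct definable_sets" by (rule elementary_projectively_correct[OF el])
  have Z2: "model_of_analysis definable_sets"
    unfolding model_of_analysis_def by (rule elementary_models[OF el models_Z2])
  have PD: "models definable_sets PD_scheme" by (rule elementary_models[OF el models_PD_scheme[OF assms]])
  have least: "definable_sets \<subseteq> N" if "projectively_correct N" for N
    by (rule definable_sets_subset[OF projectively_correct_elementary[OF that]])
  have upper: "P_game (Pi11 n) \<subseteq> definable_sets" "P_game (Sigma11 n) \<subseteq> definable_sets" for n
    using P_game_subset_definable_sets[OF assms] Dfn_class_Sigma_Pi[of n] by blast+
  have lower: "Def \<Gamma> {} \<subseteq> P_game \<Gamma>" for \<Gamma>
    unfolding Def_empty by (rule hier_subset_P_game)
  have "definable_sets = (\<Union>k. P_game (Pi11 (2 * k + 1)))"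
  proof
    show "definable_sets \<subseteq> (\<Union>k. P_game (Pi11 (2 * k + 1)))"
    proof
      fix A assume "A \<in> definable_sets"
      then obtain k where "A \<in> Def (Pi11 (2 * k + 1)) {}" by (rule definable_sets_Pi)
      then show "A \<in> (\<Union>k. P_game (Pi11 (2 * k + 1)))" using lower by blast
    qed
    show "(\<Union>k. P_game (Pi11 (2 * k + 1))) \<subseteq> definable_sets" by (rule UN_least) (rule upper)
  qed
  moreover have "definable_sets = (\<Union>k\<in>{1..}. P_game (Sigma11 (2 * k)))"
  proof
    show "definable_sets \<subseteq> (\<Union>k\<in>{1..}. P_game (Sigma11 (2 * k)))"
    proof
      fix A assume "A \<in> definable_sets"
      then obtain k where "k \<ge> 1" "A \<in> Def (Sigma11 (2 * k)) {}" by (rule definable_sets_Sigma)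
      then show "A \<in> (\<Union>k\<in>{1..}. P_game (Sigma11 (2 * k)))" using lower by force
    qed
    show "(\<Union>k\<in>{1..}. P_game (Sigma11 (2 * k))) \<subseteq> definable_sets" by (rule UN_least) (rule upper)
  qed
  ultimately show ?thesis
    unfolding P_Proj_eq[OF assms] minimal_model_def using correct Z2 PD least by simp
qed

end
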